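(* Let $(R,\mathfrak m,k)$ be a regular local ring (respectively, a standard graded polynomial ring over a field $k$). Let $I$ and $J$ be proper ideals of $R$ (homogeneous in the graded case) with $\operatorname{Fitt}_R(I)\subseteq J$, and let $(F_\bullet,d_\bullet)$ and $(G_\bullet,m_\bullet)$ be minimal free resolutions of $R/I$ and $R/J$, respectively. Let $t=\mu(I)$ be the minimal number of generators of $I$, and let $e_0^1,\dots,e_0^t$ be a basis of $F_1$. Let $Q_{j}:F_{j+1}\to\bigoplus_{i=1}^t G_{j}$ ($j\ge 1$) be the vertical maps of a trimming morphism for this data, as defined in the context. If all the maps $Q_j$, $j\geq 1$, are split injections, then $R/IJ$ is a Golod ring.
   Context: $\operatorname{Fitt}_R(I)$ denotes the ideal generated by the entries of any minimal presentation matrix of $I$ (equivalently, the entries of the matrix of $d_2:F_2\to F_1$). Trimming morphism: consider the complex (source) $\cdots\to F_{k}\xrightarrow{d_{k}}F_{k-1}\to\cdots\xrightarrow{d_3}F_2\to 0$, with $F_{k}$ placed in degree $k-1$ (so $F_2$ is in degree $1$ and degree $0$ is zero), and the complex (target) $\cdots\to\bigoplus_{i=1}^tG_{k}\xrightarrow{\bigoplus m_{k}}\bigoplus_{i=1}^tG_{k-1}\to\cdots\xrightarrow{\bigoplus m_2}\bigoplus_{i=1}^tG_1\xrightarrow{\delta}R$, with $\bigoplus_{i=1}^t G_k$ in degree $k$ for $k\ge1$ and $R$ in degree $0$, where $\delta(g^1,\dots,g^t)=-\sum_{i=1}^t m_1(g^i)\,d_1(e_0^i)$. It is a known theorem that,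 when $\operatorname{Fitt}_R(I)\subseteq J$, there is a morphism of complexes from the source to the target, with components $Q_{k-1}:F_k\to\bigoplus_{i=1}^tG_{k-1}$ for $k\ge2$, whose mapping cone is a free resolution of $R/IJ$. A trimming morphism is such a morphism. Golod rings: let $(A,\mathfrak n,k)$ be a local ring, or a standard graded $k$-algebra with homogeneous maximal ideal $\mathfrak n$. Let $K^A$ be the Koszul complex over $A$ on a minimal set of generators of $\mathfrak n$; it is a DG-algebra with $H_0(K^A)\cong k$. For a homogeneous element $a$ of a DG-algebra put $\overline a:=(-1)^{|a|+1}a$, where $|a|$ is the homological degree. A DG-algebra $B$ with $H_0(B)\cong k$ admits a trivial Massey operation if for some homogeneous $k$-basis $\mathcal B=\{h_\lambda\}_{\lambda\in\Lambda}$ of $H_{\ge 1}(B)$ there is a function $\nu:\coprod_{i=1}^\infty \mathcal B^i\to B$ such that $\nu(h_\lambda)=z_\lambda$ is a cycle with homology class $[z_\lambda]=h_\lambda$, and $d\nu(h_{\lambda_1},\dots,h_{\lambda_p})=\sum_{j=1}^{p-1}\overline{\nu(h_{\lambda_1},\dots,h_{\lambda_j})}\,\nu(h_{\lambda_{j+1}},\dots,h_{\lambda_p})$ for all $p\ge 2$. The ring $A$ is called Golod if $K^A$ admits a trivial Massey operation. *)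

theory Defs
  imports "HOL-Algebra.Algebra" "HOL-Library.Extended_Nat"
begin

section \<open>Modules, bases and complexes\<close>

definition self_module :: "('a, 'b) ring_scheme \<Rightarrow> ('a, 'a) module" where
  "self_module R = \<lparr>carrier = carrier R, monoid.mult = monoid.mult R, one = one R, ring.zero = ring.zero R,
     add = add R, smult = monoid.mult R\<rparr>"

definition mod_hom :: "('a, 'b) ring_scheme \<Rightarrow> ('a, 'm, 'c) module_scheme \<Rightarrow>
    ('a, 'n, 'd) module_scheme \<Rightarrow> ('m \<Rightarrow> 'n) set" where
  "mod_hom R M N = {h \<in> carrier M \<rightarrow> carrier N.
     (\<forall>x\<in>carrier M. \<forall>y\<in>carrier M. h (x \<oplus>\<^bsub>M\<^esub> y) = h x \<oplus>\<^bsub>N\<^esub> h y) \<and>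
     (\<forall>a\<in>carrier R. \<forall>x\<in>carrier M. h (a \<odot>\<^bsub>M\<^esub> x) = a \<odot>\<^bsub>N\<^esub> h x)}"

definition zero_module :: "('a, 'm) module \<Rightarrow> ('a, 'm) module" where
  "zero_module M = M\<lparr>carrier := {\<zero>\<^bsub>M\<^esub>}\<rparr>"

text \<open>The fields \<open>mult\<close> and \<open>one\<close> of a module record carry no meaning and are left
  unspecified below.\<close>

definition prod_module :: "('a, 'm) module \<Rightarrow> ('a, 'n) module \<Rightarrow> ('a, 'm \<times> 'n) module" where
  "prod_module M N = \<lparr>carrier = carrier M \<times> carrier N, monoid.mult = undefined, one = undefined,
     ring.zero = (\<zero>\<^bsub>M\<^esub>, \<zero>\<^bsub>N\<^esub>),
     add = (\<lambda>(x, y) (x', y'). (x \<oplus>\<^bsub>M\<^esub> x', y \<oplus>\<^bsub>N\<^esub> y')),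
     smult = (\<lambda>a (x, y). (a \<odot>\<^bsub>M\<^esub> x, a \<odot>\<^bsub>N\<^esub> y))\<rparr>"

definition power_module :: "nat \<Rightarrow> ('a, 'm) module \<Rightarrow> ('a, nat \<Rightarrow> 'm) module" where
  "power_module t M = \<lparr>carrier = {1..t} \<rightarrow>\<^sub>E carrier M, monoid.mult = undefined, one = undefined,
     ring.zero = (\<lambda>i\<in>{1..t}. \<zero>\<^bsub>M\<^esub>),
     add = (\<lambda>g h. \<lambda>i\<in>{1..t}. g i \<oplus>\<^bsub>M\<^esub> h i),
     smult = (\<lambda>a g. \<lambda>i\<in>{1..t}. a \<odot>\<^bsub>M\<^esub> g i)\<rparr>"

definition power_map :: "nat \<Rightarrow> ('m \<Rightarrow> 'n) \<Rightarrow> (nat \<Rightarrow> 'm) \<Rightarrow> (nat \<Rightarrow> 'n)" where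
  "power_map t f g = (\<lambda>i\<in>{1..t}. f (g i))"

definition combination :: "('a, 'b) ring_scheme \<Rightarrow> ('a, 'm, 'c) module_scheme \<Rightarrow>
    'i set \<Rightarrow> ('i \<Rightarrow> 'm) \<Rightarrow> ('i \<Rightarrow> 'a) \<Rightarrow> 'm \<Rightarrow> bool" where
  "combination R M A e c x \<longleftrightarrow> c \<in> A \<rightarrow>\<^sub>E carrier R \<and> finite {i \<in> A. c i \<noteq> \<zero>\<^bsub>R\<^esub>} \<and>
     x = (\<Oplus>\<^bsub>M\<^esub>i\<in>{i \<in> A. c i \<noteq> \<zero>\<^bsub>R\<^esub>}. c i \<odot>\<^bsub>M\<^esub> e i)"

definition is_basis :: "('a, 'b) ring_scheme \<Rightarrow> ('a, 'm, 'c) module_scheme \<Rightarrow>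
    'i set \<Rightarrow> ('i \<Rightarrow> 'm) \<Rightarrow> bool" where
  "is_basis R M A e \<longleftrightarrow> e \<in> A \<rightarrow> carrier M \<and> (\<forall>x\<in>carrier M. \<exists>!c. combination R M A e c x)"

definition coordinate :: "('a, 'b) ring_scheme \<Rightarrow> ('a, 'm, 'c) module_scheme \<Rightarrow>
    'i set \<Rightarrow> ('i \<Rightarrow> 'm) \<Rightarrow> 'm \<Rightarrow> 'i \<Rightarrow> 'a" where
  "coordinate R M A e x = (THE c. combination R M A e c x)"

definition matrix_entries :: "('a, 'b) ring_scheme \<Rightarrow> ('a, 'm, 'c) module_scheme \<Rightarrow>
    'i set \<Rightarrow> ('i \<Rightarrow> 'm) \<Rightarrow> 'j set \<Rightarrow> ('j \<Rightarrow> 'n) \<Rightarrow> ('n \<Rightarrow> 'm) \<Rightarrow> 'a set" where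
  "matrix_entries R M A e B f h = {coordinate R M A e (h (f j)) i | i j. i \<in> A \<and> j \<in> B}"

definition ideal_smult :: "('a, 'b) ring_scheme \<Rightarrow> 'a set \<Rightarrow> ('a, 'm, 'c) module_scheme \<Rightarrow> 'm set" where
  "ideal_smult R \<aa> M = generate (add_monoid M) {a \<odot>\<^bsub>M\<^esub> x | a x. a \<in> \<aa> \<and> x \<in> carrier M}"

text \<open>A complex \<open>\<dots> \<rightarrow> cx_mod P 2 \<rightarrow> cx_mod P 1 \<rightarrow> R\<close> whose term in degree 0 is the ring itself:
  \<open>cx_diff P k\<close> maps \<open>cx_mod P k\<close> to \<open>cx_mod P (k - 1)\<close> for \<open>k \<ge> 2\<close>, and \<open>cx_aug P\<close> is the
  differential \<open>cx_mod P 1 \<rightarrow> R\<close>. The values of \<open>cx_mod\<close> at 0 and of \<open>cx_diff\<close> at 0 and 1 are not used.\<close>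

record ('a, 'm) ring_complex =
  cx_mod :: "nat \<Rightarrow> ('a, 'm) module"
  cx_diff :: "nat \<Rightarrow> 'm \<Rightarrow> 'm"
  cx_aug :: "'m \<Rightarrow> 'a"

text \<open>\<open>P\<close> is a resolution of \<open>R/K\<close> by finitely generated free modules with \<open>P\<^sub>0 = R\<close>.\<close>

definition free_resolution :: "('a, 'b) ring_scheme \<Rightarrow> 'a set \<Rightarrow> ('a, 'm) ring_complex \<Rightarrow> bool" where
  "free_resolution R K P \<longleftrightarrow>
     (\<forall>k\<ge>1. module R (cx_mod P k) \<and>
        (\<exists>(n::nat) b. is_basis R (cx_mod P k) {1..n} b)) \<and>
     cx_aug P \<in> mod_hom R (cx_mod P 1) (self_module R) \<and>
     (\<forall>k\<ge>2. cx_diff P k \<in> mod_hom R (cx_mod P k) (cx_mod P (k - 1))) \<and>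
     cx_aug P ` carrier (cx_mod P 1) = K \<and>
     {x \<in> carrier (cx_mod P 1). cx_aug P x = \<zero>\<^bsub>R\<^esub>} = cx_diff P 2 ` carrier (cx_mod P 2) \<and>
     (\<forall>k\<ge>2. {x \<in> carrier (cx_mod P k). cx_diff P k x = \<zero>\<^bsub>cx_mod P (k - 1)\<^esub>}
               = cx_diff P (k + 1) ` carrier (cx_mod P (k + 1)))"

definition minimal_free_resolution ::
    "('a, 'b) ring_scheme \<Rightarrow> 'a set \<Rightarrow> 'a set \<Rightarrow> ('a, 'm) ring_complex \<Rightarrow> bool" where
  "minimal_free_resolution R \<mm> K P \<longleftrightarrow> free_resolution R K P \<and>
     cx_aug P ` carrier (cx_mod P 1) \<subseteq> \<mm> \<and>
     (\<forall>k\<ge>2. cx_diff P k ` carrier (cx_mod P k) \<subseteq> ideal_smult R \<mm> (cx_mod P (k - 1)))"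

definition split_injection :: "('a, 'b) ring_scheme \<Rightarrow> ('a, 'm) module \<Rightarrow> ('a, 'n) module \<Rightarrow>
    ('m \<Rightarrow> 'n) \<Rightarrow> bool" where
  "split_injection R M N h \<longleftrightarrow> h \<in> mod_hom R M N \<and>
     (\<exists>s\<in>mod_hom R N M. \<forall>x\<in>carrier M. s (h x) = x)"


section \<open>Local and graded rings\<close>

definition min_num_gens :: "('a, 'b) ring_scheme \<Rightarrow> 'a set \<Rightarrow> nat" where
  "min_num_gens R K = (LEAST n. \<exists>S \<subseteq> carrier R. finite S \<and> card S = n \<and> genideal R S = K)"

definition minimal_generators :: "('a, 'b) ring_scheme \<Rightarrow> 'a set \<Rightarrow> 'a list \<Rightarrow> bool" where
  "minimal_generators R K xs \<longleftrightarrow> distinct xs \<and> set xs \<subseteq> carrier R \<and> genideal R (set xs) = K \<and>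
     (\<forall>S. S \<subset> set xs \<longrightarrow> genideal R S \<noteq> K)"

definition local_ring :: "('a, 'b) ring_scheme \<Rightarrow> 'a set \<Rightarrow> bool" where
  "local_ring R \<mm> \<longleftrightarrow> cring R \<and> noetherian_ring R \<and> maximalideal \<mm> R \<and>
     (\<forall>M. maximalideal M R \<longrightarrow> M = \<mm>)"

definition krull_dim :: "('a, 'b) ring_scheme \<Rightarrow> enat" where
  "krull_dim R = Sup {enat n | n. \<exists>P. (\<forall>i\<le>n. primeideal (P i) R) \<and> (\<forall>i<n. P i \<subset> P (Suc i))}"

definition regular_local_ring :: "('a, 'b) ring_scheme \<Rightarrow> 'a set \<Rightarrow> bool" where
  "regular_local_ring R \<mm> \<longleftrightarrow> local_ring R \<mm> \<and> enat (min_num_gens R \<mm>) = krull_dim R"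

definition direct_sum_decomposition :: "('m, 'c) ring_scheme \<Rightarrow> (nat \<Rightarrow> 'm set) \<Rightarrow> bool" where
  "direct_sum_decomposition M gM \<longleftrightarrow> (\<forall>i. additive_subgroup (gM i) M) \<and>
     (\<forall>x\<in>carrier M. \<exists>!c. (\<forall>i. c i \<in> gM i) \<and> finite {i. c i \<noteq> \<zero>\<^bsub>M\<^esub>} \<and>
        x = (\<Oplus>\<^bsub>M\<^esub>i\<in>{i. c i \<noteq> \<zero>\<^bsub>M\<^esub>}. c i))"

definition graded_ring :: "('a, 'b) ring_scheme \<Rightarrow> (nat \<Rightarrow> 'a set) \<Rightarrow> bool" where
  "graded_ring R gr \<longleftrightarrow> cring R \<and> direct_sum_decomposition R gr \<and> \<one>\<^bsub>R\<^esub> \<in> gr 0 \<and>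
     (\<forall>i j. \<forall>a\<in>gr i. \<forall>b\<in>gr j. a \<otimes>\<^bsub>R\<^esub> b \<in> gr (i + j))"

text \<open>The ground field of a standard graded algebra is its component of degree 0.\<close>

definition standard_graded_algebra :: "('a, 'b) ring_scheme \<Rightarrow> (nat \<Rightarrow> 'a set) \<Rightarrow> bool" where
  "standard_graded_algebra R gr \<longleftrightarrow> graded_ring R gr \<and> subfield (gr 0) R \<and>
     (\<exists>S \<subseteq> gr 1. finite S \<and> generate_ring R (gr 0 \<union> S) = carrier R)"

text \<open>\<open>R = k[x\<^sub>0, \<dots>, x\<^sub>n\<^sub>-\<^sub>1]\<close> with \<open>k = gr 0\<close> and all variables of degree 1: the monomials,
  indexed by exponent vectors, form a \<open>k\<close>-basis of \<open>R\<close>.\<close>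

definition standard_graded_polynomial_ring ::
    "('a, 'b) ring_scheme \<Rightarrow> (nat \<Rightarrow> 'a set) \<Rightarrow> bool" where
  "standard_graded_polynomial_ring R gr \<longleftrightarrow> graded_ring R gr \<and> subfield (gr 0) R \<and>
     (\<exists>(n::nat) x. x \<in> {..<n} \<rightarrow> gr 1 \<and>
        is_basis (R\<lparr>carrier := gr 0\<rparr>) (self_module R) ({..<n} \<rightarrow>\<^sub>E (UNIV :: nat set))
          (\<lambda>\<alpha>. \<Otimes>\<^bsub>R\<^esub>i\<in>{..<n}. x i [^]\<^bsub>R\<^esub> \<alpha> i))"

definition irrelevant_ideal :: "('a, 'b) ring_scheme \<Rightarrow> (nat \<Rightarrow> 'a set) \<Rightarrow> 'a set" where
  "irrelevant_ideal R gr = genideal R (\<Union>i\<in>{1..}. gr i)"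

definition homogeneous_ideal :: "('a, 'b) ring_scheme \<Rightarrow> (nat \<Rightarrow> 'a set) \<Rightarrow> 'a set \<Rightarrow> bool" where
  "homogeneous_ideal R gr K \<longleftrightarrow> ideal K R \<and> K = genideal R (K \<inter> (\<Union>i. gr i))"

definition quotient_grading :: "('a, 'b) ring_scheme \<Rightarrow> (nat \<Rightarrow> 'a set) \<Rightarrow> 'a set \<Rightarrow> nat \<Rightarrow> 'a set set" where
  "quotient_grading R gr K i = (\<lambda>r. K +>\<^bsub>R\<^esub> r) ` gr i"

definition graded_free_module :: "('a, 'b) ring_scheme \<Rightarrow> (nat \<Rightarrow> 'a set) \<Rightarrow>
    ('a, 'm) module \<Rightarrow> (nat \<Rightarrow> 'm set) \<Rightarrow> bool" where
  "graded_free_module R gr M gM \<longleftrightarrow> module R M \<and> direct_sum_decomposition M gM \<and>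
     (\<forall>i j. \<forall>a\<in>gr i. \<forall>x\<in>gM j. a \<odot>\<^bsub>M\<^esub> x \<in> gM (i + j)) \<and>
     (\<exists>(n::nat) b. is_basis R M {1..n} b \<and> (\<forall>i\<in>{1..n}. \<exists>j. b i \<in> gM j))"

text \<open>Internal degrees range over the natural numbers: in a minimal graded resolution of a
  cyclic module \<open>R/K\<close> with \<open>P\<^sub>0 = R\<close>, every homogeneous generator of \<open>P\<^sub>k\<close> has a nonzero image
  in \<open>P\<^sub>k\<^sub>-\<^sub>1\<close>, so no negative degrees occur.\<close>

definition minimal_graded_free_resolution ::
    "('a, 'b) ring_scheme \<Rightarrow> (nat \<Rightarrow> 'a set) \<Rightarrow> 'a set \<Rightarrow> ('a, 'm) ring_complex \<Rightarrow> bool" where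
  "minimal_graded_free_resolution R gr K P \<longleftrightarrow>
     minimal_free_resolution R (irrelevant_ideal R gr) K P \<and>
     (\<exists>gP. (\<forall>k\<ge>1. graded_free_module R gr (cx_mod P k) (gP k)) \<and>
        (\<forall>j. cx_aug P ` gP 1 j \<subseteq> gr j) \<and>
        (\<forall>k\<ge>2. \<forall>j. cx_diff P k ` gP k j \<subseteq> gP (k - 1) j))"


section \<open>Trimming morphisms\<close>

text \<open>The source has \<open>F\<^sub>k\<^sub>+\<^sub>1\<close> in degree \<open>k \<ge> 1\<close> and 0 in degree 0, so the differential out of
  degree 1 is zero.\<close>

definition trimming_source ::
    "('a, 'b) ring_scheme \<Rightarrow> ('a, 'f) ring_complex \<Rightarrow> ('a, 'f) ring_complex" where
  "trimming_source R F = \<lparr>cx_mod = (\<lambda>k. cx_mod F (k + 1)), cx_diff = (\<lambda>k. cx_diff F (k + 1)),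
     cx_aug = (\<lambda>_. \<zero>\<^bsub>R\<^esub>)\<rparr>"

definition trimming_target :: "('a, 'b) ring_scheme \<Rightarrow> nat \<Rightarrow> (nat \<Rightarrow> 'f) \<Rightarrow>
    ('a, 'f) ring_complex \<Rightarrow> ('a, 'g) ring_complex \<Rightarrow> ('a, nat \<Rightarrow> 'g) ring_complex" where
  "trimming_target R t e F G = \<lparr>cx_mod = (\<lambda>k. power_module t (cx_mod G k)),
     cx_diff = (\<lambda>k. power_map t (cx_diff G k)),
     cx_aug = (\<lambda>g. \<ominus>\<^bsub>R\<^esub> (\<Oplus>\<^bsub>R\<^esub>i\<in>{1..t}. cx_aug G (g i) \<otimes>\<^bsub>R\<^esub> cx_aug F (e i)))\<rparr>"

text \<open>Mapping cone of \<open>\<Phi> : S \<rightarrow> T\<close>, where \<open>S\<close> vanishes in degree 0: the term in degree \<open>k\<close> is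
  \<open>S\<^sub>k\<^sub>-\<^sub>1 \<oplus> T\<^sub>k\<close>, with differential \<open>(x, y) \<mapsto> (- d x, d y + \<Phi> x)\<close>.\<close>

definition mapping_cone :: "('a, 's) ring_complex \<Rightarrow> ('a, 't) ring_complex \<Rightarrow>
    (nat \<Rightarrow> 's \<Rightarrow> 't) \<Rightarrow> ('a, 's \<times> 't) ring_complex" where
  "mapping_cone S T \<Phi> = \<lparr>
     cx_mod = (\<lambda>k. prod_module (if k = 1 then zero_module (cx_mod S 1) else cx_mod S (k - 1)) (cx_mod T k)),
     cx_diff = (\<lambda>k (x, y).
       (if k = 2 then \<zero>\<^bsub>cx_mod S 1\<^esub> else \<ominus>\<^bsub>cx_mod S (k - 2)\<^esub> cx_diff S (k - 1) x,
        cx_diff T k y \<oplus>\<^bsub>cx_mod T (k - 1)\<^esub> \<Phi> (k - 1) x)),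
     cx_aug = (\<lambda>(x, y). cx_aug T y)\<rparr>"

definition complex_morphism :: "('a, 'b) ring_scheme \<Rightarrow> ('a, 's) ring_complex \<Rightarrow>
    ('a, 't) ring_complex \<Rightarrow> (nat \<Rightarrow> 's \<Rightarrow> 't) \<Rightarrow> bool" where
  \<comment> \<open>morphisms out of a complex vanishing in degree 0\<close>
  "complex_morphism R S T \<Phi> \<longleftrightarrow>
     (\<forall>k\<ge>1. \<Phi> k \<in> mod_hom R (cx_mod S k) (cx_mod T k)) \<and>
     (\<forall>x\<in>carrier (cx_mod S 1). cx_aug T (\<Phi> 1 x) = \<zero>\<^bsub>R\<^esub>) \<and>
     (\<forall>k\<ge>2. \<forall>x\<in>carrier (cx_mod S k). cx_diff T k (\<Phi> k x) = \<Phi> (k - 1) (cx_diff S k x))"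

definition trimming_morphism :: "('a, 'b) ring_scheme \<Rightarrow> 'a set \<Rightarrow> 'a set \<Rightarrow> nat \<Rightarrow> (nat \<Rightarrow> 'f) \<Rightarrow>
    ('a, 'f) ring_complex \<Rightarrow> ('a, 'g) ring_complex \<Rightarrow> (nat \<Rightarrow> 'f \<Rightarrow> nat \<Rightarrow> 'g) \<Rightarrow> bool" where
  "trimming_morphism R I J t e F G Q \<longleftrightarrow>
     (let S = trimming_source R F; T = trimming_target R t e F G
      in complex_morphism R S T Q \<and> free_resolution R (I \<cdot>\<^bsub>R\<^esub> J) (mapping_cone S T Q))"


section \<open>DG algebras and trivial Massey operations\<close>

record 'b dg_algebra = "'b ring" +
  dgdiff :: "'b \<Rightarrow> 'b"
  homog :: "nat \<Rightarrow> 'b set"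

definition dg_cycles :: "'b dg_algebra \<Rightarrow> 'b set" where
  "dg_cycles B = {z \<in> carrier B. dgdiff B z = \<zero>\<^bsub>B\<^esub>}"

definition dg_boundaries :: "'b dg_algebra \<Rightarrow> 'b set" where
  "dg_boundaries B = dgdiff B ` carrier B"

definition dg_positive :: "'b dg_algebra \<Rightarrow> 'b set" where
  "dg_positive B = generate (add_monoid B) (\<Union>n\<in>{1..}. homog B n)"

definition homology :: "'b dg_algebra \<Rightarrow> 'b set ring" where
  "homology B = (B\<lparr>carrier := dg_cycles B\<rparr>) Quot (dg_boundaries B)"

definition homology_class :: "'b dg_algebra \<Rightarrow> 'b \<Rightarrow> 'b set" where
  "homology_class B z = dg_boundaries B +>\<^bsub>B\<^esub> z"

definition homology_zero :: "'b dg_algebra \<Rightarrow> 'b set ring" where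
  "homology_zero B = (homology B)\<lparr>carrier := homology_class B ` (dg_cycles B \<inter> homog B 0)\<rparr>"

text \<open>\<open>H\<^sub>\<ge>\<^sub>1(B)\<close> as a module over \<open>H\<^sub>0(B)\<close>, i.e. over \<open>k\<close> when \<open>H\<^sub>0(B) \<cong> k\<close>.\<close>

definition homology_positive :: "'b dg_algebra \<Rightarrow> ('b set, 'b set) module" where
  "homology_positive B = \<lparr>carrier = homology_class B ` (dg_cycles B \<inter> dg_positive B),
     monoid.mult = monoid.mult (homology B), one = one (homology B), ring.zero = ring.zero (homology B),
     add = add (homology B), smult = monoid.mult (homology B)\<rparr>"

text \<open>\<open>dg_bar B a = (-1)\<^bsup>|a|+1\<^esup> a\<close> for homogeneous \<open>a\<close>; zero, which has every degree, is fixed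
  by either sign.\<close>

definition dg_bar :: "'b dg_algebra \<Rightarrow> 'b \<Rightarrow> 'b" where
  "dg_bar B a = (if \<exists>n. odd n \<and> a \<in> homog B n then a else \<ominus>\<^bsub>B\<^esub> a)"

definition trivial_massey_operation :: "'b dg_algebra \<Rightarrow> bool" where
  "trivial_massey_operation B \<longleftrightarrow> (\<exists>\<B> \<nu>.
     is_basis (homology_zero B) (homology_positive B) \<B> (\<lambda>h. h) \<and>
     (\<forall>h\<in>\<B>. \<exists>n\<ge>1. \<exists>z \<in> dg_cycles B \<inter> homog B n. h = homology_class B z) \<and>
     (\<forall>hs. hs \<noteq> [] \<and> set hs \<subseteq> \<B> \<longrightarrow> \<nu> hs \<in> (\<Union>n. homog B n)) \<and>
     (\<forall>h\<in>\<B>. \<nu> [h] \<in> dg_cycles B \<and> homology_class B (\<nu> [h]) = h) \<and>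
     (\<forall>hs. 2 \<le> length hs \<and> set hs \<subseteq> \<B> \<longrightarrow>
        dgdiff B (\<nu> hs) =
          (\<Oplus>\<^bsub>B\<^esub>j\<in>{1..<length hs}. dg_bar B (\<nu> (take j hs)) \<otimes>\<^bsub>B\<^esub> \<nu> (drop j hs))))"


section \<open>Koszul complexes and Golod rings\<close>

definition signed :: "('a, 'b) ring_scheme \<Rightarrow> nat \<Rightarrow> 'a \<Rightarrow> 'a" where
  "signed A n a = (if even n then a else \<ominus>\<^bsub>A\<^esub> a)"

definition inversions :: "nat set \<Rightarrow> nat set \<Rightarrow> nat" where
  "inversions S T = card {(i, j). i \<in> S \<and> j \<in> T \<and> j < i}"

text \<open>The exterior algebra on \<open>e\<^sub>0, \<dots>, e\<^sub>n\<^sub>-\<^sub>1\<close> with \<open>d e\<^sub>i = xs ! i\<close>. An element is the family of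
  its coefficients with respect to the basis \<open>e\<^sub>S = e\<^sub>i\<^sub>1 \<and> \<dots> \<and> e\<^sub>i\<^sub>p\<close>, for
  \<open>S = {i\<^sub>1 < \<dots> < i\<^sub>p} \<subseteq> {..<n}\<close>; thus \<open>e\<^sub>S \<and> e\<^sub>T = (-1)\<^bsup>inversions S T\<^esup> e\<^sub>S\<^sub>\<union>\<^sub>T\<close> for disjoint \<open>S\<close>, \<open>T\<close>,
  and \<open>d e\<^sub>S\<close> is the sum of \<open>(-1)\<^bsup>inversions {i} (S - {i})\<^esup> x\<^sub>i e\<^sub>S\<^sub>-\<^sub>{\<^sub>i\<^sub>}\<close> over \<open>i \<in> S\<close>.\<close>

definition koszul :: "('a, 'b) ring_scheme \<Rightarrow> 'a list \<Rightarrow> (nat set \<Rightarrow> 'a) dg_algebra" where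
  "koszul A xs = (let V = Pow {..<length xs} in
    \<lparr>carrier = V \<rightarrow>\<^sub>E carrier A,
     monoid.mult = (\<lambda>a b. \<lambda>U\<in>V. \<Oplus>\<^bsub>A\<^esub>S\<in>Pow U. signed A (inversions S (U - S)) (a S \<otimes>\<^bsub>A\<^esub> b (U - S))),
     one = (\<lambda>U\<in>V. if U = {} then \<one>\<^bsub>A\<^esub> else \<zero>\<^bsub>A\<^esub>),
     ring.zero = (\<lambda>U\<in>V. \<zero>\<^bsub>A\<^esub>),
     add = (\<lambda>a b. \<lambda>U\<in>V. a U \<oplus>\<^bsub>A\<^esub> b U),
     dgdiff = (\<lambda>a. \<lambda>U\<in>V. \<Oplus>\<^bsub>A\<^esub>i\<in>{..<length xs} - U.
                 signed A (inversions {i} U) (xs ! i \<otimes>\<^bsub>A\<^esub> a (insert i U))),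
     homog = (\<lambda>p. {a \<in> V \<rightarrow>\<^sub>E carrier A. \<forall>S\<in>V. card S \<noteq> p \<longrightarrow> a S = \<zero>\<^bsub>A\<^esub>})\<rparr>)"

text \<open>The Koszul complex on a minimal set of generators is unique up to isomorphism; the
  definitions quantify over all choices, and such a choice exists.\<close>

definition golod_local :: "('a, 'b) ring_scheme \<Rightarrow> bool" where
  "golod_local A \<longleftrightarrow> (\<exists>\<nn>. local_ring A \<nn> \<and>
     (\<forall>xs. minimal_generators A \<nn> xs \<longrightarrow> trivial_massey_operation (koszul A xs)))"

definition golod_graded :: "('a, 'b) ring_scheme \<Rightarrow> (nat \<Rightarrow> 'a set) \<Rightarrow> bool" where
  "golod_graded A gr \<longleftrightarrow> standard_graded_algebra A gr \<and>
     (\<forall>xs. minimal_generators A (irrelevant_ideal A gr) xs \<and> set xs \<subseteq> (\<Union>i. gr i) \<longrightarrow>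
        trivial_massey_operation (koszul A xs))"

end

theory Submission
  imports Defs
begin

text \<open>The Koszul complex \<open>K\<close> of \<open>R\<close> on minimal generators of the maximal ideal is exact in positive degrees. Chasing a cycle of
  positive degree of the Koszul complex \<open>K'\<close> of \<open>R/IJ\<close> through the mapping cone resolution, and using that
  the trimming maps are split and that the resolution of \<open>R/J\<close> is minimal, one finds that every such cycle is
  homologous to the image of a sum of elements \<open>f z\<close> with \<open>f = cx_aug F (e a)\<close> in \<open>I\<close> and \<open>d z\<close> having all
  coefficients in \<open>J\<close>. In \<open>K\<close> there is \<open>Y\<close> with \<open>d Y = - f\<close>, so replacing \<open>f\<close> by \<open>Y\<close> in
  every factor but the first of a product of such sums defines a trivial Massey operation; the terms involving
  \<open>d z\<close> vanish because they are multiples of \<open>f J \<subseteq> I J\<close>.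

  Exactness of \<open>K\<close> holds because the generators form a regular sequence. For a regular local ring this is derived
  from Krull's principal ideal theorem applied along a maximal chain of primes; for a polynomial ring, minimal
  homogeneous generators are linear forms whose monomials again form a basis.\<close>

section \<open>Finite sums\<close>

text \<open>What the splitting gives: in the mapping cone, \<open>Q\<close> sends the summand coming
  from \<open>F\<close> into the copies of \<open>G\<close>, whose own differential is zero modulo
  the maximal ideal. Modulo that ideal only \<open>Q\<close> remains, and a retraction of
  \<open>Q\<close> shows that an element of the cone with differential zero modulo the ideal has its
  \<open>F\<close> component in the ideal. So the \<open>F\<close> component can be removed in the
  chase, and what survives lies in t copies of a resolution of R/J; this is the origin of the
  coefficients in \<open>J\<close>. The obstacle is that a component can be removed in positive
  Koszul degree only if the Koszul boundary already lifts to an element without \<open>F\<close>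
  component. The chase is therefore an induction in which the Koszul degree falls while the degree
  in the cone rises, and the lift is part of the statement. The sign in d Y = - f fits the Massey
  relation because the bar is minus the grading involution. A basis of the homology is chosen among
  the classes of the distinguished cycles, so that every letter has a representative carrying the
  factors f.\<close>

context abelian_monoid
begin

lemma finsum_cong_simple:
  "\<lbrakk>\<And>i. i \<in> A \<Longrightarrow> f i = g i; \<And>i. i \<in> A \<Longrightarrow> g i \<in> carrier G\<rbrakk> \<Longrightarrow> finsum G f A = finsum G g A"
  by (rule finsum_cong') auto

lemma finsum_all_zero: "(\<And>i. i \<in> A \<Longrightarrow> f i = \<zero>) \<Longrightarrow> finsum G f A = \<zero>"
  by (rule add.finprod_one_eqI)

lemma finsum_reindex_bij:
  assumes "bij_betw h A B" and "\<And>j. j \<in> B \<Longrightarrow> f j \<in> carrier G"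
  shows "finsum G f B = finsum G (\<lambda>i. f (h i)) A"
proof -
  have "B = h ` A" "inj_on h A" using assms(1) by (auto simp: bij_betw_def)
  then show ?thesis using finsum_reindex[of f h A] assms(2) by auto
qed

lemma finsum_Sigma:
  assumes "finite A" and "\<And>i. i \<in> A \<Longrightarrow> finite (B i)"
    and "\<And>i j. i \<in> A \<Longrightarrow> j \<in> B i \<Longrightarrow> f i j \<in> carrier G"
  shows "(\<Oplus>i\<in>A. \<Oplus>j\<in>B i. f i j) = (\<Oplus>p\<in>Sigma A B. f (fst p) (snd p))"
proof -
  have eq: "Sigma A B = (\<Union>i\<in>A. Pair i ` B i)" by auto
  have "(\<Oplus>p\<in>Sigma A B. f (fst p) (snd p)) = (\<Oplus>i\<in>A. \<Oplus>p\<in>Pair i ` B i. f (fst p) (snd p))"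
    unfolding eq by (rule add.finprod_UN_disjoint) (use assms in \<open>auto simp: pairwise_def disjnt_def\<close>)
  also have "\<dots> = (\<Oplus>i\<in>A. \<Oplus>j\<in>B i. f i j)"
  proof (rule finsum_cong_simple)
    fix i assume i: "i \<in> A"
    show "(\<Oplus>p\<in>Pair i ` B i. f (fst p) (snd p)) = (\<Oplus>j\<in>B i. f i j)"
      using i assms(3) by (subst finsum_reindex) (auto simp: inj_on_def)
    show "(\<Oplus>j\<in>B i. f i j) \<in> carrier G" using i assms(3) by (intro finsum_closed) auto
  qed
  finally show ?thesis by simp
qed

lemma finsum_swap:
  assumes "finite A" "finite B" and "\<And>i j. i \<in> A \<Longrightarrow> j \<in> B \<Longrightarrow> f i j \<in> carrier G"
  shows "(\<Oplus>i\<in>A. \<Oplus>j\<in>B. f i j) = (\<Oplus>j\<in>B. \<Oplus>i\<in>A. f i j)"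
proof -
  have "(\<Oplus>p\<in>A \<times> B. f (fst p) (snd p)) = (\<Oplus>p\<in>B \<times> A. f (snd p) (fst p))"
    by (subst finsum_reindex_bij[where h = "\<lambda>(x, y). (y, x)" and A = "B \<times> A"])
      (use assms in \<open>auto intro!: finsum_cong_simple simp: bij_betw_def inj_on_def image_def\<close>)
  then show ?thesis
    using assms by (simp add: finsum_Sigma)
qed

lemma finsum_extend:
  assumes "finite B" "A \<subseteq> B" "\<And>i. i \<in> B - A \<Longrightarrow> f i = \<zero>" "\<And>i. i \<in> A \<Longrightarrow> f i \<in> carrier G"
  shows "finsum G f A = finsum G f B"
  by (rule add.finprod_mono_neutral_cong_left) (use assms in auto, (metis DiffI zero_closed))

lemma finsum_single:
  assumes "finite A" "i \<in> A" "\<And>j. j \<in> A \<Longrightarrow> j \<noteq> i \<Longrightarrow> f j = \<zero>" "f i \<in> carrier G"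
  shows "finsum G f A = f i"
proof -
  have "finsum G f {i} = finsum G f A"
    by (rule finsum_extend) (use assms in auto)
  then show ?thesis using assms(4) by simp
qed

lemma finsum_Pow_insert:
  assumes "finite U" "i \<notin> U" "\<And>S. S \<subseteq> insert i U \<Longrightarrow> f S \<in> carrier G"
  shows "(\<Oplus>S\<in>Pow (insert i U). f S) = (\<Oplus>S\<in>Pow U. f S) \<oplus> (\<Oplus>S\<in>Pow U. f (insert i S))"
proof -
  have "(\<Oplus>S\<in>Pow (insert i U). f S) = (\<Oplus>S\<in>Pow U. f S) \<oplus> (\<Oplus>S\<in>insert i ` Pow U. f S)"
    unfolding Pow_insert by (rule finsum_Un_disjoint) (use assms in \<open>auto intro!: assms(3)\<close>)
  also have "(\<Oplus>S\<in>insert i ` Pow U. f S) = (\<Oplus>S\<in>Pow U. f (insert i S))"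
  proof (rule finsum_reindex)
    show "f \<in> insert i ` Pow U \<rightarrow> carrier G" by (auto intro!: assms(3))
    show "inj_on (insert i) (Pow U)" using assms(2) by (intro inj_onI) (metis PowD insert_ident subsetD)
  qed
  finally show ?thesis .
qed

end

lemma (in abelian_group) finsum_minus:
  assumes "finite A" "\<And>i. i \<in> A \<Longrightarrow> f i \<in> carrier G"
  shows "(\<Oplus>i\<in>A. \<ominus> f i) = \<ominus> (\<Oplus>i\<in>A. f i)"
  using assms
proof (induct set: finite)
  case (insert x F)
  then show ?case by (simp add: Pi_def minus_add a_comm)
qed (simp, metis minus_equality l_zero zero_closed)

section \<open>Signs\<close>

lemma inversions_Un_left:
  assumes "finite S" "finite S'" "finite T" "S \<inter> S' = {}"
  shows "inversions (S \<union> S') T = inversions S T + inversions S' T"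
proof -
  have "{(i, j). i \<in> S \<union> S' \<and> j \<in> T \<and> j < i} =
    {(i, j). i \<in> S \<and> j \<in> T \<and> j < i} \<union> {(i, j). i \<in> S' \<and> j \<in> T \<and> j < i}" by auto
  moreover have "finite {(i, j). i \<in> Z \<and> j \<in> T \<and> j < i}" if "finite Z" for Z
    by (rule finite_subset[of _ "Z \<times> T"]) (use that assms(3) in auto)
  ultimately show ?thesis
    using assms unfolding inversions_def by (subst card_Un_disjoint[symmetric]) auto
qed

lemma inversions_Un_right:
  assumes "finite S" "finite T" "finite T'" "T \<inter> T' = {}"
  shows "inversions S (T \<union> T') = inversions S T + inversions S T'"
proof -
  have "{(i, j). i \<in> S \<and> j \<in> T \<union> T' \<and> j < i} =
    {(i, j). i \<in> S \<and> j \<in> T \<and> j < i} \<union> {(i, j). i \<in> S \<and> j \<in> T' \<and> j < i}" by auto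
  moreover have "finite {(i, j). i \<in> S \<and> j \<in> Z \<and> j < i}" if "finite Z" for Z
    by (rule finite_subset[of _ "S \<times> Z"]) (use that assms(1) in auto)
  ultimately show ?thesis
    using assms unfolding inversions_def by (subst card_Un_disjoint[symmetric]) auto
qed

lemma inversions_empty [simp]: "inversions {} T = 0" "inversions S {} = 0"
  by (auto simp: inversions_def)

lemma inversions_insert_left:
  "\<lbrakk>finite S; finite T; i \<notin> S\<rbrakk> \<Longrightarrow> inversions (insert i S) T = inversions {i} T + inversions S T"
  using inversions_Un_left[of "{i}" S T] by simp

lemma inversions_insert_right:
  "\<lbrakk>finite S; finite T; i \<notin> T\<rbrakk> \<Longrightarrow> inversions S (insert i T) = inversions S {i} + inversions S T"
  using inversions_Un_right[of S "{i}" T] by simp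

text \<open>Every element of \<open>S\<close> lies either below or above \<open>i\<close>, so it is
  counted in exactly one of the two terms. This is where the sign (-1)^|S| comes from when a
  contraction passes the factor e_S.\<close>

lemma inversions_swap:
  assumes "finite S" "i \<notin> S"
  shows "inversions {i} S + inversions S {i} = card S"
proof -
  have "{(k, j). k \<in> {i} \<and> j \<in> S \<and> j < k} = Pair i ` {j \<in> S. j < i}"
    "{(k, j). k \<in> S \<and> j \<in> {i} \<and> j < k} = (\<lambda>k. (k, i)) ` {j \<in> S. i < j}" by auto
  then have "inversions {i} S = card {j \<in> S. j < i}" "inversions S {i} = card {j \<in> S. i < j}"
    unfolding inversions_def by (simp_all add: card_image inj_on_def)
  moreover have "card S = card ({j \<in> S. j < i} \<union> {j \<in> S. i < j})"
    using assms(2) by (intro arg_cong[where f = card]) (auto, metis linorder_neqE_nat)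
  ultimately show ?thesis using assms(1) by (simp add: card_Un_disjoint disjoint_iff)
qed

lemma inversions_singletons: "i \<noteq> j \<Longrightarrow> inversions {i} {j} + inversions {j} {i} = 1"
  using inversions_swap[of "{j}" i] by simp

lemma inversions_max: "(\<And>j. j \<in> U \<Longrightarrow> j < i) \<Longrightarrow> finite U \<Longrightarrow> inversions {i} U = card U"
proof -
  assume a: "\<And>j. j \<in> U \<Longrightarrow> j < i" "finite U"
  have "{(k, j). k \<in> {i} \<and> j \<in> U \<and> j < k} = Pair i ` U" using a by auto
  then show ?thesis unfolding inversions_def by (simp add: card_image inj_on_def)
qed

lemma inversions_min: "(\<And>j. j \<in> U \<Longrightarrow> i \<le> j) \<Longrightarrow> inversions {i} U = 0"
proof -
  assume "\<And>j. j \<in> U \<Longrightarrow> i \<le> j"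
  then have "{(k, j). k \<in> {i} \<and> j \<in> U \<and> j < k} = {}" by (auto simp: not_less)
  then show ?thesis unfolding inversions_def by (metis card.empty)
qed

context cring
begin

text \<open>Signs become elements of the ring: products of signs then collect into one exponent by
  \<open>sg_add\<close>, and sign identities turn into parity statements about inversion
  numbers.\<close>

abbreviation sg :: "nat \<Rightarrow> 'a" where "sg k \<equiv> signed R k \<one>"

lemma sg_closed [simp]: "sg k \<in> carrier R" by (simp add: signed_def)

lemma signed_eq: "a \<in> carrier R \<Longrightarrow> signed R k a = sg k \<otimes> a"
  by (simp add: signed_def l_minus)

lemma signed_closed [simp]: "a \<in> carrier R \<Longrightarrow> signed R k a \<in> carrier R" by (simp add: signed_def)

lemma sg_add: "sg (k + l) = sg k \<otimes> sg l"
  by (auto simp: signed_def l_minus r_minus)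

lemma sg_parity: "even k = even l \<Longrightarrow> sg k = sg l"
  by (simp add: signed_def)

lemma sg_odd: "even k \<noteq> even l \<Longrightarrow> sg k = \<ominus> sg l"
  by (auto simp: signed_def)

lemma sg_0 [simp]: "sg 0 = \<one>" by (simp add: signed_def)

lemma sg_sq [simp]: "sg k \<otimes> sg k = \<one>"
  using sg_add[of k k] by (simp add: signed_def)

end

section \<open>The Koszul complex as a differential graded algebra\<close>

locale koszul_algebra = cring A for A (structure) +
  fixes xs :: "'a list"
  assumes xs_closed: "set xs \<subseteq> carrier A"
begin

definition n where "n = length xs"

text \<open>Working forms of the operations of \<open>koszul\<close>: \<open>km\<close> is the
  product, \<open>kc i\<close> the contraction with the dual of e_i, \<open>kd\<close> the
  differential and \<open>si\<close> the grading involution. They are not cut off to subsets of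
  \<open>{..<n}\<close> and have their signs as factors, which keeps restrictions out of the
  computations; \<open>mult_B\<close> and \<open>diff_B\<close> translate back.\<close>

definition km where
  "km a b U = (\<Oplus>S\<in>Pow U. sg (inversions S (U - S)) \<otimes> (a S \<otimes> b (U - S)))"

definition kc where
  "kc i a U = (if i \<in> U then \<zero> else sg (inversions {i} U) \<otimes> a (insert i U))"

definition kd where "kd a U = (\<Oplus>i\<in>{..<n}. xs ! i \<otimes> kc i a U)"

definition si where "si a U = sg (card U) \<otimes> a U"

definition K where "K = Pow {..<n} \<rightarrow> carrier A"

abbreviation B where "B \<equiv> koszul A xs"

lemma xs_nth [simp]: "i < n \<Longrightarrow> xs ! i \<in> carrier A"
  using xs_closed by (auto simp: n_def)

lemma K_I: "(\<And>U. U \<subseteq> {..<n} \<Longrightarrow> a U \<in> carrier A) \<Longrightarrow> a \<in> K"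
  by (auto simp: K_def)

lemma K_D [simp]: "a \<in> K \<Longrightarrow> U \<subseteq> {..<n} \<Longrightarrow> a U \<in> carrier A"
  by (auto simp: K_def)

lemma K_sub: "\<lbrakk>a \<in> K; U \<subseteq> {..<n}; S \<subseteq> U\<rbrakk> \<Longrightarrow> a S \<in> carrier A" "\<lbrakk>a \<in> K; U \<subseteq> {..<n}\<rbrakk> \<Longrightarrow> a (U - S) \<in> carrier A"
  by (auto simp: K_def Pi_iff)

lemma fin_V: "U \<subseteq> {..<n} \<Longrightarrow> finite U"
  using finite_subset by blast

lemma km_closed [simp]: "\<lbrakk>a \<in> K; b \<in> K\<rbrakk> \<Longrightarrow> km a b \<in> K"
  by (intro K_I) (auto simp: km_def K_sub intro!: finsum_closed)

lemma kc_closed [simp]: "\<lbrakk>a \<in> K; i < n\<rbrakk> \<Longrightarrow> kc i a \<in> K"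
  by (intro K_I) (auto simp: kc_def)

lemma si_closed [simp]: "a \<in> K \<Longrightarrow> si a \<in> K"
  by (intro K_I) (auto simp: si_def)

lemma kd_closed [simp]: "a \<in> K \<Longrightarrow> kd a \<in> K"
  by (intro K_I) (auto simp: kd_def intro!: finsum_closed)

text \<open>Both sides are the sum over all ordered partitions of \<open>U\<close> into three
  pieces, with the inversions of all three pairs of pieces as sign. On the left the first two pieces
  come as a union \<open>T\<close> and a subset \<open>S\<close> of it, and (S, S') with T the union
  of S and S' is the change of index.\<close>

lemma km_assoc:
  assumes a: "a \<in> K" and b: "b \<in> K" and c: "c \<in> K" and U: "U \<subseteq> {..<n}"
  shows "km (km a b) c U = km a (km b c) U"
proof -
  have fU: "finite U" using fin_V[OF U] .
  let ?h = "\<lambda>S S'. sg (inversions S S' + inversions S (U - S - S') + inversions S' (U - S - S'))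
    \<otimes> (a S \<otimes> (b S' \<otimes> c (U - S - S')))"
  have cl: "\<And>S. S \<subseteq> U \<Longrightarrow> a S \<in> carrier A" "\<And>S. S \<subseteq> U \<Longrightarrow> b S \<in> carrier A" "\<And>S. S \<subseteq> U \<Longrightarrow> c S \<in> carrier A"
    using a b c U by auto
  have "km (km a b) c U = (\<Oplus>T\<in>Pow U. \<Oplus>S\<in>Pow T. ?h S (T - S))"
    unfolding km_def
  proof (rule finsum_cong_simple)
    fix T assume T: "T \<in> Pow U"
    have fT: "finite T" using T fU finite_subset by auto
    have "sg (inversions T (U - T)) \<otimes> ((\<Oplus>S\<in>Pow T. sg (inversions S (T - S)) \<otimes> (a S \<otimes> b (T - S))) \<otimes> c (U - T))
      = (\<Oplus>S\<in>Pow T. sg (inversions T (U - T)) \<otimes> ((sg (inversions S (T - S)) \<otimes> (a S \<otimes> b (T - S))) \<otimes> c (U - T)))"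
    proof -
      have 1: "(\<lambda>S. sg (inversions S (T - S)) \<otimes> (a S \<otimes> b (T - S))) \<in> Pow T \<rightarrow> carrier A"
        by (intro funcsetI m_closed cl sg_closed) (use T in auto)
      have 2: "c (U - T) \<in> carrier A" using cl by auto
      show ?thesis
        using 1 2 fT by (subst finsum_ldistr, simp_all, subst finsum_rdistr) auto
    qed
    also have "\<dots> = (\<Oplus>S\<in>Pow T. ?h S (T - S))"
    proof (rule finsum_cong_simple)
      fix S assume S: "S \<in> Pow T"
      have e: "U - S - (T - S) = U - T" using S T by auto
      have "inversions T (U - T) = inversions S (U - T) + inversions (T - S) (U - T)"
        using inversions_Un_left[of S "T - S" "U - T"] S fT fU
        by (metis Diff_disjoint Diff_partition PowD finite_Diff finite_subset)
      then have s: "sg (inversions S (T - S) + inversions S (U - S - (T - S)) + inversions (T - S) (U - S - (T - S)))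
         = sg (inversions T (U - T)) \<otimes> sg (inversions S (T - S))"
        unfolding e sg_add[symmetric] by (intro arg_cong[where f = sg]) simp
      have "a S \<in> carrier A" "b (T - S) \<in> carrier A" "c (U - T) \<in> carrier A"
        using S T by (auto intro!: cl)
      then show "sg (inversions T (U - T)) \<otimes> ((sg (inversions S (T - S)) \<otimes> (a S \<otimes> b (T - S))) \<otimes> c (U - T)) = ?h S (T - S)"
        unfolding e s[unfolded e] by (simp add: m_assoc)
      show "?h S (T - S) \<in> carrier A" using S T by (intro m_closed cl sg_closed) auto
    qed
    finally show "sg (inversions T (U - T)) \<otimes> ((\<Oplus>S\<in>Pow T. sg (inversions S (T - S)) \<otimes> (a S \<otimes> b (T - S))) \<otimes> c (U - T))
      = (\<Oplus>S\<in>Pow T. ?h S (T - S))" .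
    show "(\<Oplus>S\<in>Pow T. ?h S (T - S)) \<in> carrier A"
      using T by (intro finsum_closed funcsetI m_closed cl sg_closed) auto
  qed
  also have "\<dots> = (\<Oplus>p\<in>Sigma (Pow U) Pow. ?h (snd p) (fst p - snd p))"
    by (rule finsum_Sigma) (use fU in \<open>auto intro!: m_closed cl simp: finite_subset\<close>)
  also have "\<dots> = (\<Oplus>p\<in>Sigma (Pow U) (\<lambda>S. Pow (U - S)). ?h (fst p) (snd p))"
  proof (subst finsum_reindex_bij[where h = "\<lambda>(S, S'). (S \<union> S', S)" and A = "Sigma (Pow U) (\<lambda>S. Pow (U - S))"])
    show "bij_betw (\<lambda>(S, S'). (S \<union> S', S)) (Sigma (Pow U) (\<lambda>S. Pow (U - S))) (Sigma (Pow U) Pow)"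
      by (rule bij_betw_byWitness[where f' = "\<lambda>(T, S). (S, T - S)"]) auto
    show "?h (snd p) (fst p - snd p) \<in> carrier A" if "p \<in> Sigma (Pow U) Pow" for p
      using that by (intro m_closed cl sg_closed) auto
    show "(\<Oplus>i\<in>Sigma (Pow U) (\<lambda>S. Pow (U - S)). ?h (snd (case i of (S, S') \<Rightarrow> (S \<union> S', S))) (fst (case i of (S, S') \<Rightarrow> (S \<union> S', S)) - snd (case i of (S, S') \<Rightarrow> (S \<union> S', S)))) =
       (\<Oplus>p\<in>Sigma (Pow U) (\<lambda>S. Pow (U - S)). ?h (fst p) (snd p))"
    proof (rule finsum_cong_simple)
      fix p assume p: "p \<in> Sigma (Pow U) (\<lambda>S. Pow (U - S))"
      obtain S S' where [simp]: "p = (S, S')" by force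
      have "S \<union> S' - S = S'" using p by auto
      then show "?h (snd (case p of (S, S') \<Rightarrow> (S \<union> S', S))) (fst (case p of (S, S') \<Rightarrow> (S \<union> S', S)) - snd (case p of (S, S') \<Rightarrow> (S \<union> S', S))) = ?h (fst p) (snd p)"
        by simp
      show "?h (fst p) (snd p) \<in> carrier A" using p by (intro m_closed cl sg_closed) auto
    qed
  qed
  also have "\<dots> = (\<Oplus>S\<in>Pow U. \<Oplus>S'\<in>Pow (U - S). ?h S S')"
    by (rule finsum_Sigma[symmetric]) (use fU in \<open>auto intro!: m_closed cl simp: finite_subset\<close>)
  also have "\<dots> = km a (km b c) U"
    unfolding km_def
  proof (rule finsum_cong_simple)
    fix S assume S: "S \<in> Pow U"
    have 1: "(\<lambda>S'. sg (inversions S' (U - S - S')) \<otimes> (b S' \<otimes> c (U - S - S'))) \<in> Pow (U - S) \<rightarrow> carrier A"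
      by (intro funcsetI m_closed cl sg_closed) auto
    have aS: "a S \<in> carrier A" using S by (auto intro!: cl)
    have "sg (inversions S (U - S)) \<otimes> (a S \<otimes> (\<Oplus>S'\<in>Pow (U - S). sg (inversions S' (U - S - S')) \<otimes> (b S' \<otimes> c (U - S - S'))))
      = (\<Oplus>S'\<in>Pow (U - S). sg (inversions S (U - S)) \<otimes> (a S \<otimes> (sg (inversions S' (U - S - S')) \<otimes> (b S' \<otimes> c (U - S - S')))))"
      using 1 aS fU by (subst finsum_rdistr, simp_all, subst finsum_rdistr) auto
    also have "\<dots> = (\<Oplus>S'\<in>Pow (U - S). ?h S S')"
    proof (rule finsum_cong_simple)
      fix S' assume S': "S' \<in> Pow (U - S)"
      have f: "finite S" "finite S'" using S S' fU by (auto intro: finite_subset[of _ U])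
      have "inversions S (U - S) = inversions S S' + inversions S (U - S - S')"
        using inversions_Un_right[of S S' "U - S - S'"] S' f fU
        by (metis Diff_disjoint Diff_partition PowD finite_Diff)
      then have s: "sg (inversions S S' + inversions S (U - S - S') + inversions S' (U - S - S'))
         = sg (inversions S (U - S)) \<otimes> sg (inversions S' (U - S - S'))"
        unfolding sg_add[symmetric] by simp
      have "b S' \<in> carrier A" "c (U - S - S') \<in> carrier A" using S' by (auto intro!: cl)
      then show "sg (inversions S (U - S)) \<otimes> (a S \<otimes> (sg (inversions S' (U - S - S')) \<otimes> (b S' \<otimes> c (U - S - S')))) = ?h S S'"
        unfolding s using aS by (simp add: m_ac)
      show "?h S S' \<in> carrier A" using S S' by (intro m_closed cl sg_closed) auto
    qed
    finally show "(\<Oplus>S'\<in>Pow (U - S). ?h S S') = sg (inversions S (U - S)) \<otimes> (a S \<otimes> (\<Oplus>S'\<in>Pow (U - S). sg (inversions S' (U - S - S')) \<otimes> (b S' \<otimes> c (U - S - S'))))" by simp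
    show "sg (inversions S (U - S)) \<otimes> (a S \<otimes> (\<Oplus>S'\<in>Pow (U - S). sg (inversions S' (U - S - S')) \<otimes> (b S' \<otimes> c (U - S - S')))) \<in> carrier A"
      using aS 1 by simp
  qed
  finally show ?thesis .
qed

text \<open>Each contraction is an antiderivation; the differential is a linear combination of contractions.\<close>

lemma kc_km:
  assumes a: "a \<in> K" and b: "b \<in> K" and U: "U \<subseteq> {..<n}" and i: "i < n"
  shows "kc i (km a b) U = km (kc i a) b U \<oplus> km (si a) (kc i b) U"
proof (cases "i \<in> U")
  case False
  have fU: "finite U" using fin_V[OF U] .
  have iU: "insert i U \<subseteq> {..<n}" using U i by auto
  have cl: "\<And>S. S \<subseteq> insert i U \<Longrightarrow> a S \<in> carrier A" "\<And>S. S \<subseteq> insert i U \<Longrightarrow> b S \<in> carrier A"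
    using a b iU by (meson K_D order_trans)+
  \<comment> \<open>The subsets of \<open>insert i U\<close> are sorted by whether they contain
    \<open>i\<close>. Those that do not leave \<open>i\<close> to the right factor and give the
    contraction of \<open>b\<close>; the others give the contraction of \<open>a\<close>.\<close>
  have "kc i (km a b) U = sg (inversions {i} U) \<otimes> ((\<Oplus>S\<in>Pow U. sg (inversions S (insert i U - S)) \<otimes> (a S \<otimes> b (insert i U - S)))
     \<oplus> (\<Oplus>S\<in>Pow U. sg (inversions (insert i S) (insert i U - insert i S)) \<otimes> (a (insert i S) \<otimes> b (insert i U - insert i S))))"
    using False unfolding kc_def km_def
    by (subst finsum_Pow_insert) (use fU in \<open>auto intro!: m_closed cl\<close>)
  also have "\<dots> = (\<Oplus>S\<in>Pow U. sg (inversions {i} U) \<otimes> (sg (inversions S (insert i U - S)) \<otimes> (a S \<otimes> b (insert i U - S))))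
     \<oplus> (\<Oplus>S\<in>Pow U. sg (inversions {i} U) \<otimes> (sg (inversions (insert i S) (insert i U - insert i S)) \<otimes> (a (insert i S) \<otimes> b (insert i U - insert i S))))"
  proof -
    have 1: "(\<lambda>S. sg (inversions S (insert i U - S)) \<otimes> (a S \<otimes> b (insert i U - S))) \<in> Pow U \<rightarrow> carrier A"
      by (intro funcsetI m_closed cl sg_closed) auto
    have 2: "(\<lambda>S. sg (inversions (insert i S) (insert i U - insert i S)) \<otimes> (a (insert i S) \<otimes> b (insert i U - insert i S))) \<in> Pow U \<rightarrow> carrier A"
      by (intro funcsetI m_closed cl sg_closed) auto
    show ?thesis using 1 2 fU by (simp add: r_distr finsum_rdistr)
  qed
  also have "(\<Oplus>S\<in>Pow U. sg (inversions {i} U) \<otimes> (sg (inversions S (insert i U - S)) \<otimes> (a S \<otimes> b (insert i U - S)))) = km (si a) (kc i b) U"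
    unfolding km_def
  proof (rule finsum_cong_simple)
    fix S assume S: "S \<in> Pow U"
    have f: "finite S" "finite (U - S)" using S fU finite_subset by auto
    have n: "i \<notin> S" "i \<notin> U - S" using False S by auto
    have e: "insert i U - S = insert i (U - S)" using n by auto
    have "inversions {i} U = inversions {i} S + inversions {i} (U - S)"
      using inversions_Un_right[of "{i}" S "U - S"] f S by (metis Diff_disjoint Diff_partition PowD finite.emptyI finite_insert)
    moreover have "inversions S (insert i (U - S)) = inversions S {i} + inversions S (U - S)"
      using f n by (intro inversions_insert_right) auto
    moreover have "inversions {i} S + inversions S {i} = card S" using f n by (intro inversions_swap) auto
    ultimately have "sg (inversions {i} U) \<otimes> sg (inversions S (insert i (U - S))) = sg (inversions S (U - S)) \<otimes> (sg (card S) \<otimes> sg (inversions {i} (U - S)))"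
      unfolding sg_add[symmetric] by (intro arg_cong[where f = sg]) linarith
    moreover have "a S \<in> carrier A" "b (insert i (U - S)) \<in> carrier A" using S by (auto intro!: cl)
    ultimately show "sg (inversions {i} U) \<otimes> (sg (inversions S (insert i U - S)) \<otimes> (a S \<otimes> b (insert i U - S))) =
      sg (inversions S (U - S)) \<otimes> (si a S \<otimes> kc i b (U - S))"
      using False S unfolding e si_def kc_def by (simp add: m_ac)
    show "sg (inversions S (U - S)) \<otimes> (si a S \<otimes> kc i b (U - S)) \<in> carrier A"
      using S U a b i by (intro m_closed sg_closed K_D[of "si a"] K_D[of "kc i b"]) auto
  qed
  also have "(\<Oplus>S\<in>Pow U. sg (inversions {i} U) \<otimes> (sg (inversions (insert i S) (insert i U - insert i S)) \<otimes> (a (insert i S) \<otimes> b (insert i U - insert i S)))) = km (kc i a) b U"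
    unfolding km_def
  proof (rule finsum_cong_simple)
    fix S assume S: "S \<in> Pow U"
    have f: "finite S" "finite (U - S)" using S fU finite_subset by auto
    have n: "i \<notin> S" "i \<notin> U - S" using False S by auto
    have e: "insert i U - insert i S = U - S" using n False by auto
    have "inversions {i} U = inversions {i} S + inversions {i} (U - S)"
      using inversions_Un_right[of "{i}" S "U - S"] f S by (metis Diff_disjoint Diff_partition PowD finite.emptyI finite_insert)
    moreover have "inversions (insert i S) (U - S) = inversions {i} (U - S) + inversions S (U - S)"
      using f n by (intro inversions_insert_left) auto
    ultimately have "sg (inversions {i} U) \<otimes> sg (inversions (insert i S) (U - S)) = sg (inversions S (U - S)) \<otimes> sg (inversions {i} S)"
      unfolding sg_add[symmetric] by (intro sg_parity) auto
    moreover have "a (insert i S) \<in> carrier A" "b (U - S) \<in> carrier A" using S by (auto intro!: cl)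
    ultimately show "sg (inversions {i} U) \<otimes> (sg (inversions (insert i S) (insert i U - insert i S)) \<otimes> (a (insert i S) \<otimes> b (insert i U - insert i S))) =
      sg (inversions S (U - S)) \<otimes> (kc i a S \<otimes> b (U - S))"
      using n unfolding e kc_def by (simp add: m_assoc[symmetric])
    show "sg (inversions S (U - S)) \<otimes> (kc i a S \<otimes> b (U - S)) \<in> carrier A"
      using S U a b i by (intro m_closed sg_closed K_D[of "kc i a"] K_D[of "b"]) auto
  qed
  also have "km (si a) (kc i b) U \<oplus> km (kc i a) b U = km (kc i a) b U \<oplus> km (si a) (kc i b) U"
    using a b U i by (intro a_comm) auto
  finally show ?thesis .
next
  \<comment> \<open>Now the left side is zero, and the two terms on the right must cancel. With
    \<open>U = insert i W\<close>, the first only sees \<open>S\<close> inside \<open>W\<close> and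
    the second only sees \<open>insert i S\<close>; both then involve the product of
    \<open>a (insert i S)\<close> and \<open>b (insert i (W - S))\<close>, with opposite
    signs.\<close>
  case True
  have fU: "finite U" using fin_V[OF U] .
  define W where "W = U - {i}"
  have UW: "U = insert i W" and iW: "i \<notin> W" using True by (auto simp: W_def)
  have fW: "finite W" using fU by (simp add: W_def)
  have cl: "\<And>S. S \<subseteq> insert i W \<Longrightarrow> a S \<in> carrier A" "\<And>S. S \<subseteq> insert i W \<Longrightarrow> b S \<in> carrier A"
    using a b U unfolding UW by (meson K_D order_trans)+
  have cl': "\<And>S. S \<subseteq> insert i W \<Longrightarrow> kc i a S \<in> carrier A" "\<And>S. S \<subseteq> insert i W \<Longrightarrow> kc i b S \<in> carrier A" "\<And>S. S \<subseteq> insert i W \<Longrightarrow> si a S \<in> carrier A"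
    using a b U i unfolding UW by (meson K_D order_trans kc_closed si_closed)+
  have 1: "km (kc i a) b U = (\<Oplus>S\<in>Pow W. sg (inversions S (U - S)) \<otimes> (kc i a S \<otimes> b (U - S)))"
  proof -
    have "km (kc i a) b U = (\<Oplus>S\<in>Pow W. sg (inversions S (U - S)) \<otimes> (kc i a S \<otimes> b (U - S))) \<oplus>
      (\<Oplus>S\<in>Pow W. sg (inversions (insert i S) (U - insert i S)) \<otimes> (kc i a (insert i S) \<otimes> b (U - insert i S)))"
      unfolding km_def UW by (subst finsum_Pow_insert) (use fW iW in \<open>auto intro!: m_closed cl cl'\<close>)
    also have "(\<Oplus>S\<in>Pow W. sg (inversions (insert i S) (U - insert i S)) \<otimes> (kc i a (insert i S) \<otimes> b (U - insert i S))) = \<zero>"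
      by (rule finsum_all_zero) (use cl in \<open>auto simp: kc_def UW subset_insertI2\<close>)
    finally show ?thesis
      by (simp add: finsum_closed UW cl cl' subset_insertI2 Pi_iff Diff_subset)
  qed
  have 2: "km (si a) (kc i b) U = (\<Oplus>S\<in>Pow W. sg (inversions (insert i S) (U - insert i S)) \<otimes> (si a (insert i S) \<otimes> kc i b (U - insert i S)))"
  proof -
    have "km (si a) (kc i b) U = (\<Oplus>S\<in>Pow W. sg (inversions S (U - S)) \<otimes> (si a S \<otimes> kc i b (U - S))) \<oplus>
      (\<Oplus>S\<in>Pow W. sg (inversions (insert i S) (U - insert i S)) \<otimes> (si a (insert i S) \<otimes> kc i b (U - insert i S)))"
      unfolding km_def UW by (subst finsum_Pow_insert) (use fW iW in \<open>auto intro!: m_closed cl cl'\<close>)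
    also have "(\<Oplus>S\<in>Pow W. sg (inversions S (U - S)) \<otimes> (si a S \<otimes> kc i b (U - S))) = \<zero>"
      by (rule finsum_all_zero) (use cl' iW in \<open>auto simp: kc_def UW subset_insertI2\<close>)
    also have "\<zero> \<oplus> (\<Oplus>S\<in>Pow W. sg (inversions (insert i S) (U - insert i S)) \<otimes> (si a (insert i S) \<otimes> kc i b (U - insert i S)))
      = (\<Oplus>S\<in>Pow W. sg (inversions (insert i S) (U - insert i S)) \<otimes> (si a (insert i S) \<otimes> kc i b (U - insert i S)))"
      by (intro l_zero finsum_closed funcsetI m_closed cl' sg_closed) (auto simp: UW)
    finally show ?thesis .
  qed
  have "km (kc i a) b U = \<ominus> km (si a) (kc i b) U"
    unfolding 1 2
  proof (subst finsum_minus[symmetric])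
    show "finite (Pow W)" using fW by simp
    show c: "sg (inversions (insert i S) (U - insert i S)) \<otimes> (si a (insert i S) \<otimes> kc i b (U - insert i S)) \<in> carrier A" if "S \<in> Pow W" for S
      using that by (intro m_closed cl' sg_closed) (auto simp: UW)
    show "(\<Oplus>S\<in>Pow W. sg (inversions S (U - S)) \<otimes> (kc i a S \<otimes> b (U - S))) =
      (\<Oplus>S\<in>Pow W. \<ominus> (sg (inversions (insert i S) (U - insert i S)) \<otimes> (si a (insert i S) \<otimes> kc i b (U - insert i S))))"
    proof (rule finsum_cong_simple)
      fix S assume S: "S \<in> Pow W"
      show "\<ominus> (sg (inversions (insert i S) (U - insert i S)) \<otimes> (si a (insert i S) \<otimes> kc i b (U - insert i S))) \<in> carrier A"
        using c[OF S] by simp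
      have f: "finite S" "finite (W - S)" using S fW finite_subset by auto
      have nin: "i \<notin> S" "i \<notin> W - S" using iW S by auto
      have e: "U - S = insert i (W - S)" "U - insert i S = W - S" "insert i (U - insert i S) = insert i (W - S)"
        using nin by (auto simp: UW)
      have "inversions S (insert i (W - S)) = inversions S {i} + inversions S (W - S)"
        using f nin by (intro inversions_insert_right) auto
      moreover have "card S = inversions {i} S + inversions S {i}" using f nin by (intro inversions_swap[symmetric]) auto
      moreover have "inversions (insert i S) (W - S) = inversions {i} (W - S) + inversions S (W - S)"
        using f nin by (intro inversions_insert_left) auto
      moreover have "card (insert i S) = Suc (card S)" using f nin by simp
      ultimately have "sg (inversions S (U - S)) \<otimes> sg (inversions {i} S)
        = \<ominus> (sg (inversions (insert i S) (U - insert i S)) \<otimes> (sg (card (insert i S)) \<otimes> sg (inversions {i} (U - insert i S))))"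
        unfolding e sg_add[symmetric] by (intro sg_odd) auto
      then have "(sg (inversions S (U - S)) \<otimes> sg (inversions {i} S)) \<otimes> (a (insert i S) \<otimes> b (insert i (W - S)))
        = \<ominus> (sg (inversions (insert i S) (U - insert i S)) \<otimes> (sg (card (insert i S)) \<otimes> sg (inversions {i} (U - insert i S)))) \<otimes> (a (insert i S) \<otimes> b (insert i (W - S)))"
        by simp
      moreover have "a (insert i S) \<in> carrier A" "b (insert i (W - S)) \<in> carrier A" using S by (auto intro!: cl)
      ultimately show "sg (inversions S (U - S)) \<otimes> (kc i a S \<otimes> b (U - S)) =
        \<ominus> (sg (inversions (insert i S) (U - insert i S)) \<otimes> (si a (insert i S) \<otimes> kc i b (U - insert i S)))"
        using nin unfolding e si_def kc_def by (simp add: m_ac l_minus r_minus)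
    qed
  qed
  moreover have "km (si a) (kc i b) U \<in> carrier A" using a b U i by (intro K_D[of "km _ _"]) auto
  ultimately show ?thesis using True by (simp add: kc_def l_neg)
qed

lemma km_add_left:
  "\<lbrakk>a \<in> K; b \<in> K; c \<in> K; U \<subseteq> {..<n}\<rbrakk> \<Longrightarrow> km (\<lambda>S. a S \<oplus> b S) c U = km a c U \<oplus> km b c U"
  unfolding km_def
  by (subst finsum_addf[symmetric], auto simp: K_sub Pi_iff simp del: add.finprod_multf)
    (rule finsum_cong_simple, auto simp: l_distr r_distr K_sub)

lemma km_add_right:
  "\<lbrakk>a \<in> K; b \<in> K; c \<in> K; U \<subseteq> {..<n}\<rbrakk> \<Longrightarrow> km c (\<lambda>S. a S \<oplus> b S) U = km c a U \<oplus> km c b U"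
  unfolding km_def
  by (subst finsum_addf[symmetric], auto simp: K_sub Pi_iff simp del: add.finprod_multf)
    (rule finsum_cong_simple, auto simp: l_distr r_distr K_sub)

lemma km_smult_left:
  assumes "a \<in> K" "b \<in> K" "r \<in> carrier A" "U \<subseteq> {..<n}"
  shows "km (\<lambda>S. r \<otimes> a S) b U = r \<otimes> km a b U"
  unfolding km_def using assms fin_V[OF assms(4)]
  by (subst finsum_rdistr) (auto simp: m_ac K_sub intro!: finsum_cong_simple)

lemma km_smult_right:
  assumes "a \<in> K" "b \<in> K" "r \<in> carrier A" "U \<subseteq> {..<n}"
  shows "km a (\<lambda>S. r \<otimes> b S) U = r \<otimes> km a b U"
  unfolding km_def using assms fin_V[OF assms(4)]
  by (subst finsum_rdistr) (auto simp: m_ac K_sub intro!: finsum_cong_simple)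

lemma kd_km:
  assumes a: "a \<in> K" and b: "b \<in> K" and U: "U \<subseteq> {..<n}"
  shows "kd (km a b) U = km (kd a) b U \<oplus> km (si a) (kd b) U"
proof -
  have fU: "finite U" using fin_V[OF U] .
  have sub: "\<And>S. S \<in> Pow U \<Longrightarrow> S \<subseteq> {..<n}" "\<And>S. S \<in> Pow U \<Longrightarrow> U - S \<subseteq> {..<n}" using U by auto
  have 1: "km (kd a) b U = (\<Oplus>i\<in>{..<n}. xs ! i \<otimes> km (kc i a) b U)"
  proof -
    have "km (kd a) b U = (\<Oplus>S\<in>Pow U. \<Oplus>i\<in>{..<n}. sg (inversions S (U - S)) \<otimes> ((xs ! i \<otimes> kc i a S) \<otimes> b (U - S)))"
      unfolding km_def kd_def using a b fU sub
      by (intro finsum_cong_simple) (subst finsum_ldistr, auto intro!: finsum_rdistr finsum_closed m_closed)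
    also have "\<dots> = (\<Oplus>i\<in>{..<n}. \<Oplus>S\<in>Pow U. sg (inversions S (U - S)) \<otimes> ((xs ! i \<otimes> kc i a S) \<otimes> b (U - S)))"
      using a b fU sub by (intro finsum_swap) auto
    also have "\<dots> = (\<Oplus>i\<in>{..<n}. xs ! i \<otimes> km (kc i a) b U)"
    proof (rule finsum_cong_simple)
      fix i assume i: "i \<in> {..<n}"
      show "(\<Oplus>S\<in>Pow U. sg (inversions S (U - S)) \<otimes> ((xs ! i \<otimes> kc i a S) \<otimes> b (U - S))) = xs ! i \<otimes> km (kc i a) b U"
        using km_smult_left[of "kc i a" b "xs ! i" U] a b U i by (simp add: km_def)
      show "xs ! i \<otimes> km (kc i a) b U \<in> carrier A" using a b U i by simp
    qed
    finally show ?thesis .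
  qed
  have 2: "km (si a) (kd b) U = (\<Oplus>i\<in>{..<n}. xs ! i \<otimes> km (si a) (kc i b) U)"
  proof -
    have "km (si a) (kd b) U = (\<Oplus>S\<in>Pow U. \<Oplus>i\<in>{..<n}. sg (inversions S (U - S)) \<otimes> (si a S \<otimes> (xs ! i \<otimes> kc i b (U - S))))"
      unfolding km_def kd_def using a b fU sub
      by (intro finsum_cong_simple) (subst finsum_rdistr, auto intro!: finsum_rdistr finsum_closed m_closed)
    also have "\<dots> = (\<Oplus>i\<in>{..<n}. \<Oplus>S\<in>Pow U. sg (inversions S (U - S)) \<otimes> (si a S \<otimes> (xs ! i \<otimes> kc i b (U - S))))"
      using a b fU sub by (intro finsum_swap) auto
    also have "\<dots> = (\<Oplus>i\<in>{..<n}. xs ! i \<otimes> km (si a) (kc i b) U)"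
    proof (rule finsum_cong_simple)
      fix i assume i: "i \<in> {..<n}"
      show "(\<Oplus>S\<in>Pow U. sg (inversions S (U - S)) \<otimes> (si a S \<otimes> (xs ! i \<otimes> kc i b (U - S)))) = xs ! i \<otimes> km (si a) (kc i b) U"
        using km_smult_right[of "si a" "kc i b" "xs ! i" U] a b U i by (simp add: km_def)
      show "xs ! i \<otimes> km (si a) (kc i b) U \<in> carrier A" using a b U i by simp
    qed
    finally show ?thesis .
  qed
  have "kd (km a b) U = (\<Oplus>i\<in>{..<n}. xs ! i \<otimes> km (kc i a) b U \<oplus> xs ! i \<otimes> km (si a) (kc i b) U)"
    unfolding kd_def using a b U by (intro finsum_cong_simple) (auto simp: kc_km r_distr)
  also have "\<dots> = km (kd a) b U \<oplus> km (si a) (kd b) U"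
    unfolding 1 2 using a b U by (intro finsum_addf) auto
  finally show ?thesis .
qed

end

section \<open>The DG algebra \<open>B\<close>: ring structure, grading, Leibniz rule and
  scalars\<close>

context koszul_algebra
begin

abbreviation V where "V \<equiv> Pow {..<n}"

lemma koszul_simps:
  "carrier B = V \<rightarrow>\<^sub>E carrier A"
  "a \<otimes>\<^bsub>B\<^esub> b = (\<lambda>U\<in>V. \<Oplus>S\<in>Pow U. signed A (inversions S (U - S)) (a S \<otimes> b (U - S)))"
  "\<one>\<^bsub>B\<^esub> = (\<lambda>U\<in>V. if U = {} then \<one> else \<zero>)"
  "\<zero>\<^bsub>B\<^esub> = (\<lambda>U\<in>V. \<zero>)"
  "a \<oplus>\<^bsub>B\<^esub> b = (\<lambda>U\<in>V. a U \<oplus> b U)"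
  "dgdiff B a = (\<lambda>U\<in>V. \<Oplus>i\<in>{..<n} - U. signed A (inversions {i} U) (xs ! i \<otimes> a (insert i U)))"
  "homog B p = {a \<in> V \<rightarrow>\<^sub>E carrier A. \<forall>S\<in>V. card S \<noteq> p \<longrightarrow> a S = \<zero>}"
  by (simp_all add: koszul_def Let_def n_def)

lemma carrier_K: "a \<in> carrier B \<Longrightarrow> a \<in> K"
  by (auto simp: koszul_simps K_def)

lemma B_apply [simp]: "\<lbrakk>a \<in> carrier B; U \<subseteq> {..<n}\<rbrakk> \<Longrightarrow> a U \<in> carrier A"
  using carrier_K by auto

lemma carrier_B_I: "a \<in> K \<Longrightarrow> (\<lambda>U\<in>V. a U) \<in> carrier B"
  by (auto simp: koszul_simps)

lemma B_eqI:
  assumes "a \<in> carrier B" "b \<in> carrier B" "\<And>U. U \<subseteq> {..<n} \<Longrightarrow> a U = b U"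
  shows "a = b"
  by (rule PiE_ext[OF assms(1,2)[unfolded koszul_simps]]) (simp add: assms(3))

lemma mult_B: "\<lbrakk>a \<in> K; b \<in> K\<rbrakk> \<Longrightarrow> a \<otimes>\<^bsub>B\<^esub> b = (\<lambda>U\<in>V. km a b U)"
proof
  fix U assume ab: "a \<in> K" "b \<in> K"
  show "(a \<otimes>\<^bsub>B\<^esub> b) U = (\<lambda>U\<in>V. km a b U) U"
  proof (cases "U \<in> V")
    case True
    then have "(\<Oplus>S\<in>Pow U. signed A (inversions S (U - S)) (a S \<otimes> b (U - S))) = km a b U"
      unfolding km_def
    proof (intro finsum_cong_simple)
      fix S assume "S \<in> Pow U"
      then have "a S \<in> carrier A" "b (U - S) \<in> carrier A" using True ab by (blast intro: K_D)+
      then show "signed A (inversions S (U - S)) (a S \<otimes> b (U - S)) = sg (inversions S (U - S)) \<otimes> (a S \<otimes> b (U - S))"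
        "sg (inversions S (U - S)) \<otimes> (a S \<otimes> b (U - S)) \<in> carrier A" by (auto intro: signed_eq)
    qed
    with True show ?thesis by (simp add: koszul_simps)
  qed (simp add: koszul_simps)
qed

lemma diff_B: "a \<in> K \<Longrightarrow> dgdiff B a = (\<lambda>U\<in>V. kd a U)"
proof
  fix U assume a: "a \<in> K"
  show "dgdiff B a U = (\<lambda>U\<in>V. kd a U) U"
  proof (cases "U \<in> V")
    case True
    then have "(\<Oplus>i\<in>{..<n} - U. signed A (inversions {i} U) (xs ! i \<otimes> a (insert i U))) = (\<Oplus>i\<in>{..<n} - U. xs ! i \<otimes> kc i a U)"
      using a True by (intro finsum_cong_simple, subst signed_eq) (auto simp: kc_def m_lcomm)
    also have "\<dots> = kd a U" unfolding kd_def
      using a True by (intro finsum_extend) (auto simp: kc_def)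
    finally show ?thesis using True by (simp add: koszul_simps)
  qed (simp add: koszul_simps)
qed

lemma km_cong:
  "\<lbrakk>\<And>S. S \<subseteq> {..<n} \<Longrightarrow> a S = a' S; \<And>S. S \<subseteq> {..<n} \<Longrightarrow> b S = b' S; a' \<in> K; b' \<in> K; U \<subseteq> {..<n}\<rbrakk> \<Longrightarrow> km a b U = km a' b' U"
  unfolding km_def
proof (rule finsum_cong_simple)
  fix S assume *: "\<And>S. S \<subseteq> {..<n} \<Longrightarrow> a S = a' S" "\<And>S. S \<subseteq> {..<n} \<Longrightarrow> b S = b' S" "a' \<in> K" "b' \<in> K" "U \<subseteq> {..<n}" "S \<in> Pow U"
  then have "S \<subseteq> {..<n}" "U - S \<subseteq> {..<n}" by auto
  then show "sg (inversions S (U - S)) \<otimes> (a S \<otimes> b (U - S)) = sg (inversions S (U - S)) \<otimes> (a' S \<otimes> b' (U - S))"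
    "sg (inversions S (U - S)) \<otimes> (a' S \<otimes> b' (U - S)) \<in> carrier A" using * by auto
qed

lemma kd_cong:
  "\<lbrakk>\<And>S. S \<subseteq> {..<n} \<Longrightarrow> a S = a' S; a' \<in> K; U \<subseteq> {..<n}\<rbrakk> \<Longrightarrow> kd a U = kd a' U"
  unfolding kd_def by (rule finsum_cong_simple) (auto simp: kc_def)

lemma mult_apply: "\<lbrakk>a \<in> carrier B; b \<in> carrier B; U \<subseteq> {..<n}\<rbrakk> \<Longrightarrow> (a \<otimes>\<^bsub>B\<^esub> b) U = km a b U"
  by (simp add: mult_B carrier_K)

lemma diff_apply: "\<lbrakk>a \<in> carrier B; U \<subseteq> {..<n}\<rbrakk> \<Longrightarrow> dgdiff B a U = kd a U"
  by (simp add: diff_B carrier_K)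

lemma add_apply: "U \<subseteq> {..<n} \<Longrightarrow> (a \<oplus>\<^bsub>B\<^esub> b) U = a U \<oplus> b U"
  by (simp add: koszul_simps)

lemma mult_B_closed: "\<lbrakk>a \<in> carrier B; b \<in> carrier B\<rbrakk> \<Longrightarrow> a \<otimes>\<^bsub>B\<^esub> b \<in> carrier B"
  by (simp add: mult_B carrier_K carrier_B_I)

lemma diff_B_closed: "a \<in> carrier B \<Longrightarrow> dgdiff B a \<in> carrier B"
  by (simp add: diff_B carrier_K carrier_B_I)

lemma km_one_left: "\<lbrakk>a \<in> K; U \<subseteq> {..<n}\<rbrakk> \<Longrightarrow> km (\<lambda>S. if S = {} then \<one> else \<zero>) a U = a U"
  unfolding km_def by (subst finsum_single[where i = "{}"]) (auto simp: fin_V K_sub)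

lemma km_one_right: "\<lbrakk>a \<in> K; U \<subseteq> {..<n}\<rbrakk> \<Longrightarrow> km a (\<lambda>S. if S = {} then \<one> else \<zero>) U = a U"
  unfolding km_def by (subst finsum_single[where i = U]) (auto simp: fin_V K_sub)

lemma ring_B: "ring B"
proof (rule ringI)
  have K_add: "a \<oplus>\<^bsub>B\<^esub> b \<in> carrier B" if "a \<in> carrier B" "b \<in> carrier B" for a b
    using that by (auto simp: koszul_simps)
  show "abelian_group B"
  proof (rule abelian_groupI)
    fix x assume x: "x \<in> carrier B"
    have "(\<lambda>U\<in>V. \<ominus> x U) \<in> carrier B" "(\<lambda>U\<in>V. \<ominus> x U) \<oplus>\<^bsub>B\<^esub> x = \<zero>\<^bsub>B\<^esub>"
      using carrier_K[OF x] by (auto simp: koszul_simps l_neg intro!: restrict_ext)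
    then show "\<exists>y\<in>carrier B. y \<oplus>\<^bsub>B\<^esub> x = \<zero>\<^bsub>B\<^esub>" by blast
  next
    fix x y z assume "x \<in> carrier B" "y \<in> carrier B" "z \<in> carrier B"
    note [simp] = this[THEN carrier_K]
    show "x \<oplus>\<^bsub>B\<^esub> y \<oplus>\<^bsub>B\<^esub> z = x \<oplus>\<^bsub>B\<^esub> (y \<oplus>\<^bsub>B\<^esub> z)"
      by (auto simp: koszul_simps a_assoc intro!: restrict_ext)
  next
    fix x y assume "x \<in> carrier B" "y \<in> carrier B"
    note [simp] = this[THEN carrier_K]
    show "x \<oplus>\<^bsub>B\<^esub> y = y \<oplus>\<^bsub>B\<^esub> x"
      by (auto simp: koszul_simps a_comm intro!: restrict_ext)
  next
    fix x assume x: "x \<in> carrier B"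
    show "\<zero>\<^bsub>B\<^esub> \<oplus>\<^bsub>B\<^esub> x = x"
      by (rule B_eqI) (use x carrier_K[OF x] in \<open>auto simp: koszul_simps\<close>)
  qed (auto simp: K_add, simp add: koszul_simps)
  have one: "\<one>\<^bsub>B\<^esub> \<in> carrier B" by (auto simp: koszul_simps)
  show "monoid B"
  proof (rule monoidI)
    fix x y z assume x: "x \<in> carrier B" and y: "y \<in> carrier B" and z: "z \<in> carrier B"
    show "x \<otimes>\<^bsub>B\<^esub> y \<in> carrier B" by (rule mult_B_closed) fact+
    show "x \<otimes>\<^bsub>B\<^esub> y \<otimes>\<^bsub>B\<^esub> z = x \<otimes>\<^bsub>B\<^esub> (y \<otimes>\<^bsub>B\<^esub> z)"
    proof (rule B_eqI)
      fix U assume U: "U \<subseteq> {..<n}"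
      have "(x \<otimes>\<^bsub>B\<^esub> y \<otimes>\<^bsub>B\<^esub> z) U = km (x \<otimes>\<^bsub>B\<^esub> y) z U" by (rule mult_apply) (use x y z U mult_B_closed in auto)
      also have "\<dots> = km (km x y) z U" by (rule km_cong) (use x y z U in \<open>auto simp: mult_apply carrier_K\<close>)
      also have "\<dots> = km x (km y z) U" using x y z U by (simp add: km_assoc carrier_K)
      also have "\<dots> = km x (y \<otimes>\<^bsub>B\<^esub> z) U"
        by (rule km_cong[symmetric]) (use x y z U in \<open>auto simp: mult_apply carrier_K\<close>)
      also have "\<dots> = (x \<otimes>\<^bsub>B\<^esub> (y \<otimes>\<^bsub>B\<^esub> z)) U" by (rule mult_apply[symmetric]) (use x y z U mult_B_closed in auto)
      finally show "(x \<otimes>\<^bsub>B\<^esub> y \<otimes>\<^bsub>B\<^esub> z) U = (x \<otimes>\<^bsub>B\<^esub> (y \<otimes>\<^bsub>B\<^esub> z)) U" .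
    qed (use x y z in \<open>auto intro!: mult_B_closed\<close>)
  next
    fix x assume x: "x \<in> carrier B"
    have k: "(\<lambda>S. if S = {} then \<one> else \<zero>) \<in> K" by (auto intro: K_I)
    show "\<one>\<^bsub>B\<^esub> \<otimes>\<^bsub>B\<^esub> x = x"
    proof (rule B_eqI)
      fix U assume U: "U \<subseteq> {..<n}"
      have "(\<one>\<^bsub>B\<^esub> \<otimes>\<^bsub>B\<^esub> x) U = km (\<lambda>S. if S = {} then \<one> else \<zero>) x U"
        using U x one by (subst mult_apply) (auto intro!: km_cong k carrier_K simp: koszul_simps)
      then show "(\<one>\<^bsub>B\<^esub> \<otimes>\<^bsub>B\<^esub> x) U = x U" using U x by (simp add: km_one_left carrier_K)
    qed (use x one in \<open>auto intro!: mult_B_closed\<close>)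
    show "x \<otimes>\<^bsub>B\<^esub> \<one>\<^bsub>B\<^esub> = x"
    proof (rule B_eqI)
      fix U assume U: "U \<subseteq> {..<n}"
      have "(x \<otimes>\<^bsub>B\<^esub> \<one>\<^bsub>B\<^esub>) U = km x (\<lambda>S. if S = {} then \<one> else \<zero>) U"
        using U x one by (subst mult_apply) (auto intro!: km_cong k carrier_K simp: koszul_simps)
      then show "(x \<otimes>\<^bsub>B\<^esub> \<one>\<^bsub>B\<^esub>) U = x U" using U x by (simp add: km_one_right carrier_K)
    qed (use x one in \<open>auto intro!: mult_B_closed\<close>)
  qed (rule one)
  fix x y z assume x: "x \<in> carrier B" and y: "y \<in> carrier B" and z: "z \<in> carrier B"
  have k: "(\<lambda>S. x S \<oplus> y S) \<in> K" using x y by (intro K_I) simp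
  show "(x \<oplus>\<^bsub>B\<^esub> y) \<otimes>\<^bsub>B\<^esub> z = x \<otimes>\<^bsub>B\<^esub> z \<oplus>\<^bsub>B\<^esub> y \<otimes>\<^bsub>B\<^esub> z"
  proof (rule B_eqI)
    fix U assume U: "U \<subseteq> {..<n}"
    have "((x \<oplus>\<^bsub>B\<^esub> y) \<otimes>\<^bsub>B\<^esub> z) U = km (\<lambda>S. x S \<oplus> y S) z U"
      using U x y z by (subst mult_apply) (auto intro!: km_cong k carrier_K K_add simp: add_apply)
    then show "((x \<oplus>\<^bsub>B\<^esub> y) \<otimes>\<^bsub>B\<^esub> z) U = (x \<otimes>\<^bsub>B\<^esub> z \<oplus>\<^bsub>B\<^esub> y \<otimes>\<^bsub>B\<^esub> z) U"
      using U x y z by (simp add: km_add_left carrier_K add_apply mult_apply)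
  qed (use x y z in \<open>auto intro!: mult_B_closed K_add\<close>)
  show "z \<otimes>\<^bsub>B\<^esub> (x \<oplus>\<^bsub>B\<^esub> y) = z \<otimes>\<^bsub>B\<^esub> x \<oplus>\<^bsub>B\<^esub> z \<otimes>\<^bsub>B\<^esub> y"
  proof (rule B_eqI)
    fix U assume U: "U \<subseteq> {..<n}"
    have "(z \<otimes>\<^bsub>B\<^esub> (x \<oplus>\<^bsub>B\<^esub> y)) U = km z (\<lambda>S. x S \<oplus> y S) U"
      using U x y z by (subst mult_apply) (auto intro!: km_cong k carrier_K K_add simp: add_apply)
    then show "(z \<otimes>\<^bsub>B\<^esub> (x \<oplus>\<^bsub>B\<^esub> y)) U = (z \<otimes>\<^bsub>B\<^esub> x \<oplus>\<^bsub>B\<^esub> z \<otimes>\<^bsub>B\<^esub> y) U"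
      using U x y z by (simp add: km_add_right carrier_K add_apply mult_apply)
  qed (use x y z in \<open>auto intro!: mult_B_closed K_add\<close>)
qed

sublocale B: ring B by (rule ring_B)

lemma zero_apply [simp]: "U \<subseteq> {..<n} \<Longrightarrow> \<zero>\<^bsub>B\<^esub> U = \<zero>"
  by (simp add: koszul_simps)

lemma minus_apply: "\<lbrakk>a \<in> carrier B; U \<subseteq> {..<n}\<rbrakk> \<Longrightarrow> (\<ominus>\<^bsub>B\<^esub> a) U = \<ominus> a U"
proof -
  assume a: "a \<in> carrier B" and U: "U \<subseteq> {..<n}"
  have "(\<ominus>\<^bsub>B\<^esub> a \<oplus>\<^bsub>B\<^esub> a) U = \<zero>" using a U by (simp add: B.l_neg)
  then have "(\<ominus>\<^bsub>B\<^esub> a) U \<oplus> a U = \<zero>" using U by (simp add: add_apply)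
  then show ?thesis using a U by (metis B.a_inv_closed K_D carrier_K minus_equality minus_minus)
qed

text \<open>The grading involution, (-1)^p in degree p. Defined on all of \<open>B\<close>, it
  states the Leibniz rule also for sums of elements of different degrees.\<close>

definition invol where "invol a = (\<lambda>U\<in>V. sg (card U) \<otimes> a U)"

lemma invol_closed: "a \<in> carrier B \<Longrightarrow> invol a \<in> carrier B"
  using carrier_B_I[of "si a"] by (simp add: invol_def si_def[abs_def] carrier_K si_closed[unfolded si_def[abs_def]])

lemma leibniz:
  assumes a: "a \<in> carrier B" and b: "b \<in> carrier B"
  shows "dgdiff B (a \<otimes>\<^bsub>B\<^esub> b) = dgdiff B a \<otimes>\<^bsub>B\<^esub> b \<oplus>\<^bsub>B\<^esub> invol a \<otimes>\<^bsub>B\<^esub> dgdiff B b"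
proof (rule B_eqI)
  fix U assume U: "U \<subseteq> {..<n}"
  have "dgdiff B (a \<otimes>\<^bsub>B\<^esub> b) U = kd (km a b) U"
    using a b U by (subst diff_apply) (auto intro!: kd_cong simp: mult_apply carrier_K mult_B_closed)
  also have "\<dots> = km (kd a) b U \<oplus> km (si a) (kd b) U"
    using a b U by (intro kd_km carrier_K)
  also have "km (kd a) b U = (dgdiff B a \<otimes>\<^bsub>B\<^esub> b) U"
    using a b U by (subst mult_apply) (auto intro!: km_cong[symmetric] simp: diff_apply carrier_K diff_B_closed)
  also have "km (si a) (kd b) U = (invol a \<otimes>\<^bsub>B\<^esub> dgdiff B b) U"
    using a b U by (subst mult_apply, auto intro!: km_cong[symmetric] simp: diff_apply carrier_K diff_B_closed invol_closed)
      (simp add: invol_def si_def)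
  finally show "dgdiff B (a \<otimes>\<^bsub>B\<^esub> b) U = (dgdiff B a \<otimes>\<^bsub>B\<^esub> b \<oplus>\<^bsub>B\<^esub> invol a \<otimes>\<^bsub>B\<^esub> dgdiff B b) U"
    using U by (simp add: add_apply)
qed (use a b in \<open>auto intro!: diff_B_closed mult_B_closed invol_closed\<close>)

lemma diff_add:
  assumes a: "a \<in> carrier B" and b: "b \<in> carrier B"
  shows "dgdiff B (a \<oplus>\<^bsub>B\<^esub> b) = dgdiff B a \<oplus>\<^bsub>B\<^esub> dgdiff B b"
proof (rule B_eqI)
  fix U assume U: "U \<subseteq> {..<n}"
  have [simp]: "a \<in> K" "b \<in> K" using a b by (auto intro: carrier_K)
  have "kd (a \<oplus>\<^bsub>B\<^esub> b) U = (\<Oplus>i\<in>{..<n}. xs ! i \<otimes> kc i a U \<oplus> xs ! i \<otimes> kc i b U)"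
    unfolding kd_def using U
    by (intro finsum_cong_simple) (auto simp: kc_def add_apply r_distr)
  also have "\<dots> = kd a U \<oplus> kd b U"
    unfolding kd_def using U by (intro finsum_addf) auto
  finally show "dgdiff B (a \<oplus>\<^bsub>B\<^esub> b) U = (dgdiff B a \<oplus>\<^bsub>B\<^esub> dgdiff B b) U"
    using U a b by (simp add: add_apply diff_apply)
qed (use a b in \<open>auto intro!: diff_B_closed\<close>)

lemma homogD:
  assumes "a \<in> homog B p"
  shows "a \<in> carrier B" and "\<And>S. \<lbrakk>S \<subseteq> {..<n}; card S \<noteq> p\<rbrakk> \<Longrightarrow> a S = \<zero>"
  using assms by (auto simp: koszul_simps)

lemma homogI: "\<lbrakk>a \<in> carrier B; \<And>S. \<lbrakk>S \<subseteq> {..<n}; card S \<noteq> p\<rbrakk> \<Longrightarrow> a S = \<zero>\<rbrakk> \<Longrightarrow> a \<in> homog B p"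
  by (auto simp: koszul_simps)

lemma invol_homog:
  assumes "a \<in> homog B p"
  shows "invol a = (if even p then a else \<ominus>\<^bsub>B\<^esub> a)"
proof (rule B_eqI)
  have a: "a \<in> carrier B" by (rule homogD) fact
  show "invol a \<in> carrier B" "(if even p then a else \<ominus>\<^bsub>B\<^esub> a) \<in> carrier B" using a invol_closed by auto
  fix U assume U: "U \<subseteq> {..<n}"
  have aU: "a U \<in> carrier A" using a U by simp
  show "invol a U = (if even p then a else \<ominus>\<^bsub>B\<^esub> a) U"
  proof (cases "card U = p")
    case True then show ?thesis using U a aU by (auto simp: invol_def minus_apply signed_def l_minus)
  next
    case False
    then have "a U = \<zero>" using homogD(2)[OF assms U] by simp
    then show ?thesis using U a by (auto simp: invol_def minus_apply)
  qed
qed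

text \<open>\<open>dg_bar\<close> asks for the existence of an odd degree. An element that lies in
  an even and in an odd degree is zero, so the choice is harmless, and the bar is the negative of
  the sign that the Leibniz rule produces.\<close>

lemma dg_bar_homog:
  assumes a: "a \<in> homog B p"
  shows "dg_bar B a = \<ominus>\<^bsub>B\<^esub> invol a"
proof -
  have ca: "a \<in> carrier B" by (rule homogD) fact
  show ?thesis
  proof (cases "odd p")
    case True
    then show ?thesis using a ca by (auto simp: dg_bar_def invol_homog)
  next
    case False
    have "a = \<ominus>\<^bsub>B\<^esub> a" if q: "odd q" "a \<in> homog B q" for q
    proof -
      have "a = \<zero>\<^bsub>B\<^esub>"
      proof (rule B_eqI)
        fix U assume U: "U \<subseteq> {..<n}"
        have "card U \<noteq> p \<or> card U \<noteq> q" using q False by auto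
        then show "a U = \<zero>\<^bsub>B\<^esub> U" using homogD(2)[OF a U] homogD(2)[OF q(2) U] U by auto
      qed (use ca in auto)
      then show ?thesis by simp
    qed
    then show ?thesis using a False by (auto simp: dg_bar_def invol_homog)
  qed
qed

lemma homog_mult:
  assumes a: "a \<in> homog B p" and b: "b \<in> homog B q"
  shows "a \<otimes>\<^bsub>B\<^esub> b \<in> homog B (p + q)"
proof (rule homogI)
  note ca = homogD(1)[OF a] and cb = homogD(1)[OF b]
  show "a \<otimes>\<^bsub>B\<^esub> b \<in> carrier B" using ca cb by (rule mult_B_closed)
  fix U assume U: "U \<subseteq> {..<n}" "card U \<noteq> p + q"
  have "km a b U = \<zero>" unfolding km_def
  proof (rule finsum_all_zero)
    fix S assume S: "S \<in> Pow U"
    have fU: "finite U" by (rule fin_V) fact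
    have sub: "S \<subseteq> {..<n}" "U - S \<subseteq> {..<n}" using S U by auto
    have "card U = card S + card (U - S)"
      using S fU by (metis PowD card_Diff_subset card_mono finite_subset le_add_diff_inverse)
    then have "card S \<noteq> p \<or> card (U - S) \<noteq> q" using U by auto
    then have "a S = \<zero> \<or> b (U - S) = \<zero>" using homogD(2)[OF a sub(1)] homogD(2)[OF b sub(2)] by auto
    moreover have "a S \<in> carrier A" "b (U - S) \<in> carrier A" using ca cb sub by auto
    ultimately show "sg (inversions S (U - S)) \<otimes> (a S \<otimes> b (U - S)) = \<zero>" by auto
  qed
  then show "(a \<otimes>\<^bsub>B\<^esub> b) U = \<zero>" using ca cb U by (simp add: mult_apply)
qed

lemma homog_add:
  assumes a: "a \<in> homog B p" and b: "b \<in> homog B p"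
  shows "a \<oplus>\<^bsub>B\<^esub> b \<in> homog B p"
  using homogD[OF a] homogD[OF b] by (intro homogI) (auto simp: add_apply)

lemma homog_zero: "\<zero>\<^bsub>B\<^esub> \<in> homog B p"
  by (intro homogI) auto

text \<open>Multiplication by a scalar of \<open>A\<close>, which is not a field of the DG algebra
  record. By \<open>iota_mult\<close> it is multiplication by a degree zero element.\<close>

definition sc where "sc r a = (\<lambda>U\<in>V. r \<otimes> a U)"

lemma sc_closed: "\<lbrakk>r \<in> carrier A; a \<in> carrier B\<rbrakk> \<Longrightarrow> sc r a \<in> carrier B"
  unfolding sc_def by (intro carrier_B_I K_I) auto

lemma sc_apply: "U \<subseteq> {..<n} \<Longrightarrow> sc r a U = r \<otimes> a U"
  by (simp add: sc_def)

lemma sc_homog: "\<lbrakk>r \<in> carrier A; a \<in> homog B p\<rbrakk> \<Longrightarrow> sc r a \<in> homog B p"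
  using homogD[of a p] by (intro homogI) (auto simp: sc_closed sc_apply)

lemma sc_mult_left:
  "\<lbrakk>r \<in> carrier A; a \<in> carrier B; b \<in> carrier B\<rbrakk> \<Longrightarrow> sc r a \<otimes>\<^bsub>B\<^esub> b = sc r (a \<otimes>\<^bsub>B\<^esub> b)"
proof (rule B_eqI)
  fix U assume *: "r \<in> carrier A" "a \<in> carrier B" "b \<in> carrier B" "U \<subseteq> {..<n}"
  have "(sc r a \<otimes>\<^bsub>B\<^esub> b) U = km (\<lambda>S. r \<otimes> a S) b U"
    using * by (subst mult_apply) (auto intro!: km_cong K_I simp: sc_apply sc_closed carrier_K)
  then show "(sc r a \<otimes>\<^bsub>B\<^esub> b) U = sc r (a \<otimes>\<^bsub>B\<^esub> b) U"
    using * by (simp add: km_smult_left carrier_K sc_apply mult_apply)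
qed (auto intro!: mult_B_closed sc_closed)

lemma sc_mult_right:
  "\<lbrakk>r \<in> carrier A; a \<in> carrier B; b \<in> carrier B\<rbrakk> \<Longrightarrow> a \<otimes>\<^bsub>B\<^esub> sc r b = sc r (a \<otimes>\<^bsub>B\<^esub> b)"
proof (rule B_eqI)
  fix U assume *: "r \<in> carrier A" "a \<in> carrier B" "b \<in> carrier B" "U \<subseteq> {..<n}"
  have "(a \<otimes>\<^bsub>B\<^esub> sc r b) U = km a (\<lambda>S. r \<otimes> b S) U"
    using * by (subst mult_apply) (auto intro!: km_cong K_I simp: sc_apply sc_closed carrier_K)
  then show "(a \<otimes>\<^bsub>B\<^esub> sc r b) U = sc r (a \<otimes>\<^bsub>B\<^esub> b) U"
    using * by (simp add: km_smult_right carrier_K sc_apply mult_apply)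
qed (auto intro!: mult_B_closed sc_closed)

lemma diff_sc:
  assumes r: "r \<in> carrier A" and a: "a \<in> carrier B"
  shows "dgdiff B (sc r a) = sc r (dgdiff B a)"
proof (rule B_eqI)
  fix U assume U: "U \<subseteq> {..<n}"
  have [simp]: "a \<in> K" using a by (rule carrier_K)
  have "kd (sc r a) U = (\<Oplus>i\<in>{..<n}. r \<otimes> (xs ! i \<otimes> kc i a U))"
    unfolding kd_def using U r by (intro finsum_cong_simple) (auto simp: kc_def sc_apply m_ac)
  also have "\<dots> = r \<otimes> kd a U"
    unfolding kd_def using U r by (intro finsum_rdistr[symmetric]) auto
  finally show "dgdiff B (sc r a) U = sc r (dgdiff B a) U"
    using U a r by (simp add: diff_apply sc_apply sc_closed)
qed (use r a in \<open>auto intro!: diff_B_closed sc_closed\<close>)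

lemma finsum_apply:
  assumes "finite I" "\<And>i. i \<in> I \<Longrightarrow> f i \<in> carrier B" "U \<subseteq> {..<n}"
  shows "(\<Oplus>\<^bsub>B\<^esub>i\<in>I. f i) U = (\<Oplus>i\<in>I. f i U)"
  using assms(1,2)
proof (induct set: finite)
  case empty then show ?case using assms(3) by simp
next
  case (insert x F)
  then have "(\<lambda>i. f i U) \<in> F \<rightarrow> carrier A" "f x U \<in> carrier A" using assms(3) by auto
  with insert show ?case using assms(3) by (simp add: add_apply Pi_def)
qed

lemma finsum_homog:
  assumes "finite I" "\<And>i. i \<in> I \<Longrightarrow> f i \<in> homog B p"
  shows "(\<Oplus>\<^bsub>B\<^esub>i\<in>I. f i) \<in> homog B p"
  using assms
proof (induct set: finite)
  case empty then show ?case by (simp add: homog_zero)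
next
  case (insert x F)
  then show ?case by (subst B.finsum_insert) (auto intro!: homog_add dest: homogD(1))
qed

lemma diff_zero: "dgdiff B \<zero>\<^bsub>B\<^esub> = \<zero>\<^bsub>B\<^esub>"
  using diff_add[of "\<zero>\<^bsub>B\<^esub>" "\<zero>\<^bsub>B\<^esub>"] diff_B_closed[of "\<zero>\<^bsub>B\<^esub>"]
  by (metis B.add.l_cancel_one' B.add.r_cancel_one B.l_zero B.zero_closed)

lemma diff_minus: "a \<in> carrier B \<Longrightarrow> dgdiff B (\<ominus>\<^bsub>B\<^esub> a) = \<ominus>\<^bsub>B\<^esub> dgdiff B a"
  using diff_add[of "\<ominus>\<^bsub>B\<^esub> a" a]
  by (metis B.a_inv_closed B.l_neg B.minus_equality diff_B_closed diff_zero)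

lemma diff_finsum:
  assumes "finite I" "\<And>i. i \<in> I \<Longrightarrow> f i \<in> carrier B"
  shows "dgdiff B (\<Oplus>\<^bsub>B\<^esub>i\<in>I. f i) = (\<Oplus>\<^bsub>B\<^esub>i\<in>I. dgdiff B (f i))"
  using assms
proof (induct set: finite)
  case empty then show ?case by (simp add: diff_zero)
next
  case (insert x F) then show ?case by (simp add: diff_add diff_B_closed Pi_def)
qed

end

section \<open>Koszul complexes with coefficients in a module\<close>

text \<open>Degree p of the Koszul complex with coefficients in \<open>M\<close>. The default value
  off the p-subsets is zero and not \<open>undefined\<close>, so chains can be added pointwise and
  equality of chains is equality of functions.\<close>

definition kchain :: "('a, 'm, 'c) module_scheme \<Rightarrow> nat \<Rightarrow> nat \<Rightarrow> (nat set \<Rightarrow> 'm) set" where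
  "kchain M n p = {a. \<forall>U. if U \<subseteq> {..<n} \<and> card U = p then a U \<in> carrier M else a U = \<zero>\<^bsub>M\<^esub>}"

definition kdiff :: "('a, 'b) ring_scheme \<Rightarrow> ('a, 'm, 'c) module_scheme \<Rightarrow> 'a list \<Rightarrow> (nat set \<Rightarrow> 'm) \<Rightarrow> nat set \<Rightarrow> 'm" where
  "kdiff R M ys a U = (if U \<subseteq> {..<length ys}
     then \<Oplus>\<^bsub>M\<^esub>i\<in>{..<length ys}. ys ! i \<odot>\<^bsub>M\<^esub> (if i \<in> U then \<zero>\<^bsub>M\<^esub> else signed R (inversions {i} U) \<one>\<^bsub>R\<^esub> \<odot>\<^bsub>M\<^esub> a (insert i U))
     else \<zero>\<^bsub>M\<^esub>)"

definition multiples :: "('a, 'm, 'c) module_scheme \<Rightarrow> 'a list \<Rightarrow> nat \<Rightarrow> 'm set" where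
  "multiples M ys k = {\<Oplus>\<^bsub>M\<^esub>i\<in>{..<k}. ys ! i \<odot>\<^bsub>M\<^esub> m i | m. m \<in> {..<k} \<rightarrow> carrier M}"

text \<open>Weak regularity: \<open>M\<close> may coincide with the multiples of the whole sequence.
  The condition is phrased by membership in \<open>multiples\<close>, so that no quotient modules
  are formed.\<close>

definition regular_seq :: "('a, 'm, 'c) module_scheme \<Rightarrow> 'a list \<Rightarrow> bool" where
  "regular_seq M ys \<longleftrightarrow> (\<forall>k<length ys. \<forall>x\<in>carrier M. ys ! k \<odot>\<^bsub>M\<^esub> x \<in> multiples M ys k \<longrightarrow> x \<in> multiples M ys k)"

lemma (in abelian_group) a_inv_zero: "\<ominus> \<zero> = \<zero>"
  by (metis minus_equality l_zero zero_closed)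

text \<open>Terms off the diagonal cancel in pairs. Antisymmetry alone does not kill the diagonal
  when 2 is not invertible, which is why its vanishing is a separate assumption.\<close>

lemma (in abelian_group) finsum_antisym:
  assumes "\<And>i j. i < k \<Longrightarrow> j < k \<Longrightarrow> f i j \<in> carrier G"
    and "\<And>i j. i < k \<Longrightarrow> j < k \<Longrightarrow> i \<noteq> j \<Longrightarrow> f i j = \<ominus> f j i" and "\<And>i. i < k \<Longrightarrow> f i i = \<zero>"
  shows "(\<Oplus>i\<in>{..<k::nat}. \<Oplus>j\<in>{..<k}. f i j) = \<zero>"
  using assms
proof (induct k)
  case (Suc k)
  have IH: "(\<Oplus>i\<in>{..<k}. \<Oplus>j\<in>{..<k}. f i j) = \<zero>"
    by (rule Suc(1); (rule Suc(2) | rule Suc(3) | rule Suc(4)); simp)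
  have c: "\<And>i j. i \<le> k \<Longrightarrow> j \<le> k \<Longrightarrow> f i j \<in> carrier G" using Suc(2) by auto
  have in1: "(\<Oplus>j\<in>{..<Suc k}. f i j) = f i k \<oplus> (\<Oplus>j\<in>{..<k}. f i j)" if "i \<le> k" for i
    unfolding lessThan_Suc using that c by (subst finsum_insert) auto
  have "(\<Oplus>i\<in>{..<Suc k}. \<Oplus>j\<in>{..<Suc k}. f i j) = (\<Oplus>j\<in>{..<Suc k}. f k j) \<oplus> (\<Oplus>i\<in>{..<k}. \<Oplus>j\<in>{..<Suc k}. f i j)"
  proof -
    have "(\<lambda>i. \<Oplus>j\<in>{..<Suc k}. f i j) \<in> {..<k} \<rightarrow> carrier G" "(\<Oplus>j\<in>{..<Suc k}. f k j) \<in> carrier G"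
      by (intro funcsetI finsum_closed c; simp)+
    then show ?thesis unfolding lessThan_Suc[of k] by (subst finsum_insert) simp_all
  qed
  also have "(\<Oplus>i\<in>{..<k}. \<Oplus>j\<in>{..<Suc k}. f i j) = (\<Oplus>i\<in>{..<k}. f i k \<oplus> (\<Oplus>j\<in>{..<k}. f i j))"
    using c by (intro finsum_cong_simple) (auto simp: in1 intro!: finsum_closed a_closed)
  also have "\<dots> = (\<Oplus>i\<in>{..<k}. f i k) \<oplus> (\<Oplus>i\<in>{..<k}. \<Oplus>j\<in>{..<k}. f i j)"
    using c by (intro finsum_addf) (auto intro!: finsum_closed)
  also have "\<dots> = (\<Oplus>i\<in>{..<k}. f i k)" unfolding IH using c by (intro r_zero finsum_closed) auto
  also have "\<dots> = (\<Oplus>i\<in>{..<k}. \<ominus> f k i)"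
    using c by (intro finsum_cong_simple) (auto intro!: Suc(3))
  also have "\<dots> = \<ominus> (\<Oplus>i\<in>{..<k}. f k i)" using c by (intro finsum_minus) auto
  also have "(\<Oplus>j\<in>{..<Suc k}. f k j) = (\<Oplus>j\<in>{..<k}. f k j)"
    using in1[of k] Suc(4)[of k] c by (simp add: finsum_closed Pi_iff)
  also have "(\<Oplus>j\<in>{..<k}. f k j) \<oplus> \<ominus> (\<Oplus>j\<in>{..<k}. f k j) = \<zero>"
    using c by (intro r_neg finsum_closed) auto
  finally show ?case .
qed simp

locale koszul_module = module R M for R (structure) and M (structure) +
  fixes ys :: "'a list"
  assumes ys_closed: "set ys \<subseteq> carrier R"
begin

abbreviation "n \<equiv> length ys"
abbreviation "D \<equiv> kdiff R M ys"
abbreviation "KM \<equiv> kchain M n"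

lemma ys_nth [simp]: "i < n \<Longrightarrow> ys ! i \<in> carrier R"
  using ys_closed by auto

lemma smult_zero_r [simp]: "a \<in> carrier R \<Longrightarrow> a \<odot>\<^bsub>M\<^esub> \<zero>\<^bsub>M\<^esub> = \<zero>\<^bsub>M\<^esub>"
  by (rule smult_r_null)

definition mc where "mc i a U = (if i \<in> U then \<zero>\<^bsub>M\<^esub> else sg (inversions {i} U) \<odot>\<^bsub>M\<^esub> a (insert i U))"

lemma D_eq: "D a U = (if U \<subseteq> {..<n} then \<Oplus>\<^bsub>M\<^esub>i\<in>{..<n}. ys ! i \<odot>\<^bsub>M\<^esub> mc i a U else \<zero>\<^bsub>M\<^esub>)"
  by (simp add: kdiff_def mc_def)

lemma kchain_closed [simp]: "a \<in> KM p \<Longrightarrow> a U \<in> carrier M"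
  unfolding kchain_def by (auto, metis M.zero_closed)

lemma kchain_zero: "a \<in> KM p \<Longrightarrow> \<not> (U \<subseteq> {..<n} \<and> card U = p) \<Longrightarrow> a U = \<zero>\<^bsub>M\<^esub>"
  unfolding kchain_def by auto

lemma kchainI: "(\<And>U. U \<subseteq> {..<n} \<Longrightarrow> card U = p \<Longrightarrow> a U \<in> carrier M) \<Longrightarrow> (\<And>U. \<not> (U \<subseteq> {..<n} \<and> card U = p) \<Longrightarrow> a U = \<zero>\<^bsub>M\<^esub>) \<Longrightarrow> a \<in> KM p"
  unfolding kchain_def by auto

text \<open>Families without homogeneity. Linearity of \<open>D\<close> and \<open>D_D\<close> are
  proved at this level, so they apply to sums and to the intermediate contractions.\<close>

definition cochain where "cochain a \<longleftrightarrow> (\<forall>U. a U \<in> carrier M)"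

lemma cochainD [simp]: "cochain a \<Longrightarrow> a U \<in> carrier M" by (simp add: cochain_def)

lemma kchain_cochain [simp]: "a \<in> KM p \<Longrightarrow> cochain a" by (simp add: cochain_def)

lemma mc_closed [simp]: "cochain a \<Longrightarrow> mc i a U \<in> carrier M"
  by (simp add: mc_def)

lemma D_closed [simp]: "cochain a \<Longrightarrow> D a U \<in> carrier M"
  by (auto simp: D_eq intro!: M.finsum_closed)

lemma D_cochain [simp]: "cochain a \<Longrightarrow> cochain (D a)"
  by (simp add: cochain_def D_closed)

lemma D_kchain [simp]:
  assumes a: "a \<in> KM (Suc p)" shows "D a \<in> KM p"
proof (rule kchainI)
  fix U assume "\<not> (U \<subseteq> {..<n} \<and> card U = p)"
  moreover have "D a U = \<zero>\<^bsub>M\<^esub>" if "U \<subseteq> {..<n}" "card U \<noteq> p"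
  proof -
    have "mc i a U = \<zero>\<^bsub>M\<^esub>" for i
      using that kchain_zero[OF a, of "insert i U"] by (auto simp: mc_def card_insert_if finite_subset[of U])
    then show ?thesis by (auto simp: D_eq intro!: M.finsum_all_zero)
  qed
  ultimately show "D a U = \<zero>\<^bsub>M\<^esub>" by (auto simp: D_eq)
qed (use a in simp)

lemma mc_add: "\<lbrakk>cochain a; cochain b\<rbrakk> \<Longrightarrow> mc i (\<lambda>U. a U \<oplus>\<^bsub>M\<^esub> b U) U = mc i a U \<oplus>\<^bsub>M\<^esub> mc i b U"
  by (simp add: mc_def smult_r_distr)

lemma D_add: "\<lbrakk>cochain a; cochain b\<rbrakk> \<Longrightarrow> D (\<lambda>U. a U \<oplus>\<^bsub>M\<^esub> b U) U = D a U \<oplus>\<^bsub>M\<^esub> D b U"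
proof -
  assume ab: "cochain a" "cochain b"
  have "(\<Oplus>\<^bsub>M\<^esub>i\<in>{..<n}. ys ! i \<odot>\<^bsub>M\<^esub> mc i (\<lambda>U. a U \<oplus>\<^bsub>M\<^esub> b U) U) = (\<Oplus>\<^bsub>M\<^esub>i\<in>{..<n}. ys ! i \<odot>\<^bsub>M\<^esub> mc i a U \<oplus>\<^bsub>M\<^esub> ys ! i \<odot>\<^bsub>M\<^esub> mc i b U)"
    using ab by (intro M.finsum_cong_simple) (auto simp: mc_add smult_r_distr)
  then show ?thesis using ab by (simp add: D_eq Pi_iff)
qed

lemma D_smult: "\<lbrakk>cochain a; r \<in> carrier R\<rbrakk> \<Longrightarrow> D (\<lambda>U. r \<odot>\<^bsub>M\<^esub> a U) U = r \<odot>\<^bsub>M\<^esub> D a U"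
proof -
  assume ab: "cochain a" "r \<in> carrier R"
  have "(\<Oplus>\<^bsub>M\<^esub>i\<in>{..<n}. ys ! i \<odot>\<^bsub>M\<^esub> mc i (\<lambda>U. r \<odot>\<^bsub>M\<^esub> a U) U) = (\<Oplus>\<^bsub>M\<^esub>i\<in>{..<n}. r \<odot>\<^bsub>M\<^esub> (ys ! i \<odot>\<^bsub>M\<^esub> mc i a U))"
    using ab by (intro M.finsum_cong_simple) (auto simp: mc_def smult_assoc1[symmetric] m_ac)
  then show ?thesis using ab by (simp add: D_eq Pi_iff finsum_smult_ldistr)
qed

lemma minus_smult: "x \<in> carrier M \<Longrightarrow> \<ominus>\<^bsub>M\<^esub> x = (\<ominus> \<one>) \<odot>\<^bsub>M\<^esub> x"
  using smult_l_minus[of "\<one>" x] by simp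

lemma D_minus: "cochain a \<Longrightarrow> D (\<lambda>U. \<ominus>\<^bsub>M\<^esub> a U) U = \<ominus>\<^bsub>M\<^esub> D a U"
  using D_smult[of a "\<ominus> \<one>" U] by (simp add: minus_smult)

text \<open>Contractions anticommute: the two orders of inserting \<open>i\<close> and
  \<open>j\<close> differ by exactly one inversion, by \<open>inversions_singletons\<close>.\<close>

lemma mc_mc:
  assumes a: "cochain a" and U: "finite U" and ij: "i \<noteq> j"
  shows "mc i (mc j a) U = \<ominus>\<^bsub>M\<^esub> mc j (mc i a) U"
proof (cases "i \<in> U \<or> j \<in> U")
  case False
  have e: "inversions {i} (insert j U) = inversions {i} {j} + inversions {i} U"
      "inversions {j} (insert i U) = inversions {j} {i} + inversions {j} U"
    using False U by (auto intro: inversions_insert_right)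
  have o: "odd (inversions {i} {j} + inversions {j} {i})" using inversions_singletons[OF ij] by simp
  have "sg (inversions {i} U) \<otimes> sg (inversions {j} (insert i U)) = \<ominus> (sg (inversions {j} U) \<otimes> sg (inversions {i} (insert j U)))"
    unfolding e sg_add[symmetric] by (rule sg_odd) (use o in auto)
  then have "(sg (inversions {i} U) \<otimes> sg (inversions {j} (insert i U))) \<odot>\<^bsub>M\<^esub> a (insert i (insert j U)) = \<ominus>\<^bsub>M\<^esub> ((sg (inversions {j} U) \<otimes> sg (inversions {i} (insert j U))) \<odot>\<^bsub>M\<^esub> a (insert i (insert j U)))"
    using a by (simp add: smult_l_minus)
  then show ?thesis using False ij a by (auto simp: mc_def smult_assoc1 insert_commute)
next
  case True
  then show ?thesis using a by (auto simp: mc_def M.a_inv_zero)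
qed

text \<open>Expanding both differentials gives a double sum over \<open>i\<close> and
  \<open>j\<close> that is antisymmetric by \<open>mc_mc\<close> and has zero diagonal, since a
  contraction applied twice vanishes.\<close>

lemma D_D: assumes a: "cochain a" shows "D (D a) U = \<zero>\<^bsub>M\<^esub>"
proof (cases "U \<subseteq> {..<n}")
  case True
  have fU: "finite U" using True finite_subset by blast
  have "D (D a) U = (\<Oplus>\<^bsub>M\<^esub>i\<in>{..<n}. \<Oplus>\<^bsub>M\<^esub>j\<in>{..<n}. (ys ! i \<otimes> ys ! j) \<odot>\<^bsub>M\<^esub> mc i (mc j a) U)"
  proof -
    have "ys ! i \<odot>\<^bsub>M\<^esub> mc i (D a) U = (\<Oplus>\<^bsub>M\<^esub>j\<in>{..<n}. (ys ! i \<otimes> ys ! j) \<odot>\<^bsub>M\<^esub> mc i (mc j a) U)" if i: "i < n" for i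
    proof (cases "i \<in> U")
      case True then show ?thesis using i by (auto simp: mc_def intro!: M.finsum_all_zero[symmetric])
    next
      case False
      have "ys ! i \<odot>\<^bsub>M\<^esub> mc i (D a) U = (ys ! i \<otimes> sg (inversions {i} U)) \<odot>\<^bsub>M\<^esub> (\<Oplus>\<^bsub>M\<^esub>j\<in>{..<n}. ys ! j \<odot>\<^bsub>M\<^esub> mc j a (insert i U))"
        using False True i a by (simp add: mc_def D_eq smult_assoc1 cochain_def M.finsum_closed Pi_iff)
      also have "\<dots> = (\<Oplus>\<^bsub>M\<^esub>j\<in>{..<n}. (ys ! i \<otimes> sg (inversions {i} U)) \<odot>\<^bsub>M\<^esub> (ys ! j \<odot>\<^bsub>M\<^esub> mc j a (insert i U)))"
        using i a by (intro finsum_smult_ldistr) auto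
      also have "\<dots> = (\<Oplus>\<^bsub>M\<^esub>j\<in>{..<n}. (ys ! i \<otimes> ys ! j) \<odot>\<^bsub>M\<^esub> mc i (mc j a) U)"
        using i a False by (intro M.finsum_cong_simple) (auto simp: mc_def[of i] smult_assoc1[symmetric] m_ac)
      finally show ?thesis .
    qed
    then have "(\<Oplus>\<^bsub>M\<^esub>i\<in>{..<n}. ys ! i \<odot>\<^bsub>M\<^esub> mc i (D a) U) = (\<Oplus>\<^bsub>M\<^esub>i\<in>{..<n}. \<Oplus>\<^bsub>M\<^esub>j\<in>{..<n}. (ys ! i \<otimes> ys ! j) \<odot>\<^bsub>M\<^esub> mc i (mc j a) U)"
      using a by (intro M.finsum_cong_simple) (auto intro!: M.finsum_closed mc_closed simp: cochain_def[of "mc _ _"])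
    then show ?thesis using True by (simp add: D_eq[of "D a"])
  qed
  also have "\<dots> = \<zero>\<^bsub>M\<^esub>"
  proof (rule M.finsum_antisym)
    fix i j assume ij: "i < n" "j < n"
    have m: "cochain (mc j a)" for j using a by (simp add: cochain_def)
    show "(ys ! i \<otimes> ys ! j) \<odot>\<^bsub>M\<^esub> mc i (mc j a) U \<in> carrier M" using ij m by auto
    show "(ys ! i \<otimes> ys ! j) \<odot>\<^bsub>M\<^esub> mc i (mc j a) U = \<ominus>\<^bsub>M\<^esub> ((ys ! j \<otimes> ys ! i) \<odot>\<^bsub>M\<^esub> mc j (mc i a) U)" if "i \<noteq> j"
      using mc_mc[OF a fU that] ij m by (simp add: smult_r_minus m_comm)
    show "(ys ! i \<otimes> ys ! i) \<odot>\<^bsub>M\<^esub> mc i (mc i a) U = \<zero>\<^bsub>M\<^esub>" using ij by (simp add: mc_def)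
  qed
  finally show ?thesis .
qed (simp add: D_eq)

lemma D_deg1:
  assumes b: "b \<in> KM 1"
  shows "D b U = (if U = {} then \<Oplus>\<^bsub>M\<^esub>i\<in>{..<n}. ys ! i \<odot>\<^bsub>M\<^esub> b {i} else \<zero>\<^bsub>M\<^esub>)"
proof (cases "U = {}")
  case True then show ?thesis using b by (simp add: D_eq mc_def)
next
  case False
  have "D b \<in> KM 0" using b by simp
  then show ?thesis using False by (auto intro!: kchain_zero simp: finite_subset card_eq_0_iff)
qed

text \<open>The Koszul complex on the first \<open>k\<close> elements of the sequence, seen inside
  the full complex; this is the parameter of the induction for exactness.\<close>

definition supp where "supp k a \<longleftrightarrow> (\<forall>U. \<not> U \<subseteq> {..<k} \<longrightarrow> a U = \<zero>\<^bsub>M\<^esub>)"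

text \<open>The exterior product of \<open>c\<close> with e_k from the right. For \<open>c\<close>
  supported below \<open>k\<close> there are no inversions, hence no sign in the formula.\<close>

definition J where "J k c U = (if k \<in> U then c (U - {k}) else \<zero>\<^bsub>M\<^esub>)"

lemma J_kchain:
  assumes c: "c \<in> KM p" "supp k c" and k: "k < n"
  shows "J k c \<in> KM (Suc p)" "supp (Suc k) (J k c)"
proof -
  show "J k c \<in> KM (Suc p)"
  proof (rule kchainI)
    fix U assume "\<not> (U \<subseteq> {..<n} \<and> card U = Suc p)"
    moreover have "card U = Suc (card (U - {k}))" if "k \<in> U" "U - {k} \<subseteq> {..<n}"
      using that by (metis card.remove finite_Diff2 finite_lessThan finite_subset finite.emptyI finite.insertI)
    ultimately have "k \<in> U \<Longrightarrow> \<not> (U - {k} \<subseteq> {..<n} \<and> card (U - {k}) = p)"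
      using k by auto
    then show "J k c U = \<zero>\<^bsub>M\<^esub>" using kchain_zero[OF c(1), of "U - {k}"] by (simp add: J_def)
  qed (use c in \<open>simp add: J_def\<close>)
  show "supp (Suc k) (J k c)"
    unfolding supp_def
  proof (intro allI impI)
    fix U assume "\<not> U \<subseteq> {..<Suc k}"
    then have "\<not> U - {k} \<subseteq> {..<k}" by (auto simp: lessThan_Suc)
    then show "J k c U = \<zero>\<^bsub>M\<^esub>" using c(2) by (auto simp: J_def supp_def)
  qed
qed

lemma supp_D: assumes "supp k a" "cochain a" shows "supp k (D a)"
  unfolding supp_def
proof (intro allI impI)
  fix U assume "\<not> U \<subseteq> {..<k}"
  then have "mc i a U = \<zero>\<^bsub>M\<^esub>" for i using assms by (auto simp: mc_def supp_def)
  then show "D a U = \<zero>\<^bsub>M\<^esub>" by (auto simp: D_eq intro!: M.finsum_all_zero)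
qed

text \<open>The Leibniz rule for the product of \<open>c\<close> with e_k. At sets containing
  \<open>k\<close>, an index below \<open>k\<close> gives the same sign with or without
  \<open>k\<close>, and the other indices contribute nothing because of the support. At sets
  avoiding \<open>k\<close> only the contraction with \<open>k\<close> survives, and
  \<open>k\<close> exceeds all \<open>p\<close> elements of the set.\<close>

lemma D_J:
  assumes c: "c \<in> KM p" "supp k c" and k: "k < n"
  shows "D (J k c) U = J k (D c) U \<oplus>\<^bsub>M\<^esub> sg p \<odot>\<^bsub>M\<^esub> (ys ! k \<odot>\<^bsub>M\<^esub> c U)"
proof (cases "U \<subseteq> {..<n}")
  case False
  then have "\<not> U - {k} \<subseteq> {..<n}" using k by auto
  then show ?thesis using False k kchain_zero[OF c(1), of U] by (simp add: D_eq J_def)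
next
  case True
  have fU: "finite U" using True finite_subset by blast
  have cc: "cochain c" using c(1) by simp
  show ?thesis
  proof (cases "k \<in> U")
    case kU: True
    have cU: "c U = \<zero>\<^bsub>M\<^esub>" using c(2) kU by (auto simp: supp_def)
    have "D (J k c) U = (\<Oplus>\<^bsub>M\<^esub>i\<in>{..<n}. ys ! i \<odot>\<^bsub>M\<^esub> mc i c (U - {k}))"
      unfolding D_eq using True
    proof (simp, intro M.finsum_cong_simple)
      fix i assume i: "i \<in> {..<n}"
      show "ys ! i \<odot>\<^bsub>M\<^esub> mc i c (U - {k}) \<in> carrier M" using i cc by simp
      show "ys ! i \<odot>\<^bsub>M\<^esub> mc i (J k c) U = ys ! i \<odot>\<^bsub>M\<^esub> mc i c (U - {k})"
      proof (cases "i < k")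
        case True
        have "U = insert k (U - {k})" using kU by auto
        then have "inversions {i} U = inversions {i} {k} + inversions {i} (U - {k})"
          using inversions_insert_right[of "{i}" "U - {k}" k] fU by simp
        moreover have "inversions {i} {k} = 0" using True by (intro inversions_min) auto
        moreover have "insert i U - {k} = insert i (U - {k})" using True by auto
        ultimately show ?thesis using kU True by (auto simp: mc_def J_def)
      next
        case False
        have "c (insert i (U - {k})) = \<zero>\<^bsub>M\<^esub>" using c(2) False by (auto simp: supp_def)
        moreover have "i \<notin> U \<Longrightarrow> insert i U - {k} = insert i (U - {k})" using kU by auto
        ultimately show ?thesis using kU i by (auto simp: mc_def J_def)
      qed
    qed
    also have "\<dots> = J k (D c) U" using True kU by (auto simp: J_def D_eq)
    finally show ?thesis using cU k cc by (simp add: J_def)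
  next
    case kU: False
    have "D (J k c) U = (\<Oplus>\<^bsub>M\<^esub>i\<in>{..<n}. ys ! i \<odot>\<^bsub>M\<^esub> mc i (J k c) U)" using True by (simp add: D_eq)
    also have "\<dots> = ys ! k \<odot>\<^bsub>M\<^esub> mc k (J k c) U"
      using kU k cc by (intro M.finsum_single) (auto simp: mc_def J_def)
    also have "mc k (J k c) U = sg (inversions {k} U) \<odot>\<^bsub>M\<^esub> c U"
      using kU by (simp add: mc_def J_def)
    also have "\<dots> = sg p \<odot>\<^bsub>M\<^esub> c U"
    proof (cases "U \<subseteq> {..<k} \<and> card U = p")
      case True
      then have "inversions {k} U = p" using fU by (subst inversions_max) auto
      then show ?thesis by simp
    next
      case False
      then have "c U = \<zero>\<^bsub>M\<^esub>" using c kchain_zero[OF c(1)] by (auto simp: supp_def)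
      then show ?thesis by simp
    qed
    finally have "D (J k c) U = ys ! k \<odot>\<^bsub>M\<^esub> (sg p \<odot>\<^bsub>M\<^esub> c U)" .
    then show ?thesis using kU k cc by (simp add: J_def smult_assoc1[symmetric] m_comm)
  qed
qed

lemma kchain_add: "\<lbrakk>a \<in> KM p; b \<in> KM p\<rbrakk> \<Longrightarrow> (\<lambda>U. a U \<oplus>\<^bsub>M\<^esub> b U) \<in> KM p"
  using kchain_zero[of a p] kchain_zero[of b p] by (intro kchainI) auto

lemma kchain_smult: "\<lbrakk>a \<in> KM p; r \<in> carrier R\<rbrakk> \<Longrightarrow> (\<lambda>U. r \<odot>\<^bsub>M\<^esub> a U) \<in> KM p"
  using kchain_zero[of a p] by (intro kchainI) auto

lemma kchain_minus: "a \<in> KM p \<Longrightarrow> (\<lambda>U. \<ominus>\<^bsub>M\<^esub> a U) \<in> KM p"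
  using kchain_zero[of a p] by (intro kchainI) auto

lemma kchain_zeros: "(\<lambda>U. \<zero>\<^bsub>M\<^esub>) \<in> KM p"
  by (rule kchainI) auto

lemma multiples_boundary:
  assumes "x \<in> multiples M ys k" "k \<le> n"
  shows "\<exists>b\<in>KM 1. supp k b \<and> D b = (\<lambda>U. if U = {} then x else \<zero>\<^bsub>M\<^esub>)"
proof -
  obtain m where m: "m \<in> {..<k} \<rightarrow> carrier M" "x = (\<Oplus>\<^bsub>M\<^esub>i\<in>{..<k}. ys ! i \<odot>\<^bsub>M\<^esub> m i)"
    using assms by (auto simp: multiples_def)
  define b where "b U = (if \<exists>i<k. U = {i} then m (the_elem U) else \<zero>\<^bsub>M\<^esub>)" for U
  have b: "b \<in> KM 1"
  proof (rule kchainI)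
    show "b U \<in> carrier M" for U using m by (auto simp: b_def)
    fix U assume "\<not> (U \<subseteq> {..<n} \<and> card U = 1)"
    then show "b U = \<zero>\<^bsub>M\<^esub>" using assms(2) by (auto simp: b_def)
  qed
  have bi: "b {i} = (if i < k then m i else \<zero>\<^bsub>M\<^esub>)" for i by (auto simp: b_def)
  have "x = (\<Oplus>\<^bsub>M\<^esub>i\<in>{..<k}. ys ! i \<odot>\<^bsub>M\<^esub> b {i})"
    unfolding m(2) using m(1) assms(2) by (intro M.finsum_cong_simple) (auto simp: bi Pi_iff)
  also have "\<dots> = (\<Oplus>\<^bsub>M\<^esub>i\<in>{..<n}. ys ! i \<odot>\<^bsub>M\<^esub> b {i})"
    using m(1) assms(2) by (intro M.finsum_extend) (auto simp: bi Pi_iff)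
  finally have "D b = (\<lambda>U. if U = {} then x else \<zero>\<^bsub>M\<^esub>)" by (auto simp: D_deg1[OF b])
  moreover have "supp k b" by (auto simp: supp_def b_def)
  ultimately show ?thesis using b by blast
qed

text \<open>Induction on the number \<open>k\<close> of elements that the cycle involves. Write a =
  a0 + a1 e_k with \<open>a0\<close> and \<open>a1\<close> supported below \<open>k\<close>. Then
  \<open>a1\<close> is a cycle, and the boundary of \<open>a0\<close> is y_k times \<open>a1\<close>
  up to sign. Once \<open>a1\<close> is written as a boundary of some \<open>b1\<close>, subtracting
  the boundary of b1 e_k leaves a cycle that does not involve e_k.\<close>

theorem koszul_exact:
  assumes reg: "regular_seq M ys"
    and a: "a \<in> KM (Suc p)" and da: "\<And>U. D a U = \<zero>\<^bsub>M\<^esub>"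
  shows "\<exists>b\<in>KM (Suc (Suc p)). D b = a"
proof -
  have "\<exists>b\<in>KM (Suc (Suc p)). supp k b \<and> D b = a"
    if "k \<le> n" "a \<in> KM (Suc p)" "supp k a" "\<And>U. D a U = \<zero>\<^bsub>M\<^esub>" for k a p
    using that
  proof (induct k arbitrary: a p)
    case 0
    have "a U = \<zero>\<^bsub>M\<^esub>" for U
      using 0 kchain_zero[OF 0(2), of U] by (cases "U = {}") (auto simp: supp_def)
    then have "a = (\<lambda>U. \<zero>\<^bsub>M\<^esub>)" by auto
    moreover have "D (\<lambda>U. \<zero>\<^bsub>M\<^esub>) = (\<lambda>U. \<zero>\<^bsub>M\<^esub>)"
      by (auto simp: fun_eq_iff D_eq mc_def intro!: M.finsum_all_zero)
    ultimately show ?case using kchain_zeros by (auto simp: supp_def)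
  next
    case (Suc k)
    have k: "k < n" using Suc by simp
    define a0 where "a0 U = (if k \<in> U then \<zero>\<^bsub>M\<^esub> else a U)" for U
    define a1 where "a1 U = (if k \<in> U then \<zero>\<^bsub>M\<^esub> else a (insert k U))" for U
    have a0: "a0 \<in> KM (Suc p)"
      using Suc(3) kchain_zero[OF Suc(3)] by (intro kchainI) (auto simp: a0_def)
    have s0: "supp k a0"
      unfolding supp_def
    proof (intro allI impI)
      fix U assume "\<not> U \<subseteq> {..<k}"
      then have "k \<in> U \<or> \<not> U \<subseteq> {..<Suc k}" by (auto simp: lessThan_Suc)
      then show "a0 U = \<zero>\<^bsub>M\<^esub>" using Suc(4) by (auto simp: a0_def supp_def)
    qed
    have a1: "a1 \<in> KM p"
    proof (rule kchainI)
      show "a1 U \<in> carrier M" for U using Suc(3) by (auto simp: a1_def)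
      fix U assume "\<not> (U \<subseteq> {..<n} \<and> card U = p)"
      then have "k \<in> U \<or> \<not> (insert k U \<subseteq> {..<n} \<and> card (insert k U) = Suc p)"
        by (auto simp: finite_subset card_insert_if)
      then show "a1 U = \<zero>\<^bsub>M\<^esub>" using kchain_zero[OF Suc(3), of "insert k U"] by (metis a1_def)
    qed
    have s1: "supp k a1"
      unfolding supp_def
    proof (intro allI impI)
      fix U assume "\<not> U \<subseteq> {..<k}"
      then have "k \<in> U \<or> \<not> insert k U \<subseteq> {..<Suc k}" by (auto simp: lessThan_Suc)
      then show "a1 U = \<zero>\<^bsub>M\<^esub>" using Suc(4) by (metis a1_def supp_def)
    qed
    have a_split: "a = (\<lambda>U. a0 U \<oplus>\<^bsub>M\<^esub> J k a1 U)"
      using Suc(3) by (auto simp: fun_eq_iff a0_def a1_def J_def insert_absorb)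
    note J1 = J_kchain[OF a1 s1 k]
    have da: "D a0 U \<oplus>\<^bsub>M\<^esub> (J k (D a1) U \<oplus>\<^bsub>M\<^esub> sg p \<odot>\<^bsub>M\<^esub> (ys ! k \<odot>\<^bsub>M\<^esub> a1 U)) = \<zero>\<^bsub>M\<^esub>" for U
      using Suc(5)[of U] a0 J1 unfolding a_split D_J[OF a1 s1 k, symmetric] by (subst (asm) D_add) auto
    have sD0: "supp k (D a0)" using s0 a0 by (intro supp_D) auto
    have sD1: "supp k (D a1)" using s1 a1 by (intro supp_D) auto
    \<comment> \<open>At \<open>insert k U\<close> the terms with \<open>D a0\<close> and with
      \<open>a1\<close> vanish because of their supports, and only \<open>D a1 U\<close> is
      left.\<close>
    have da1: "D a1 U = \<zero>\<^bsub>M\<^esub>" for U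
    proof (cases "U \<subseteq> {..<k}")
      case True
      then have "k \<notin> U" by auto
      then show ?thesis using da[of "insert k U"] sD0 s1 k a1 a0
        by (simp add: supp_def J_def insert_Diff_if)
    qed (use sD1 in \<open>auto simp: supp_def\<close>)
    have da0: "D a0 U = \<ominus>\<^bsub>M\<^esub> (sg p \<odot>\<^bsub>M\<^esub> (ys ! k \<odot>\<^bsub>M\<^esub> a1 U))" for U
    proof -
      have "J k (D a1) U = \<zero>\<^bsub>M\<^esub>" using da1 by (simp add: J_def)
      then have "D a0 U \<oplus>\<^bsub>M\<^esub> sg p \<odot>\<^bsub>M\<^esub> (ys ! k \<odot>\<^bsub>M\<^esub> a1 U) = \<zero>\<^bsub>M\<^esub>"
        using da[of U] k a1 by simp
      then show ?thesis using k a0 a1 by (intro M.minus_equality[symmetric]) auto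
    qed
    have "\<exists>b1\<in>KM (Suc p). supp k b1 \<and> D b1 = a1"
    proof (cases p)
      case (Suc q)
      then show ?thesis using Suc.hyps[of a1 q] a1 s1 da1 k by simp
    next
      \<comment> \<open>In degree zero the induction hypothesis says nothing and regularity takes
        its place: the equation for \<open>D a0\<close> at the empty set puts y_k times
        \<open>a1 {}\<close> among the multiples of the earlier elements.\<close>
      case 0
      have a0': "a0 \<in> KM 1" using a0 0 by simp
      have "ys ! k \<odot>\<^bsub>M\<^esub> a1 {} = \<ominus>\<^bsub>M\<^esub> D a0 {}"
        using da0[of "{}"] 0 k a1 by simp
      also have "D a0 {} = (\<Oplus>\<^bsub>M\<^esub>i\<in>{..<k}. ys ! i \<odot>\<^bsub>M\<^esub> a0 {i})"
        unfolding D_deg1[OF a0'] using k a0 s0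
        by (auto intro!: M.finsum_extend[symmetric] simp: supp_def)
      also have "\<ominus>\<^bsub>M\<^esub> \<dots> = (\<Oplus>\<^bsub>M\<^esub>i\<in>{..<k}. \<ominus>\<^bsub>M\<^esub> (ys ! i \<odot>\<^bsub>M\<^esub> a0 {i}))"
        using k a0 by (intro M.finsum_minus[symmetric]) auto
      also have "\<dots> = (\<Oplus>\<^bsub>M\<^esub>i\<in>{..<k}. ys ! i \<odot>\<^bsub>M\<^esub> (\<ominus>\<^bsub>M\<^esub> a0 {i}))"
        using k a0 by (intro M.finsum_cong_simple) (auto simp: smult_r_minus)
      finally have "ys ! k \<odot>\<^bsub>M\<^esub> a1 {} \<in> multiples M ys k"
        using a0 by (auto simp: multiples_def)
      then have "a1 {} \<in> multiples M ys k" using reg k a1 by (auto simp: regular_seq_def)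
      then obtain b1 where b1: "b1 \<in> KM 1" "supp k b1" "D b1 = (\<lambda>U. if U = {} then a1 {} else \<zero>\<^bsub>M\<^esub>)"
        using multiples_boundary k by (meson less_imp_le_nat)
      have "a1 U = \<zero>\<^bsub>M\<^esub>" if "U \<noteq> {}" for U
        using kchain_zero[OF a1, of U] that 0 finite_subset[of U "{..<n}"] by (cases "U \<subseteq> {..<n}") auto
      then have "D b1 = a1" using b1(3) by (auto simp: fun_eq_iff)
      then show ?thesis using b1 0 by auto
    qed
    then obtain b1 where b1: "b1 \<in> KM (Suc p)" "supp k b1" "D b1 = a1" by blast
    note Jb = J_kchain[OF b1(1,2) k]
    \<comment> \<open>What remains of \<open>a\<close> after subtracting \<open>D (J k b1)\<close>:
      by \<open>D_J\<close> the part along e_k cancels, and the other term of that boundary is y_k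
      times \<open>b1\<close> with sign \<open>sg (Suc p)\<close>.\<close>
    define c where "c U = a0 U \<oplus>\<^bsub>M\<^esub> (\<ominus> sg (Suc p) \<otimes> ys ! k) \<odot>\<^bsub>M\<^esub> b1 U" for U
    have c: "c \<in> KM (Suc p)" unfolding c_def using a0 b1 k by (intro kchain_add kchain_smult) auto
    have sc: "supp k c" using s0 b1(2) k by (auto simp: supp_def c_def)
    have ac: "a U = c U \<oplus>\<^bsub>M\<^esub> D (J k b1) U" for U
    proof -
      have "c U \<oplus>\<^bsub>M\<^esub> D (J k b1) U = (a0 U \<oplus>\<^bsub>M\<^esub> (\<ominus> sg (Suc p) \<otimes> ys ! k) \<odot>\<^bsub>M\<^esub> b1 U) \<oplus>\<^bsub>M\<^esub> (J k a1 U \<oplus>\<^bsub>M\<^esub> (sg (Suc p) \<otimes> ys ! k) \<odot>\<^bsub>M\<^esub> b1 U)"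
        unfolding D_J[OF b1(1,2) k] b1(3) c_def using b1 k by (simp add: smult_assoc1)
      also have "\<dots> = (a0 U \<oplus>\<^bsub>M\<^esub> J k a1 U) \<oplus>\<^bsub>M\<^esub> ((\<ominus> sg (Suc p) \<otimes> ys ! k) \<odot>\<^bsub>M\<^esub> b1 U \<oplus>\<^bsub>M\<^esub> (sg (Suc p) \<otimes> ys ! k) \<odot>\<^bsub>M\<^esub> b1 U)"
        using a0 J1 b1 k by (simp add: M.a_ac)
      also have "(\<ominus> sg (Suc p) \<otimes> ys ! k) \<odot>\<^bsub>M\<^esub> b1 U \<oplus>\<^bsub>M\<^esub> (sg (Suc p) \<otimes> ys ! k) \<odot>\<^bsub>M\<^esub> b1 U = \<zero>\<^bsub>M\<^esub>"
        using b1 k by (simp add: l_minus smult_l_minus M.l_neg)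
      finally show ?thesis using a0 J1 by (simp add: a_split)
    qed
    have dc: "D c U = \<zero>\<^bsub>M\<^esub>" for U
    proof -
      have "a = (\<lambda>U. c U \<oplus>\<^bsub>M\<^esub> D (J k b1) U)" using ac by auto
      then have "D a U = D c U \<oplus>\<^bsub>M\<^esub> D (D (J k b1)) U" using c Jb by (simp add: D_add)
      then show ?thesis using Suc(5)[of U] c Jb by (simp add: D_D)
    qed
    obtain b0 where b0: "b0 \<in> KM (Suc (Suc p))" "supp k b0" "D b0 = c"
      using Suc(1)[OF _ c sc dc] k by auto
    define b where "b U = b0 U \<oplus>\<^bsub>M\<^esub> J k b1 U" for U
    have "b \<in> KM (Suc (Suc p))" unfolding b_def using b0 Jb by (intro kchain_add) auto
    moreover have "supp (Suc k) b"
      using b0(2) Jb(2) by (auto simp: supp_def b_def lessThan_Suc)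
    moreover have "D b = a"
    proof
      fix U
      have "D b U = D b0 U \<oplus>\<^bsub>M\<^esub> D (J k b1) U"
        unfolding b_def[abs_def] using b0(1) Jb(1) by (intro D_add) auto
      then show "D b U = a U" by (simp add: b0(3) ac[of U])
    qed
    ultimately show ?case by blast
  qed
  moreover have "supp n a" using kchain_zero[OF a] by (auto simp: supp_def)
  ultimately show ?thesis using a da by blast
qed

end

section \<open>Bases of vector spaces\<close>

context module
begin

definition indep where
  "indep E \<longleftrightarrow> (\<forall>F c. finite F \<and> F \<subseteq> E \<and> c \<in> F \<rightarrow> carrier R \<and> (\<Oplus>\<^bsub>M\<^esub>h\<in>F. c h \<odot>\<^bsub>M\<^esub> h) = \<zero>\<^bsub>M\<^esub> \<longrightarrow> (\<forall>h\<in>F. c h = \<zero>))"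

definition lin_span where
  "lin_span E = {x. \<exists>F c. finite F \<and> F \<subseteq> E \<and> c \<in> F \<rightarrow> carrier R \<and> x = (\<Oplus>\<^bsub>M\<^esub>h\<in>F. c h \<odot>\<^bsub>M\<^esub> h)}"

lemma smult_r_zero [simp]: "a \<in> carrier R \<Longrightarrow> a \<odot>\<^bsub>M\<^esub> \<zero>\<^bsub>M\<^esub> = \<zero>\<^bsub>M\<^esub>"
  by (rule smult_r_null)

lemma smult_l_zero [simp]: "x \<in> carrier M \<Longrightarrow> \<zero> \<odot>\<^bsub>M\<^esub> x = \<zero>\<^bsub>M\<^esub>"
  by (rule smult_l_null)

lemma combination_extend:
  assumes "finite F'" "F \<subseteq> F'" "F' \<subseteq> carrier M" "c \<in> F \<rightarrow> carrier R"
  shows "(\<Oplus>\<^bsub>M\<^esub>h\<in>F. c h \<odot>\<^bsub>M\<^esub> h) = (\<Oplus>\<^bsub>M\<^esub>h\<in>F'. (if h \<in> F then c h else \<zero>) \<odot>\<^bsub>M\<^esub> h)"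
proof -
  have "(\<Oplus>\<^bsub>M\<^esub>h\<in>F. c h \<odot>\<^bsub>M\<^esub> h) = (\<Oplus>\<^bsub>M\<^esub>h\<in>F. (if h \<in> F then c h else \<zero>) \<odot>\<^bsub>M\<^esub> h)"
    using assms by (intro M.finsum_cong_simple) (auto simp: Pi_iff subset_iff)
  also have "\<dots> = (\<Oplus>\<^bsub>M\<^esub>h\<in>F'. (if h \<in> F then c h else \<zero>) \<odot>\<^bsub>M\<^esub> h)"
    using assms by (intro M.finsum_extend) (auto simp: Pi_iff subset_iff)
  finally show ?thesis .
qed

lemma combination_add:
  assumes "finite F" "F \<subseteq> carrier M" "c \<in> F \<rightarrow> carrier R" "d \<in> F \<rightarrow> carrier R"
  shows "(\<Oplus>\<^bsub>M\<^esub>h\<in>F. (c h \<oplus> d h) \<odot>\<^bsub>M\<^esub> h) = (\<Oplus>\<^bsub>M\<^esub>h\<in>F. c h \<odot>\<^bsub>M\<^esub> h) \<oplus>\<^bsub>M\<^esub> (\<Oplus>\<^bsub>M\<^esub>h\<in>F. d h \<odot>\<^bsub>M\<^esub> h)"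
proof -
  have "(\<Oplus>\<^bsub>M\<^esub>h\<in>F. (c h \<oplus> d h) \<odot>\<^bsub>M\<^esub> h) = (\<Oplus>\<^bsub>M\<^esub>h\<in>F. c h \<odot>\<^bsub>M\<^esub> h \<oplus>\<^bsub>M\<^esub> d h \<odot>\<^bsub>M\<^esub> h)"
    using assms by (intro M.finsum_cong_simple) (auto simp: Pi_iff subset_iff smult_l_distr)
  also have "\<dots> = (\<Oplus>\<^bsub>M\<^esub>h\<in>F. c h \<odot>\<^bsub>M\<^esub> h) \<oplus>\<^bsub>M\<^esub> (\<Oplus>\<^bsub>M\<^esub>h\<in>F. d h \<odot>\<^bsub>M\<^esub> h)"
    using assms by (intro M.finsum_addf) (auto simp: Pi_iff subset_iff)
  finally show ?thesis .
qed

lemma combination_smult: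
  assumes "finite F" "F \<subseteq> carrier M" "c \<in> F \<rightarrow> carrier R" "a \<in> carrier R"
  shows "(\<Oplus>\<^bsub>M\<^esub>h\<in>F. (a \<otimes> c h) \<odot>\<^bsub>M\<^esub> h) = a \<odot>\<^bsub>M\<^esub> (\<Oplus>\<^bsub>M\<^esub>h\<in>F. c h \<odot>\<^bsub>M\<^esub> h)"
proof -
  have "(\<Oplus>\<^bsub>M\<^esub>h\<in>F. (a \<otimes> c h) \<odot>\<^bsub>M\<^esub> h) = (\<Oplus>\<^bsub>M\<^esub>h\<in>F. a \<odot>\<^bsub>M\<^esub> (c h \<odot>\<^bsub>M\<^esub> h))"
    using assms by (intro M.finsum_cong_simple) (auto simp: Pi_iff subset_iff smult_assoc1)
  also have "\<dots> = a \<odot>\<^bsub>M\<^esub> (\<Oplus>\<^bsub>M\<^esub>h\<in>F. c h \<odot>\<^bsub>M\<^esub> h)"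
    using assms by (intro finsum_smult_ldistr[symmetric]) (auto simp: Pi_iff subset_iff)
  finally show ?thesis .
qed

lemma lin_spanI: "\<lbrakk>finite F; F \<subseteq> E; c \<in> F \<rightarrow> carrier R\<rbrakk> \<Longrightarrow> (\<Oplus>\<^bsub>M\<^esub>h\<in>F. c h \<odot>\<^bsub>M\<^esub> h) \<in> lin_span E"
  unfolding lin_span_def by blast

lemma lin_span_smult:
  assumes "E \<subseteq> carrier M" "x \<in> lin_span E" "a \<in> carrier R"
  shows "a \<odot>\<^bsub>M\<^esub> x \<in> lin_span E"
proof -
  obtain F c where F: "finite F" "F \<subseteq> E" "c \<in> F \<rightarrow> carrier R" "x = (\<Oplus>\<^bsub>M\<^esub>h\<in>F. c h \<odot>\<^bsub>M\<^esub> h)"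
    using assms(2) unfolding lin_span_def by blast
  have "a \<odot>\<^bsub>M\<^esub> x = (\<Oplus>\<^bsub>M\<^esub>h\<in>F. (a \<otimes> c h) \<odot>\<^bsub>M\<^esub> h)"
    unfolding F(4) using F assms by (intro combination_smult[symmetric]) auto
  then show ?thesis using F assms by (auto intro!: lin_spanI simp: Pi_iff)
qed

lemma lin_span_add:
  assumes "E \<subseteq> carrier M" "x \<in> lin_span E" "y \<in> lin_span E"
  shows "x \<oplus>\<^bsub>M\<^esub> y \<in> lin_span E"
proof -
  obtain F c where F: "finite F" "F \<subseteq> E" "c \<in> F \<rightarrow> carrier R" "x = (\<Oplus>\<^bsub>M\<^esub>h\<in>F. c h \<odot>\<^bsub>M\<^esub> h)"
    using assms(2) unfolding lin_span_def by blast
  obtain F' c' where F': "finite F'" "F' \<subseteq> E" "c' \<in> F' \<rightarrow> carrier R" "y = (\<Oplus>\<^bsub>M\<^esub>h\<in>F'. c' h \<odot>\<^bsub>M\<^esub> h)"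
    using assms(3) unfolding lin_span_def by blast
  have "x \<oplus>\<^bsub>M\<^esub> y = (\<Oplus>\<^bsub>M\<^esub>h\<in>F \<union> F'. ((if h \<in> F then c h else \<zero>) \<oplus> (if h \<in> F' then c' h else \<zero>)) \<odot>\<^bsub>M\<^esub> h)"
    unfolding F(4) F'(4)
    by (subst combination_add, use F F' assms in auto)
      (subst (1 2) combination_extend[of "F \<union> F'"], use F F' assms in auto)
  then show ?thesis using F F' assms
    by (auto intro!: lin_spanI simp: Pi_iff)
qed

lemma lin_span_zero: "\<zero>\<^bsub>M\<^esub> \<in> lin_span E"
  using lin_spanI[of "{}" E "\<lambda>_. \<zero>"] by simp

lemma lin_span_incl: assumes "E \<subseteq> carrier M" "x \<in> E" shows "x \<in> lin_span E"
  using lin_spanI[of "{x}" E "\<lambda>_. \<one>"] assms by (auto simp: subset_iff)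

text \<open>Zorn's lemma gives a maximal independent subset of \<open>E\<close>; a dependence
  produced by one more element of \<open>E\<close> has an invertible coefficient there, so that
  element lies in the span. The basis is taken inside \<open>E\<close> because the elements of
  \<open>E\<close> will have special representatives. Spanning is phrased as minimality among closed
  sets, which is easy to verify for homology classes.\<close>

lemma basis_of_spanning:
  assumes field: "\<And>a. a \<in> carrier R \<Longrightarrow> a \<noteq> \<zero> \<Longrightarrow> \<exists>b\<in>carrier R. b \<otimes> a = \<one>"
    and E: "E \<subseteq> carrier M"
    and span: "\<And>N. \<lbrakk>\<zero>\<^bsub>M\<^esub> \<in> N; \<And>x y. x \<in> N \<Longrightarrow> y \<in> N \<Longrightarrow> x \<oplus>\<^bsub>M\<^esub> y \<in> N;
         \<And>a x. a \<in> carrier R \<Longrightarrow> x \<in> N \<Longrightarrow> a \<odot>\<^bsub>M\<^esub> x \<in> N; E \<subseteq> N\<rbrakk> \<Longrightarrow> carrier M \<subseteq> N"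
  shows "\<exists>E'\<subseteq>E. is_basis R M E' (\<lambda>h. h)"
proof -
  have "\<exists>B\<in>{B. B \<subseteq> E \<and> indep B}. \<forall>B'\<in>{B. B \<subseteq> E \<and> indep B}. B \<subseteq> B' \<longrightarrow> B' = B"
  proof (rule subset_Zorn')
    fix C assume C: "subset.chain {B. B \<subseteq> E \<and> indep B} C"
    then have CE: "\<And>B. B \<in> C \<Longrightarrow> B \<subseteq> E \<and> indep B" by (auto simp: subset.chain_def)
    have "indep (\<Union>C)"
      unfolding indep_def
    proof (intro allI impI)
      fix F c assume F: "finite F \<and> F \<subseteq> \<Union>C \<and> c \<in> F \<rightarrow> carrier R \<and> (\<Oplus>\<^bsub>M\<^esub>h\<in>F. c h \<odot>\<^bsub>M\<^esub> h) = \<zero>\<^bsub>M\<^esub>"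
      show "\<forall>h\<in>F. c h = \<zero>"
      proof (cases "C = {}")
        case True then show ?thesis using F by auto
      next
        case False
        then obtain B where "B \<in> C" "F \<subseteq> B"
          using finite_subset_Union_chain[of F C] F C by auto
        then show ?thesis using CE[of B] F unfolding indep_def by blast
      qed
    qed
    then show "\<Union>C \<in> {B. B \<subseteq> E \<and> indep B}" using CE by auto
  qed
  then obtain B where B0: "B \<in> {B. B \<subseteq> E \<and> indep B}" and max0: "\<forall>B'\<in>{B. B \<subseteq> E \<and> indep B}. B \<subseteq> B' \<longrightarrow> B' = B"
    by (rule bexE)
  from B0 have B: "B \<subseteq> E" "indep B" by simp_all
  have max: "B' = B" if "B' \<subseteq> E" "indep B'" "B \<subseteq> B'" for B'
    using max0[THEN bspec, of B'] that by simp
  have BM: "B \<subseteq> carrier M" using B E by auto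
  have "E \<subseteq> lin_span B"
  proof
    fix e assume e: "e \<in> E"
    show "e \<in> lin_span B"
    proof (cases "e \<in> B")
      case True then show ?thesis using BM by (intro lin_span_incl)
    next
      case False
      then have "\<not> indep (insert e B)" using max[of "insert e B"] B e by blast
      then obtain F c where F: "finite F" "F \<subseteq> insert e B" "c \<in> F \<rightarrow> carrier R"
        "(\<Oplus>\<^bsub>M\<^esub>h\<in>F. c h \<odot>\<^bsub>M\<^esub> h) = \<zero>\<^bsub>M\<^esub>" "\<exists>h\<in>F. c h \<noteq> \<zero>"
        unfolding indep_def by blast
      have eM: "e \<in> carrier M" using e E by auto
      have FM: "F \<subseteq> carrier M" using F BM eM by auto
      have "e \<in> F"
      proof (rule ccontr)
        assume "e \<notin> F"
        then have "F \<subseteq> B" using F by auto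
        then show False using F B(2) unfolding indep_def by blast
      qed
      define G where "G = F - {e}"
      have G: "F = insert e G" "e \<notin> G" "finite G" "G \<subseteq> B" using F \<open>e \<in> F\<close> by (auto simp: G_def)
      have cG: "c \<in> G \<rightarrow> carrier R" "c e \<in> carrier R" using F G by auto
      have GM: "G \<subseteq> carrier M" using G BM by auto
      define s where "s = (\<Oplus>\<^bsub>M\<^esub>h\<in>G. c h \<odot>\<^bsub>M\<^esub> h)"
      have cl: "(\<lambda>h. c h \<odot>\<^bsub>M\<^esub> h) \<in> G \<rightarrow> carrier M" using cG GM by (auto simp: Pi_iff subset_iff)
      have sM: "s \<in> carrier M" unfolding s_def using cl by (rule M.finsum_closed)
      have eq: "c e \<odot>\<^bsub>M\<^esub> e \<oplus>\<^bsub>M\<^esub> s = \<zero>\<^bsub>M\<^esub>"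
        using F(4) unfolding G(1) s_def using G cl cG eM by (subst (asm) M.finsum_insert) auto
      have sspan: "s \<in> lin_span B" unfolding s_def using G cG by (intro lin_spanI) auto
      have "c e \<noteq> \<zero>"
      proof
        assume z: "c e = \<zero>"
        then have "s = \<zero>\<^bsub>M\<^esub>" using eq eM sM by simp
        then have "\<forall>h\<in>G. c h = \<zero>" using B(2) G cG unfolding indep_def s_def by blast
        then show False using F(5) z G by auto
      qed
      then obtain b where b: "b \<in> carrier R" "b \<otimes> c e = \<one>" using field cG by blast
      have "c e \<odot>\<^bsub>M\<^esub> e = \<ominus>\<^bsub>M\<^esub> s" using eq eM sM cG by (metis M.minus_equality smult_closed)
      then have "b \<odot>\<^bsub>M\<^esub> (c e \<odot>\<^bsub>M\<^esub> e) = b \<odot>\<^bsub>M\<^esub> (\<ominus>\<^bsub>M\<^esub> s)" by simp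
      then have "e = (\<ominus> b) \<odot>\<^bsub>M\<^esub> s"
        using b cG eM sM by (simp add: smult_assoc1[symmetric] smult_r_minus smult_l_minus)
      then show ?thesis using lin_span_smult[OF BM sspan, of "\<ominus> b"] b by simp
    qed
  qed
  then have all: "carrier M \<subseteq> lin_span B"
    using span[of "lin_span B"] lin_span_zero lin_span_add[OF BM] lin_span_smult[OF BM] by blast
  have "is_basis R M B (\<lambda>h. h)"
    unfolding is_basis_def
  proof (intro conjI ballI)
    show "(\<lambda>h. h) \<in> B \<rightarrow> carrier M" using BM by auto
    fix x assume x: "x \<in> carrier M"
    obtain F c where F: "finite F" "F \<subseteq> B" "c \<in> F \<rightarrow> carrier R" "x = (\<Oplus>\<^bsub>M\<^esub>h\<in>F. c h \<odot>\<^bsub>M\<^esub> h)"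
      using all x unfolding lin_span_def by blast
    define c' where "c' = (\<lambda>h\<in>B. if h \<in> F then c h else \<zero>)"
    have c': "c' \<in> B \<rightarrow>\<^sub>E carrier R" using F by (auto simp: c'_def)
    have supp: "{h \<in> B. c' h \<noteq> \<zero>} \<subseteq> F" using F by (auto simp: c'_def split: if_splits)
    have "combination R M B (\<lambda>h. h) c' x"
      unfolding combination_def
    proof (intro conjI c')
      show "finite {i \<in> B. c' i \<noteq> \<zero>}" using supp F(1) finite_subset by blast
      have "x = (\<Oplus>\<^bsub>M\<^esub>h\<in>F. c' h \<odot>\<^bsub>M\<^esub> h)"
        unfolding F(4) using F BM by (intro M.finsum_cong_simple) (auto simp: c'_def Pi_iff subset_iff)
      also have "\<dots> = (\<Oplus>\<^bsub>M\<^esub>i\<in>{i \<in> B. c' i \<noteq> \<zero>}. c' i \<odot>\<^bsub>M\<^esub> i)"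
        using F BM supp c' by (intro M.finsum_extend[symmetric]) (auto simp: subset_iff)
      finally show "x = (\<Oplus>\<^bsub>M\<^esub>i\<in>{i \<in> B. c' i \<noteq> \<zero>}. c' i \<odot>\<^bsub>M\<^esub> i)" .
    qed
    moreover have "d = d'" if d: "combination R M B (\<lambda>h. h) d x" and d': "combination R M B (\<lambda>h. h) d' x" for d d'
    proof (rule PiE_ext)
      show dR: "d \<in> B \<rightarrow>\<^sub>E carrier R" "d' \<in> B \<rightarrow>\<^sub>E carrier R" using d d' by (auto simp: combination_def)
      define S where "S = {i \<in> B. d i \<noteq> \<zero>} \<union> {i \<in> B. d' i \<noteq> \<zero>}"
      have S: "finite S" "S \<subseteq> B" using d d' by (auto simp: combination_def S_def)
      have SM: "S \<subseteq> carrier M" using S BM by auto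
      have dS: "d \<in> S \<rightarrow> carrier R" "d' \<in> S \<rightarrow> carrier R" using dR S by auto
      have 1: "x = (\<Oplus>\<^bsub>M\<^esub>i\<in>S. d i \<odot>\<^bsub>M\<^esub> i)"
      proof -
        have "x = (\<Oplus>\<^bsub>M\<^esub>i\<in>{i \<in> B. d i \<noteq> \<zero>}. d i \<odot>\<^bsub>M\<^esub> i)" using d by (auto simp: combination_def)
        also have "\<dots> = (\<Oplus>\<^bsub>M\<^esub>i\<in>S. d i \<odot>\<^bsub>M\<^esub> i)"
          using S SM dS by (intro M.finsum_extend) (auto simp: S_def Pi_iff subset_iff)
        finally show ?thesis .
      qed
      have 2: "x = (\<Oplus>\<^bsub>M\<^esub>i\<in>S. d' i \<odot>\<^bsub>M\<^esub> i)"
      proof -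
        have "x = (\<Oplus>\<^bsub>M\<^esub>i\<in>{i \<in> B. d' i \<noteq> \<zero>}. d' i \<odot>\<^bsub>M\<^esub> i)" using d' by (auto simp: combination_def)
        also have "\<dots> = (\<Oplus>\<^bsub>M\<^esub>i\<in>S. d' i \<odot>\<^bsub>M\<^esub> i)"
          using S SM dS by (intro M.finsum_extend) (auto simp: S_def Pi_iff subset_iff)
        finally show ?thesis .
      qed
      have "(\<Oplus>\<^bsub>M\<^esub>i\<in>S. (d i \<oplus> \<ominus> \<one> \<otimes> d' i) \<odot>\<^bsub>M\<^esub> i) = x \<oplus>\<^bsub>M\<^esub> (\<ominus> \<one>) \<odot>\<^bsub>M\<^esub> x"
        using S SM dS by (subst combination_add) (auto simp: 1[symmetric] combination_smult 2[symmetric])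
      also have "\<dots> = \<zero>\<^bsub>M\<^esub>" using x by (simp add: smult_l_minus M.r_neg)
      finally have z: "(\<Oplus>\<^bsub>M\<^esub>i\<in>S. (d i \<oplus> \<ominus> \<one> \<otimes> d' i) \<odot>\<^bsub>M\<^esub> i) = \<zero>\<^bsub>M\<^esub>" .
      have dR': "(\<lambda>i. d i \<oplus> \<ominus> \<one> \<otimes> d' i) \<in> S \<rightarrow> carrier R" using dS by (auto simp: Pi_iff)
      have *: "\<forall>i\<in>S. d i \<oplus> \<ominus> \<one> \<otimes> d' i = \<zero>"
        by (rule B(2)[unfolded indep_def, THEN spec, THEN spec, THEN mp]) (intro conjI S dR' z)
      have eq: "\<forall>i\<in>S. d i = d' i"
      proof (intro ballI)
        fix i assume i: "i \<in> S"
        have c: "d i \<in> carrier R" "d' i \<in> carrier R" using dS i by auto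
        have "\<ominus> \<one> \<otimes> d' i = \<ominus> d' i" using c by (simp add: l_minus)
        then have "d i \<oplus> \<ominus> d' i = \<zero>" using bspec[OF * i] by (simp only:)
        from R.minus_equality[OF this] c show "d i = d' i" by simp
      qed
      fix i assume i: "i \<in> B"
      show "d i = d' i"
      proof (cases "i \<in> S")
        case True
        then show ?thesis by (rule eq[THEN bspec])
      next
        case False
        then have "d i = \<zero>" "d' i = \<zero>" using i by (auto simp: S_def)
        then show ?thesis by simp
      qed
    qed
    ultimately show "\<exists>!c. combination R M B (\<lambda>h. h) c x" by blast
  qed
  then show ?thesis using B by blast
qed

end

section \<open>The ring as a module over itself\<close>

lemma module_self: "cring A \<Longrightarrow> module A (self_module A)"
proof -
  assume "cring A"
  then interpret cring A .
  show ?thesis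
    by (rule moduleI)
      (auto simp: self_module_def is_cring l_distr r_distr m_assoc intro!: abelian_groupI a_assoc a_comm bexI[of _ "a_inv A _"] l_neg)
qed

lemma finsum_self_module: "finsum (self_module A) f S = finsum A f S"
  by (simp add: finsum_def finprod_def self_module_def)

lemma self_module_simps [simp]:
  "carrier (self_module A) = carrier A" "\<zero>\<^bsub>self_module A\<^esub> = \<zero>\<^bsub>A\<^esub>"
  "a \<odot>\<^bsub>self_module A\<^esub> b = a \<otimes>\<^bsub>A\<^esub> b" "a \<oplus>\<^bsub>self_module A\<^esub> b = a \<oplus>\<^bsub>A\<^esub> b"
  by (simp_all add: self_module_def)

lemma minus_self_module [simp]: "\<ominus>\<^bsub>self_module A\<^esub> a = \<ominus>\<^bsub>A\<^esub> a"
  by (simp add: a_inv_def m_inv_def self_module_def)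

section \<open>Homology of the Koszul complex\<close>

context koszul_algebra
begin

lemma koszul_module_self: "koszul_module A (self_module A) xs"
  by (intro koszul_module.intro module_self is_cring koszul_module_axioms.intro xs_closed)

text \<open>Links the differential of the algebra with the one on chains, so that the square of the
  former vanishes because that of the latter does.\<close>

lemma kd_kdiff: "U \<subseteq> {..<n} \<Longrightarrow> kd a U = kdiff A (self_module A) xs a U"
  by (simp add: kdiff_def kd_def kc_def finsum_self_module n_def cong: if_cong)

lemma diff_diff:
  assumes a: "a \<in> carrier B" shows "dgdiff B (dgdiff B a) = \<zero>\<^bsub>B\<^esub>"
proof (rule B_eqI)
  interpret KM: koszul_module A "self_module A" xs by (rule koszul_module_self)
  fix U assume U: "U \<subseteq> {..<n}"
  \<comment> \<open>Elements of \<open>B\<close> are undefined off the subsets of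
    \<open>{..<n}\<close>, while cochains take values in the carrier everywhere; extension by zero
    mediates.\<close>
  define a' where "a' U = (if U \<subseteq> {..<n} then a U else \<zero>)" for U
  have a': "KM.cochain a'" using a by (auto simp: KM.cochain_def a'_def)
  have K: "kdiff A (self_module A) xs a' \<in> K"
    using KM.D_cochain[OF a'] by (intro K_I) (auto simp: KM.cochain_def)
  have "dgdiff B (dgdiff B a) U = kd (dgdiff B a) U" using a U by (simp add: diff_apply diff_B_closed)
  also have "\<dots> = kd (kdiff A (self_module A) xs a') U"
  proof (rule kd_cong[OF _ K U])
    fix S assume S: "S \<subseteq> {..<n}"
    have "kd a S = kd a' S" by (rule kd_cong) (use a S in \<open>auto simp: a'_def intro!: K_I\<close>)
    then show "dgdiff B a S = kdiff A (self_module A) xs a' S" using a S by (simp add: diff_apply kd_kdiff)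
  qed
  also have "\<dots> = \<zero>" using KM.D_D[OF a', of U] U by (simp add: kd_kdiff)
  finally show "dgdiff B (dgdiff B a) U = \<zero>\<^bsub>B\<^esub> U" using U by simp
qed (use a in \<open>auto intro!: diff_B_closed\<close>)

lemma diff_one: "dgdiff B \<one>\<^bsub>B\<^esub> = \<zero>\<^bsub>B\<^esub>"
proof (rule B_eqI)
  fix U assume U: "U \<subseteq> {..<n}"
  have "kd \<one>\<^bsub>B\<^esub> U = \<zero>" unfolding kd_def
    by (rule finsum_all_zero) (use U in \<open>auto simp: kc_def koszul_simps\<close>)
  then show "dgdiff B \<one>\<^bsub>B\<^esub> U = \<zero>\<^bsub>B\<^esub> U" using U by (simp add: diff_apply)
qed (auto intro!: diff_B_closed)

lemma invol_invol: "a \<in> carrier B \<Longrightarrow> invol (invol a) = a"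
  by (rule B_eqI) (auto simp: invol_closed, simp add: invol_def m_assoc[symmetric])

text \<open>The coefficient of the differential at \<open>U\<close> only sees sets with one element
  more than \<open>U\<close>, whose sign is the opposite one.\<close>

lemma diff_invol:
  assumes a: "a \<in> carrier B" shows "dgdiff B (invol a) = \<ominus>\<^bsub>B\<^esub> invol (dgdiff B a)"
proof (rule B_eqI)
  fix U assume U: "U \<subseteq> {..<n}"
  have fU: "finite U" by (rule fin_V) fact
  have aK: "a \<in> K" using a by (rule carrier_K)
  have "kd (invol a) U = (\<Oplus>i\<in>{..<n}. (\<ominus> sg (card U)) \<otimes> (xs ! i \<otimes> kc i a U))"
    unfolding kd_def
  proof (rule finsum_cong_simple)
    fix i assume i: "i \<in> {..<n}"
    have k: "kc i a U \<in> carrier A" using aK i U by auto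
    show "(\<ominus> sg (card U)) \<otimes> (xs ! i \<otimes> kc i a U) \<in> carrier A" using k i by auto
    have "kc i (invol a) U = (\<ominus> sg (card U)) \<otimes> kc i a U"
    proof (cases "i \<in> U")
      case False
      have "a (insert i U) \<in> carrier A" using a U i by auto
      moreover have "sg (card (insert i U)) = \<ominus> sg (card U)" using False fU by (intro sg_odd) auto
      moreover have "insert i U \<subseteq> {..<n}" using U i by auto
      ultimately show ?thesis using False by (simp add: kc_def invol_def m_lcomm)
    qed (simp add: kc_def)
    then show "xs ! i \<otimes> kc i (invol a) U = (\<ominus> sg (card U)) \<otimes> (xs ! i \<otimes> kc i a U)"
      using k i by (simp add: m_lcomm)
  qed
  also have "\<dots> = (\<ominus> sg (card U)) \<otimes> kd a U"
    unfolding kd_def using aK U by (intro finsum_rdistr[symmetric]) auto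
  finally show "dgdiff B (invol a) U = (\<ominus>\<^bsub>B\<^esub> invol (dgdiff B a)) U"
    using a U by (simp add: diff_apply invol_closed minus_apply diff_B_closed)
      (simp add: invol_def l_minus diff_apply K_D[OF kd_closed[OF aK]])
qed (use a in \<open>auto intro!: diff_B_closed invol_closed\<close>)

abbreviation "Zy \<equiv> dg_cycles B"
abbreviation "bd \<equiv> dg_boundaries B"
abbreviation "cls \<equiv> homology_class B"
abbreviation "H \<equiv> homology B"

lemma cycleD: "z \<in> Zy \<Longrightarrow> z \<in> carrier B" "z \<in> Zy \<Longrightarrow> dgdiff B z = \<zero>\<^bsub>B\<^esub>"
  by (auto simp: dg_cycles_def)

lemma cycleI: "z \<in> carrier B \<Longrightarrow> dgdiff B z = \<zero>\<^bsub>B\<^esub> \<Longrightarrow> z \<in> Zy"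
  by (auto simp: dg_cycles_def)

lemma boundaryI: "u \<in> carrier B \<Longrightarrow> dgdiff B u \<in> bd"
  by (auto simp: dg_boundaries_def)

lemma boundary_cycle: "z \<in> bd \<Longrightarrow> z \<in> Zy"
  by (auto simp: dg_boundaries_def intro!: cycleI diff_diff diff_B_closed)

lemma cycle_add: "\<lbrakk>a \<in> Zy; b \<in> Zy\<rbrakk> \<Longrightarrow> a \<oplus>\<^bsub>B\<^esub> b \<in> Zy"
  by (auto intro!: cycleI simp: diff_add cycleD)

lemma cycle_minus: "a \<in> Zy \<Longrightarrow> \<ominus>\<^bsub>B\<^esub> a \<in> Zy"
  by (auto intro!: cycleI simp: diff_minus cycleD B.minus_zero)

lemma cycle_mult: "\<lbrakk>a \<in> Zy; b \<in> Zy\<rbrakk> \<Longrightarrow> a \<otimes>\<^bsub>B\<^esub> b \<in> Zy"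
  by (auto intro!: cycleI simp: leibniz cycleD invol_closed)

lemma cycle_one: "\<one>\<^bsub>B\<^esub> \<in> Zy"
  by (auto intro!: cycleI simp: diff_one)

lemma cycle_zero: "\<zero>\<^bsub>B\<^esub> \<in> Zy"
  by (auto intro!: cycleI simp: diff_zero)

lemma ring_Z: "ring (B\<lparr>carrier := Zy\<rparr>)"
  by (rule B.subring_is_ring, rule B.subringI)
    (auto simp: cycle_add cycle_minus cycle_mult cycle_one cycleD)

lemma boundary_add: "\<lbrakk>a \<in> bd; b \<in> bd\<rbrakk> \<Longrightarrow> a \<oplus>\<^bsub>B\<^esub> b \<in> bd"
proof -
  assume "a \<in> bd" "b \<in> bd"
  then obtain u v where "u \<in> carrier B" "v \<in> carrier B" "a = dgdiff B u" "b = dgdiff B v"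
    by (auto simp: dg_boundaries_def)
  then show ?thesis using boundaryI[of "u \<oplus>\<^bsub>B\<^esub> v"] by (simp add: diff_add)
qed

lemma boundary_minus: "a \<in> bd \<Longrightarrow> \<ominus>\<^bsub>B\<^esub> a \<in> bd"
proof -
  assume "a \<in> bd"
  then obtain u where "u \<in> carrier B" "a = dgdiff B u"
    by (auto simp: dg_boundaries_def)
  then show ?thesis using boundaryI[of "\<ominus>\<^bsub>B\<^esub> u"] by (simp add: diff_minus)
qed

lemma boundary_zero: "\<zero>\<^bsub>B\<^esub> \<in> bd"
  using boundaryI[of "\<zero>\<^bsub>B\<^esub>"] by (simp add: diff_zero)

lemma boundary_mult_right: "\<lbrakk>a \<in> bd; x \<in> Zy\<rbrakk> \<Longrightarrow> a \<otimes>\<^bsub>B\<^esub> x \<in> bd"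
proof -
  assume "a \<in> bd" and x: "x \<in> Zy"
  then obtain u where u: "u \<in> carrier B" "a = dgdiff B u"
    by (auto simp: dg_boundaries_def)
  have "dgdiff B (u \<otimes>\<^bsub>B\<^esub> x) = a \<otimes>\<^bsub>B\<^esub> x"
    using u x by (simp add: leibniz cycleD invol_closed diff_B_closed)
  then show ?thesis using boundaryI[of "u \<otimes>\<^bsub>B\<^esub> x"] u x by (simp add: cycleD)
qed

text \<open>For a cycle \<open>x\<close> the Leibniz rule puts the involution on \<open>x\<close>,
  so the preimage of \<open>x a\<close> is built with \<open>invol x\<close> in place of
  \<open>x\<close>.\<close>

lemma boundary_mult_left: "\<lbrakk>a \<in> bd; x \<in> Zy\<rbrakk> \<Longrightarrow> x \<otimes>\<^bsub>B\<^esub> a \<in> bd"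
proof -
  assume "a \<in> bd" and x: "x \<in> Zy"
  then obtain u where u: "u \<in> carrier B" "a = dgdiff B u"
    by (auto simp: dg_boundaries_def)
  have z: "invol \<zero>\<^bsub>B\<^esub> = \<zero>\<^bsub>B\<^esub>" by (rule B_eqI) (auto simp: invol_closed, simp add: invol_def)
  have "dgdiff B (invol x \<otimes>\<^bsub>B\<^esub> u) = x \<otimes>\<^bsub>B\<^esub> a"
    using u x by (simp add: leibniz cycleD invol_closed diff_B_closed diff_invol z invol_invol B.minus_zero)
  then show ?thesis using boundaryI[of "invol x \<otimes>\<^bsub>B\<^esub> u"] u x by (simp add: cycleD invol_closed)
qed

lemma ideal_bd: "ideal bd (B\<lparr>carrier := Zy\<rparr>)"
proof -
  interpret Z: ring "B\<lparr>carrier := Zy\<rparr>" by (rule ring_Z)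
  have inv: "\<ominus>\<^bsub>B\<lparr>carrier := Zy\<rparr>\<^esub> a = \<ominus>\<^bsub>B\<^esub> a" if "a \<in> Zy" for a
    by (rule Z.minus_equality) (use that in \<open>auto simp: cycle_minus B.l_neg cycleD\<close>)
  show ?thesis
  proof (rule idealI)
    show "subgroup bd (add_monoid (B\<lparr>carrier := Zy\<rparr>))"
    proof (rule Z.add.subgroupI)
      fix a assume a: "a \<in> bd"
      then show "\<ominus>\<^bsub>B\<lparr>carrier := Zy\<rparr>\<^esub> a \<in> bd" by (simp add: inv boundary_cycle boundary_minus)
    qed (use boundary_zero boundary_cycle boundary_add in auto)
  qed (use ring_Z boundary_mult_left boundary_mult_right in auto)
qed

sublocale bd: ideal bd "B\<lparr>carrier := Zy\<rparr>" by (rule ideal_bd)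

lemma H_eq: "H = (B\<lparr>carrier := Zy\<rparr>) Quot bd" by (simp add: homology_def)

sublocale H: ring H unfolding H_eq by (rule bd.quotient_is_ring)

lemma cls_eq: "cls z = bd +>\<^bsub>B\<lparr>carrier := Zy\<rparr>\<^esub> z"
  by (simp add: homology_class_def a_r_coset_def r_coset_def)

lemma cls_hom: "cls \<in> ring_hom (B\<lparr>carrier := Zy\<rparr>) H"
  using bd.rcos_ring_hom unfolding H_eq cls_eq[abs_def] .

lemma cls_closed: "z \<in> Zy \<Longrightarrow> cls z \<in> carrier H"
  using ring_hom_closed[OF cls_hom] by simp

lemma cls_add: "\<lbrakk>a \<in> Zy; b \<in> Zy\<rbrakk> \<Longrightarrow> cls (a \<oplus>\<^bsub>B\<^esub> b) = cls a \<oplus>\<^bsub>H\<^esub> cls b"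
  using ring_hom_add[OF cls_hom, of a b] by simp

lemma cls_mult: "\<lbrakk>a \<in> Zy; b \<in> Zy\<rbrakk> \<Longrightarrow> cls (a \<otimes>\<^bsub>B\<^esub> b) = cls a \<otimes>\<^bsub>H\<^esub> cls b"
  using ring_hom_mult[OF cls_hom, of a b] by simp

lemma cls_one: "cls \<one>\<^bsub>B\<^esub> = \<one>\<^bsub>H\<^esub>"
  using ring_hom_one[OF cls_hom] by simp

lemma cls_boundary: "z \<in> bd \<Longrightarrow> cls z = \<zero>\<^bsub>H\<^esub>"
  unfolding cls_eq H_eq by (subst bd.a_rcos_const) (auto simp: FactRing_def)

lemma cls_minus: "z \<in> Zy \<Longrightarrow> cls (\<ominus>\<^bsub>B\<^esub> z) = \<ominus>\<^bsub>H\<^esub> cls z"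
proof -
  assume z: "z \<in> Zy"
  have "cls (\<ominus>\<^bsub>B\<^esub> z) \<oplus>\<^bsub>H\<^esub> cls z = \<zero>\<^bsub>H\<^esub>"
    using z by (simp add: cls_add[symmetric] cycle_minus B.l_neg cycleD cls_boundary boundary_zero)
  then show ?thesis using z by (metis H.minus_equality cls_closed cycle_minus)
qed

text \<open>The embedding of \<open>A\<close> in degree zero. By \<open>homog0_iota\<close> it is
  onto that degree, so every class in \<open>H0\<close> comes from a scalar.\<close>

definition \<iota> where "\<iota> r = sc r \<one>\<^bsub>B\<^esub>"

lemma one_apply: "U \<subseteq> {..<n} \<Longrightarrow> \<one>\<^bsub>B\<^esub> U = (if U = {} then \<one> else \<zero>)"
  by (simp add: koszul_simps)

lemma iota_closed: "r \<in> carrier A \<Longrightarrow> \<iota> r \<in> carrier B" by (simp add: \<iota>_def sc_closed)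

lemma iota_apply: "U \<subseteq> {..<n} \<Longrightarrow> r \<in> carrier A \<Longrightarrow> \<iota> r U = (if U = {} then r else \<zero>)"
  by (cases "U = {}") (simp_all add: \<iota>_def sc_apply one_apply)

lemma iota_homog: "r \<in> carrier A \<Longrightarrow> \<iota> r \<in> homog B 0"
  by (auto intro!: homogI simp: iota_closed iota_apply)

lemma iota_cycle: "r \<in> carrier A \<Longrightarrow> \<iota> r \<in> Zy"
proof (rule cycleI)
  assume r: "r \<in> carrier A"
  show "dgdiff B (\<iota> r) = \<zero>\<^bsub>B\<^esub>"
    using r by (simp add: \<iota>_def diff_sc diff_one) (rule B_eqI, auto simp: sc_closed sc_apply)
qed (rule iota_closed)

lemma homog0_iota: "a \<in> homog B 0 \<Longrightarrow> a = \<iota> (a {})"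
proof (rule B_eqI)
  assume a: "a \<in> homog B 0"
  note ca = homogD(1)[OF a]
  show "a \<in> carrier B" by fact
  show "\<iota> (a {}) \<in> carrier B" using ca by (auto intro!: iota_closed)
  fix U assume U: "U \<subseteq> {..<n}"
  have "card U \<noteq> 0" if "U \<noteq> {}" using that U fin_V by auto
  then show "a U = \<iota> (a {}) U" using homogD(2)[OF a U] U ca by (auto simp: iota_apply)
qed

lemma iota_mult: "\<lbrakk>r \<in> carrier A; a \<in> carrier B\<rbrakk> \<Longrightarrow> \<iota> r \<otimes>\<^bsub>B\<^esub> a = sc r a"
  by (simp add: \<iota>_def sc_mult_left)

lemma sc_iota: "\<lbrakk>r \<in> carrier A; s \<in> carrier A\<rbrakk> \<Longrightarrow> sc r (\<iota> s) = \<iota> (r \<otimes> s)"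
  by (rule B_eqI) (auto simp: sc_closed iota_closed sc_apply iota_apply)

lemma iota_add: "\<lbrakk>r \<in> carrier A; s \<in> carrier A\<rbrakk> \<Longrightarrow> \<iota> (r \<oplus> s) = \<iota> r \<oplus>\<^bsub>B\<^esub> \<iota> s"
  by (rule B_eqI) (auto simp: iota_closed add_apply iota_apply)

lemma iota_minus: "r \<in> carrier A \<Longrightarrow> \<iota> (\<ominus> r) = \<ominus>\<^bsub>B\<^esub> \<iota> r"
  by (rule B_eqI) (auto simp: iota_closed minus_apply iota_apply)

abbreviation "H0 \<equiv> homology_zero B"

lemma H0_carrier: "carrier H0 = (\<lambda>r. cls (\<iota> r)) ` carrier A"
proof -
  have "Zy \<inter> homog B 0 = \<iota> ` carrier A"
  proof
    show "Zy \<inter> homog B 0 \<subseteq> \<iota> ` carrier A"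
    proof
      fix a assume a: "a \<in> Zy \<inter> homog B 0"
      then have "a = \<iota> (a {})" "a {} \<in> carrier A" using homog0_iota by (auto simp: cycleD)
      then show "a \<in> \<iota> ` carrier A" by blast
    qed
  qed (auto simp: iota_cycle iota_homog)
  then show ?thesis by (simp add: homology_zero_def image_image)
qed

text \<open>The homology ring is commutative only up to sign; on the subring formed by the classes
  of scalars, commutativity is inherited from \<open>A\<close>.\<close>

lemma H0_cring: "cring H0"
proof -
  let ?S = "carrier H0"
  have e: "H0 = H\<lparr>carrier := ?S\<rparr>" by (simp add: homology_zero_def)
  have "subcring ?S H"
  proof (rule H.subcringI, rule H.subringI)
    show "?S \<subseteq> carrier H" by (auto simp: H0_carrier cls_closed iota_cycle)
    have "\<one>\<^bsub>H\<^esub> = cls (\<iota> \<one>)"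
      by (simp add: cls_one[symmetric]) (rule arg_cong[where f = cls], rule B_eqI, simp_all add: iota_closed iota_apply one_apply)
    then show "\<one>\<^bsub>H\<^esub> \<in> ?S" by (auto simp: H0_carrier)
    show "\<ominus>\<^bsub>H\<^esub> h \<in> ?S" if "h \<in> ?S" for h
      using that by (auto simp: H0_carrier cls_minus[symmetric] iota_cycle iota_minus[symmetric])
    show "h \<otimes>\<^bsub>H\<^esub> h' \<in> ?S" if "h \<in> ?S" "h' \<in> ?S" for h h'
      using that by (auto simp: H0_carrier cls_mult[symmetric] iota_cycle iota_mult iota_closed sc_iota)
    show "h \<oplus>\<^bsub>H\<^esub> h' \<in> ?S" if "h \<in> ?S" "h' \<in> ?S" for h h'
      using that by (auto simp: H0_carrier cls_add[symmetric] iota_cycle iota_add[symmetric])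
    show "h \<otimes>\<^bsub>H\<^esub> h' = h' \<otimes>\<^bsub>H\<^esub> h" if "h \<in> ?S" "h' \<in> ?S" for h h'
      using that by (auto simp: H0_carrier cls_mult[symmetric] iota_cycle iota_mult iota_closed sc_iota m_comm)
  qed
  then have "cring (H\<lparr>carrier := ?S\<rparr>)"
    using H.subcring_iff subcringE(1) by blast
  then show ?thesis using e by simp
qed

end

section \<open>A criterion for trivial Massey operations\<close>

context koszul_algebra
begin

definition part where "part p a = (\<lambda>U\<in>V. if card U = p then a U else \<zero>)"

lemma part_homog: "a \<in> carrier B \<Longrightarrow> part p a \<in> homog B p"
  by (rule homogI) (auto simp: part_def koszul_simps)

lemma part_closed: "a \<in> carrier B \<Longrightarrow> part p a \<in> carrier B"
  by (rule homogD(1)[OF part_homog])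

lemma card_V: "U \<subseteq> {..<n} \<Longrightarrow> card U \<le> n"
  using card_mono[of "{..<n}" U] by simp

lemma sum_parts:
  assumes a: "a \<in> carrier B" and "a {} = \<zero>"
  shows "a = (\<Oplus>\<^bsub>B\<^esub>p\<in>{1..n}. part p a)"
proof (rule B_eqI)
  fix U assume U: "U \<subseteq> {..<n}"
  have cl: "part p a U \<in> carrier A" for p using part_closed[OF a] U by auto
  have "(\<Oplus>\<^bsub>B\<^esub>p\<in>{1..n}. part p a) U = (\<Oplus>p\<in>{1..n}. part p a U)"
    using a U by (intro finsum_apply) (auto intro: part_closed)
  also have "\<dots> = a U"
  proof (cases "U = {}")
    case True
    then have "(\<Oplus>p\<in>{1..n}. part p a U) = \<zero>" by (intro finsum_all_zero) (auto simp: part_def)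
    then show ?thesis using True assms by simp
  next
    case False
    then have "card U \<in> {1..n}" using U card_V[OF U] fin_V[OF U] by (auto simp: Suc_le_eq card_gt_0_iff)
    then have "(\<Oplus>p\<in>{1..n}. part p a U) = part (card U) a U"
      using cl[of "card U"] U by (intro finsum_single) (auto simp: part_def)
    then show ?thesis using U by (simp add: part_def)
  qed
  finally show "a U = (\<Oplus>\<^bsub>B\<^esub>p\<in>{1..n}. part p a) U" by simp
qed (use a in \<open>auto intro!: B.finsum_closed part_closed\<close>)

text \<open>The differential lowers the degree by one: its coefficient at \<open>U\<close> depends
  on the component of degree card U + 1 only, so components of cycles are cycles.\<close>

lemma diff_part:
  assumes a: "a \<in> carrier B" and z: "dgdiff B a = \<zero>\<^bsub>B\<^esub>"
  shows "dgdiff B (part p a) = \<zero>\<^bsub>B\<^esub>"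
proof (rule B_eqI)
  fix U assume U: "U \<subseteq> {..<n}"
  have fU: "finite U" by (rule fin_V) fact
  have "kd (part p a) U = \<zero>"
  proof (cases "Suc (card U) = p")
    case True
    have "kd (part p a) U = kd a U"
      unfolding kd_def using U True a fU
      by (intro finsum_cong_simple) (auto simp: kc_def part_def)
    also have "\<dots> = \<zero>" using z a U diff_apply[of a U] by simp
    finally show ?thesis .
  next
    case False
    then show ?thesis unfolding kd_def using U fU
      by (intro finsum_all_zero) (auto simp: kc_def part_def)
  qed
  then show "dgdiff B (part p a) U = \<zero>\<^bsub>B\<^esub> U" using U a by (simp add: diff_apply part_closed)
qed (use a in \<open>auto intro!: diff_B_closed part_closed\<close>)

lemma finsum_in_subgroup:
  assumes "finite I" "\<And>i. i \<in> I \<Longrightarrow> f i \<in> N" "N \<subseteq> carrier B" "\<zero>\<^bsub>B\<^esub> \<in> N" "\<And>x y. x \<in> N \<Longrightarrow> y \<in> N \<Longrightarrow> x \<oplus>\<^bsub>B\<^esub> y \<in> N"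
  shows "(\<Oplus>\<^bsub>B\<^esub>i\<in>I. f i) \<in> N"
  using assms(1,2)
proof (induct set: finite)
  case empty then show ?case using assms by simp
next
  case (insert x F)
  then show ?case using assms(3-5) by (subst B.finsum_insert) (auto simp: subset_iff)
qed

lemma a_inv_Z: "a_inv B x = m_inv (add_monoid B) x" by (simp add: a_inv_def)

text \<open>Replaces the generated subgroup by a condition on one coefficient: the empty set carries
  the whole degree zero part, and \<open>sum_parts\<close> recovers the rest from the components of
  degree 1 to n.\<close>

lemma dg_positive_eq: "dg_positive B = {a \<in> carrier B. a {} = \<zero>}"
proof
  show "dg_positive B \<subseteq> {a \<in> carrier B. a {} = \<zero>}"
  proof
    fix a assume "a \<in> dg_positive B"
    then have "a \<in> generate (add_monoid B) (\<Union>n\<in>{1..}. homog B n)" by (simp add: dg_positive_def)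
    then show "a \<in> {a \<in> carrier B. a {} = \<zero>}"
    proof (induct rule: generate.induct)
      case one then show ?case by simp
    next
      case (incl h) then show ?case using homogD[of h] by fastforce
    next
      case (inv h)
      then have "h \<in> carrier B" "h {} = \<zero>" using homogD[of h] by fastforce+
      then show ?case by (simp add: a_inv_Z[symmetric] minus_apply)
    next
      case (eng h1 h2) then show ?case by (simp add: add_apply)
    qed
  qed
  show "{a \<in> carrier B. a {} = \<zero>} \<subseteq> dg_positive B"
  proof
    fix a assume a: "a \<in> {a \<in> carrier B. a {} = \<zero>}"
    have "(\<Oplus>\<^bsub>B\<^esub>p\<in>{1..n}. part p a) \<in> generate (add_monoid B) (\<Union>n\<in>{1..}. homog B n)"
    proof (rule finsum_in_subgroup)
      have sub: "(\<Union>n\<in>{1..}. homog B n) \<subseteq> carrier (add_monoid B)" by (auto dest: homogD(1))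
      show "generate (add_monoid B) (\<Union>n\<in>{1..}. homog B n) \<subseteq> carrier B"
        using B.add.generate_incl[of "\<Union>n\<in>{1..}. homog B n"] sub by simp
    next
      show "\<zero>\<^bsub>B\<^esub> \<in> generate (add_monoid B) (\<Union>n\<in>{1..}. homog B n)"
        using generate.one[of "add_monoid B"] by simp
    next
      fix x y assume "x \<in> generate (add_monoid B) (\<Union>n\<in>{1..}. homog B n)" "y \<in> generate (add_monoid B) (\<Union>n\<in>{1..}. homog B n)"
      then show "x \<oplus>\<^bsub>B\<^esub> y \<in> generate (add_monoid B) (\<Union>n\<in>{1..}. homog B n)"
        using generate.eng[of x "add_monoid B"] by simp
    qed (use a in \<open>auto intro!: generate.incl part_homog\<close>)
    then show "a \<in> dg_positive B" using sum_parts[of a] a by (simp add: dg_positive_def)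
  qed
qed

abbreviation "HP \<equiv> homology_positive B"

lemma HP_simps:
  "carrier HP = cls ` (Zy \<inter> dg_positive B)" "\<zero>\<^bsub>HP\<^esub> = \<zero>\<^bsub>H\<^esub>" "a \<oplus>\<^bsub>HP\<^esub> b = a \<oplus>\<^bsub>H\<^esub> b" "a \<odot>\<^bsub>HP\<^esub> b = a \<otimes>\<^bsub>H\<^esub> b"
  by (simp_all add: homology_positive_def)

lemma H0_simps: "\<zero>\<^bsub>H0\<^esub> = \<zero>\<^bsub>H\<^esub>" "a \<oplus>\<^bsub>H0\<^esub> b = a \<oplus>\<^bsub>H\<^esub> b" "a \<otimes>\<^bsub>H0\<^esub> b = a \<otimes>\<^bsub>H\<^esub> b" "\<one>\<^bsub>H0\<^esub> = \<one>\<^bsub>H\<^esub>"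
  by (simp_all add: homology_zero_def)

lemma HP_sub: "x \<in> carrier HP \<Longrightarrow> x \<in> carrier H"
  by (auto simp: HP_simps cls_closed)

lemma H0_sub: "x \<in> carrier H0 \<Longrightarrow> x \<in> carrier H"
  by (auto simp: H0_carrier cls_closed iota_cycle)

lemma HP_module: "module H0 HP"
proof (rule moduleI)
  have add: "x \<oplus>\<^bsub>HP\<^esub> y \<in> carrier HP" if xy: "x \<in> carrier HP" "y \<in> carrier HP" for x y
  proof -
    obtain a b where ab: "a \<in> Zy" "b \<in> Zy" "a \<in> dg_positive B" "b \<in> dg_positive B" "x = cls a" "y = cls b"
      using xy unfolding HP_simps by blast
    then have "x \<oplus>\<^bsub>HP\<^esub> y = cls (a \<oplus>\<^bsub>B\<^esub> b)" "a \<oplus>\<^bsub>B\<^esub> b \<in> Zy \<inter> dg_positive B"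
      by (auto simp: HP_simps cls_add cycle_add dg_positive_eq add_apply)
    then show ?thesis by (auto simp: HP_simps)
  qed
  show "abelian_group HP"
  proof (rule abelian_groupI)
    show "\<zero>\<^bsub>HP\<^esub> \<in> carrier HP"
      using cls_boundary[OF boundary_zero] cycle_zero
      by (auto simp: HP_simps dg_positive_eq intro!: image_eqI[of _ _ "\<zero>\<^bsub>B\<^esub>"])
    fix x assume x: "x \<in> carrier HP"
    then obtain a where a: "a \<in> Zy" "a \<in> dg_positive B" "x = cls a"  by (auto simp: HP_simps)
    have "\<ominus>\<^bsub>B\<^esub> a \<in> Zy \<inter> dg_positive B" using a by (auto simp: cycle_minus dg_positive_eq minus_apply)
    then have "cls (\<ominus>\<^bsub>B\<^esub> a) \<in> carrier HP" unfolding HP_simps by (rule imageI)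
    moreover have "cls (\<ominus>\<^bsub>B\<^esub> a) \<oplus>\<^bsub>HP\<^esub> x = \<zero>\<^bsub>HP\<^esub>"
      using a by (simp add: HP_simps cls_minus H.l_neg cls_closed)
    ultimately show "\<exists>y\<in>carrier HP. y \<oplus>\<^bsub>HP\<^esub> x = \<zero>\<^bsub>HP\<^esub>" by blast
  qed (use add HP_sub in \<open>auto simp: HP_simps(2,3) H.a_ac\<close>)
  show "cring H0" by (rule H0_cring)
  fix c x assume c: "c \<in> carrier H0" and x: "x \<in> carrier HP"
  obtain r where r: "r \<in> carrier A" "c = cls (\<iota> r)" using c by (auto simp: H0_carrier)
  obtain a where a: "a \<in> Zy" "a \<in> dg_positive B" "x = cls a" using x by (auto simp: HP_simps)
  have "c \<odot>\<^bsub>HP\<^esub> x = cls (sc r a)" using r a by (simp add: HP_simps cls_mult[symmetric] iota_cycle iota_mult cycleD)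
  moreover have "sc r a \<in> Zy" using cycle_mult[OF iota_cycle[OF r(1)] a(1)] r a by (simp add: iota_mult cycleD)
  moreover have "sc r a \<in> dg_positive B" using a r by (auto simp: dg_positive_eq sc_closed sc_apply)
  ultimately show "c \<odot>\<^bsub>HP\<^esub> x \<in> carrier HP" by (auto simp: HP_simps)
qed (use HP_sub H0_sub in \<open>auto simp: HP_simps(2-4) H0_simps H.l_distr H.r_distr H.m_assoc\<close>)

text \<open>Let w be the sum of the f_a z_a, and YZ the sum of the Y_a z_a. From d Y_a = - f_a the
  Leibniz rule gives d YZ = - w - r, where r is the sum of the Y_a d z_a and is killed by every f_b.
  A product that begins with some w carries such a factor and hence kills r. So appending a letter h
  to hs changes the differential by the bar of nu hs times w h, and the Massey relation follows by
  induction on words from the right. The assumption \<open>local\<close> makes degree zero homology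
  a field, as a basis of homology demands.\<close>

lemma massey_criterion:
  fixes f :: "nat \<Rightarrow> 'a" and Y :: "nat \<Rightarrow> nat set \<Rightarrow> 'a" and T :: "nat set"
  assumes local: "\<And>r. r \<in> carrier A \<Longrightarrow> \<iota> r \<in> bd \<or> (\<exists>s\<in>carrier A. \<iota> (s \<otimes> r \<ominus> \<one>) \<in> bd)"
    and T: "finite T"
    and f: "\<And>a. a \<in> T \<Longrightarrow> f a \<in> carrier A"
    and Y: "\<And>a. a \<in> T \<Longrightarrow> Y a \<in> homog B 1" "\<And>a. a \<in> T \<Longrightarrow> dgdiff B (Y a) = \<ominus>\<^bsub>B\<^esub> \<iota> (f a)"
    and gens: "\<And>p w. \<lbrakk>1 \<le> p; w \<in> homog B p; w \<in> Zy\<rbrakk> \<Longrightarrow>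
      \<exists>z v. (\<forall>a\<in>T. z a \<in> homog B p) \<and> (\<forall>a\<in>T. \<forall>b\<in>T. sc (f b) (dgdiff B (z a)) = \<zero>\<^bsub>B\<^esub>) \<and>
        v \<in> carrier B \<and> w = (\<Oplus>\<^bsub>B\<^esub>a\<in>T. sc (f a) (z a)) \<oplus>\<^bsub>B\<^esub> dgdiff B v"
  shows "trivial_massey_operation B"
proof -
  interpret HP: module H0 HP by (rule HP_module)
  define good where "good p z \<longleftrightarrow> 1 \<le> p \<and> (\<forall>a\<in>T. z a \<in> homog B p) \<and> (\<forall>a\<in>T. \<forall>b\<in>T. sc (f b) (dgdiff B (z a)) = \<zero>\<^bsub>B\<^esub>)" for p z
  define W where "W z = (\<Oplus>\<^bsub>B\<^esub>a\<in>T. sc (f a) (z a))" for z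
  have zc: "z a \<in> carrier B" if "good p z" "a \<in> T" for p z a using that by (auto simp: good_def dest: homogD(1))
  have W_homog: "W z \<in> homog B p" if "good p z" for p z
    unfolding W_def using that T f by (intro finsum_homog) (auto simp: good_def intro: sc_homog)
  have W_cycle: "W z \<in> Zy" if g: "good p z" for p z
  proof (rule cycleI)
    show "W z \<in> carrier B" using W_homog[OF that] by (rule homogD(1))
    have "dgdiff B (W z) = (\<Oplus>\<^bsub>B\<^esub>a\<in>T. dgdiff B (sc (f a) (z a)))"
      unfolding W_def using T f zc[OF g] by (intro diff_finsum) (auto intro: sc_closed)
    also have "\<dots> = \<zero>\<^bsub>B\<^esub>"
      using f zc[OF g] g by (intro B.finsum_all_zero) (auto simp: diff_sc good_def)
    finally show "dgdiff B (W z) = \<zero>\<^bsub>B\<^esub>" .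
  qed
  \<comment> \<open>The classes with a representative of the required shape. They span by the
    assumption on cycles, applied to homogeneous components.\<close>
  define E where "E = {cls (W z) | p z. good p z}"
  have W_pos: "W z \<in> dg_positive B" if "good p z" for p z
    using homogD[OF W_homog[OF that]] that by (auto simp: dg_positive_eq good_def)
  have E: "E \<subseteq> carrier HP" using W_cycle W_pos by (auto simp: E_def HP_simps)
  have "\<exists>\<B>\<subseteq>E. is_basis H0 HP \<B> (\<lambda>h. h)"
  proof (rule HP.basis_of_spanning[OF _ E])
    \<comment> \<open>\<open>H0\<close> is a field: a nonzero class of a scalar is not a boundary,
      so some multiple of the scalar is 1 up to a boundary.\<close>
    fix c assume c: "c \<in> carrier H0" "c \<noteq> \<zero>\<^bsub>H0\<^esub>"
    then obtain r where r: "r \<in> carrier A" "c = cls (\<iota> r)" by (auto simp: H0_carrier)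
    have "\<iota> r \<notin> bd" using c r cls_boundary by (auto simp: H0_simps)
    then obtain s where s: "s \<in> carrier A" "\<iota> (s \<otimes> r \<ominus> \<one>) \<in> bd" using local r by blast
    have one: "\<iota> \<one> = \<one>\<^bsub>B\<^esub>" by (rule B_eqI) (auto simp: iota_closed iota_apply one_apply)
    have "s \<otimes> r = (s \<otimes> r \<ominus> \<one>) \<oplus> \<one>" using s r by (simp add: a_minus_def a_assoc l_neg)
    then have "cls (\<iota> (s \<otimes> r)) = cls (\<iota> (s \<otimes> r \<ominus> \<one>)) \<oplus>\<^bsub>H\<^esub> cls (\<iota> \<one>)"
      using s r by (subst cls_add[symmetric]) (auto simp: iota_cycle iota_add[symmetric])
    also have "\<dots> = \<one>\<^bsub>H\<^esub>" using s by (simp add: cls_boundary one cls_one)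
    finally have "cls (\<iota> s) \<otimes>\<^bsub>H0\<^esub> c = \<one>\<^bsub>H0\<^esub>"
      using s r by (simp add: H0_simps cls_mult[symmetric] iota_cycle iota_mult iota_closed sc_iota)
    then show "\<exists>b\<in>carrier H0. b \<otimes>\<^bsub>H0\<^esub> c = \<one>\<^bsub>H0\<^esub>" using s by (auto simp: H0_carrier)
  next
    fix N assume N: "\<zero>\<^bsub>HP\<^esub> \<in> N" "\<And>x y. x \<in> N \<Longrightarrow> y \<in> N \<Longrightarrow> x \<oplus>\<^bsub>HP\<^esub> y \<in> N" "E \<subseteq> N"
    show "carrier HP \<subseteq> N"
    proof
      fix x assume "x \<in> carrier HP"
      then obtain a where a: "a \<in> Zy" "a \<in> dg_positive B" "x = cls a" by (auto simp: HP_simps)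
      have aB: "a \<in> carrier B" "a {} = \<zero>" using a by (auto simp: dg_positive_eq)
      have "part p a \<in> Zy \<and> cls (part p a) \<in> N" if p1: "1 \<le> p" for p
      proof -
        have pc: "part p a \<in> Zy" using diff_part[OF aB(1)] a aB by (intro cycleI part_closed) (auto simp: cycleD)
        obtain z v where zv: "\<forall>a\<in>T. z a \<in> homog B p" "\<forall>a\<in>T. \<forall>b\<in>T. sc (f b) (dgdiff B (z a)) = \<zero>\<^bsub>B\<^esub>"
          "v \<in> carrier B" "part p a = (\<Oplus>\<^bsub>B\<^esub>a\<in>T. sc (f a) (z a)) \<oplus>\<^bsub>B\<^esub> dgdiff B v"
          using gens[OF p1 part_homog[OF aB(1)] pc] by blast
        have g: "good p z" using zv p1 by (auto simp: good_def)
        have e: "part p a = W z \<oplus>\<^bsub>B\<^esub> dgdiff B v" using zv(4) by (simp add: W_def)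
        have "cls (part p a) = cls (W z) \<oplus>\<^bsub>H\<^esub> cls (dgdiff B v)"
          unfolding e using W_cycle[OF g] zv(3) by (intro cls_add) (auto intro: boundary_cycle boundaryI)
        also have "\<dots> = cls (W z)" using W_cycle[OF g] zv(3) by (simp add: cls_boundary boundaryI cls_closed)
        finally have "cls (part p a) \<in> E" using g by (auto simp: E_def)
        then show ?thesis using N(3) pc by blast
      qed
      note parts = this
      \<comment> \<open>The class map is additive on cycles only, so the induction over partial sums
        also records that each of them is a cycle.\<close>
      have "finite I \<Longrightarrow> I \<subseteq> {1..n} \<Longrightarrow> (\<Oplus>\<^bsub>B\<^esub>p\<in>I. part p a) \<in> Zy \<and> cls (\<Oplus>\<^bsub>B\<^esub>p\<in>I. part p a) \<in> N" for I
      proof (induct I rule: finite_induct)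
        case empty then show ?case using N(1) cls_boundary[OF boundary_zero] cycle_zero by (simp add: HP_simps)
      next
        case (insert p I)
        have pz: "part p a \<in> Zy" "cls (part p a) \<in> N" using insert(4) parts[of p] by auto
        have eq: "(\<Oplus>\<^bsub>B\<^esub>p\<in>insert p I. part p a) = part p a \<oplus>\<^bsub>B\<^esub> (\<Oplus>\<^bsub>B\<^esub>p\<in>I. part p a)"
          using insert aB by (intro B.finsum_insert) (auto intro: part_closed)
        show ?case unfolding eq using insert pz N(2)[of "cls (part p a)"] by (auto simp: cycle_add cls_add HP_simps)
      qed
      from this[of "{1..n}"] show "x \<in> N" using sum_parts[OF aB] a(3) by simp
    qed
  qed
  then obtain \<B> where \<B>: "\<B> \<subseteq> E" "is_basis H0 HP \<B> (\<lambda>h. h)" by blast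
  have "\<forall>h\<in>\<B>. \<exists>pz. good (fst pz) (snd pz) \<and> h = cls (W (snd pz))"
    using \<B>(1) by (auto simp: E_def)
  then obtain PZ where PZ: "\<And>h. h \<in> \<B> \<Longrightarrow> good (fst (PZ h)) (snd (PZ h)) \<and> h = cls (W (snd (PZ h)))"
    by metis
  define w where "w h = W (snd (PZ h))" for h
  define YZ where "YZ h = (\<Oplus>\<^bsub>B\<^esub>a\<in>T. Y a \<otimes>\<^bsub>B\<^esub> snd (PZ h) a)" for h
  \<comment> \<open>The part of \<open>d (YZ h)\<close> beyond \<open>- w h\<close>. It may be
    nonzero, but each \<open>f b\<close> kills it because \<open>f b\<close> kills every
    \<open>d z\<close>.\<close>
  define r where "r h = (\<Oplus>\<^bsub>B\<^esub>a\<in>T. Y a \<otimes>\<^bsub>B\<^esub> dgdiff B (snd (PZ h) a))" for h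
  define \<nu> where "\<nu> hs = foldl (\<lambda>acc h. acc \<otimes>\<^bsub>B\<^esub> YZ h) (w (hd hs)) (tl hs)" for hs
  have \<nu>1: "\<nu> [h] = w h" for h by (simp add: \<nu>_def)
  have \<nu>snoc: "\<nu> (hs @ [h]) = \<nu> hs \<otimes>\<^bsub>B\<^esub> YZ h" if "hs \<noteq> []" for hs h
    using that by (simp add: \<nu>_def)
  have Yc: "\<And>a. a \<in> T \<Longrightarrow> Y a \<in> carrier B" using Y(1) by (auto dest: homogD(1))
  have hz: "snd (PZ h) a \<in> carrier B" if "h \<in> \<B>" "a \<in> T" for h a using PZ[OF that(1)] zc that by blast
  have YZ_homog: "YZ h \<in> homog B (1 + fst (PZ h))" if "h \<in> \<B>" for h
    unfolding YZ_def using PZ[OF that] T Y by (intro finsum_homog homog_mult) (auto simp: good_def)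
  have YZ_c: "YZ h \<in> carrier B" if "h \<in> \<B>" for h using YZ_homog[OF that] by (rule homogD(1))
  have r_c: "r h \<in> carrier B" if "h \<in> \<B>" for h
    unfolding r_def using Yc hz[OF that] by (intro B.finsum_closed) (auto intro!: mult_B_closed diff_B_closed)
  have w_c: "w h \<in> carrier B" if "h \<in> \<B>" for h using W_homog PZ[OF that] unfolding w_def by (blast dest: homogD(1))
  have w_homog: "w h \<in> homog B (fst (PZ h))" if "h \<in> \<B>" for h using W_homog PZ[OF that] unfolding w_def by blast
  have dYZ: "dgdiff B (YZ h) = \<ominus>\<^bsub>B\<^esub> w h \<ominus>\<^bsub>B\<^esub> r h" if h: "h \<in> \<B>" for h
  proof -
    have "dgdiff B (YZ h) = (\<Oplus>\<^bsub>B\<^esub>a\<in>T. dgdiff B (Y a \<otimes>\<^bsub>B\<^esub> snd (PZ h) a))"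
      unfolding YZ_def using T Yc hz[OF h] by (intro diff_finsum) (auto intro: mult_B_closed)
    also have "\<dots> = (\<Oplus>\<^bsub>B\<^esub>a\<in>T. \<ominus>\<^bsub>B\<^esub> sc (f a) (snd (PZ h) a) \<oplus>\<^bsub>B\<^esub> \<ominus>\<^bsub>B\<^esub> (Y a \<otimes>\<^bsub>B\<^esub> dgdiff B (snd (PZ h) a)))"
    proof (rule B.finsum_cong_simple)
      fix a assume a: "a \<in> T"
      have z: "snd (PZ h) a \<in> carrier B" using hz h a by blast
      show "dgdiff B (Y a \<otimes>\<^bsub>B\<^esub> snd (PZ h) a) = \<ominus>\<^bsub>B\<^esub> sc (f a) (snd (PZ h) a) \<oplus>\<^bsub>B\<^esub> \<ominus>\<^bsub>B\<^esub> (Y a \<otimes>\<^bsub>B\<^esub> dgdiff B (snd (PZ h) a))"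
        using a z f Y by (simp add: leibniz Yc invol_homog[OF Y(1)] B.l_minus iota_closed iota_mult diff_B_closed)
      show "\<ominus>\<^bsub>B\<^esub> sc (f a) (snd (PZ h) a) \<oplus>\<^bsub>B\<^esub> \<ominus>\<^bsub>B\<^esub> (Y a \<otimes>\<^bsub>B\<^esub> dgdiff B (snd (PZ h) a)) \<in> carrier B"
        using a z f Yc by (auto intro!: B.a_inv_closed sc_closed mult_B_closed diff_B_closed)
    qed
    also have "\<dots> = (\<Oplus>\<^bsub>B\<^esub>a\<in>T. \<ominus>\<^bsub>B\<^esub> sc (f a) (snd (PZ h) a)) \<oplus>\<^bsub>B\<^esub> (\<Oplus>\<^bsub>B\<^esub>a\<in>T. \<ominus>\<^bsub>B\<^esub> (Y a \<otimes>\<^bsub>B\<^esub> dgdiff B (snd (PZ h) a)))"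
      using f Yc hz[OF h] by (intro B.finsum_addf) (auto intro!: B.a_inv_closed sc_closed mult_B_closed diff_B_closed)
    also have "\<dots> = \<ominus>\<^bsub>B\<^esub> w h \<oplus>\<^bsub>B\<^esub> \<ominus>\<^bsub>B\<^esub> r h"
      unfolding w_def W_def r_def using T f Yc hz[OF h]
      by (subst (1 2) B.finsum_minus) (auto intro!: sc_closed mult_B_closed diff_B_closed)
    finally show ?thesis by (simp add: a_minus_def)
  qed
  have \<nu>_homog: "\<exists>q. \<nu> hs \<in> homog B q" if "hs \<noteq> []" "set hs \<subseteq> \<B>" for hs
    using that
  proof (induct hs rule: rev_nonempty_induct)
    case (single h) then show ?case using w_homog by (auto simp: \<nu>1)
  next
    case (snoc h hs)
    then obtain q where "\<nu> hs \<in> homog B q" by auto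
    then show ?case using homog_mult[OF _ YZ_homog] snoc by (auto simp: \<nu>snoc)
  qed
  have \<nu>_c: "\<nu> hs \<in> carrier B" if "hs \<noteq> []" "set hs \<subseteq> \<B>" for hs using \<nu>_homog[OF that] by (auto dest: homogD(1))
  \<comment> \<open>The factor \<open>f\<close> carried by the first letter kills the terms \<open>Y a \<otimes> d z\<close>.\<close>
  have ann: "\<nu> hs \<otimes>\<^bsub>B\<^esub> c = \<zero>\<^bsub>B\<^esub>"
    if "hs \<noteq> []" "set hs \<subseteq> \<B>" "c \<in> carrier B" "\<And>b. b \<in> T \<Longrightarrow> sc (f b) c = \<zero>\<^bsub>B\<^esub>" for hs c
    using that
  proof (induct hs arbitrary: c rule: rev_nonempty_induct)
    case (single h)
    have h: "h \<in> \<B>" using single by simp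
    have "w h \<otimes>\<^bsub>B\<^esub> c = (\<Oplus>\<^bsub>B\<^esub>a\<in>T. sc (f a) (snd (PZ h) a) \<otimes>\<^bsub>B\<^esub> c)"
      unfolding w_def W_def using T f hz[OF h] single(2) by (intro B.finsum_ldistr) (auto intro: sc_closed)
    also have "\<dots> = \<zero>\<^bsub>B\<^esub>"
    proof (rule B.finsum_all_zero)
      fix a assume a: "a \<in> T"
      have "sc (f a) (snd (PZ h) a) \<otimes>\<^bsub>B\<^esub> c = snd (PZ h) a \<otimes>\<^bsub>B\<^esub> sc (f a) c"
        using a f hz[OF h] single(2) by (simp add: sc_mult_left sc_mult_right)
      then show "sc (f a) (snd (PZ h) a) \<otimes>\<^bsub>B\<^esub> c = \<zero>\<^bsub>B\<^esub>" using a single(3) hz[OF h] by simp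
    qed
    finally show ?case by (simp add: \<nu>1)
  next
    case (snoc h hs)
    have h: "h \<in> \<B>" using snoc by simp
    have "\<nu> hs \<otimes>\<^bsub>B\<^esub> (YZ h \<otimes>\<^bsub>B\<^esub> c) = \<zero>\<^bsub>B\<^esub>"
    proof (rule snoc(2))
      fix b assume b: "b \<in> T"
      have "sc (f b) (YZ h \<otimes>\<^bsub>B\<^esub> c) = YZ h \<otimes>\<^bsub>B\<^esub> sc (f b) c"
        using b f YZ_c[OF h] snoc(4) by (simp add: sc_mult_right)
      then show "sc (f b) (YZ h \<otimes>\<^bsub>B\<^esub> c) = \<zero>\<^bsub>B\<^esub>" using snoc(5)[OF b] YZ_c[OF h] by simp
    qed (use snoc YZ_c in \<open>auto intro: mult_B_closed\<close>)
    then show ?case using \<nu>_c[of hs] snoc YZ_c[OF h] by (simp add: \<nu>snoc B.m_assoc)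
  qed
  have formula: "dgdiff B (\<nu> hs) = (\<Oplus>\<^bsub>B\<^esub>j\<in>{1..<length hs}. dg_bar B (\<nu> (take j hs)) \<otimes>\<^bsub>B\<^esub> \<nu> (drop j hs))"
    if "hs \<noteq> []" "set hs \<subseteq> \<B>" for hs
    using that
  proof (induct hs rule: rev_nonempty_induct)
    case (single h)
    then have "w h \<in> Zy" using PZ[of h] W_cycle unfolding w_def by auto
    then show ?case by (simp add: \<nu>1 cycleD)
  next
    case (snoc h hs)
    have h: "h \<in> \<B>" and hs: "set hs \<subseteq> \<B>" "hs \<noteq> []" using snoc by auto
    obtain q where q: "\<nu> hs \<in> homog B q" using \<nu>_homog hs by blast
    have c\<nu>: "\<nu> hs \<in> carrier B" using q by (rule homogD(1))
    have "sc (f b) (r h) = \<zero>\<^bsub>B\<^esub>" if b: "b \<in> T" for b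
    proof -
      have "sc (f b) (r h) = \<iota> (f b) \<otimes>\<^bsub>B\<^esub> r h" using f[OF b] r_c[OF h] by (simp add: iota_mult)
      also have "\<dots> = (\<Oplus>\<^bsub>B\<^esub>a\<in>T. \<iota> (f b) \<otimes>\<^bsub>B\<^esub> (Y a \<otimes>\<^bsub>B\<^esub> dgdiff B (snd (PZ h) a)))"
        unfolding r_def using T f[OF b] Yc hz[OF h] by (intro B.finsum_rdistr) (auto intro!: mult_B_closed diff_B_closed iota_closed)
      also have "\<dots> = \<zero>\<^bsub>B\<^esub>"
      proof (rule B.finsum_all_zero)
        fix a assume a: "a \<in> T"
        have "sc (f b) (dgdiff B (snd (PZ h) a)) = \<zero>\<^bsub>B\<^esub>" using PZ[OF h] a b by (auto simp: good_def)
        moreover have "\<iota> (f b) \<otimes>\<^bsub>B\<^esub> (Y a \<otimes>\<^bsub>B\<^esub> dgdiff B (snd (PZ h) a)) = Y a \<otimes>\<^bsub>B\<^esub> sc (f b) (dgdiff B (snd (PZ h) a))"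
          using a b f Yc hz[OF h] by (simp add: iota_mult mult_B_closed diff_B_closed sc_mult_right)
        ultimately show "\<iota> (f b) \<otimes>\<^bsub>B\<^esub> (Y a \<otimes>\<^bsub>B\<^esub> dgdiff B (snd (PZ h) a)) = \<zero>\<^bsub>B\<^esub>" using Yc[OF a] by simp
      qed
      finally show ?thesis .
    qed
    then have nr: "\<nu> hs \<otimes>\<^bsub>B\<^esub> r h = \<zero>\<^bsub>B\<^esub>" using ann[OF hs(2,1) r_c[OF h]] by blast
    have "invol (\<nu> hs) \<otimes>\<^bsub>B\<^esub> r h = \<zero>\<^bsub>B\<^esub>"
      using nr c\<nu> r_c[OF h] by (auto simp: invol_homog[OF q] B.l_minus B.minus_zero)
    \<comment> \<open>The summand with \<open>j = length hs\<close> in the Massey relation. The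
      minus sign of \<open>w h\<close> in the differential of \<open>YZ h\<close> turns the
      involution into the bar.\<close>
    then have 2: "invol (\<nu> hs) \<otimes>\<^bsub>B\<^esub> dgdiff B (YZ h) = dg_bar B (\<nu> hs) \<otimes>\<^bsub>B\<^esub> w h"
      using c\<nu> w_c[OF h] r_c[OF h] invol_closed[OF c\<nu>]
      by (simp add: dYZ[OF h] dg_bar_homog[OF q] a_minus_def B.r_distr B.r_minus B.l_minus B.minus_zero)
    have bar_c: "dg_bar B (\<nu> (take j hs)) \<in> carrier B" if "1 \<le> j" for j
    proof -
      have ne: "take j hs \<noteq> []" "set (take j hs) \<subseteq> \<B>" using that hs by (auto dest: in_set_takeD)
      obtain q' where "\<nu> (take j hs) \<in> homog B q'" using \<nu>_homog[OF ne] by blast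
      then show ?thesis using \<nu>_c[OF ne] by (simp add: dg_bar_homog invol_closed)
    qed
    have drop_c: "\<nu> (drop j hs) \<in> carrier B" if "j < length hs" for j
      using that hs by (intro \<nu>_c) (auto dest: in_set_dropD)
    have "dgdiff B (\<nu> hs) \<otimes>\<^bsub>B\<^esub> YZ h = (\<Oplus>\<^bsub>B\<^esub>j\<in>{1..<length hs}. (dg_bar B (\<nu> (take j hs)) \<otimes>\<^bsub>B\<^esub> \<nu> (drop j hs)) \<otimes>\<^bsub>B\<^esub> YZ h)"
      using snoc(2) hs YZ_c[OF h] bar_c drop_c by (simp, intro B.finsum_ldistr) (auto intro!: mult_B_closed)
    also have "\<dots> = (\<Oplus>\<^bsub>B\<^esub>j\<in>{1..<length hs}. dg_bar B (\<nu> (take j (hs @ [h]))) \<otimes>\<^bsub>B\<^esub> \<nu> (drop j (hs @ [h])))"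
      using bar_c drop_c YZ_c[OF h]
      by (intro B.finsum_cong_simple) (auto simp: \<nu>snoc B.m_assoc intro!: mult_B_closed)
    finally have 1: "dgdiff B (\<nu> hs) \<otimes>\<^bsub>B\<^esub> YZ h = (\<Oplus>\<^bsub>B\<^esub>j\<in>{1..<length hs}. dg_bar B (\<nu> (take j (hs @ [h]))) \<otimes>\<^bsub>B\<^esub> \<nu> (drop j (hs @ [h])))" .
    have ins: "{1..<length (hs @ [h])} = insert (length hs) {1..<length hs}" using hs by (cases hs) auto
    have "(\<Oplus>\<^bsub>B\<^esub>j\<in>{1..<length (hs @ [h])}. dg_bar B (\<nu> (take j (hs @ [h]))) \<otimes>\<^bsub>B\<^esub> \<nu> (drop j (hs @ [h])))
      = dg_bar B (\<nu> hs) \<otimes>\<^bsub>B\<^esub> w h \<oplus>\<^bsub>B\<^esub> dgdiff B (\<nu> hs) \<otimes>\<^bsub>B\<^esub> YZ h"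
      unfolding ins 1 using bar_c[of "length hs"] bar_c drop_c YZ_c[OF h] w_c[OF h] hs
      by (subst B.finsum_insert) (auto simp: \<nu>1 \<nu>snoc Suc_le_eq intro!: mult_B_closed)
    moreover have "dgdiff B (\<nu> (hs @ [h])) = dgdiff B (\<nu> hs) \<otimes>\<^bsub>B\<^esub> YZ h \<oplus>\<^bsub>B\<^esub> dg_bar B (\<nu> hs) \<otimes>\<^bsub>B\<^esub> w h"
      using hs c\<nu> YZ_c[OF h] by (simp add: \<nu>snoc leibniz 2)
    ultimately show ?case
      using c\<nu> YZ_c[OF h] w_c[OF h] bar_c[of "length hs"] hs
      by (simp add: B.a_comm mult_B_closed diff_B_closed Suc_le_eq)
  qed
  show ?thesis
    unfolding trivial_massey_operation_def
  proof (intro exI conjI)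
    show "is_basis H0 HP \<B> (\<lambda>h. h)" by fact
    show "\<forall>h\<in>\<B>. \<exists>n\<ge>1. \<exists>z\<in>Zy \<inter> homog B n. h = cls z"
    proof
      fix h assume h: "h \<in> \<B>"
      have "good (fst (PZ h)) (snd (PZ h))" "h = cls (w h)" using PZ[OF h] by (auto simp: w_def)
      then show "\<exists>n\<ge>1. \<exists>z\<in>Zy \<inter> homog B n. h = cls z"
        using W_cycle w_homog[OF h] unfolding w_def good_def by blast
    qed
    show "\<forall>hs. hs \<noteq> [] \<and> set hs \<subseteq> \<B> \<longrightarrow> \<nu> hs \<in> (\<Union>n. homog B n)" using \<nu>_homog by blast
    show "\<forall>h\<in>\<B>. \<nu> [h] \<in> Zy \<and> cls (\<nu> [h]) = h" using PZ W_cycle by (auto simp: \<nu>1 w_def)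
    show "\<forall>hs. 2 \<le> length hs \<and> set hs \<subseteq> \<B> \<longrightarrow> dgdiff B (\<nu> hs) =
       (\<Oplus>\<^bsub>B\<^esub>j\<in>{1..<length hs}. dg_bar B (\<nu> (take j hs)) \<otimes>\<^bsub>B\<^esub> \<nu> (drop j hs))"
      by (intro allI impI formula) auto
  qed
qed

end

section \<open>Functoriality and regular sequences on free modules\<close>

lemma mod_homD:
  assumes "h \<in> mod_hom R M N"
  shows "x \<in> carrier M \<Longrightarrow> h x \<in> carrier N"
    and "\<lbrakk>x \<in> carrier M; y \<in> carrier M\<rbrakk> \<Longrightarrow> h (x \<oplus>\<^bsub>M\<^esub> y) = h x \<oplus>\<^bsub>N\<^esub> h y"
    and "\<lbrakk>a \<in> carrier R; x \<in> carrier M\<rbrakk> \<Longrightarrow> h (a \<odot>\<^bsub>M\<^esub> x) = a \<odot>\<^bsub>N\<^esub> h x"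
  using assms by (auto simp: mod_hom_def)

lemma mod_hom_zero:
  assumes "module R M" "module R N" "h \<in> mod_hom R M N" shows "h \<zero>\<^bsub>M\<^esub> = \<zero>\<^bsub>N\<^esub>"
proof -
  interpret M: module R M by fact
  interpret N: module R N by fact
  have "h \<zero>\<^bsub>M\<^esub> \<in> carrier N" using mod_homD(1)[OF assms(3)] by simp
  moreover have "h \<zero>\<^bsub>M\<^esub> = h \<zero>\<^bsub>M\<^esub> \<oplus>\<^bsub>N\<^esub> h \<zero>\<^bsub>M\<^esub>" using mod_homD(2)[OF assms(3), of "\<zero>\<^bsub>M\<^esub>" "\<zero>\<^bsub>M\<^esub>"] by simp
  ultimately show ?thesis by (metis N.M.add.r_cancel_one')
qed

lemma mod_hom_minus:
  assumes "module R M" "module R N" "h \<in> mod_hom R M N" "x \<in> carrier M"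
  shows "h (\<ominus>\<^bsub>M\<^esub> x) = \<ominus>\<^bsub>N\<^esub> h x"
proof -
  interpret M: module R M by fact
  interpret N: module R N by fact
  have "h (\<ominus>\<^bsub>M\<^esub> x) \<oplus>\<^bsub>N\<^esub> h x = \<zero>\<^bsub>N\<^esub>"
    using mod_homD(2)[OF assms(3), of "\<ominus>\<^bsub>M\<^esub> x" x] assms(4) mod_hom_zero[OF assms(1-3)] by (simp add: M.M.l_neg)
  then show ?thesis using mod_homD(1)[OF assms(3)] assms(4) by (metis M.M.a_inv_closed N.M.minus_equality)
qed

lemma mod_hom_finsum:
  assumes "module R M" "module R N" "h \<in> mod_hom R M N" "finite S" "\<And>i. i \<in> S \<Longrightarrow> f i \<in> carrier M"
  shows "h (finsum M f S) = (\<Oplus>\<^bsub>N\<^esub>i\<in>S. h (f i))"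
  using assms(4,5)
proof (induct set: finite)
  interpret M: module R M by fact
  interpret N: module R N by fact
  case empty then show ?case using mod_hom_zero[OF assms(1-3)] by simp
next
  interpret M: module R M by fact
  interpret N: module R N by fact
  case (insert x F)
  then have "(\<lambda>i. h (f i)) \<in> F \<rightarrow> carrier N" "h (f x) \<in> carrier N" "f \<in> F \<rightarrow> carrier M" "f x \<in> carrier M"
    using mod_homD(1)[OF assms(3)] by auto
  with insert show ?case using mod_homD(2)[OF assms(3)] by simp
qed

lemma mod_hom_comp:
  assumes "h \<in> mod_hom R M N" "k \<in> mod_hom R N L" shows "(\<lambda>x. k (h x)) \<in> mod_hom R M L"
  using mod_homD[OF assms(1)] mod_homD[OF assms(2)] unfolding mod_hom_def by auto

context koszul_module
begin

lemma hom_D: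
  assumes N: "koszul_module R N ys" and h: "h \<in> mod_hom R M N" and a: "a \<in> KM p"
  shows "kdiff R N ys (\<lambda>U. h (a U)) U = h (D a U)"
proof (cases "U \<subseteq> {..<n}")
  case True
  interpret N: koszul_module R N ys by fact
  have mM: "module R M" and mN: "module R N" by unfold_locales
  have m: "h (mc i a U) = N.mc i (\<lambda>U. h (a U)) U" for i
    using a mod_homD(3)[OF h] mod_hom_zero[OF mM mN h] by (simp add: mc_def N.mc_def)
  have c: "mc i a U \<in> carrier M" for i using a by simp
  have "h (D a U) = (\<Oplus>\<^bsub>N\<^esub>i\<in>{..<n}. h (ys ! i \<odot>\<^bsub>M\<^esub> mc i a U))"
    using True c by (simp add: D_eq) (intro mod_hom_finsum[OF mM mN h], auto)
  also have "\<dots> = (\<Oplus>\<^bsub>N\<^esub>i\<in>{..<n}. ys ! i \<odot>\<^bsub>N\<^esub> N.mc i (\<lambda>U. h (a U)) U)"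
    using c mod_homD(1,3)[OF h] by (intro N.M.finsum_cong_simple) (auto simp: m[symmetric])
  finally show ?thesis using True by (simp add: N.D_eq)
next
  case False
  have mM: "module R M" using module_axioms .
  have mN: "module R N" using N by (rule koszul_module.axioms)
  show ?thesis using False mod_hom_zero[OF mM mN h] by (simp add: kdiff_def)
qed

lemma hom_kchain:
  assumes N: "module R N" and h: "h \<in> mod_hom R M N" and a: "a \<in> KM p"
  shows "(\<lambda>U. h (a U)) \<in> kchain N n p"
proof -
  have z: "h \<zero>\<^bsub>M\<^esub> = \<zero>\<^bsub>N\<^esub>" by (rule mod_hom_zero[OF module_axioms N h])
  show ?thesis unfolding kchain_def
    using a kchain_zero[OF a] mod_homD(1)[OF h] z by auto
qed

text \<open>Preimages are chosen coefficient by coefficient, with the prescribed default zero off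
  the p-subsets; \<open>z\<close> makes the two defaults compatible.\<close>

lemma lift_kchain:
  assumes a: "a \<in> kchain N n p" and im: "\<And>U. \<lbrakk>U \<subseteq> {..<n}; card U = p\<rbrakk> \<Longrightarrow> a U \<in> h ` carrier M"
    and z: "h \<zero>\<^bsub>M\<^esub> = \<zero>\<^bsub>N\<^esub>"
  shows "\<exists>b\<in>KM p. (\<lambda>U. h (b U)) = a"
proof -
  have "\<exists>x\<in>carrier M. h x = a U \<and> (\<not> (U \<subseteq> {..<n} \<and> card U = p) \<longrightarrow> x = \<zero>\<^bsub>M\<^esub>)" for U
  proof (cases "U \<subseteq> {..<n} \<and> card U = p")
    case True then show ?thesis using im[of U] by auto
  next
    case False
    then have "a U = \<zero>\<^bsub>N\<^esub>" using a unfolding kchain_def by auto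
    then show ?thesis using z by (intro bexI[of _ "\<zero>\<^bsub>M\<^esub>"]) auto
  qed
  then obtain b where b: "\<And>U. b U \<in> carrier M \<and> h (b U) = a U \<and> (\<not> (U \<subseteq> {..<n} \<and> card U = p) \<longrightarrow> b U = \<zero>\<^bsub>M\<^esub>)"
    by metis
  then have "b \<in> KM p" by (intro kchainI) auto
  then show ?thesis using b by auto
qed

lemma boundary_multiples:
  assumes b: "b \<in> KM 1" shows "D b {} \<in> multiples M ys n"
  using b by (auto simp: D_deg1[OF b] multiples_def intro!: exI[of _ "\<lambda>i. b {i}"])

end

lemma (in module) basis_coords:
  assumes b: "is_basis R M S b" and S: "finite S" and x: "x \<in> carrier M"
  shows "\<exists>c\<in>S \<rightarrow> carrier R. x = (\<Oplus>\<^bsub>M\<^esub>i\<in>S. c i \<odot>\<^bsub>M\<^esub> b i)"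
proof -
  have bM: "\<And>i. i \<in> S \<Longrightarrow> b i \<in> carrier M" using b by (auto simp: is_basis_def)
  obtain c where c: "c \<in> S \<rightarrow>\<^sub>E carrier R" "x = (\<Oplus>\<^bsub>M\<^esub>i\<in>{i \<in> S. c i \<noteq> \<zero>}. c i \<odot>\<^bsub>M\<^esub> b i)"
    using b x unfolding is_basis_def combination_def by blast
  have "x = (\<Oplus>\<^bsub>M\<^esub>i\<in>S. c i \<odot>\<^bsub>M\<^esub> b i)"
    unfolding c(2) using c(1) S bM by (intro M.finsum_extend) auto
  then show ?thesis using c(1) by (intro bexI[of _ c]) auto
qed

lemma (in module) basis_unique:
  assumes b: "is_basis R M S b" and S: "finite S"
    and c: "c \<in> S \<rightarrow> carrier R" and d: "d \<in> S \<rightarrow> carrier R"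
    and eq: "(\<Oplus>\<^bsub>M\<^esub>i\<in>S. c i \<odot>\<^bsub>M\<^esub> b i) = (\<Oplus>\<^bsub>M\<^esub>i\<in>S. d i \<odot>\<^bsub>M\<^esub> b i)" and i: "i \<in> S"
  shows "c i = d i"
proof -
  have bM: "\<And>i. i \<in> S \<Longrightarrow> b i \<in> carrier M" using b by (auto simp: is_basis_def)
  have comb: "combination R M S b (restrict c S) (\<Oplus>\<^bsub>M\<^esub>i\<in>S. c i \<odot>\<^bsub>M\<^esub> b i)" if c: "c \<in> S \<rightarrow> carrier R" for c
  proof -
    have "(\<Oplus>\<^bsub>M\<^esub>i\<in>S. c i \<odot>\<^bsub>M\<^esub> b i) = (\<Oplus>\<^bsub>M\<^esub>i\<in>S. restrict c S i \<odot>\<^bsub>M\<^esub> b i)"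
      using c bM by (intro M.finsum_cong_simple) (auto simp: Pi_iff)
    also have "\<dots> = (\<Oplus>\<^bsub>M\<^esub>i\<in>{i \<in> S. restrict c S i \<noteq> \<zero>}. restrict c S i \<odot>\<^bsub>M\<^esub> b i)"
      using c bM S by (intro M.finsum_extend[symmetric]) (auto simp: Pi_iff)
    finally show ?thesis unfolding combination_def using c S by auto
  qed
  have "(\<Oplus>\<^bsub>M\<^esub>i\<in>S. c i \<odot>\<^bsub>M\<^esub> b i) \<in> carrier M" using c bM by (intro M.finsum_closed) (auto simp: Pi_iff)
  then have "restrict c S = restrict d S"
    using b comb[OF c] comb[OF d] eq unfolding is_basis_def by (metis (no_types, lifting))
  then show ?thesis using i by (metis restrict_apply')
qed

text \<open>In a finite basis, membership in the multiples of the first \<open>k\<close> elements is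
  decided coordinate by coordinate: exchanging the two sums turns a relation between vectors into
  one relation in \<open>R\<close> for each basis element.\<close>

lemma regular_seq_free:
  fixes R (structure)
  assumes R: "cring R" and ys: "set ys \<subseteq> carrier R" and reg: "regular_seq (self_module R) ys"
    and M: "module R M" and b: "is_basis R M S b" and S: "finite S"
  shows "regular_seq M ys"
  unfolding regular_seq_def
proof (intro allI ballI impI)
  interpret module R M by fact
  have bM: "\<And>i. i \<in> S \<Longrightarrow> b i \<in> carrier M" using b by (auto simp: is_basis_def)
  fix k x assume k: "k < length ys" and x: "x \<in> carrier M" and yx: "ys ! k \<odot>\<^bsub>M\<^esub> x \<in> multiples M ys k"
  have yR: "\<And>i. i < length ys \<Longrightarrow> ys ! i \<in> carrier R" using ys by auto
  obtain m where m: "m \<in> {..<k} \<rightarrow> carrier M" "ys ! k \<odot>\<^bsub>M\<^esub> x = (\<Oplus>\<^bsub>M\<^esub>i\<in>{..<k}. ys ! i \<odot>\<^bsub>M\<^esub> m i)"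
    using yx by (auto simp: multiples_def)
  obtain c where c: "c \<in> S \<rightarrow> carrier R" "x = (\<Oplus>\<^bsub>M\<^esub>s\<in>S. c s \<odot>\<^bsub>M\<^esub> b s)" using basis_coords[OF b S x] by blast
  have "\<forall>i\<in>{..<k}. \<exists>d\<in>S \<rightarrow> carrier R. m i = (\<Oplus>\<^bsub>M\<^esub>s\<in>S. d s \<odot>\<^bsub>M\<^esub> b s)" using m basis_coords[OF b S] by auto
  then obtain d where d: "\<And>i. i < k \<Longrightarrow> d i \<in> S \<rightarrow> carrier R" "\<And>i. i < k \<Longrightarrow> m i = (\<Oplus>\<^bsub>M\<^esub>s\<in>S. d i s \<odot>\<^bsub>M\<^esub> b s)"
    by (metis lessThan_iff)
  have swap: "(\<Oplus>\<^bsub>M\<^esub>i\<in>{..<k}. ys ! i \<odot>\<^bsub>M\<^esub> (\<Oplus>\<^bsub>M\<^esub>s\<in>S. d i s \<odot>\<^bsub>M\<^esub> b s)) = (\<Oplus>\<^bsub>M\<^esub>s\<in>S. (\<Oplus>i\<in>{..<k}. ys ! i \<otimes> d i s) \<odot>\<^bsub>M\<^esub> b s)"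
    if d: "\<And>i. i < k \<Longrightarrow> d i \<in> S \<rightarrow> carrier R" for d
  proof -
    have dR: "\<And>i s. i < k \<Longrightarrow> s \<in> S \<Longrightarrow> d i s \<in> carrier R" using d by auto
    have yk: "\<And>i. i < k \<Longrightarrow> ys ! i \<in> carrier R" using yR k by auto
    have "(\<Oplus>\<^bsub>M\<^esub>i\<in>{..<k}. ys ! i \<odot>\<^bsub>M\<^esub> (\<Oplus>\<^bsub>M\<^esub>s\<in>S. d i s \<odot>\<^bsub>M\<^esub> b s)) = (\<Oplus>\<^bsub>M\<^esub>i\<in>{..<k}. \<Oplus>\<^bsub>M\<^esub>s\<in>S. (ys ! i \<otimes> d i s) \<odot>\<^bsub>M\<^esub> b s)"
      using dR yk bM S by (intro M.finsum_cong_simple) (auto simp: finsum_smult_ldistr smult_assoc1 Pi_iff intro!: M.finsum_cong_simple M.finsum_closed)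
    also have "\<dots> = (\<Oplus>\<^bsub>M\<^esub>s\<in>S. \<Oplus>\<^bsub>M\<^esub>i\<in>{..<k}. (ys ! i \<otimes> d i s) \<odot>\<^bsub>M\<^esub> b s)"
      using dR yk bM S by (intro M.finsum_swap) auto
    also have "\<dots> = (\<Oplus>\<^bsub>M\<^esub>s\<in>S. (\<Oplus>i\<in>{..<k}. ys ! i \<otimes> d i s) \<odot>\<^bsub>M\<^esub> b s)"
    proof (rule M.finsum_cong_simple)
      fix s assume s: "s \<in> S"
      have "finite I \<Longrightarrow> I \<subseteq> {..<k} \<Longrightarrow> (\<Oplus>\<^bsub>M\<^esub>i\<in>I. (ys ! i \<otimes> d i s) \<odot>\<^bsub>M\<^esub> b s) = (\<Oplus>i\<in>I. ys ! i \<otimes> d i s) \<odot>\<^bsub>M\<^esub> b s" for I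
      proof (induct I rule: finite_induct)
        case empty then show ?case using bM s by (simp add: smult_l_null)
      next
        case (insert j I)
        have "(\<lambda>i. ys ! i \<otimes> d i s) \<in> I \<rightarrow> carrier R" "ys ! j \<otimes> d j s \<in> carrier R" using insert dR yk s by auto
        then show ?case using insert bM s by (simp add: Pi_iff smult_l_distr)
      qed
      then show "(\<Oplus>\<^bsub>M\<^esub>i\<in>{..<k}. (ys ! i \<otimes> d i s) \<odot>\<^bsub>M\<^esub> b s) = (\<Oplus>i\<in>{..<k}. ys ! i \<otimes> d i s) \<odot>\<^bsub>M\<^esub> b s" by blast
      show "(\<Oplus>i\<in>{..<k}. ys ! i \<otimes> d i s) \<odot>\<^bsub>M\<^esub> b s \<in> carrier M" using s dR yk bM by (auto intro!: R.finsum_closed)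
    qed
    finally show ?thesis .
  qed
  have "(\<Oplus>\<^bsub>M\<^esub>s\<in>S. (ys ! k \<otimes> c s) \<odot>\<^bsub>M\<^esub> b s) = ys ! k \<odot>\<^bsub>M\<^esub> x"
    unfolding c(2) using c(1) S bM yR[OF k]
    by (subst finsum_smult_ldistr) (auto simp: smult_assoc1 Pi_iff intro!: M.finsum_cong_simple)
  also have "\<dots> = (\<Oplus>\<^bsub>M\<^esub>i\<in>{..<k}. ys ! i \<odot>\<^bsub>M\<^esub> (\<Oplus>\<^bsub>M\<^esub>s\<in>S. d i s \<odot>\<^bsub>M\<^esub> b s))"
    unfolding m(2) using d(2) m(1) yR k by (intro M.finsum_cong_simple) (auto simp: d(2)[symmetric] Pi_iff)
  also have "\<dots> = (\<Oplus>\<^bsub>M\<^esub>s\<in>S. (\<Oplus>i\<in>{..<k}. ys ! i \<otimes> d i s) \<odot>\<^bsub>M\<^esub> b s)" using d(1) by (rule swap)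
  finally have eq: "(\<Oplus>\<^bsub>M\<^esub>s\<in>S. (ys ! k \<otimes> c s) \<odot>\<^bsub>M\<^esub> b s) = (\<Oplus>\<^bsub>M\<^esub>s\<in>S. (\<Oplus>i\<in>{..<k}. ys ! i \<otimes> d i s) \<odot>\<^bsub>M\<^esub> b s)" .
  have "\<forall>s\<in>S. \<exists>e\<in>{..<k} \<rightarrow> carrier R. c s = (\<Oplus>i\<in>{..<k}. ys ! i \<otimes> e i)"
  proof
    fix s assume s: "s \<in> S"
    have dR: "\<And>i s. i < k \<Longrightarrow> s \<in> S \<Longrightarrow> d i s \<in> carrier R" using d by auto
    have "ys ! k \<otimes> c s = (\<Oplus>i\<in>{..<k}. ys ! i \<otimes> d i s)"
      by (rule basis_unique[OF b S _ _ eq s]) (use c yR k dR in \<open>auto intro!: R.finsum_closed simp: Pi_iff\<close>)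
    then have "ys ! k \<otimes> c s \<in> multiples (self_module R) ys k"
      using dR s by (auto simp: multiples_def finsum_self_module intro!: exI[of _ "\<lambda>i. d i s"])
    moreover have "c s \<in> carrier R" using c s by auto
    ultimately have "c s \<in> multiples (self_module R) ys k" using reg k by (auto simp: regular_seq_def)
    then show "\<exists>e\<in>{..<k} \<rightarrow> carrier R. c s = (\<Oplus>i\<in>{..<k}. ys ! i \<otimes> e i)"
      by (auto simp: multiples_def finsum_self_module)
  qed
  then obtain e where e: "\<And>s. s \<in> S \<Longrightarrow> e s \<in> {..<k} \<rightarrow> carrier R" "\<And>s. s \<in> S \<Longrightarrow> c s = (\<Oplus>i\<in>{..<k}. ys ! i \<otimes> e s i)"
    by metis
  have "x = (\<Oplus>\<^bsub>M\<^esub>s\<in>S. (\<Oplus>i\<in>{..<k}. ys ! i \<otimes> e s i) \<odot>\<^bsub>M\<^esub> b s)"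
    unfolding c(2) using c(1) bM by (intro M.finsum_cong_simple) (auto simp: e(2)[symmetric] Pi_iff)
  also have "\<dots> = (\<Oplus>\<^bsub>M\<^esub>i\<in>{..<k}. ys ! i \<odot>\<^bsub>M\<^esub> (\<Oplus>\<^bsub>M\<^esub>s\<in>S. e s i \<odot>\<^bsub>M\<^esub> b s))"
    using e(1) by (intro swap[symmetric]) auto
  finally show "x \<in> multiples M ys k"
    using e(1) bM by (auto simp: multiples_def Pi_iff intro!: exI[of _ "\<lambda>i. \<Oplus>\<^bsub>M\<^esub>s\<in>S. e s i \<odot>\<^bsub>M\<^esub> b s"] M.finsum_closed)
qed

section \<open>The diagram chase\<close>

text \<open>The features of the cone that the chase uses: \<open>C\<close> is the cone with
  differential \<open>d\<close> and augmentation \<open>\<epsilon>\<close>, \<open>P\<close> is the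
  summand from \<open>F\<close>, with projection \<open>\<pi>\<close> and linear section
  \<open>\<sigma>\<close>. The section is not a chain map, but \<open>\<pi>d\<close> makes the
  kernel of the projection stable under \<open>d\<close>. The assumption \<open>minimal\<close> is
  the property into which minimality of \<open>G\<close> and the splitting of \<open>Q\<close> will
  be condensed.\<close>

locale cone_chase =
  fixes R (structure) and ys and C :: "nat \<Rightarrow> ('a, 'c) module" and P :: "nat \<Rightarrow> ('a, 'p) module"
    and d :: "nat \<Rightarrow> 'c \<Rightarrow> 'c" and \<epsilon> :: "'c \<Rightarrow> 'a" and \<pi> :: "nat \<Rightarrow> 'c \<Rightarrow> 'p" and \<sigma> :: "nat \<Rightarrow> 'p \<Rightarrow> 'c"
  assumes R: "cring R" and ys: "set ys \<subseteq> carrier R"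
    and C: "\<And>i. 1 \<le> i \<Longrightarrow> module R (C i)" and P: "\<And>i. 2 \<le> i \<Longrightarrow> module R (P i)"
    and regP: "\<And>i. 2 \<le> i \<Longrightarrow> regular_seq (P i) ys"
    and d: "\<And>i. 2 \<le> i \<Longrightarrow> d i \<in> mod_hom R (C i) (C (i - 1))"
    and \<epsilon>: "\<epsilon> \<in> mod_hom R (C 1) (self_module R)"
    and exact: "\<And>i x. \<lbrakk>2 \<le> i; x \<in> carrier (C i); d i x = \<zero>\<^bsub>C (i - 1)\<^esub>\<rbrakk> \<Longrightarrow> x \<in> d (i + 1) ` carrier (C (i + 1))"
    and exact1: "\<And>x. \<lbrakk>x \<in> carrier (C 1); \<epsilon> x = \<zero>\<rbrakk> \<Longrightarrow> x \<in> d 2 ` carrier (C 2)"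
    and dd: "\<And>i x. \<lbrakk>2 \<le> i; x \<in> carrier (C (i + 1))\<rbrakk> \<Longrightarrow> d i (d (i + 1) x) = \<zero>\<^bsub>C (i - 1)\<^esub>"
    and \<pi>: "\<And>i. 2 \<le> i \<Longrightarrow> \<pi> i \<in> mod_hom R (C i) (P i)" and \<sigma>: "\<And>i. 2 \<le> i \<Longrightarrow> \<sigma> i \<in> mod_hom R (P i) (C i)"
    and \<pi>\<sigma>: "\<And>i x. \<lbrakk>2 \<le> i; x \<in> carrier (P i)\<rbrakk> \<Longrightarrow> \<pi> i (\<sigma> i x) = x"
    and \<pi>d: "\<And>i x. \<lbrakk>2 \<le> i; x \<in> carrier (C (i + 1)); \<pi> (i + 1) x = \<zero>\<^bsub>P (i + 1)\<^esub>\<rbrakk> \<Longrightarrow> \<pi> i (d (i + 1) x) = \<zero>\<^bsub>P i\<^esub>"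
    and minimal: "\<And>i x. \<lbrakk>2 \<le> i; x \<in> carrier (C i); d i x \<in> multiples (C (i - 1)) ys (length ys)\<rbrakk> \<Longrightarrow> \<pi> i x \<in> multiples (P i) ys (length ys)"
begin

abbreviation "n \<equiv> length ys"
abbreviation "KC i l \<equiv> kchain (C i) n l"
abbreviation "DC i \<equiv> kdiff R (C i) ys"

lemma kmC: "1 \<le> i \<Longrightarrow> koszul_module R (C i) ys"
  by (intro koszul_module.intro C koszul_module_axioms.intro ys)

lemma kmP: "2 \<le> i \<Longrightarrow> koszul_module R (P i) ys"
  by (intro koszul_module.intro P koszul_module_axioms.intro ys)

text \<open>In the splitting \<open>w = y + D u + d v\<close> the summand \<open>y\<close> lies in the kernel of \<open>\<pi>\<close>, and so does a
  witness for \<open>D y\<close> being in the image of \<open>d\<close>.\<close>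

definition split where
  "split i l w \<longleftrightarrow> (\<exists>y\<in>KC i l. \<exists>u\<in>KC i (Suc l). \<exists>v\<in>KC (i + 1) l.
     (\<forall>U. w U = y U \<oplus>\<^bsub>C i\<^esub> (DC i u U \<oplus>\<^bsub>C i\<^esub> d (i + 1) (v U))) \<and> (\<forall>U. \<pi> i (y U) = \<zero>\<^bsub>P i\<^esub>) \<and>
     (\<forall>k. l = Suc k \<longrightarrow> (\<exists>g\<in>KC (i + 1) k. (\<forall>U. \<pi> (i + 1) (g U) = \<zero>\<^bsub>P (i + 1)\<^esub>) \<and> (\<forall>U. DC i y U = d (i + 1) (g U)))))"

text \<open>The Koszul boundary of \<open>w\<close> lifts along \<open>d\<close> to a chain
  \<open>w'\<close> of one Koszul degree less and one cone degree more. If \<open>w'\<close> splits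
  as g + D u + d v, then subtracting d u from \<open>w\<close> removes D u from the boundary, and d
  v disappears since d d = 0. What is left of the boundary is d g, with \<open>g\<close> in the
  kernel of the projection.\<close>

lemma step:
  assumes i: "1 \<le> i" and w: "w \<in> KC i (Suc l)"
    and im: "\<And>U. DC i w U \<in> d (i + 1) ` carrier (C (i + 1))"
    and IH: "\<And>w'. \<lbrakk>w' \<in> KC (i + 1) l; \<And>U. d (i + 1) (DC (i + 1) w' U) = \<zero>\<^bsub>C i\<^esub>; \<exists>b\<in>KC i (Suc l). \<forall>U. DC i b U = d (i + 1) (w' U)\<rbrakk> \<Longrightarrow> split (i + 1) l w'"
  shows "\<exists>y\<in>KC i (Suc l). \<exists>v\<in>KC (i + 1) (Suc l). \<exists>g\<in>KC (i + 1) l. (\<forall>U. w U = y U \<oplus>\<^bsub>C i\<^esub> d (i + 1) (v U)) \<and>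
    (\<forall>U. \<pi> (i + 1) (g U) = \<zero>\<^bsub>P (i + 1)\<^esub>) \<and> (\<forall>U. DC i y U = d (i + 1) (g U))"
proof -
  interpret C: koszul_module R "C i" ys using i by (rule kmC)
  interpret C': koszul_module R "C (i + 1)" ys by (rule kmC) simp
  have dh: "d (i + 1) \<in> mod_hom R (C (i + 1)) (C i)" using d[of "i + 1"] i by simp
  have dz: "d (i + 1) \<zero>\<^bsub>C (i + 1)\<^esub> = \<zero>\<^bsub>C i\<^esub>" by (rule mod_hom_zero[OF _ _ dh]) (use C i in auto)
  have "DC i w \<in> KC i l" using w by simp
  then obtain w' where w': "w' \<in> KC (i + 1) l" "(\<lambda>U. d (i + 1) (w' U)) = DC i w"
    using C'.lift_kchain[of "DC i w" "C i" l "d (i + 1)"] im dz by blast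
  have "d (i + 1) (DC (i + 1) w' U) = \<zero>\<^bsub>C i\<^esub>" for U
    using C'.hom_D[OF kmC[OF i] dh w'(1), of U] unfolding w'(2) using w by (simp add: C.D_D)
  then have "split (i + 1) l w'" using IH[OF w'(1)] w w'(2) by (metis (full_types))
  then obtain g u v where g: "g \<in> KC (i + 1) l" and u: "u \<in> KC (i + 1) (Suc l)" and v: "v \<in> KC (i + 1 + 1) l"
    and eq: "\<And>U. w' U = g U \<oplus>\<^bsub>C (i + 1)\<^esub> (DC (i + 1) u U \<oplus>\<^bsub>C (i + 1)\<^esub> d (i + 1 + 1) (v U))"
    and pg: "\<And>U. \<pi> (i + 1) (g U) = \<zero>\<^bsub>P (i + 1)\<^esub>"
    unfolding split_def by blast
  interpret C'': koszul_module R "C (i + 1 + 1)" ys by (rule kmC) simp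
  have d2: "d (i + 1 + 1) (v U) \<in> carrier (C (i + 1))" for U
    using mod_homD(1)[OF d[of "i + 1 + 1"], of "v U"] C''.kchain_closed[OF v, of U] i by simp
  have du: "(\<lambda>U. d (i + 1) (u U)) \<in> KC i (Suc l)" by (rule C'.hom_kchain[OF C[OF i] dh u])
  define y where "y U = w U \<oplus>\<^bsub>C i\<^esub> \<ominus>\<^bsub>C i\<^esub> d (i + 1) (u U)" for U
  have y: "y \<in> KC i (Suc l)" unfolding y_def by (intro C.kchain_add C.kchain_minus w du)
  have "DC i y U = d (i + 1) (g U)" for U
  proof -
    have "DC i y U = DC i w U \<oplus>\<^bsub>C i\<^esub> \<ominus>\<^bsub>C i\<^esub> DC i (\<lambda>U. d (i + 1) (u U)) U"
      unfolding y_def[abs_def] using w du C.kchain_minus[OF du] by (simp add: C.D_add C.D_minus)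
    also have "DC i (\<lambda>U. d (i + 1) (u U)) U = d (i + 1) (DC (i + 1) u U)"
      by (rule C'.hom_D[OF kmC[OF i] dh u])
    also have "DC i w U = d (i + 1) (g U) \<oplus>\<^bsub>C i\<^esub> (d (i + 1) (DC (i + 1) u U) \<oplus>\<^bsub>C i\<^esub> \<zero>\<^bsub>C i\<^esub>)"
    proof -
      have "DC i w U = d (i + 1) (w' U)" using w'(2) by (metis)
      also have "\<dots> = d (i + 1) (g U) \<oplus>\<^bsub>C i\<^esub> (d (i + 1) (DC (i + 1) u U) \<oplus>\<^bsub>C i\<^esub> d (i + 1) (d (i + 1 + 1) (v U)))"
        unfolding eq using C'.kchain_closed[OF g, of U] C'.D_closed[OF C'.kchain_cochain[OF u], of U] d2[of U]
        by (simp only: mod_homD(2)[OF dh] C'.M.a_closed)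
      also have "d (i + 1) (d (i + 1 + 1) (v U)) = \<zero>\<^bsub>C i\<^esub>" using dd[of "i + 1" "v U"] i C''.kchain_closed[OF v, of U] by simp
      finally show ?thesis .
    qed
    finally show ?thesis
      using mod_homD(1)[OF dh C'.kchain_closed[OF g, of U]] mod_homD(1)[OF dh C'.D_closed[OF C'.kchain_cochain[OF u], of U]]
      by (simp add: C.M.a_assoc C.M.r_neg)
  qed
  moreover have "w U = y U \<oplus>\<^bsub>C i\<^esub> d (i + 1) (u U)" for U
    using w mod_homD(1)[OF dh C'.kchain_closed[OF u, of U]] by (simp add: y_def C.M.a_assoc C.M.l_neg)
  ultimately show ?thesis using y u g pg by blast
qed

text \<open>Induction on the Koszul degree \<open>l\<close> for all \<open>i\<close> at once.
  \<open>step\<close> makes the boundary of \<open>y\<close> come from the kernel of the projection,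
  so the projection of \<open>y\<close> is a Koszul cycle over the free module \<open>P i\<close>;
  it is a boundary, and lifting it by the section corrects \<open>y\<close>. In degree zero, where
  the Koszul complex is not exact, \<open>minimal\<close> replaces exactness, and the last
  assumption provides its premise.\<close>

lemma split_ge2:
  assumes "2 \<le> i" "w \<in> KC i l" "\<And>U. d i (DC i w U) = \<zero>\<^bsub>C (i - 1)\<^esub>"
    "\<exists>b\<in>KC (i - 1) (Suc l). \<forall>U. DC (i - 1) b U = d i (w U)"
  shows "split i l w"
  using assms
proof (induct l arbitrary: i w)
  case 0
  interpret C: koszul_module R "C i" ys using 0 by (intro kmC) simp
  interpret P: koszul_module R "P i" ys using 0 by (intro kmP) simp
  interpret Cm: koszul_module R "C (i - 1)" ys using 0 by (intro kmC) simp
  interpret Cp: koszul_module R "C (i + 1)" ys by (intro kmC) simp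
  have mC: "module R (C i)" and mP: "module R (P i)" using 0 C P by auto
  note \<pi> = \<pi>[OF 0(1)] and \<sigma> = \<sigma>[OF 0(1)]
  obtain b where b: "b \<in> KC (i - 1) 1" "\<And>U. DC (i - 1) b U = d i (w U)" using 0(4) by auto
  \<comment> \<open>A boundary in degree zero is a combination of the elements of \<open>ys\<close>,
    so \<open>d i (w {})\<close> satisfies the premise of \<open>minimal\<close>.\<close>
  have "d i (w {}) \<in> multiples (C (i - 1)) ys n" using Cm.boundary_multiples[OF b(1)] b(2) by simp
  then have "\<pi> i (w {}) \<in> multiples (P i) ys n" using 0 by (intro minimal) auto
  then obtain x where x: "x \<in> kchain (P i) n 1" "kdiff R (P i) ys x = (\<lambda>U. if U = {} then \<pi> i (w {}) else \<zero>\<^bsub>P i\<^esub>)"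
    using P.multiples_boundary by blast
  define u where "u U = \<sigma> i (x U)" for U
  have u: "u \<in> KC i 1" unfolding u_def by (rule P.hom_kchain[OF mC \<sigma> x(1)])
  have Du: "DC i u U = \<sigma> i (kdiff R (P i) ys x U)" for U unfolding u_def by (rule P.hom_D[OF kmC \<sigma> x(1)]) (use 0 in simp)
  have w0: "w U = \<zero>\<^bsub>C i\<^esub>" if "U \<noteq> {}" for U
    using C.kchain_zero[OF 0(2), of U] that finite_subset[of U "{..<n}"] by (cases "U \<subseteq> {..<n}") auto
  define y where "y U = w U \<oplus>\<^bsub>C i\<^esub> \<ominus>\<^bsub>C i\<^esub> DC i u U" for U
  have Duk: "DC i u \<in> KC i 0" using u by simp
  have y: "y \<in> KC i 0" unfolding y_def by (intro C.kchain_add C.kchain_minus 0(2) Duk)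
  have "\<pi> i (y U) = \<zero>\<^bsub>P i\<^esub>" for U
  proof -
    have "\<pi> i (y U) = \<pi> i (w U) \<oplus>\<^bsub>P i\<^esub> \<ominus>\<^bsub>P i\<^esub> kdiff R (P i) ys x U"
      unfolding y_def using 0(1,2) Duk x(1)
      by (simp add: mod_homD(2)[OF \<pi>] mod_hom_minus[OF mC mP \<pi>]) (simp add: Du \<pi>\<sigma>)
    also have "\<dots> = \<zero>\<^bsub>P i\<^esub>"
      using x(2) w0[of U] mod_hom_zero[OF mC mP \<pi>] mod_homD(1)[OF \<pi>] 0(2) by (cases "U = {}") (auto simp: P.M.r_neg)
    finally show ?thesis .
  qed
  moreover have "w U = y U \<oplus>\<^bsub>C i\<^esub> (DC i u U \<oplus>\<^bsub>C i\<^esub> d (i + 1) \<zero>\<^bsub>C (i + 1)\<^esub>)" for U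
  proof -
    have "d (i + 1) \<zero>\<^bsub>C (i + 1)\<^esub> = \<zero>\<^bsub>C i\<^esub>"
      by (rule mod_hom_zero[of R]) (use C d[of "i + 1"] 0(1) in auto)
    then show ?thesis using 0(2) Duk by (simp add: y_def C.M.a_assoc C.M.l_neg)
  qed
  ultimately show ?case unfolding split_def using y u Cp.kchain_zeros[of 0]
    by (intro bexI[of _ y] bexI[of _ u] bexI[of _ "\<lambda>U. \<zero>\<^bsub>C (i + 1)\<^esub>"]) auto
next
  case (Suc l)
  interpret C: koszul_module R "C i" ys using Suc by (intro kmC) simp
  interpret P: koszul_module R "P i" ys using Suc by (intro kmP) simp
  have mC: "module R (C i)" and mP: "module R (P i)" using Suc(2) C P by auto
  note \<pi> = \<pi>[OF Suc(2)] and \<sigma> = \<sigma>[OF Suc(2)]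
  have i1: "1 \<le> i" using Suc(2) by simp
  have im: "DC i w U \<in> d (i + 1) ` carrier (C (i + 1))" for U
    by (rule exact[OF Suc(2)]) (use Suc in auto)
  have "\<exists>y\<in>KC i (Suc l). \<exists>v\<in>KC (i + 1) (Suc l). \<exists>g\<in>KC (i + 1) l. (\<forall>U. w U = y U \<oplus>\<^bsub>C i\<^esub> d (i + 1) (v U)) \<and>
    (\<forall>U. \<pi> (i + 1) (g U) = \<zero>\<^bsub>P (i + 1)\<^esub>) \<and> (\<forall>U. DC i y U = d (i + 1) (g U))"
    by (rule step[OF i1 Suc(3) im]) (rule Suc(1), use i1 in auto)
  then obtain y v g where y: "y \<in> KC i (Suc l)" and v: "v \<in> KC (i + 1) (Suc l)" and g: "g \<in> KC (i + 1) l"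
    and w_eq: "\<And>U. w U = y U \<oplus>\<^bsub>C i\<^esub> d (i + 1) (v U)" and \<pi>g: "\<And>U. \<pi> (i + 1) (g U) = \<zero>\<^bsub>P (i + 1)\<^esub>"
    and Dy: "\<And>U. DC i y U = d (i + 1) (g U)" by blast
  interpret Cp: koszul_module R "C (i + 1)" ys by (intro kmC) simp
  have \<pi>y: "(\<lambda>U. \<pi> i (y U)) \<in> kchain (P i) n (Suc l)" by (rule C.hom_kchain[OF mP \<pi> y])
  \<comment> \<open>The boundary of \<open>y\<close> is \<open>d\<close> of something in the kernel
    of the projection, and \<open>\<pi>d\<close> keeps it in that kernel.\<close>
  have "kdiff R (P i) ys (\<lambda>U. \<pi> i (y U)) U = \<zero>\<^bsub>P i\<^esub>" for U
    using C.hom_D[OF kmP[OF Suc(2)] \<pi> y, of U] \<pi>d[OF Suc(2) Cp.kchain_closed[OF g] \<pi>g, of U] unfolding Dy[of U] by (simp only:)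
  then obtain x where x: "x \<in> kchain (P i) n (Suc (Suc l))" "kdiff R (P i) ys x = (\<lambda>U. \<pi> i (y U))"
    using P.koszul_exact[OF regP[OF Suc(2)] \<pi>y] by blast
  define u where "u U = \<sigma> i (x U)" for U
  have u: "u \<in> KC i (Suc (Suc l))" unfolding u_def by (rule P.hom_kchain[OF mC \<sigma> x(1)])
  have Du: "DC i u U = \<sigma> i (\<pi> i (y U))" for U
    unfolding u_def using P.hom_D[OF kmC[OF i1] \<sigma> x(1), of U] x(2) by simp
  define y' where "y' U = y U \<oplus>\<^bsub>C i\<^esub> \<ominus>\<^bsub>C i\<^esub> DC i u U" for U
  have Duk: "DC i u \<in> KC i (Suc l)" using u by simp
  have y': "y' \<in> KC i (Suc l)" unfolding y'_def by (intro C.kchain_add C.kchain_minus y Duk)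
  have "\<pi> i (y' U) = \<zero>\<^bsub>P i\<^esub>" for U
  proof -
    have "\<pi> i (y U) \<in> carrier (P i)" using mod_homD(1)[OF \<pi>] y by simp
    then show ?thesis
      unfolding y'_def using y Duk Suc(2)
      by (simp add: mod_homD(2)[OF \<pi>] mod_hom_minus[OF mC mP \<pi>]) (simp add: Du \<pi>\<sigma> P.M.r_neg)
  qed
  moreover have "DC i y' U = d (i + 1) (g U)" for U
  proof -
    have "DC i y' U = DC i y U \<oplus>\<^bsub>C i\<^esub> \<ominus>\<^bsub>C i\<^esub> DC i (DC i u) U"
      unfolding y'_def[abs_def] using y Duk C.kchain_minus[OF Duk] by (simp add: C.D_add C.D_minus)
    then show ?thesis using u y Dy[of U] C.D_closed[of y U] by (simp add: C.D_D C.M.a_inv_zero)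
  qed
  moreover have "w U = y' U \<oplus>\<^bsub>C i\<^esub> (DC i u U \<oplus>\<^bsub>C i\<^esub> d (i + 1) (v U))" for U
  proof -
    have "d (i + 1) (v U) \<in> carrier (C i)" using mod_homD(1)[OF d[of "i + 1"], of "v U"] Cp.kchain_closed[OF v, of U] i1 by simp
    moreover have "y U \<in> carrier (C i)" "DC i u U \<in> carrier (C i)" using y Duk by simp_all
    ultimately show ?thesis unfolding w_eq y'_def
      by (simp add: C.M.a_assoc) (simp add: C.M.a_assoc[symmetric] C.M.l_neg)
  qed
  ultimately show ?case unfolding split_def using y' u v g \<pi>g
    by (intro bexI[of _ y'] bexI[of _ u] bexI[of _ v]) auto
qed

text \<open>In degree 1 the cone has no summand from \<open>F\<close>, so there is no component left
  to remove: one application of \<open>step\<close>, fed by \<open>split_ge2\<close>, is enough, and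
  Koszul degree zero is immediate.\<close>

lemma split_1:
  assumes w: "w \<in> KC 1 l" and e: "\<And>U. \<epsilon> (DC 1 w U) = \<zero>"
  shows "\<exists>y\<in>KC 1 l. \<exists>v\<in>KC 2 l. (\<forall>U. w U = y U \<oplus>\<^bsub>C 1\<^esub> d 2 (v U)) \<and>
    (\<forall>k. l = Suc k \<longrightarrow> (\<exists>g\<in>KC 2 k. (\<forall>U. \<pi> 2 (g U) = \<zero>\<^bsub>P 2\<^esub>) \<and> (\<forall>U. DC 1 y U = d 2 (g U))))"
proof (cases l)
  case 0
  interpret C: koszul_module R "C 1" ys by (intro kmC) simp
  interpret C2: koszul_module R "C 2" ys by (intro kmC) simp
  have "d 2 \<zero>\<^bsub>C 2\<^esub> = \<zero>\<^bsub>C 1\<^esub>"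
    by (rule mod_hom_zero[of R]) (use C d[of 2] in auto)
  then have "(\<forall>U. w U = w U \<oplus>\<^bsub>C 1\<^esub> d 2 \<zero>\<^bsub>C 2\<^esub>)" using C.M.r_zero[OF C.kchain_closed[OF w]] by (simp only: simp_thms)
  then show ?thesis using w by (intro bexI[OF _ w] bexI[OF _ C2.kchain_zeros[of l]] conjI) (simp_all add: 0)
next
  case (Suc k)
  interpret C: koszul_module R "C 1" ys by (intro kmC) simp
  have w': "w \<in> KC 1 (Suc k)" using w Suc by simp
  have im: "DC 1 w U \<in> d (1 + 1) ` carrier (C (1 + 1))" for U
    unfolding one_add_one using C.D_closed[OF C.kchain_cochain[OF w']] e by (rule exact1)
  have "\<exists>y\<in>KC 1 (Suc k). \<exists>v\<in>KC (1 + 1) (Suc k). \<exists>g\<in>KC (1 + 1) k. (\<forall>U. w U = y U \<oplus>\<^bsub>C 1\<^esub> d (1 + 1) (v U)) \<and>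
    (\<forall>U. \<pi> (1 + 1) (g U) = \<zero>\<^bsub>P (1 + 1)\<^esub>) \<and> (\<forall>U. DC 1 y U = d (1 + 1) (g U))"
    by (rule step[OF _ w' im]) (simp, rule split_ge2, auto)
  then show ?thesis unfolding Suc one_add_one by blast
qed

end

section \<open>Submodules of multiples, and finite powers of a module\<close>

lemma multiples_hom:
  fixes R (structure)
  assumes M: "module R M" and N: "module R N" and h: "h \<in> mod_hom R M N" and ys: "set ys \<subseteq> carrier R"
    and x: "x \<in> multiples M ys (length ys)"
  shows "h x \<in> multiples N ys (length ys)"
proof -
  obtain m where m: "m \<in> {..<length ys} \<rightarrow> carrier M" "x = (\<Oplus>\<^bsub>M\<^esub>i\<in>{..<length ys}. ys ! i \<odot>\<^bsub>M\<^esub> m i)"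
    using x by (auto simp: multiples_def)
  interpret M: module R M by fact
  interpret N: module R N by fact
  have yR: "\<And>i. i < length ys \<Longrightarrow> ys ! i \<in> carrier R" using ys by auto
  have "h x = (\<Oplus>\<^bsub>N\<^esub>i\<in>{..<length ys}. h (ys ! i \<odot>\<^bsub>M\<^esub> m i))"
    unfolding m(2) using m(1) yR by (intro mod_hom_finsum[OF M N h]) auto
  also have "\<dots> = (\<Oplus>\<^bsub>N\<^esub>i\<in>{..<length ys}. ys ! i \<odot>\<^bsub>N\<^esub> h (m i))"
    using m(1) yR mod_homD(1,3)[OF h] by (intro N.M.finsum_cong_simple) (auto simp: Pi_iff)
  finally show ?thesis using m(1) mod_homD(1)[OF h] by (auto simp: multiples_def intro!: exI[of _ "\<lambda>i. h (m i)"])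
qed

context module
begin

lemma multiples_add:
  assumes ys: "set ys \<subseteq> carrier R" and "x \<in> multiples M ys k" "y \<in> multiples M ys k" and k: "k \<le> length ys"
  shows "x \<oplus>\<^bsub>M\<^esub> y \<in> multiples M ys k"
proof -
  obtain m m' where m: "m \<in> {..<k} \<rightarrow> carrier M" "x = (\<Oplus>\<^bsub>M\<^esub>i\<in>{..<k}. ys ! i \<odot>\<^bsub>M\<^esub> m i)"
    and m': "m' \<in> {..<k} \<rightarrow> carrier M" "y = (\<Oplus>\<^bsub>M\<^esub>i\<in>{..<k}. ys ! i \<odot>\<^bsub>M\<^esub> m' i)"
    using assms unfolding multiples_def by blast
  have yR: "\<And>i. i < k \<Longrightarrow> ys ! i \<in> carrier R" using ys k by auto
  have "(\<Oplus>\<^bsub>M\<^esub>i\<in>{..<k}. ys ! i \<odot>\<^bsub>M\<^esub> (m i \<oplus>\<^bsub>M\<^esub> m' i)) = (\<Oplus>\<^bsub>M\<^esub>i\<in>{..<k}. ys ! i \<odot>\<^bsub>M\<^esub> m i \<oplus>\<^bsub>M\<^esub> ys ! i \<odot>\<^bsub>M\<^esub> m' i)"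
    using m m' yR by (intro M.finsum_cong_simple) (auto simp: smult_r_distr Pi_iff)
  also have "\<dots> = x \<oplus>\<^bsub>M\<^esub> y"
    unfolding m(2) m'(2) using m m' yR by (intro M.finsum_addf) auto
  finally show ?thesis using m m' by (auto simp: multiples_def Pi_iff intro!: exI[of _ "\<lambda>i. m i \<oplus>\<^bsub>M\<^esub> m' i"])
qed

lemma multiples_smult:
  assumes ys: "set ys \<subseteq> carrier R" and "x \<in> multiples M ys k" and k: "k \<le> length ys" and a: "a \<in> carrier R"
  shows "a \<odot>\<^bsub>M\<^esub> x \<in> multiples M ys k"
proof -
  obtain m where m: "m \<in> {..<k} \<rightarrow> carrier M" "x = (\<Oplus>\<^bsub>M\<^esub>i\<in>{..<k}. ys ! i \<odot>\<^bsub>M\<^esub> m i)"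
    using assms unfolding multiples_def by blast
  have yR: "\<And>i. i < k \<Longrightarrow> ys ! i \<in> carrier R" using ys k by auto
  have "a \<odot>\<^bsub>M\<^esub> x = (\<Oplus>\<^bsub>M\<^esub>i\<in>{..<k}. a \<odot>\<^bsub>M\<^esub> (ys ! i \<odot>\<^bsub>M\<^esub> m i))"
    unfolding m(2) using m yR a by (intro finsum_smult_ldistr) auto
  also have "\<dots> = (\<Oplus>\<^bsub>M\<^esub>i\<in>{..<k}. ys ! i \<odot>\<^bsub>M\<^esub> (a \<odot>\<^bsub>M\<^esub> m i))"
    using m yR a by (intro M.finsum_cong_simple) (auto simp: smult_assoc1[symmetric] m_comm Pi_iff)
  finally show ?thesis using m a by (auto simp: multiples_def Pi_iff intro!: exI[of _ "\<lambda>i. a \<odot>\<^bsub>M\<^esub> m i"])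
qed

lemma multiples_closed:
  assumes "set ys \<subseteq> carrier R" and "x \<in> multiples M ys k" and "k \<le> length ys" shows "x \<in> carrier M"
proof -
  have yR: "\<And>i. i < k \<Longrightarrow> ys ! i \<in> carrier R" using assms by auto
  then show ?thesis using assms by (auto simp: multiples_def Pi_iff intro!: M.finsum_closed)
qed

lemma multiples_zero:
  assumes "set ys \<subseteq> carrier R" "k \<le> length ys" shows "\<zero>\<^bsub>M\<^esub> \<in> multiples M ys k"
proof -
  have yR: "\<And>i. i < k \<Longrightarrow> ys ! i \<in> carrier R" using assms by auto
  then have "(\<Oplus>\<^bsub>M\<^esub>i\<in>{..<k}. ys ! i \<odot>\<^bsub>M\<^esub> \<zero>\<^bsub>M\<^esub>) = \<zero>\<^bsub>M\<^esub>" by (intro M.finsum_all_zero) (simp add: smult_r_null)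
  from this[symmetric] show ?thesis unfolding multiples_def by (intro CollectI exI[of _ "\<lambda>_. \<zero>\<^bsub>M\<^esub>"]) simp
qed

lemma multiples_minus:
  assumes ys: "set ys \<subseteq> carrier R" and x: "x \<in> multiples M ys k" and k: "k \<le> length ys"
  shows "\<ominus>\<^bsub>M\<^esub> x \<in> multiples M ys k"
  using multiples_smult[OF ys x k, of "\<ominus> \<one>"] multiples_closed[OF ys x k] by (simp add: smult_l_minus)

text \<open>Turns minimality of a resolution, expressed by \<open>ideal_smult\<close>, into
  membership in \<open>multiples\<close>, the form in which Koszul boundaries appear.\<close>

lemma ideal_smult_multiples:
  assumes ys: "set ys \<subseteq> carrier R" and m: "\<mm> \<subseteq> multiples (self_module R) ys (length ys)"
  shows "ideal_smult R \<mm> M \<subseteq> multiples M ys (length ys)"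
proof
  fix x assume "x \<in> ideal_smult R \<mm> M"
  then have "x \<in> generate (add_monoid M) {a \<odot>\<^bsub>M\<^esub> x | a x. a \<in> \<mm> \<and> x \<in> carrier M}" by (simp add: ideal_smult_def)
  have yR: "\<And>i. i < length ys \<Longrightarrow> ys ! i \<in> carrier R" using ys by auto
  have gen: "a \<odot>\<^bsub>M\<^esub> x \<in> multiples M ys (length ys)" if a: "a \<in> \<mm>" and x: "x \<in> carrier M" for a x
  proof -
    have h: "(\<lambda>r. r \<odot>\<^bsub>M\<^esub> x) \<in> mod_hom R (self_module R) M"
      using x by (auto simp: mod_hom_def smult_l_distr smult_assoc1)
    show ?thesis
      using multiples_hom[OF module_self[OF is_cring] module_axioms h ys] a m by auto
  qed
  from \<open>x \<in> generate _ _\<close> show "x \<in> multiples M ys (length ys)"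
  proof (induct rule: generate.induct)
    case one then show ?case using multiples_zero[OF ys] by simp
  next
    case (incl h) then show ?case using gen by auto
  next
    case (inv h)
    then have "h \<in> multiples M ys (length ys)" using gen by auto
    then show ?case using multiples_minus[OF ys] by (simp add: a_inv_def[symmetric])
  next
    case (eng h1 h2) then show ?case using multiples_add[OF ys] by simp
  qed
qed

end

lemma power_module_simps:
  "carrier (power_module t M) = {1..t} \<rightarrow>\<^sub>E carrier M" "\<zero>\<^bsub>power_module t M\<^esub> = (\<lambda>i\<in>{1..t}. \<zero>\<^bsub>M\<^esub>)"
  "g \<oplus>\<^bsub>power_module t M\<^esub> h = (\<lambda>i\<in>{1..t}. g i \<oplus>\<^bsub>M\<^esub> h i)" "a \<odot>\<^bsub>power_module t M\<^esub> g = (\<lambda>i\<in>{1..t}. a \<odot>\<^bsub>M\<^esub> g i)"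
  by (simp_all add: power_module_def)

lemma module_power:
  fixes R (structure) and M :: "('a, 'm) module"
  assumes M: "module R M" shows "module R (power_module t M)"
proof -
  interpret module R M by fact
  note ps = power_module_simps
  have cl: "g i \<in> carrier M" if "g \<in> {1..t} \<rightarrow>\<^sub>E carrier M" "i \<in> {1..t}" for g i using that by auto
  show ?thesis
  proof (rule moduleI)
    show "abelian_group (power_module t M)"
    proof (rule abelian_groupI)
      fix x assume x: "x \<in> carrier (power_module t M)"
      show "\<zero>\<^bsub>power_module t M\<^esub> \<oplus>\<^bsub>power_module t M\<^esub> x = x"
        using x unfolding ps by (intro PiE_ext[of _ "{1..t}" "\<lambda>_. carrier M"]) (auto simp: cl)
      have "(\<lambda>i\<in>{1..t}. \<ominus>\<^bsub>M\<^esub> x i) \<oplus>\<^bsub>power_module t M\<^esub> x = \<zero>\<^bsub>power_module t M\<^esub>"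
        using x unfolding ps by (auto intro!: restrict_ext M.l_neg)
      moreover have "(\<lambda>i\<in>{1..t}. \<ominus>\<^bsub>M\<^esub> x i) \<in> carrier (power_module t M)" using x unfolding ps by auto
      ultimately show "\<exists>y\<in>carrier (power_module t M). y \<oplus>\<^bsub>power_module t M\<^esub> x = \<zero>\<^bsub>power_module t M\<^esub>" by blast
    next
      fix x y z assume "x \<in> carrier (power_module t M)" "y \<in> carrier (power_module t M)" "z \<in> carrier (power_module t M)"
      then show "x \<oplus>\<^bsub>power_module t M\<^esub> y \<oplus>\<^bsub>power_module t M\<^esub> z = x \<oplus>\<^bsub>power_module t M\<^esub> (y \<oplus>\<^bsub>power_module t M\<^esub> z)"
        unfolding ps by (intro restrict_ext) (simp add: cl M.a_assoc)
    next
      fix x y assume "x \<in> carrier (power_module t M)" "y \<in> carrier (power_module t M)"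
      then show "x \<oplus>\<^bsub>power_module t M\<^esub> y = y \<oplus>\<^bsub>power_module t M\<^esub> x"
        unfolding ps by (intro restrict_ext) (simp add: cl M.a_comm)
    qed (auto simp: ps cl)
    show "cring R" by (rule is_cring)
    fix x assume x: "x \<in> carrier (power_module t M)"
    then have xi: "\<And>i. i \<in> {1..t} \<Longrightarrow> x i \<in> carrier M" by (auto simp: ps)
    show "\<one> \<odot>\<^bsub>power_module t M\<^esub> x = x"
      using x unfolding ps by (intro PiE_ext[of _ "{1..t}" "\<lambda>_. carrier M"]) (auto simp: cl)
    fix a assume a: "a \<in> carrier R"
    then show "a \<odot>\<^bsub>power_module t M\<^esub> x \<in> carrier (power_module t M)" using xi by (auto simp: ps)
    fix b assume b: "b \<in> carrier R"
    show "(a \<oplus> b) \<odot>\<^bsub>power_module t M\<^esub> x = a \<odot>\<^bsub>power_module t M\<^esub> x \<oplus>\<^bsub>power_module t M\<^esub> b \<odot>\<^bsub>power_module t M\<^esub> x"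
      unfolding ps using a b xi by (intro restrict_ext) (simp add: smult_l_distr)
    show "(a \<otimes> b) \<odot>\<^bsub>power_module t M\<^esub> x = a \<odot>\<^bsub>power_module t M\<^esub> (b \<odot>\<^bsub>power_module t M\<^esub> x)"
      unfolding ps using a b xi by (intro restrict_ext) (simp add: smult_assoc1)
  next
    fix a x y assume a: "a \<in> carrier R" and "x \<in> carrier (power_module t M)" "y \<in> carrier (power_module t M)"
    then have xi: "\<And>i. i \<in> {1..t} \<Longrightarrow> x i \<in> carrier M" "\<And>i. i \<in> {1..t} \<Longrightarrow> y i \<in> carrier M" by (auto simp: ps)
    then show "a \<odot>\<^bsub>power_module t M\<^esub> (x \<oplus>\<^bsub>power_module t M\<^esub> y) = a \<odot>\<^bsub>power_module t M\<^esub> x \<oplus>\<^bsub>power_module t M\<^esub> a \<odot>\<^bsub>power_module t M\<^esub> y"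
      unfolding ps using a by (intro restrict_ext) (simp add: smult_r_distr)
  qed
qed

lemma finsum_power:
  fixes R (structure) and M :: "('a, 'm) module"
  assumes M: "module R M" and S: "finite S" and f: "\<And>s. s \<in> S \<Longrightarrow> f s \<in> carrier (power_module t M)" and i: "i \<in> {1..t}"
  shows "finsum (power_module t M) f S i = (\<Oplus>\<^bsub>M\<^esub>s\<in>S. f s i)"
proof -
  have "(\<lambda>g. g i) \<in> mod_hom R (power_module t M) M"
    using i by (auto simp: mod_hom_def power_module_simps)
  from mod_hom_finsum[OF module_power[OF M] M this S f] show ?thesis .
qed

lemma multiples_power:
  fixes R (structure) and M :: "('a, 'm) module"
  assumes M: "module R M" and ys: "set ys \<subseteq> carrier R" and g: "g \<in> carrier (power_module t M)"
    and m: "\<And>i. i \<in> {1..t} \<Longrightarrow> g i \<in> multiples M ys k" and k: "k \<le> length ys"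
  shows "g \<in> multiples (power_module t M) ys k"
proof -
  interpret module R M by fact
  interpret T: module R "power_module t M" by (rule module_power) fact
  have "\<forall>i\<in>{1..t}. \<exists>m. m \<in> {..<k} \<rightarrow> carrier M \<and> g i = (\<Oplus>\<^bsub>M\<^esub>j\<in>{..<k}. ys ! j \<odot>\<^bsub>M\<^esub> m j)"
    using m unfolding multiples_def by blast
  then obtain m where m: "\<And>i. i \<in> {1..t} \<Longrightarrow> m i \<in> {..<k} \<rightarrow> carrier M" "\<And>i. i \<in> {1..t} \<Longrightarrow> g i = (\<Oplus>\<^bsub>M\<^esub>j\<in>{..<k}. ys ! j \<odot>\<^bsub>M\<^esub> m i j)"
    by metis
  define m' where "m' j = (\<lambda>i\<in>{1..t}. m i j)" for j
  have yR: "\<And>i. i < k \<Longrightarrow> ys ! i \<in> carrier R" using ys k by auto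
  have m': "m' \<in> {..<k} \<rightarrow> carrier (power_module t M)" using m(1) by (auto simp: m'_def power_module_simps Pi_iff)
  have "g = (\<Oplus>\<^bsub>power_module t M\<^esub>j\<in>{..<k}. ys ! j \<odot>\<^bsub>power_module t M\<^esub> m' j)" (is "_ = ?s")
  proof
    fix i
    have s: "?s \<in> carrier (power_module t M)" using m' yR by (intro T.M.finsum_closed) (auto simp: Pi_iff)
    show "g i = ?s i"
    proof (cases "i \<in> {1..t}")
      case True
      have "?s i = (\<Oplus>\<^bsub>M\<^esub>j\<in>{..<k}. (ys ! j \<odot>\<^bsub>power_module t M\<^esub> m' j) i)"
        using m' yR True by (intro finsum_power[OF M]) (auto simp: Pi_iff)
      also have "\<dots> = g i" unfolding m(2)[OF True]
        using True m(1)[OF True] yR by (intro M.finsum_cong_simple) (auto simp: power_module_simps m'_def)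
      finally show ?thesis by simp
    next
      case False
      then show ?thesis using s g PiE_arb[of g "{1..t}" "\<lambda>_. carrier M" i] PiE_arb[of ?s "{1..t}" "\<lambda>_. carrier M" i]
        unfolding power_module_simps by simp
    qed
  qed
  then show ?thesis using m' unfolding multiples_def by blast
qed

lemma free_resolutionD:
  assumes "free_resolution R K P"
  shows "\<And>k. 1 \<le> k \<Longrightarrow> module R (cx_mod P k)"
    and "\<And>k. 1 \<le> k \<Longrightarrow> \<exists>(n::nat) b. is_basis R (cx_mod P k) {1..n} b"
    and "cx_aug P \<in> mod_hom R (cx_mod P 1) (self_module R)"
    and "\<And>k. 2 \<le> k \<Longrightarrow> cx_diff P k \<in> mod_hom R (cx_mod P k) (cx_mod P (k - 1))"
    and "cx_aug P ` carrier (cx_mod P 1) = K"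
    and "\<And>x. \<lbrakk>x \<in> carrier (cx_mod P 1); cx_aug P x = \<zero>\<^bsub>R\<^esub>\<rbrakk> \<Longrightarrow> x \<in> cx_diff P 2 ` carrier (cx_mod P 2)"
    and "\<And>x. x \<in> carrier (cx_mod P 2) \<Longrightarrow> cx_aug P (cx_diff P 2 x) = \<zero>\<^bsub>R\<^esub>"
    and "\<And>k x. \<lbrakk>2 \<le> k; x \<in> carrier (cx_mod P k); cx_diff P k x = \<zero>\<^bsub>cx_mod P (k - 1)\<^esub>\<rbrakk> \<Longrightarrow> x \<in> cx_diff P (k + 1) ` carrier (cx_mod P (k + 1))"
    and "\<And>k x. \<lbrakk>2 \<le> k; x \<in> carrier (cx_mod P (k + 1))\<rbrakk> \<Longrightarrow> cx_diff P k (cx_diff P (k + 1) x) = \<zero>\<^bsub>cx_mod P (k - 1)\<^esub>"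
  using assms unfolding free_resolution_def by (blast | (simp only: set_eq_iff image_iff mem_Collect_eq; metis))+

lemma prod_module_simps: "carrier (prod_module M N) = carrier M \<times> carrier N" "\<zero>\<^bsub>prod_module M N\<^esub> = (\<zero>\<^bsub>M\<^esub>, \<zero>\<^bsub>N\<^esub>)"
  "x \<oplus>\<^bsub>prod_module M N\<^esub> y = (fst x \<oplus>\<^bsub>M\<^esub> fst y, snd x \<oplus>\<^bsub>N\<^esub> snd y)" "a \<odot>\<^bsub>prod_module M N\<^esub> x = (a \<odot>\<^bsub>M\<^esub> fst x, a \<odot>\<^bsub>N\<^esub> snd x)"
  for M :: "('b, 'm) module" and N :: "('b, 'n) module"
  by (auto simp: prod_module_def split_beta)

section \<open>The mapping cone of the trimming morphism\<close>

declare One_nat_def [simp del]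

text \<open>What the local and the graded case have in common: a regular sequence \<open>ys\<close>
  generating the distinguished ideal, with respect to which \<open>G\<close> is minimal.\<close>

locale trimming_setup =
  fixes R (structure) and I J :: "'a set" and F :: "('a, 'f) ring_complex" and G :: "('a, 'g) ring_complex"
    and t :: nat and e :: "nat \<Rightarrow> 'f" and Q :: "nat \<Rightarrow> 'f \<Rightarrow> nat \<Rightarrow> 'g" and ys \<mm>
  assumes R: "cring R" and J: "ideal J R"
    and ys: "set ys \<subseteq> carrier R" and reg: "regular_seq (self_module R) ys"
    and mm: "\<mm> = multiples (self_module R) ys (length ys)"
    and J_mm: "J \<subseteq> \<mm>"
    and e: "e \<in> {1..t} \<rightarrow> carrier (cx_mod F 1)"
    and trim: "trimming_morphism R I J t e F G Q"
    and split: "\<And>j. 1 \<le> j \<Longrightarrow> split_injection R (cx_mod F (j + 1)) (power_module t (cx_mod G j)) (Q j)"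
    and F: "free_resolution R I F" and G: "minimal_free_resolution R \<mm> J G"
begin

sublocale cring R by (rule R)

definition cone where "cone = mapping_cone (trimming_source R F) (trimming_target R t e F G) Q"

lemma cone: "free_resolution R (I \<cdot> J) cone"
  using trim by (simp add: trimming_morphism_def cone_def Let_def)

lemma G': "free_resolution R J G" using G by (simp add: minimal_free_resolution_def)

abbreviation "T k \<equiv> power_module t (cx_mod G k)"

text \<open>The shift in \<open>trimming_source\<close> and the shift of the mapping cone cancel, so
  degree \<open>k\<close> contains the k-th module of \<open>F\<close> itself. Degree 1 is
  exceptional: there that summand is zero.\<close>

lemma cone_mod: "2 \<le> k \<Longrightarrow> cx_mod cone k = prod_module (cx_mod F k) (T k)"
  "cx_mod cone 1 = prod_module (zero_module (cx_mod F 2)) (T 1)"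
  by (auto simp: cone_def mapping_cone_def trimming_source_def trimming_target_def numeral_2_eq_2)

lemma cone_diff: "cx_diff cone k = (\<lambda>(x, y). (if k = 2 then \<zero>\<^bsub>cx_mod F 2\<^esub> else \<ominus>\<^bsub>cx_mod F (k - 2 + 1)\<^esub> cx_diff F (k - 1 + 1) x,
   power_map t (cx_diff G k) y \<oplus>\<^bsub>T (k - 1)\<^esub> Q (k - 1) x))"
  by (simp add: cone_def mapping_cone_def trimming_source_def trimming_target_def numeral_2_eq_2 fun_eq_iff)

lemma cone_aug: "cx_aug cone z = \<ominus> (\<Oplus>i\<in>{1..t}. cx_aug G (snd z i) \<otimes> cx_aug F (e i))"
  by (simp add: cone_def mapping_cone_def trimming_target_def split_beta)

lemma Gmod: "1 \<le> k \<Longrightarrow> module R (cx_mod G k)" by (rule free_resolutionD(1)[OF G'])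
lemma Fmod: "1 \<le> k \<Longrightarrow> module R (cx_mod F k)" by (rule free_resolutionD(1)[OF F])
lemma Tmod: "1 \<le> k \<Longrightarrow> module R (T k)" by (rule module_power[OF Gmod])

lemma snd_hom: "1 \<le> k \<Longrightarrow> snd \<in> mod_hom R (cx_mod cone k) (T k)"
  by (cases "k = 1") (auto simp: cone_mod mod_hom_def prod_module_simps)

lemma proj_hom: "\<lbrakk>1 \<le> k; a \<in> {1..t}\<rbrakk> \<Longrightarrow> (\<lambda>c. snd c a) \<in> mod_hom R (cx_mod cone k) (cx_mod G k)"
proof -
  assume k: "1 \<le> k" and a: "a \<in> {1..t}"
  interpret module R "cx_mod G k" by (rule Gmod) fact
  have "(\<lambda>g. g a) \<in> mod_hom R (T k) (cx_mod G k)"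
    using a by (auto simp: mod_hom_def power_module_simps)
  from mod_hom_comp[OF snd_hom[OF k] this] show ?thesis .
qed

text \<open>The second component of the differential is d_G (snd x) + Q (fst x). Its first term has
  coefficients in the maximal ideal because \<open>G\<close> is minimal, so the same holds for the
  second, and applying a retraction of \<open>Q\<close> carries this over to
  \<open>fst x\<close>.\<close>

lemma cone_minimal:
  assumes i: "2 \<le> i" and x: "x \<in> carrier (cx_mod cone i)" and dx: "cx_diff cone i x \<in> multiples (cx_mod cone (i - 1)) ys (length ys)"
  shows "fst x \<in> multiples (cx_mod F i) ys (length ys)"
proof -
  have i1: "1 \<le> i - 1" "1 \<le> i" using i by auto
  interpret T: module R "T (i - 1)" by (rule Tmod[OF i1(1)])
  interpret Gm: module R "cx_mod G (i - 1)" by (rule Gmod[OF i1(1)])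
  have xF: "fst x \<in> carrier (cx_mod F i)" and xT: "snd x \<in> carrier (T i)" using x i by (auto simp: cone_mod prod_module_simps)
  have gc: "snd x a \<in> carrier (cx_mod G i)" if "a \<in> {1..t}" for a
    using xT that by (auto simp: power_module_simps)
  have Q: "split_injection R (cx_mod F i) (T (i - 1)) (Q (i - 1))" using split[OF i1(1)] i by simp
  then obtain s where s: "s \<in> mod_hom R (T (i - 1)) (cx_mod F i)" "\<And>x. x \<in> carrier (cx_mod F i) \<Longrightarrow> s (Q (i - 1) x) = x"
    and Qh: "Q (i - 1) \<in> mod_hom R (cx_mod F i) (T (i - 1))" by (auto simp: split_injection_def)
  have "snd (cx_diff cone i x) \<in> multiples (T (i - 1)) ys (length ys)"
    by (rule multiples_hom[OF _ Tmod[OF i1(1)] snd_hom[OF i1(1)] ys dx]) (rule free_resolutionD(1)[OF cone i1(1)])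
  then have 1: "power_map t (cx_diff G i) (snd x) \<oplus>\<^bsub>T (i - 1)\<^esub> Q (i - 1) (fst x) \<in> multiples (T (i - 1)) ys (length ys)"
    by (simp add: cone_diff split_beta)
  have dG: "cx_diff G i \<in> mod_hom R (cx_mod G i) (cx_mod G (i - 1))" by (rule free_resolutionD(4)[OF G' i])
  have pm: "power_map t (cx_diff G i) (snd x) \<in> carrier (T (i - 1))"
    using gc mod_homD(1)[OF dG] by (auto simp: power_map_def power_module_simps)
  have 2: "power_map t (cx_diff G i) (snd x) \<in> multiples (T (i - 1)) ys (length ys)"
  proof (rule multiples_power[OF Gmod[OF i1(1)] ys pm])
    fix a assume a: "a \<in> {1..t}"
    have "cx_diff G i (snd x a) \<in> ideal_smult R \<mm> (cx_mod G (i - 1))"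
      using G i gc[OF a] unfolding minimal_free_resolution_def by blast
    then show "power_map t (cx_diff G i) (snd x) a \<in> multiples (cx_mod G (i - 1)) ys (length ys)"
      using Gm.ideal_smult_multiples[OF ys, of \<mm>] mm a by (auto simp: power_map_def)
  qed simp
  have Qx: "Q (i - 1) (fst x) \<in> carrier (T (i - 1))" using mod_homD(1)[OF Qh xF] .
  have "Q (i - 1) (fst x) = \<ominus>\<^bsub>T (i - 1)\<^esub> power_map t (cx_diff G i) (snd x) \<oplus>\<^bsub>T (i - 1)\<^esub> (power_map t (cx_diff G i) (snd x) \<oplus>\<^bsub>T (i - 1)\<^esub> Q (i - 1) (fst x))"
    using pm Qx by (simp add: T.M.a_assoc[symmetric] T.M.l_neg)
  then have "Q (i - 1) (fst x) \<in> multiples (T (i - 1)) ys (length ys)"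
    using T.multiples_add[OF ys T.multiples_minus[OF ys 2] 1] by simp
  then have "s (Q (i - 1) (fst x)) \<in> multiples (cx_mod F i) ys (length ys)"
    by (rule multiples_hom[OF Tmod[OF i1(1)] Fmod[OF i1(2)] s(1) ys])
  then show ?thesis using s(2)[OF xF] by simp
qed

text \<open>The section puts an element of \<open>F\<close> into the first component with second
  component zero. The first component of the cone differential is the differential of
  \<open>F\<close> up to sign, whence the stability of the kernel of \<open>fst\<close>.\<close>

lemma cone_chase:
  "cone_chase R ys (cx_mod cone) (cx_mod F) (cx_diff cone) (cx_aug cone) (\<lambda>_. fst) (\<lambda>i x. (x, \<zero>\<^bsub>T i\<^esub>))"
proof (rule cone_chase.intro)
  show "cring R" by (rule R)
  show "set ys \<subseteq> carrier R" by (rule ys)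
  show "module R (cx_mod cone i)" if "1 \<le> i" for i using free_resolutionD(1)[OF cone that] .
  show "module R (cx_mod F i)" if "2 \<le> i" for i using Fmod that by simp
  show "regular_seq (cx_mod F i) ys" if i: "2 \<le> i" for i
  proof -
    obtain m :: nat and b where b: "is_basis R (cx_mod F i) {1..m} b" using free_resolutionD(2)[OF F, of i] i by auto
    show ?thesis by (rule regular_seq_free[OF R ys reg Fmod b]) (use i in auto)
  qed
  show "cx_diff cone i \<in> mod_hom R (cx_mod cone i) (cx_mod cone (i - 1))" if "2 \<le> i" for i
    using free_resolutionD(4)[OF cone that] .
  show "cx_aug cone \<in> mod_hom R (cx_mod cone 1) (self_module R)" by (rule free_resolutionD(3)[OF cone])
  show "x \<in> cx_diff cone (i + 1) ` carrier (cx_mod cone (i + 1))"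
    if "2 \<le> i" "x \<in> carrier (cx_mod cone i)" "cx_diff cone i x = \<zero>\<^bsub>cx_mod cone (i - 1)\<^esub>" for i x
    using free_resolutionD(8)[OF cone that] .
  show "x \<in> cx_diff cone 2 ` carrier (cx_mod cone 2)" if "x \<in> carrier (cx_mod cone 1)" "cx_aug cone x = \<zero>" for x
    using free_resolutionD(6)[OF cone that] .
  show "cx_diff cone i (cx_diff cone (i + 1) x) = \<zero>\<^bsub>cx_mod cone (i - 1)\<^esub>"
    if "2 \<le> i" "x \<in> carrier (cx_mod cone (i + 1))" for i x
    using free_resolutionD(9)[OF cone that] .
  show "fst \<in> mod_hom R (cx_mod cone i) (cx_mod F i)" if "2 \<le> i" for i
    using that by (auto simp: cone_mod mod_hom_def prod_module_simps)
  show "(\<lambda>x. (x, \<zero>\<^bsub>T i\<^esub>)) \<in> mod_hom R (cx_mod F i) (cx_mod cone i)" if i: "2 \<le> i" for i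
  proof -
    interpret T: module R "T i" using i by (intro Tmod) simp
    show ?thesis using i by (auto simp: cone_mod mod_hom_def prod_module_simps T.smult_r_null)
  qed
  show "fst (x, \<zero>\<^bsub>T i\<^esub>) = x" if "2 \<le> i" "x \<in> carrier (cx_mod F i)" for i x by simp
  show "fst (cx_diff cone (i + 1) x) = \<zero>\<^bsub>cx_mod F i\<^esub>"
    if i: "2 \<le> i" and "x \<in> carrier (cx_mod cone (i + 1))" "fst x = \<zero>\<^bsub>cx_mod F (i + 1)\<^esub>" for i x
  proof -
    have dF: "cx_diff F (i + 1) \<in> mod_hom R (cx_mod F (i + 1)) (cx_mod F i)" using free_resolutionD(4)[OF F, of "i + 1"] i by simp
    interpret M: module R "cx_mod F i" using i by (intro Fmod) simp
    have "cx_diff F (i + 1) \<zero>\<^bsub>cx_mod F (i + 1)\<^esub> = \<zero>\<^bsub>cx_mod F i\<^esub>"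
      by (rule mod_hom_zero[OF Fmod Fmod dF]) (use i in auto)
    moreover have "i + 1 - 2 + 1 = i" "i + 1 - 1 + 1 = i + 1" using i by auto
    ultimately show ?thesis using i that(3) by (simp add: cone_diff split_beta M.M.a_inv_zero)
  qed
  show "fst x \<in> multiples (cx_mod F i) ys (length ys)"
    if "2 \<le> i" "x \<in> carrier (cx_mod cone i)" "cx_diff cone i x \<in> multiples (cx_mod cone (i - 1)) ys (length ys)" for i x
    using cone_minimal[OF that] .
qed

abbreviation "n \<equiv> length ys"
abbreviation "KR l \<equiv> kchain (self_module R) n l"
abbreviation "DR \<equiv> kdiff R (self_module R) ys"

lemma kmR: "koszul_module R (self_module R) ys"
  by (intro koszul_module.intro module_self R koszul_module_axioms.intro ys)

text \<open>The coefficients of \<open>DR w\<close> lie in the image of the augmentation of the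
  cone, so they lift to its degree 1. The chase improves the lift to \<open>y\<close>, whose
  boundary comes from the copies of \<open>G\<close> alone. Hence the image of each of the t
  coordinates of \<open>y\<close> under the augmentation of \<open>G\<close> is a Koszul chain with
  coefficients in \<open>J\<close> that bounds some \<open>z0 a\<close>. Since the augmentation of
  the cone is minus the sum of f_a times these images, adding the sum of the f_a z0_a to
  \<open>w\<close> gives a cycle, and cycles of positive degree are boundaries.\<close>

theorem koszul_cycle_decomposition:
  assumes w: "w \<in> KR (Suc l)" and dw: "\<And>U. DR w U \<in> I \<cdot> J"
  shows "\<exists>z v. (\<forall>a\<in>{1..t}. z a \<in> KR (Suc l) \<and> (\<forall>U. DR (z a) U \<in> J)) \<and> v \<in> KR (Suc (Suc l)) \<and>
    (\<forall>U. w U = (\<Oplus>a\<in>{1..t}. cx_aug F (e a) \<otimes> z a U) \<oplus> DR v U)"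
proof -
  interpret ch: cone_chase R ys "cx_mod cone" "cx_mod F" "cx_diff cone" "cx_aug cone" "\<lambda>_. fst" "\<lambda>i x. (x, \<zero>\<^bsub>T i\<^esub>)"
    by (rule cone_chase)
  interpret K: koszul_module R "self_module R" ys by (rule kmR)
  interpret C: koszul_module R "cx_mod cone 1" ys by (rule ch.kmC) simp
  have mS: "module R (self_module R)" by (rule module_self) (rule R)
  have mC: "module R (cx_mod cone 1)" by (rule C.module_axioms)
  note \<epsilon> = free_resolutionD(3)[OF cone]
  have Dw: "DR w \<in> KR l" using w by simp
  obtain w1 where w1: "w1 \<in> kchain (cx_mod cone 1) n l" "(\<lambda>U. cx_aug cone (w1 U)) = DR w"
    using C.lift_kchain[OF Dw, of "cx_aug cone"] dw free_resolutionD(5)[OF cone] mod_hom_zero[OF mC mS \<epsilon>] by auto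
  have eD: "cx_aug cone (C.D w1 U) = \<zero>" for U
    using C.hom_D[OF kmR \<epsilon> w1(1), of U] K.D_D[of w U] w unfolding w1(2) by simp
  obtain y v1 where y: "y \<in> kchain (cx_mod cone 1) n l" and v1: "v1 \<in> kchain (cx_mod cone 2) n l"
    and w1_eq: "\<And>U. w1 U = y U \<oplus>\<^bsub>cx_mod cone 1\<^esub> cx_diff cone 2 (v1 U)"
    and g: "\<And>k. l = Suc k \<Longrightarrow> \<exists>g\<in>kchain (cx_mod cone 2) n k. (\<forall>U. fst (g U) = \<zero>\<^bsub>cx_mod F 2\<^esub>) \<and> (\<forall>U. C.D y U = cx_diff cone 2 (g U))"
    using ch.split_1[OF w1(1) eD] by blast
  define f where "f a = cx_aug F (e a)" for a
  have fR: "f a \<in> carrier R" if "a \<in> {1..t}" for a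
    using mod_homD(1)[OF free_resolutionD(3)[OF F] funcset_mem[OF e that]] by (simp add: f_def)
  interpret C2: koszul_module R "cx_mod cone 2" ys by (rule ch.kmC) simp
  have cy: "DR w U = cx_aug cone (y U)" for U
  proof -
    have "DR w U = cx_aug cone (w1 U)" using w1(2) by metis
    also have "\<dots> = cx_aug cone (y U) \<oplus> cx_aug cone (cx_diff cone 2 (v1 U))"
    proof -
      have "cx_diff cone 2 \<in> mod_hom R (cx_mod cone 2) (cx_mod cone 1)"
        using free_resolutionD(4)[OF cone, of 2] by (simp add: One_nat_def)
      from mod_homD(1)[OF this C2.kchain_closed[OF v1]] show ?thesis
        unfolding w1_eq using C.kchain_closed[OF y] by (subst mod_homD(2)[OF \<epsilon>]) auto
    qed
    also have "cx_aug cone (cx_diff cone 2 (v1 U)) = \<zero>"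
      using free_resolutionD(7)[OF cone] C2.kchain_closed[OF v1] by blast
    finally show ?thesis using mod_homD(1)[OF \<epsilon> C.kchain_closed[OF y]] by simp
  qed
  \<comment> \<open>Each coordinate is treated separately: the chain \<open>x\<close> of its values
    under the augmentation of \<open>G\<close> is to be written as a boundary.\<close>
  have "\<forall>a\<in>{1..t}. \<exists>z\<in>KR (Suc l). \<forall>U. DR z U = cx_aug G (snd (y U) a)"
  proof
    fix a assume a: "a \<in> {1..t}"
    note pr = proj_hom[of 1, OF _ a, simplified]
    note aG = free_resolutionD(3)[OF G']
    define x where "x U = cx_aug G (snd (y U) a)" for U
    have pa: "(\<lambda>c. cx_aug G (snd c a)) \<in> mod_hom R (cx_mod cone 1) (self_module R)"
      using mod_hom_comp[OF proj_hom[of 1, OF _ a] aG] by simp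
    have x: "x \<in> KR l" unfolding x_def by (rule C.hom_kchain[OF mS pa y])
    show "\<exists>z\<in>KR (Suc l). \<forall>U. DR z U = cx_aug G (snd (y U) a)"
    proof (cases l)
      case 0
      \<comment> \<open>Koszul exactness does not reach degree zero; here it is the inclusion of
        \<open>J\<close> in the maximal ideal that makes \<open>x\<close> a boundary.\<close>
      have "x {} \<in> J" using free_resolutionD(5)[OF G'] mod_homD(1)[OF proj_hom[of 1, OF _ a] C.kchain_closed[OF y]] by (auto simp: x_def)
      then have "x {} \<in> multiples (self_module R) ys n" using J_mm mm by auto
      then obtain z where z: "z \<in> KR 1" "DR z = (\<lambda>U. if U = {} then x {} else \<zero>)"
        using K.multiples_boundary[of "x {}" n] by (auto cong: if_cong)
      have "x U = \<zero>" if "U \<noteq> {}" for U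
        using K.kchain_zero[OF x, of U] that 0 finite_subset[of U "{..<n}"] by (cases "U \<subseteq> {..<n}") auto
      then have "\<forall>U. DR z U = x U" using z(2) by auto
      then show ?thesis using z(1) 0 by (intro bexI[of _ z]) (simp_all add: x_def One_nat_def)
    next
      case (Suc k)
      obtain gg where gg: "gg \<in> kchain (cx_mod cone 2) n k" "\<And>U. fst (gg U) = \<zero>\<^bsub>cx_mod F 2\<^esub>" "\<And>U. C.D y U = cx_diff cone 2 (gg U)"
        using g[OF Suc] by blast
      have "DR x U = \<zero>" for U
      proof -
        have "DR x U = cx_aug G (snd (C.D y U) a)"
          unfolding x_def using C.hom_D[OF kmR pa y] .
        also have "C.D y U = cx_diff cone 2 (gg U)" by (rule gg)
        \<comment> \<open>\<open>gg\<close> has no component from \<open>F\<close>, so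
          \<open>Q\<close> contributes zero and only the differential of \<open>G\<close> is
          seen.\<close>
        also have "snd (cx_diff cone 2 (gg U)) a = cx_diff G 2 (snd (gg U) a)"
        proof -
          interpret G1: module R "cx_mod G 1" by (rule Gmod) simp
          have Qh: "Q 1 \<in> mod_hom R (cx_mod F 2) (T 1)" using split[of 1] by (simp add: split_injection_def numeral_2_eq_2)
          have "Q 1 \<zero>\<^bsub>cx_mod F 2\<^esub> = \<zero>\<^bsub>T 1\<^esub>" by (rule mod_hom_zero[OF Fmod Tmod Qh]) auto
          moreover have cc: "cx_diff G 2 (snd (gg U) a) \<in> carrier (cx_mod G 1)"
            using mod_homD(1)[OF free_resolutionD(4)[OF G', of 2]] mod_homD(1)[OF proj_hom[of 2, OF _ a] C2.kchain_closed[OF gg(1)]] by (simp add: One_nat_def)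
          ultimately show ?thesis using a gg(2)[of U] G1.M.r_zero[OF cc]
            by (simp add: cone_diff split_beta power_module_simps power_map_def One_nat_def)
        qed
        also have "cx_aug G \<dots> = \<zero>"
          using free_resolutionD(7)[OF G'] mod_homD(1)[OF proj_hom[of 2, OF _ a] C2.kchain_closed[OF gg(1)]] by simp
        finally show ?thesis .
      qed
      then obtain z where z: "z \<in> KR (Suc (Suc k))" "DR z = x" using K.koszul_exact[OF reg, of x k] x Suc by auto
      have "\<forall>U. DR z U = cx_aug G (snd (y U) a)" unfolding z(2) x_def by simp
      with z(1) show ?thesis unfolding Suc by blast
    qed
  qed
  then obtain z0 where z0: "\<And>a. a \<in> {1..t} \<Longrightarrow> z0 a \<in> KR (Suc l)" "\<And>a U. a \<in> {1..t} \<Longrightarrow> DR (z0 a) U = cx_aug G (snd (y U) a)"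
    by metis
  have z0c: "z0 a U \<in> carrier R" if "a \<in> {1..t}" for a U using K.kchain_closed[OF z0(1)[OF that], of U] by simp
  \<comment> \<open>Defined for arbitrary index sets, so that linearity of \<open>DR\<close> over
    the finite sum can be proved by induction.\<close>
  define s where "s A U = (\<Oplus>a\<in>A. f a \<otimes> z0 a U)" for A U
  have s: "s A \<in> KR (Suc l) \<and> (\<forall>U. DR (s A) U = (\<Oplus>a\<in>A. f a \<otimes> DR (z0 a) U))" if "finite A" "A \<subseteq> {1..t}" for A
    using that
  proof (induct A rule: finite_induct)
    case empty
    have "DR (\<lambda>U. \<zero>) U = \<zero>" for U
      using K.D_smult[of "\<lambda>U. \<zero>" \<zero> U] K.kchain_zeros[of 0] K.D_closed[of "\<lambda>U. \<zero>" U] by (simp add: K.cochain_def)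
    then show ?case using K.kchain_zeros by (simp add: s_def[abs_def])
  next
    case (insert b A)
    have b: "b \<in> {1..t}" and A: "A \<subseteq> {1..t}" using insert by auto
    have sc: "(\<lambda>U. f b \<otimes> z0 b U) \<in> KR (Suc l)" using K.kchain_smult[OF z0(1)[OF b] fR[OF b]] by simp
    have c1: "(\<lambda>a. f a \<otimes> z0 a U) \<in> A \<rightarrow> carrier R" for U using A fR z0c by auto
    have eq: "s (insert b A) = (\<lambda>U. f b \<otimes> z0 b U \<oplus> s A U)"
      using insert c1 fR[OF b] z0c[OF b] by (auto simp: s_def fun_eq_iff)
    have Dc: "DR (z0 a) U \<in> carrier R" if "a \<in> {1..t}" for a U using K.D_closed[OF K.kchain_cochain[OF z0(1)[OF that]], of U] by simp
    have "s (insert b A) \<in> KR (Suc l)" unfolding eq using K.kchain_add[OF sc, of "s A"] insert A by simp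
    moreover have "DR (s (insert b A)) U = (\<Oplus>a\<in>insert b A. f a \<otimes> DR (z0 a) U)" for U
    proof -
      have "DR (s (insert b A)) U = DR (\<lambda>U. f b \<otimes> z0 b U) U \<oplus> DR (s A) U"
      proof -
        have "s A \<in> KR (Suc l)" using insert A by blast
        from K.D_add[OF K.kchain_cochain[OF sc] K.kchain_cochain[OF this], of U] show ?thesis
          unfolding eq by simp
      qed
      also have "DR (\<lambda>U. f b \<otimes> z0 b U) U = f b \<otimes> DR (z0 b) U"
        using K.D_smult[OF K.kchain_cochain[OF z0(1)[OF b]] fR[OF b], of U] by simp
      also have "f b \<otimes> DR (z0 b) U \<oplus> DR (s A) U = (\<Oplus>a\<in>insert b A. f a \<otimes> DR (z0 a) U)"
        using insert A fR Dc b by (subst finsum_insert) (auto simp: subset_iff)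
      finally show ?thesis .
    qed
    ultimately show ?case by blast
  qed
  have s1: "s {1..t} \<in> KR (Suc l)" and s2: "\<And>U. DR (s {1..t}) U = (\<Oplus>a\<in>{1..t}. f a \<otimes> DR (z0 a) U)" using s[of "{1..t}"] by auto
  \<comment> \<open>The sum is added, not subtracted: the augmentation of the trimming target has a
    minus sign, so \<open>DR w\<close> is the negative of the boundary of \<open>s\<close>.\<close>
  define c where "c U = w U \<oplus> s {1..t} U" for U
  have c: "c \<in> KR (Suc l)" using K.kchain_add[OF w s1] by (simp add: c_def[abs_def])
  have gy: "cx_aug G (snd (y U) a) \<in> carrier R" if "a \<in> {1..t}" for a U
    using mod_homD(1)[OF free_resolutionD(3)[OF G'] mod_homD(1)[OF proj_hom[of 1, OF _ that] C.kchain_closed[OF y, of U]]] by simp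
  have "DR c U = \<zero>" for U
  proof -
    have "DR c U = DR w U \<oplus> DR (s {1..t}) U" using K.D_add[of w "s {1..t}" U] w s1 by (simp add: c_def[abs_def])
    also have "DR (s {1..t}) U = (\<Oplus>i\<in>{1..t}. cx_aug G (snd (y U) i) \<otimes> cx_aug F (e i))"
      unfolding s2 using gy fR by (intro finsum_cong_simple) (auto simp: z0(2) f_def m_comm)
    also have "DR w U = \<ominus> \<dots>" unfolding cy by (simp add: cone_aug)
    finally show ?thesis using gy fR by (auto simp: f_def intro!: l_neg finsum_closed)
  qed
  then obtain v where v: "v \<in> KR (Suc (Suc l))" "DR v = c" using K.koszul_exact[OF reg c] by auto
  \<comment> \<open>The sign lost in \<open>c\<close> is put back here; coefficients of the boundary
    stay in \<open>J\<close>.\<close>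
  define z where "z a U = \<ominus> z0 a U" for a U
  have z: "z a \<in> KR (Suc l) \<and> (\<forall>U. DR (z a) U \<in> J)" if a: "a \<in> {1..t}" for a
  proof -
    interpret J: ideal J R by (rule J)
    have "DR (z a) U = \<ominus> cx_aug G (snd (y U) a)" for U
      using K.D_minus[OF K.kchain_cochain[OF z0(1)[OF a]], of U] z0(2)[OF a] by (simp add: z_def[abs_def])
    moreover have "cx_aug G (snd (y U) a) \<in> J" for U
      using free_resolutionD(5)[OF G'] mod_homD(1)[OF proj_hom[of 1, OF _ a] C.kchain_closed[OF y]] by auto
    ultimately show ?thesis using K.kchain_minus[OF z0(1)[OF a]] by (simp add: z_def[abs_def])
  qed
  have "w U = (\<Oplus>a\<in>{1..t}. cx_aug F (e a) \<otimes> z a U) \<oplus> DR v U" for U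
  proof -
    have "(\<Oplus>a\<in>{1..t}. cx_aug F (e a) \<otimes> z a U) = (\<Oplus>a\<in>{1..t}. \<ominus> (f a \<otimes> z0 a U))"
      using fR z0c by (intro finsum_cong_simple) (auto simp: z_def f_def r_minus)
    also have "\<dots> = \<ominus> s {1..t} U" unfolding s_def using fR z0c by (intro finsum_minus) auto
    finally have 1: "(\<Oplus>a\<in>{1..t}. cx_aug F (e a) \<otimes> z a U) = \<ominus> s {1..t} U" .
    have cl: "w U \<in> carrier R" "s {1..t} U \<in> carrier R"
      using K.kchain_closed[OF w, of U] K.kchain_closed[OF s1, of U] by simp_all
    then have "\<ominus> s {1..t} U \<oplus> (w U \<oplus> s {1..t} U) = w U \<oplus> (\<ominus> s {1..t} U \<oplus> s {1..t} U)" by (intro a_lcomm) auto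
    then show ?thesis unfolding 1 v(2) c_def using cl by (simp add: l_neg)
  qed
  then show ?thesis using z v(1) by blast
qed

end

declare One_nat_def [simp]

section \<open>Passing to the quotient ring\<close>

context trimming_setup
begin

text \<open>Chains over \<open>R\<close> are reduced coefficientwise to elements of the Koszul
  algebra of the quotient. Homogeneous elements lift, and a lift of a cycle has boundary in
  \<open>I \<cdot> J\<close>, which is the premise of the decomposition. The assumption
  \<open>local\<close> is inversion modulo the distinguished ideal, so that it also holds in the
  graded case, where elements outside the ideal need not be units.\<close>

lemma massey_quotient:
  assumes I: "ideal I R" and I_mm: "I \<subseteq> \<mm>"
    and local: "\<And>r. r \<in> carrier R \<Longrightarrow> r \<in> \<mm> \<or> (\<exists>s\<in>carrier R. s \<otimes> r \<ominus> \<one> \<in> \<mm>)"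
  shows "trivial_massey_operation (koszul (R Quot (I \<cdot> J)) (map (\<lambda>r. (I \<cdot> J) +> r) ys))"
proof -
  define N where "N = I \<cdot> J"
  define A where "A = R Quot N"
  define \<phi> where "\<phi> = (\<lambda>r. N +> r)"
  define xs where "xs = map \<phi> ys"
  have N: "ideal N R" unfolding N_def by (rule ideal_prod_is_ideal[OF I J])
  interpret N: ideal N R by (rule N)
  interpret \<phi>: ring_hom_cring R A \<phi> unfolding A_def \<phi>_def by (rule N.rcos_ring_hom_cring) (rule R)
  have ker: "\<phi> r = \<zero>\<^bsub>A\<^esub> \<longleftrightarrow> r \<in> N" if "r \<in> carrier R" for r
    using that N.a_rcos_const[of r] N.rcos_const_imp_mem[of r] by (auto simp: A_def \<phi>_def FactRing_def)
  have surj: "\<exists>r\<in>carrier R. \<phi> r = a" if "a \<in> carrier A" for a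
    using that by (auto simp: A_def \<phi>_def FactRing_def A_RCOSETS_def')
  interpret A: koszul_algebra A xs
    by (intro koszul_algebra.intro koszul_algebra_axioms.intro \<phi>.S.is_cring) (use ys in \<open>auto simp: xs_def\<close>)
  interpret K: koszul_module R "self_module R" ys by (rule kmR)
  have n: "A.n = n" unfolding A.n_def by (simp add: xs_def)
  have yR: "i < n \<Longrightarrow> ys ! i \<in> carrier R" for i using ys by auto
  define p where "p a = (\<lambda>U\<in>Pow {..<n}. \<phi> (a U))" for a :: "nat set \<Rightarrow> 'a"
  have KRc: "a U \<in> carrier R" if "a \<in> KR l" for a l U using K.kchain_closed[OF that, of U] by simp
  have p_apply: "p a U = \<phi> (a U)" if "U \<subseteq> {..<n}" for a U using that by (simp add: p_def)
  have p_homog: "p a \<in> homog A.B l" if a: "a \<in> KR l" for a l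
  proof (rule A.homogI)
    show "p a \<in> carrier A.B" using KRc[OF a] by (auto simp: p_def A.koszul_simps n)
    show "p a S = \<zero>\<^bsub>A\<^esub>" if "S \<subseteq> {..<A.n}" "card S \<noteq> l" for S
      using K.kchain_zero[OF a, of S] that by (auto simp: p_def n)
  qed
  have p_c: "p a \<in> carrier A.B" if a: "a \<in> KR l" for a l using p_homog[OF a] by (rule A.homogD(1))
  have sgn: "\<phi> (signed R k \<one>) = signed A k \<one>\<^bsub>A\<^esub>" for k by (simp add: signed_def)
  have DRc: "DR a U \<in> carrier R" if a: "a \<in> KR l" for a l U using K.D_closed[OF K.kchain_cochain[OF a], of U] by simp
  have pD: "dgdiff A.B (p a) U = \<phi> (DR a U)" if a: "a \<in> KR l" and U: "U \<subseteq> {..<n}" for a l U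
  proof -
    have "dgdiff A.B (p a) U = A.kd (p a) U" using A.diff_apply[OF p_c[OF a]] U n by simp
    also have "\<dots> = (\<Oplus>\<^bsub>A\<^esub>i\<in>{..<n}. \<phi> (ys ! i \<otimes> (if i \<in> U then \<zero> else signed R (inversions {i} U) \<one> \<otimes> a (insert i U))))"
      unfolding A.kd_def n
    proof (rule \<phi>.S.finsum_cong_simple)
      fix i assume i: "i \<in> {..<n}"
      show "xs ! i \<otimes>\<^bsub>A\<^esub> A.kc i (p a) U = \<phi> (ys ! i \<otimes> (if i \<in> U then \<zero> else signed R (inversions {i} U) \<one> \<otimes> a (insert i U)))"
        using i U yR KRc[OF a] by (auto simp: A.kc_def p_def xs_def sgn)
      show "\<phi> (ys ! i \<otimes> (if i \<in> U then \<zero> else signed R (inversions {i} U) \<one> \<otimes> a (insert i U))) \<in> carrier A"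
        using i yR KRc[OF a] by auto
    qed
    also have "\<dots> = \<phi> (\<Oplus>i\<in>{..<n}. ys ! i \<otimes> (if i \<in> U then \<zero> else signed R (inversions {i} U) \<one> \<otimes> a (insert i U)))"
      using yR KRc[OF a] by (subst \<phi>.hom_finsum) (auto simp: o_def)
    also have "\<dots> = \<phi> (DR a U)" using U by (simp add: kdiff_def finsum_self_module cong: if_cong)
    finally show ?thesis .
  qed
  have p_lift: "\<exists>a\<in>KR l. p a = w" if w: "w \<in> homog A.B l" for w l
  proof -
    have "\<exists>r\<in>carrier R. \<phi> r = w U \<and> (card U \<noteq> l \<longrightarrow> r = \<zero>)" if U: "U \<subseteq> {..<n}" for U
    proof (cases "card U = l")
      case True then show ?thesis using surj[of "w U"] A.homogD(1)[OF w] U n by auto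
    next
      case False then show ?thesis using A.homogD(2)[OF w, of U] U n by (intro bexI[of _ \<zero>]) auto
    qed
    then obtain a where a: "\<And>U. U \<subseteq> {..<n} \<Longrightarrow> a U \<in> carrier R \<and> \<phi> (a U) = w U \<and> (card U \<noteq> l \<longrightarrow> a U = \<zero>)"
      by metis
    define a' where "a' U = (if U \<subseteq> {..<n} then a U else \<zero>)" for U
    have "a' \<in> KR l" using a by (intro K.kchainI) (auto simp: a'_def)
    moreover have "p a' = w"
      by (rule A.B_eqI[OF p_c[OF calculation] A.homogD(1)[OF w]]) (use a in \<open>simp add: n p_def a'_def\<close>)
    ultimately show ?thesis by blast
  qed
  \<comment> \<open>Elements of the ideal generated by \<open>ys\<close> are boundaries of chains of
    degree 1. Applied to \<open>\<ominus> f a\<close> this gives the elements \<open>Y\<close>, and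
    applied to other elements it shows that degree zero homology is a field.\<close>
  have bdry: "\<exists>b\<in>KR 1. dgdiff A.B (p b) = A.\<iota> (\<phi> r)" if r: "r \<in> \<mm>" "r \<in> carrier R" for r
  proof -
    obtain b where b: "b \<in> KR 1" "DR b = (\<lambda>U. if U = {} then r else \<zero>)"
      using K.multiples_boundary[of r n] r mm by (auto cong: if_cong)
    have "dgdiff A.B (p b) = A.\<iota> (\<phi> r)"
    proof (rule A.B_eqI)
      fix U assume "U \<subseteq> {..<A.n}"
      then show "dgdiff A.B (p b) U = A.\<iota> (\<phi> r) U" using pD[OF b(1), of U] b(2) r n by (simp add: A.iota_apply)
    qed (use p_c[OF b(1)] r in \<open>auto intro: A.diff_B_closed A.iota_closed\<close>)
    then show ?thesis using b(1) by blast
  qed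
  have mmR: "\<mm> \<subseteq> carrier R" using module.multiples_closed[OF module_self[OF R] ys] mm by auto
  define f where "f a = cx_aug F (e a)" for a
  have fI: "f a \<in> I" if "a \<in> {1..t}" for a
    using free_resolutionD(5)[OF F] funcset_mem[OF e that] by (auto simp: f_def)
  interpret I: ideal I R by (rule I)
  have fR: "f a \<in> carrier R" if "a \<in> {1..t}" for a using fI[OF that] by (rule I.Icarr)
  have "\<forall>a\<in>{1..t}. \<exists>b\<in>KR 1. dgdiff A.B (p b) = A.\<iota> (\<phi> (\<ominus> f a))"
  proof
    fix a assume a: "a \<in> {1..t}"
    have "\<ominus> f a \<in> I" using fI[OF a] by (rule I.a_inv_closed)
    then show "\<exists>b\<in>KR 1. dgdiff A.B (p b) = A.\<iota> (\<phi> (\<ominus> f a))" using bdry I_mm I.Icarr by blast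
  qed
  then obtain b where b: "\<And>a. a \<in> {1..t} \<Longrightarrow> b a \<in> KR 1" "\<And>a. a \<in> {1..t} \<Longrightarrow> dgdiff A.B (p (b a)) = A.\<iota> (\<phi> (\<ominus> f a))"
    by metis
  have "trivial_massey_operation A.B"
  proof (rule A.massey_criterion[where T = "{1..t}" and f = "\<lambda>a. \<phi> (f a)" and Y = "\<lambda>a. p (b a)"])
    fix r' assume "r' \<in> carrier A"
    then obtain r where r: "r \<in> carrier R" "r' = \<phi> r" using surj by blast
    from local[OF r(1)] show "A.\<iota> r' \<in> A.bd \<or> (\<exists>s\<in>carrier A. A.\<iota> (s \<otimes>\<^bsub>A\<^esub> r' \<ominus>\<^bsub>A\<^esub> \<one>\<^bsub>A\<^esub>) \<in> A.bd)"
    proof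
      assume "r \<in> \<mm>"
      then show ?thesis using bdry[of r] r p_c A.boundaryI by metis
    next
      assume "\<exists>s\<in>carrier R. s \<otimes> r \<ominus> \<one> \<in> \<mm>"
      then obtain s where s: "s \<in> carrier R" "s \<otimes> r \<ominus> \<one> \<in> \<mm>" by blast
      have "\<phi> (s \<otimes> r \<ominus> \<one>) = \<phi> s \<otimes>\<^bsub>A\<^esub> r' \<ominus>\<^bsub>A\<^esub> \<one>\<^bsub>A\<^esub>" using r s by (simp add: a_minus_def)
      moreover have "A.\<iota> (\<phi> (s \<otimes> r \<ominus> \<one>)) \<in> A.bd" using bdry[of "s \<otimes> r \<ominus> \<one>"] s mmR p_c A.boundaryI by (metis subsetD)
      ultimately show ?thesis using s by auto
    qed
  next
    fix a assume a: "a \<in> {1..t}"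
    show "\<phi> (f a) \<in> carrier A" using fR[OF a] by simp
    show "p (b a) \<in> homog A.B 1" using b(1)[OF a] by (rule p_homog)
    show "dgdiff A.B (p (b a)) = \<ominus>\<^bsub>A.B\<^esub> A.\<iota> (\<phi> (f a))" using b(2)[OF a] fR[OF a] by (simp add: A.iota_minus)
  next
    fix q w assume q: "1 \<le> q" and w: "w \<in> homog A.B q" "w \<in> A.Zy"
    obtain l where l: "q = Suc l" using q by (cases q) (auto simp: One_nat_def)
    obtain w0 where w0: "w0 \<in> KR (Suc l)" "p w0 = w" using p_lift[OF w(1)] l by blast
    \<comment> \<open>The lift of a cycle of the quotient is a cycle only up to the kernel of
      reduction.\<close>
    have "DR w0 U \<in> I \<cdot> J" for U
    proof (cases "U \<subseteq> {..<n}")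
      case True
      have "\<phi> (DR w0 U) = dgdiff A.B w U" using pD[OF w0(1) True] w0(2) by simp
      also have "\<dots> = \<zero>\<^bsub>A\<^esub>" using A.cycleD(2)[OF w(2)] True n by simp
      finally show ?thesis using ker[OF DRc[OF w0(1)]] by (simp add: N_def)
    next
      case False
      then have "DR w0 U = \<zero>" by (simp add: kdiff_def)
      then show ?thesis using N.zero_closed by (simp add: N_def)
    qed
    then obtain z v where z: "\<And>a. a \<in> {1..t} \<Longrightarrow> z a \<in> KR (Suc l)" "\<And>a U. a \<in> {1..t} \<Longrightarrow> DR (z a) U \<in> J"
      and v: "v \<in> KR (Suc (Suc l))" and eq: "\<And>U. w0 U = (\<Oplus>a\<in>{1..t}. cx_aug F (e a) \<otimes> z a U) \<oplus> DR v U"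
      using koszul_cycle_decomposition[OF w0(1)] by blast
    have "w = (\<Oplus>\<^bsub>A.B\<^esub>a\<in>{1..t}. A.sc (\<phi> (f a)) (p (z a))) \<oplus>\<^bsub>A.B\<^esub> dgdiff A.B (p v)"
    proof (rule A.B_eqI)
      have sc: "A.sc (\<phi> (f a)) (p (z a)) \<in> carrier A.B" if "a \<in> {1..t}" for a
        using fR[OF that] p_c[OF z(1)[OF that]] by (intro A.sc_closed) auto
      show "w \<in> carrier A.B" using w(1) by (rule A.homogD(1))
      show "(\<Oplus>\<^bsub>A.B\<^esub>a\<in>{1..t}. A.sc (\<phi> (f a)) (p (z a))) \<oplus>\<^bsub>A.B\<^esub> dgdiff A.B (p v) \<in> carrier A.B"
        using sc p_c[OF v] by (intro A.B.a_closed A.B.finsum_closed A.diff_B_closed) auto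
      fix U assume U: "U \<subseteq> {..<A.n}"
      then have Un: "U \<subseteq> {..<n}" using n by simp
      have c: "(\<lambda>a. f a \<otimes> z a U) \<in> {1..t} \<rightarrow> carrier R" using fR KRc[OF z(1)] by auto
      have "w U = \<phi> (w0 U)" using w0(2) Un p_apply by blast
      also have "\<dots> = \<phi> (\<Oplus>a\<in>{1..t}. f a \<otimes> z a U) \<oplus>\<^bsub>A\<^esub> \<phi> (DR v U)"
        unfolding eq f_def[symmetric] using c DRc[OF v] by (intro \<phi>.hom_add finsum_closed) auto
      also have "\<phi> (DR v U) = dgdiff A.B (p v) U" using pD[OF v Un] by simp
      also have "\<phi> (\<Oplus>a\<in>{1..t}. f a \<otimes> z a U) = (\<Oplus>\<^bsub>A\<^esub>a\<in>{1..t}. \<phi> (f a \<otimes> z a U))"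
        using c by (simp add: o_def)
      also have "\<dots> = (\<Oplus>\<^bsub>A\<^esub>a\<in>{1..t}. A.sc (\<phi> (f a)) (p (z a)) U)"
        using fR KRc[OF z(1)] U Un p_apply by (intro \<phi>.S.finsum_cong_simple) (auto simp: A.sc_apply)
      also have "\<dots> = (\<Oplus>\<^bsub>A.B\<^esub>a\<in>{1..t}. A.sc (\<phi> (f a)) (p (z a))) U"
        using sc U by (intro A.finsum_apply[symmetric]) auto
      finally show "w U = ((\<Oplus>\<^bsub>A.B\<^esub>a\<in>{1..t}. A.sc (\<phi> (f a)) (p (z a))) \<oplus>\<^bsub>A.B\<^esub> dgdiff A.B (p v)) U"
        using U by (simp add: A.add_apply)
    qed
    \<comment> \<open>The scalar \<open>f b\<close> lies in \<open>I\<close> and the boundary of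
      \<open>z a\<close> has coefficients in \<open>J\<close>, so the product dies in the
      quotient.\<close>
    moreover have "A.sc (\<phi> (f b)) (dgdiff A.B (p (z a))) = \<zero>\<^bsub>A.B\<^esub>" if ab: "a \<in> {1..t}" "b \<in> {1..t}" for a b
    proof (rule A.B_eqI)
      show "A.sc (\<phi> (f b)) (dgdiff A.B (p (z a))) \<in> carrier A.B"
        using fR[OF ab(2)] p_c[OF z(1)[OF ab(1)]] by (intro A.sc_closed A.diff_B_closed) auto
      fix U assume U: "U \<subseteq> {..<A.n}"
      then have Un: "U \<subseteq> {..<n}" using n by simp
      have "f b \<otimes> DR (z a) U \<in> N" unfolding N_def using fI[OF ab(2)] z(2)[OF ab(1)] by (rule ideal_prod.prod)
      then have "\<phi> (f b \<otimes> DR (z a) U) = \<zero>\<^bsub>A\<^esub>" using ker m_closed[OF fR[OF ab(2)] DRc[OF z(1)[OF ab(1)]]] by blast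
      then show "A.sc (\<phi> (f b)) (dgdiff A.B (p (z a))) U = \<zero>\<^bsub>A.B\<^esub> U"
        using pD[OF z(1)[OF ab(1)] Un] U fR[OF ab(2)] DRc[OF z(1)[OF ab(1)]] by (simp add: A.sc_apply)
    qed simp
    ultimately show "\<exists>z v. (\<forall>a\<in>{1..t}. z a \<in> homog A.B q) \<and>
        (\<forall>a\<in>{1..t}. \<forall>b\<in>{1..t}. A.sc (\<phi> (f b)) (dgdiff A.B (z a)) = \<zero>\<^bsub>A.B\<^esub>) \<and>
        v \<in> carrier A.B \<and> w = (\<Oplus>\<^bsub>A.B\<^esub>a\<in>{1..t}. A.sc (\<phi> (f a)) (z a)) \<oplus>\<^bsub>A.B\<^esub> dgdiff A.B v"
      using p_homog[OF z(1)] p_c[OF v] l by (intro exI[of _ "\<lambda>a. p (z a)"] exI[of _ "p v"]) auto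
  qed simp
  then show ?thesis by (simp add: A_def N_def xs_def \<phi>_def)
qed

end

section \<open>Adjoining one element to an ideal\<close>

context cring
begin

text \<open>The ideal a + R x, written out so that membership yields the two summands.\<close>

definition adj where "adj a x = {\<alpha> \<oplus> s \<otimes> x | \<alpha> s. \<alpha> \<in> a \<and> s \<in> carrier R}"

lemma ideal_addD: "ideal a R \<Longrightarrow> x \<in> a \<Longrightarrow> y \<in> a \<Longrightarrow> x \<oplus> y \<in> a"
  by (simp add: additive_subgroup.a_closed ideal.axioms(1))

lemma ideal_minusD: "ideal a R \<Longrightarrow> x \<in> a \<Longrightarrow> \<ominus> x \<in> a"
  by (simp add: additive_subgroup.a_inv_closed ideal.axioms(1))

lemma ideal_zeroD: "ideal a R \<Longrightarrow> \<zero> \<in> a"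
  by (simp add: additive_subgroup.zero_closed ideal.axioms(1))

lemma ideal_sub: "ideal a R \<Longrightarrow> x \<in> a \<Longrightarrow> x \<in> carrier R"
  by (rule ideal.Icarr)

lemma idealI':
  assumes "a \<subseteq> carrier R" "\<zero> \<in> a" "\<And>x y. x \<in> a \<Longrightarrow> y \<in> a \<Longrightarrow> x \<oplus> y \<in> a" "\<And>r x. r \<in> carrier R \<Longrightarrow> x \<in> a \<Longrightarrow> r \<otimes> x \<in> a"
  shows "ideal a R"
proof (rule idealI)
  show "subgroup a (add_monoid R)"
  proof (rule add.subgroupI)
    fix x assume x: "x \<in> a"
    have "\<ominus> x = \<ominus> \<one> \<otimes> x" using x assms(1) by (auto simp: l_minus)
    then show "\<ominus> x \<in> a" using assms(4)[of "\<ominus> \<one>" x] x by simp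
  qed (use assms in auto)
  show "x \<otimes> r \<in> a" if "x \<in> a" "r \<in> carrier R" for x r
    using assms(1,4) that by (auto simp: m_comm subset_iff)
qed (use assms ring_axioms in auto)

lemma ideal_diff:
  assumes "ideal a R" "x \<in> carrier R" "y \<in> carrier R" "x \<oplus> y \<in> a" "y \<in> a" shows "x \<in> a"
proof -
  have "x = (x \<oplus> y) \<oplus> \<ominus> y" using assms by (simp add: a_assoc r_neg)
  then show ?thesis using assms ideal_addD ideal_minusD by metis
qed

lemma adj_ideal:
  assumes a: "ideal a R" and x: "x \<in> carrier R" shows "ideal (adj a x) R"
proof (rule idealI')
  show "adj a x \<subseteq> carrier R" using ideal_sub[OF a] x by (auto simp: adj_def)
  show "\<zero> \<in> adj a x" using ideal_zeroD[OF a] x unfolding adj_def by (intro CollectI exI[of _ \<zero>]) simp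
next
  fix u v assume "u \<in> adj a x" "v \<in> adj a x"
  then obtain \<alpha> s \<beta> r where *: "\<alpha> \<in> a" "\<beta> \<in> a" "s \<in> carrier R" "r \<in> carrier R" "u = \<alpha> \<oplus> s \<otimes> x" "v = \<beta> \<oplus> r \<otimes> x"
    unfolding adj_def by blast
  have c: "\<alpha> \<in> carrier R" "\<beta> \<in> carrier R" using * ideal_sub[OF a] by auto
  have "u \<oplus> v = (\<alpha> \<oplus> \<beta>) \<oplus> (s \<oplus> r) \<otimes> x" using * c x by (simp add: l_distr a_ac)
  then show "u \<oplus> v \<in> adj a x" using * ideal_addD[OF a] unfolding adj_def by blast
next
  fix r u assume r: "r \<in> carrier R" and "u \<in> adj a x"
  then obtain \<alpha> s where *: "\<alpha> \<in> a" "s \<in> carrier R" "u = \<alpha> \<oplus> s \<otimes> x" unfolding adj_def by blast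
  have "r \<otimes> u = r \<otimes> \<alpha> \<oplus> (r \<otimes> s) \<otimes> x" using * r x ideal_sub[OF a] by (simp add: r_distr m_assoc)
  then show "r \<otimes> u \<in> adj a x" using * r ideal.I_l_closed[OF a] unfolding adj_def by blast
qed

lemma adj_incl: assumes "ideal a R" "x \<in> carrier R" shows "a \<subseteq> adj a x" "x \<in> adj a x"
proof -
  show "a \<subseteq> adj a x"
  proof
    fix u assume u: "u \<in> a"
    then have "u = u \<oplus> \<zero> \<otimes> x" using assms ideal_sub by simp
    then show "u \<in> adj a x" using u unfolding adj_def by blast
  qed
  have "x = \<zero> \<oplus> \<one> \<otimes> x" using assms by simp
  then show "x \<in> adj a x" using ideal_zeroD[OF assms(1)] unfolding adj_def by blast
qed

lemma adj_min: "\<lbrakk>ideal b R; a \<subseteq> b; x \<in> b\<rbrakk> \<Longrightarrow> adj a x \<subseteq> b"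
proof
  fix u assume b: "ideal b R" "a \<subseteq> b" "x \<in> b" and "u \<in> adj a x"
  then obtain \<alpha> s where u: "\<alpha> \<in> a" "s \<in> carrier R" "u = \<alpha> \<oplus> s \<otimes> x" unfolding adj_def by blast
  have "s \<otimes> x \<in> b" by (rule ideal.I_l_closed[OF b(1) b(3) u(2)])
  then show "u \<in> b" unfolding u(3) using u(1) b(2) by (intro ideal_addD[OF b(1)]) auto
qed

end

section \<open>Krull's principal ideal theorem\<close>

text \<open>Localisation at a prime \<open>L\<close> is replaced by saturation: \<open>sat L b\<close> is the contraction to \<open>R\<close> of the
  extension of \<open>b\<close> to the localisation.\<close>

locale noetherian_cring = cring R + noetherian_ring R for R (structure)
begin

definition sat where "sat L b = {r \<in> carrier R. \<exists>s\<in>carrier R. s \<notin> L \<and> s \<otimes> r \<in> b}"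

lemma primeD:
  assumes "primeideal P R"
  shows "ideal P R" "\<one> \<notin> P" "\<And>u v. \<lbrakk>u \<in> carrier R; v \<in> carrier R; u \<otimes> v \<in> P\<rbrakk> \<Longrightarrow> u \<in> P \<or> v \<in> P"
    "\<And>u v. \<lbrakk>u \<in> carrier R; v \<in> carrier R; u \<notin> P; v \<notin> P\<rbrakk> \<Longrightarrow> u \<otimes> v \<notin> P"
proof -
  interpret primeideal P R by fact
  show "ideal P R" by (rule is_ideal)
  show "\<one> \<notin> P" using one_imp_carrier I_notcarr by blast
  show "\<And>u v. \<lbrakk>u \<in> carrier R; v \<in> carrier R; u \<otimes> v \<in> P\<rbrakk> \<Longrightarrow> u \<in> P \<or> v \<in> P" by (rule I_prime)
  then show "\<And>u v. \<lbrakk>u \<in> carrier R; v \<in> carrier R; u \<notin> P; v \<notin> P\<rbrakk> \<Longrightarrow> u \<otimes> v \<notin> P" by blast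
qed

lemma sat_ideal:
  assumes L: "primeideal L R" and b: "ideal b R" shows "ideal (sat L b) R"
proof (rule idealI')
  show "sat L b \<subseteq> carrier R" by (auto simp: sat_def)
  show "\<zero> \<in> sat L b" using primeD(2)[OF L] ideal_zeroD[OF b] by (auto simp: sat_def)
next
  fix x y assume "x \<in> sat L b" "y \<in> sat L b"
  then obtain s r where *: "x \<in> carrier R" "y \<in> carrier R" "s \<in> carrier R" "r \<in> carrier R" "s \<notin> L" "r \<notin> L" "s \<otimes> x \<in> b" "r \<otimes> y \<in> b"
    by (auto simp: sat_def)
  have "(s \<otimes> r) \<otimes> (x \<oplus> y) = r \<otimes> (s \<otimes> x) \<oplus> s \<otimes> (r \<otimes> y)" using *(1-4) by (simp add: r_distr m_ac)
  then have "(s \<otimes> r) \<otimes> (x \<oplus> y) \<in> b" using * ideal_addD[OF b] ideal.I_l_closed[OF b] by metis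
  then show "x \<oplus> y \<in> sat L b" using * primeD(4)[OF L, of s r] by (auto simp: sat_def)
next
  fix r x assume r: "r \<in> carrier R" and "x \<in> sat L b"
  then obtain s where *: "x \<in> carrier R" "s \<in> carrier R" "s \<notin> L" "s \<otimes> x \<in> b" by (auto simp: sat_def)
  then have "s \<otimes> (r \<otimes> x) \<in> b" using r ideal.I_l_closed[OF b, of "s \<otimes> x" r] by (simp add: m_lcomm)
  then show "r \<otimes> x \<in> sat L b" using * r by (auto simp: sat_def)
qed

lemma sat_incl: "primeideal L R \<Longrightarrow> ideal b R \<Longrightarrow> b \<subseteq> sat L b"
  using primeD(2)[of L] ideal_sub[of b] by (auto simp: sat_def intro!: bexI[of _ \<one>])

lemma sat_mono: "b \<subseteq> c \<Longrightarrow> sat L b \<subseteq> sat L c"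
  by (auto simp: sat_def)

lemma sat_sat:
  assumes L: "primeideal L R" and b: "ideal b R" shows "sat L (sat L b) = sat L b"
proof
  show "sat L b \<subseteq> sat L (sat L b)" by (rule sat_incl[OF L sat_ideal[OF L b]])
  show "sat L (sat L b) \<subseteq> sat L b"
  proof
    fix r assume "r \<in> sat L (sat L b)"
    then obtain s s' where *: "r \<in> carrier R" "s \<in> carrier R" "s' \<in> carrier R" "s \<notin> L" "s' \<notin> L" "s' \<otimes> (s \<otimes> r) \<in> b"
      by (auto simp: sat_def)
    then have "(s' \<otimes> s) \<otimes> r \<in> b" by (simp add: m_assoc)
    then show "r \<in> sat L b" using * primeD(4)[OF L, of s' s] by (auto simp: sat_def)
  qed
qed

lemma sat_prime:
  assumes P: "primeideal P R" and "P \<subseteq> L" shows "sat L P \<subseteq> P"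
  using primeD(3)[OF P] assms(2) by (auto simp: sat_def)

lemma noeth_max:
  assumes "C \<noteq> {}" "\<And>a. a \<in> C \<Longrightarrow> ideal a R"
  shows "\<exists>M\<in>C. \<forall>N\<in>C. M \<subseteq> N \<longrightarrow> N = M"
proof (rule subset_Zorn_nonempty[OF assms(1)])
  fix D assume D: "D \<noteq> {}" "subset.chain C D"
  have "subset.chain {I. ideal I R} D" using D assms(2) by (auto simp: subset.chain_def)
  then have "\<Union>D \<in> D" using ideal_chain_is_trivial D by blast
  then show "\<Union>D \<in> C" using D by (auto simp: subset.chain_def)
qed

text \<open>One generator is dropped. Locally at \<open>L\<close>, \<open>M\<close> is generated by
  \<open>m\<close> over \<open>b\<close>, and \<open>m\<close> lies in N + c M. Clearing
  denominators gives S s m = beta + c m with S s outside \<open>L\<close> and c inside, so S s - c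
  is outside \<open>L\<close> and carries \<open>m\<close> into \<open>b\<close>.\<close>

lemma local_nakayama_step:
  assumes L: "primeideal L R" and N: "ideal N R" and M: "ideal M R" and c: "ideal \<cc> R" "\<cc> \<subseteq> L"
    and hyp: "\<And>m. m \<in> M \<Longrightarrow> \<exists>s\<in>carrier R. s \<notin> L \<and> (\<exists>\<nu>\<in>N. \<exists>p\<in>\<cc> \<cdot> M. s \<otimes> m = \<nu> \<oplus> p)"
    and b: "ideal b R" "N \<subseteq> b" and m: "m \<in> M" and Mb: "M \<subseteq> sat L (adj b m)"
  shows "M \<subseteq> sat L b"
proof -
  have mR: "m \<in> carrier R" using m M ideal_sub by blast
  \<comment> \<open>The elements that some denominator outside \<open>L\<close> carries into b + c
    m. The set contains \<open>N\<close> and the product \<open>\<cc> \<cdot> M\<close>, hence also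
    the multiple of \<open>m\<close> given by \<open>hyp\<close>.\<close>
  define T where "T = {y \<in> carrier R. \<exists>S\<in>carrier R. \<exists>c\<in>\<cc>. \<exists>\<beta>\<in>b. S \<notin> L \<and> S \<otimes> y = \<beta> \<oplus> c \<otimes> m}"
  have T_add: "y \<oplus> y' \<in> T" if "y \<in> T" "y' \<in> T" for y y'
  proof -
    obtain S c \<beta> S' c' \<beta>' where *: "y \<in> carrier R" "y' \<in> carrier R" "S \<in> carrier R" "S' \<in> carrier R" "c \<in> \<cc>" "c' \<in> \<cc>" "\<beta> \<in> b" "\<beta>' \<in> b"
      "S \<notin> L" "S' \<notin> L" "S \<otimes> y = \<beta> \<oplus> c \<otimes> m" "S' \<otimes> y' = \<beta>' \<oplus> c' \<otimes> m"
      using \<open>y \<in> T\<close> \<open>y' \<in> T\<close> unfolding T_def by blast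
    have cl: "c \<in> carrier R" "c' \<in> carrier R" "\<beta> \<in> carrier R" "\<beta>' \<in> carrier R" using * c(1) b(1) ideal_sub by auto
    have "(S \<otimes> S') \<otimes> (y \<oplus> y') = S' \<otimes> (S \<otimes> y) \<oplus> S \<otimes> (S' \<otimes> y')" using *(1-4) by (simp add: r_distr m_ac)
    also have "\<dots> = (S' \<otimes> \<beta> \<oplus> S \<otimes> \<beta>') \<oplus> (S' \<otimes> c \<oplus> S \<otimes> c') \<otimes> m"
      unfolding *(11,12) using * cl mR by (simp add: r_distr l_distr m_assoc a_ac)
    finally have "(S \<otimes> S') \<otimes> (y \<oplus> y') = (S' \<otimes> \<beta> \<oplus> S \<otimes> \<beta>') \<oplus> (S' \<otimes> c \<oplus> S \<otimes> c') \<otimes> m" .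
    moreover have "S' \<otimes> \<beta> \<oplus> S \<otimes> \<beta>' \<in> b" "S' \<otimes> c \<oplus> S \<otimes> c' \<in> \<cc>"
      using * ideal_addD[OF b(1)] ideal_addD[OF c(1)] ideal.I_l_closed[OF b(1)] ideal.I_l_closed[OF c(1)] by auto
    moreover have "S \<otimes> S' \<notin> L" using * primeD(4)[OF L] by blast
    ultimately show ?thesis unfolding T_def using * by blast
  qed
  have NT: "N \<subseteq> T"
  proof
    fix y assume y: "y \<in> N"
    have "\<one> \<otimes> y = y \<oplus> \<zero> \<otimes> m" using y N ideal_sub mR by simp
    then show "y \<in> T" unfolding T_def using y b(2) N ideal_sub ideal_zeroD[OF c(1)] primeD(2)[OF L] by blast
  qed
  have "\<cc> \<cdot> M \<subseteq> T"
  proof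
    fix y assume "y \<in> \<cc> \<cdot> M"
    then show "y \<in> T"
    proof (induct rule: ideal_prod.induct)
      case (prod i j)
      then obtain s where s: "s \<in> carrier R" "s \<notin> L" "s \<otimes> j \<in> adj b m" "j \<in> carrier R" using Mb by (auto simp: sat_def)
      then obtain \<beta> r where r: "\<beta> \<in> b" "r \<in> carrier R" "s \<otimes> j = \<beta> \<oplus> r \<otimes> m" by (auto simp: adj_def)
      have cl: "i \<in> carrier R" "\<beta> \<in> carrier R" using prod r b(1) c(1) ideal_sub by auto
      have "s \<otimes> (i \<otimes> j) = i \<otimes> (s \<otimes> j)" using s cl by (simp add: m_lcomm)
      also have "\<dots> = i \<otimes> \<beta> \<oplus> (i \<otimes> r) \<otimes> m" unfolding r(3) using cl r mR by (simp add: r_distr m_assoc)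
      finally have "s \<otimes> (i \<otimes> j) = i \<otimes> \<beta> \<oplus> (i \<otimes> r) \<otimes> m" .
      moreover have "i \<otimes> \<beta> \<in> b" using ideal.I_l_closed[OF b(1) r(1) cl(1)] .
      moreover have "i \<otimes> r \<in> \<cc>" using ideal.I_r_closed[OF c(1) prod(1) r(2)] .
      ultimately show ?case unfolding T_def using s cl by blast
    next
      case (sum s1 s2) then show ?case by (intro T_add)
    qed
  qed
  obtain s \<nu> p where s: "s \<in> carrier R" "s \<notin> L" "\<nu> \<in> N" "p \<in> \<cc> \<cdot> M" "s \<otimes> m = \<nu> \<oplus> p" using hyp[OF m] by blast
  have "s \<otimes> m \<in> T" unfolding s(5) using NT \<open>\<cc> \<cdot> M \<subseteq> T\<close> s by (intro T_add) auto
  then obtain S c \<beta> where S: "S \<in> carrier R" "S \<notin> L" "c \<in> \<cc>" "\<beta> \<in> b" "S \<otimes> (s \<otimes> m) = \<beta> \<oplus> c \<otimes> m" unfolding T_def by blast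
  have cl: "c \<in> carrier R" "\<beta> \<in> carrier R" using S b(1) \<open>ideal \<cc> R\<close> ideal_sub by auto
  have "(S \<otimes> s \<oplus> \<ominus> c) \<otimes> m = \<beta>"
  proof -
    have "(S \<otimes> s \<oplus> \<ominus> c) \<otimes> m = S \<otimes> (s \<otimes> m) \<oplus> \<ominus> (c \<otimes> m)" using S s cl mR by (simp add: l_distr m_assoc l_minus)
    then show ?thesis unfolding S(5) using cl mR by (simp add: a_assoc r_neg)
  qed
  moreover have "S \<otimes> s \<oplus> \<ominus> c \<notin> L"
  proof
    assume "S \<otimes> s \<oplus> \<ominus> c \<in> L"
    then have "S \<otimes> s \<in> L"
      using ideal_diff[OF primeD(1)[OF L], of "S \<otimes> s" "\<ominus> c"] ideal_minusD[OF primeD(1)[OF L]] S s cl c(2) by auto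
    then show False using primeD(4)[OF L] S s by blast
  qed
  ultimately have "m \<in> sat L b" using S s cl mR unfolding sat_def by (intro CollectI conjI bexI[of _ "S \<otimes> s \<oplus> \<ominus> c"]) auto
  then have "adj b m \<subseteq> sat L b" using sat_incl[OF L b(1)] by (intro adj_min sat_ideal L b)
  then have "sat L (adj b m) \<subseteq> sat L b" using sat_mono[of "adj b m" "sat L b" L] sat_sat[OF L b(1)] by simp
  then show ?thesis using Mb by blast
qed

text \<open>The ideal \<open>M\<close> is finitely generated, so it lies in the ideal obtained by
  adjoining its generators to \<open>N\<close>; \<open>local_nakayama_step\<close> then removes the
  generators one at a time.\<close>

lemma local_nakayama:
  assumes L: "primeideal L R" and N: "ideal N R" and M: "ideal M R" and c: "ideal \<cc> R" "\<cc> \<subseteq> L"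
    and hyp: "\<And>m. m \<in> M \<Longrightarrow> \<exists>s\<in>carrier R. s \<notin> L \<and> (\<exists>\<nu>\<in>N. \<exists>p\<in>\<cc> \<cdot> M. s \<otimes> m = \<nu> \<oplus> p)"
  shows "M \<subseteq> sat L N"
proof -
  have *: "M \<subseteq> sat L N" if "set ms \<subseteq> M" "M \<subseteq> sat L (foldr (\<lambda>m b. adj b m) ms N)" for ms
    using that
  proof (induct ms)
    case (Cons m ms)
    define b where "b = foldr (\<lambda>m b. adj b m) ms N"
    have "set ms \<subseteq> carrier R" using Cons(2) M ideal_sub by auto
    then have "ideal b R \<and> N \<subseteq> b" unfolding b_def
    proof (induct ms)
      case (Cons a ms)
      then show ?case using adj_ideal[of "foldr (\<lambda>m b. adj b m) ms N" a] adj_incl(1)[of "foldr (\<lambda>m b. adj b m) ms N" a] by auto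
    qed (use N in auto)
    then show ?case using local_nakayama_step[OF L N M c hyp, of b m] Cons by (auto simp: b_def)
  qed simp
  obtain A where A: "A \<subseteq> carrier R" "finite A" "M = Idl A" using finetely_gen[OF M] by blast
  obtain ms where ms: "set ms = A" using A finite_list by blast
  have AM: "A \<subseteq> M" using A genideal_self by auto
  have fold: "set ms' \<subseteq> carrier R \<Longrightarrow> ideal (foldr (\<lambda>m b. adj b m) ms' N) R \<and> set ms' \<subseteq> foldr (\<lambda>m b. adj b m) ms' N" for ms'
  proof (induct ms')
    case (Cons a ms') then show ?case using adj_ideal[of "foldr (\<lambda>m b. adj b m) ms' N" a] adj_incl[of "foldr (\<lambda>m b. adj b m) ms' N" a] by auto
  qed (use N in auto)
  have "M \<subseteq> foldr (\<lambda>m b. adj b m) ms N" unfolding A(3) using fold[of ms] ms A by (intro genideal_minimal) auto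
  also have "\<dots> \<subseteq> sat L \<dots>" using fold[of ms] ms A by (intro sat_incl L) auto
  finally show ?thesis using * ms AM by blast
qed

lemma colon_ideal: assumes b: "ideal b R" and r: "r \<in> carrier R" shows "ideal {s \<in> carrier R. s \<otimes> r \<in> b} R"
proof (rule idealI')
  show "\<zero> \<in> {s \<in> carrier R. s \<otimes> r \<in> b}" using r ideal_zeroD[OF b] by simp
  show "x \<oplus> y \<in> {s \<in> carrier R. s \<otimes> r \<in> b}" if "x \<in> {s \<in> carrier R. s \<otimes> r \<in> b}" "y \<in> {s \<in> carrier R. s \<otimes> r \<in> b}" for x y
    using that r ideal_addD[OF b] by (auto simp: l_distr)
  show "u \<otimes> x \<in> {s \<in> carrier R. s \<otimes> r \<in> b}" if "u \<in> carrier R" "x \<in> {s \<in> carrier R. s \<otimes> r \<in> b}" for u x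
    using that r ideal.I_l_closed[OF b] by (auto simp: m_assoc)
qed auto

text \<open>An ideal maximal among the colon ideals (b : r) with r outside \<open>b\<close> is
  prime: if u v lies in it and u does not, then (b : u r) is a larger member of the family
  containing v, so by maximality v lies in (b : r).\<close>

lemma associated_prime:
  assumes b: "ideal b R" "b \<noteq> carrier R"
  shows "\<exists>r\<in>carrier R. r \<notin> b \<and> primeideal {s \<in> carrier R. s \<otimes> r \<in> b} R"
proof -
  define C where "C = {{s \<in> carrier R. s \<otimes> r \<in> b} | r. r \<in> carrier R \<and> r \<notin> b}"
  have "C \<noteq> {}" using b ideal_sub unfolding C_def by blast
  moreover have "ideal a R" if "a \<in> C" for a using that colon_ideal[OF b(1)] unfolding C_def by blast
  ultimately obtain M where M: "M \<in> C" "\<forall>N\<in>C. M \<subseteq> N \<longrightarrow> N = M" using noeth_max by blast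
  then obtain r where r: "r \<in> carrier R" "r \<notin> b" "M = {s \<in> carrier R. s \<otimes> r \<in> b}" unfolding C_def by blast
  have "primeideal M R"
  proof (rule primeidealI)
    show "ideal M R" unfolding r(3) by (rule colon_ideal[OF b(1) r(1)])
    show "cring R" by (rule is_cring)
    have "\<one> \<notin> M" using r by simp
    then show "carrier R \<noteq> M" by blast
    fix u v assume u: "u \<in> carrier R" and v: "v \<in> carrier R" and uv: "u \<otimes> v \<in> M"
    show "u \<in> M \<or> v \<in> M"
    proof (rule ccontr)
      assume n: "\<not> (u \<in> M \<or> v \<in> M)"
      define M' where "M' = {s \<in> carrier R. s \<otimes> (u \<otimes> r) \<in> b}"
      have "u \<otimes> r \<notin> b" using n u by (simp add: r(3))
      then have "M' \<in> C" using u r(1) unfolding C_def M'_def by blast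
      moreover have "M \<subseteq> M'"
      proof
        fix s assume s: "s \<in> M"
        then have "u \<otimes> (s \<otimes> r) \<in> b" using ideal.I_l_closed[OF b(1) _ u] by (simp add: r(3))
        then show "s \<in> M'" using s u r(1) by (simp add: M'_def r(3) m_lcomm)
      qed
      ultimately have "M' = M" using M(2) by blast
      moreover have "v \<in> M'" using uv u v r(1) by (simp add: M'_def r(3)) (simp add: m_ac)
      ultimately show False using n by simp
    qed
  qed
  then show ?thesis using r by blast
qed

text \<open>Noetherian induction in place of composition series. Let \<open>b\<close> be maximal
  among the saturated ideals above which some descending chain does not stabilise, and let
  \<open>z\<close> outside \<open>b\<close> satisfy L z inside \<open>b\<close>. After localisation,
  the saturation \<open>b'\<close> of b + R z is simple over \<open>b\<close>, so the intersections
  of the chain with \<open>b'\<close> stabilise; its sums with \<open>b'\<close> stabilise by the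
  choice of \<open>b\<close>. Together they fix the chain.\<close>

lemma saturated_dcc:
  assumes L: "primeideal L R"
    and ass: "\<And>b. \<lbrakk>ideal b R; sat L b = b; b0 \<subseteq> b; b \<noteq> carrier R\<rbrakk> \<Longrightarrow> \<exists>z\<in>carrier R. z \<notin> b \<and> (\<forall>l\<in>L. l \<otimes> z \<in> b)"
    and b0: "ideal b0 R" "sat L b0 = b0"
    and a: "\<And>k. ideal (a k) R" "\<And>k. sat L (a k) = a k" "\<And>k. b0 \<subseteq> a k" "\<And>k. a (Suc k) \<subseteq> a k"
  shows "\<exists>N::nat. a (Suc N) = a N"
proof -
  define good where "good b \<longleftrightarrow> (\<forall>a :: nat \<Rightarrow> 'a set. (\<forall>k. ideal (a k) R \<and> sat L (a k) = a k \<and> b \<subseteq> a k \<and> a (Suc k) \<subseteq> a k) \<longrightarrow> (\<exists>N. \<forall>k\<ge>N. a k = a N))" for b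
  define C where "C = {b. ideal b R \<and> sat L b = b \<and> b0 \<subseteq> b \<and> \<not> good b}"
  have "C = {}"
  proof (rule ccontr)
    assume "C \<noteq> {}"
    then obtain b where bC: "b \<in> C" and max: "\<forall>N\<in>C. b \<subseteq> N \<longrightarrow> N = b" using noeth_max[of C] unfolding C_def by blast
    have b: "ideal b R" "sat L b = b" "b0 \<subseteq> b" "\<not> good b" using bC by (auto simp: C_def)
    obtain a where a: "\<And>k. ideal (a k) R" "\<And>k. sat L (a k) = a k" "\<And>k. b \<subseteq> a k" "\<And>k. a (Suc k) \<subseteq> a k"
      and nst: "\<not> (\<exists>N. \<forall>k\<ge>N. a k = a N)" using b(4) unfolding good_def by blast
    have anti: "a k \<subseteq> a j" if "j \<le> k" for j k using that by (rule lift_Suc_antimono_le[of a, rotated]) (rule a(4))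
    have "b \<noteq> carrier R"
    proof
      assume "b = carrier R"
      then have "a k = carrier R" for k using a(1,3) ideal_sub by blast
      then show False using nst by blast
    qed
    then obtain z where z: "z \<in> carrier R" "z \<notin> b" "\<And>l. l \<in> L \<Longrightarrow> l \<otimes> z \<in> b" using ass[OF b(1-3)] by blast
    define b' where "b' = sat L (adj b z)"
    note az = adj_ideal[OF b(1) z(1)]
    have b': "ideal b' R" "sat L b' = b'" "b \<subseteq> b'" "z \<in> b'"
      unfolding b'_def using sat_ideal[OF L az] sat_sat[OF L az] sat_incl[OF L az] adj_incl[OF b(1) z(1)] by auto
    have "b' \<notin> C" using max b' z(2) by blast
    then have gb': "good b'" using b' b(3) unfolding C_def by blast
    \<comment> \<open>Simplicity of \<open>b'\<close> over \<open>b\<close>: for r in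
      \<open>b'\<close> some s outside \<open>L\<close> gives s r = beta + t z. If t is in
      \<open>L\<close> then r is already in \<open>b\<close>; otherwise \<open>z\<close> can be
      recovered from r.\<close>
    have dich: "z \<in> c \<or> c \<inter> b' = b" if c: "ideal c R" "sat L c = c" "b \<subseteq> c" for c
    proof (rule disjCI)
      assume "c \<inter> b' \<noteq> b"
      then obtain r where r: "r \<in> c" "r \<in> b'" "r \<notin> b" using c(3) b'(3) by blast
      then obtain s where s: "r \<in> carrier R" "s \<in> carrier R" "s \<notin> L" "s \<otimes> r \<in> adj b z" by (auto simp: b'_def sat_def)
      then obtain \<beta> t where t: "\<beta> \<in> b" "t \<in> carrier R" "s \<otimes> r = \<beta> \<oplus> t \<otimes> z" by (auto simp: adj_def)
      have "t \<notin> L"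
      proof
        assume "t \<in> L"
        then have "s \<otimes> r \<in> b" unfolding t(3) using z(3) t(1) ideal_addD[OF b(1)] by blast
        then have "r \<in> sat L b" using s by (auto simp: sat_def)
        then show False using r(3) b(2) by simp
      qed
      have "s \<otimes> r \<in> c" using ideal.I_l_closed[OF c(1) r(1) s(2)] .
      then have "t \<otimes> z \<in> c"
        using t z(1) c(3) ideal_sub[OF b(1)] ideal_diff[OF c(1), of "t \<otimes> z" \<beta>] by (auto simp: a_comm)
      then have "z \<in> sat L c" using t z(1) \<open>t \<notin> L\<close> by (auto simp: sat_def)
      then show "z \<in> c" using c(2) by simp
    qed
    have "\<exists>N. \<forall>k\<ge>N. a k \<inter> b' = a N \<inter> b'"
    proof (cases "\<forall>k. z \<in> a k")
      case True
      have "b' \<subseteq> a k" for k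
      proof -
        have "adj b z \<subseteq> a k" using True a(1,3) by (intro adj_min) auto
        then show ?thesis unfolding b'_def using sat_mono[of "adj b z" "a k" L] a(2)[of k] by simp
      qed
      then show ?thesis by (intro exI[of _ 0]) blast
    next
      case False
      then obtain N where "z \<notin> a N" by blast
      then have "a k \<inter> b' = b" if "N \<le> k" for k using dich[OF a(1,2,3), of k] anti[OF that] by blast
      then show ?thesis by (intro exI[of _ N]) simp
    qed
    then obtain N1 where N1: "\<And>k. N1 \<le> k \<Longrightarrow> a k \<inter> b' = a N1 \<inter> b'" by blast
    \<comment> \<open>The sums with \<open>b'\<close> have to be saturated again before the choice
      of \<open>b\<close> applies to them. The original chain is then recovered from its
      intersections and these sums by the modular law.\<close>
    define c where "c k = sat L (a k <+> b')" for k
    have ci: "ideal (a k <+> b') R" for k by (rule add_ideals[OF a(1) b'(1)])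
    have ab: "a k <+> b' = {\<alpha> \<oplus> \<beta> | \<alpha> \<beta>. \<alpha> \<in> a k \<and> \<beta> \<in> b'}" for k unfolding set_add_def' by blast
    have "b' \<subseteq> a k <+> b'" for k
    proof
      fix x assume x: "x \<in> b'"
      have "x = \<zero> \<oplus> x" using x b'(1) ideal_sub by simp
      then show "x \<in> a k <+> b'" unfolding ab using x ideal_zeroD[OF a(1)] by blast
    qed
    then have "\<forall>k. ideal (c k) R \<and> sat L (c k) = c k \<and> b' \<subseteq> c k \<and> c (Suc k) \<subseteq> c k"
    proof (intro allI conjI)
      fix k
      show "ideal (c k) R" unfolding c_def by (rule sat_ideal[OF L ci])
      show "sat L (c k) = c k" unfolding c_def by (rule sat_sat[OF L ci])
      show "b' \<subseteq> c k" unfolding c_def using \<open>\<And>k. b' \<subseteq> a k <+> b'\<close> sat_incl[OF L ci] by blast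
      show "c (Suc k) \<subseteq> c k" unfolding c_def by (rule sat_mono) (use a(4)[of k] in \<open>auto simp: ab\<close>)
    qed
    then obtain N2 where N2: "\<And>k. N2 \<le> k \<Longrightarrow> c k = c N2" using gb' unfolding good_def by blast
    define N where "N = max N1 N2"
    have "a k = a N" if k: "N \<le> k" for k
    proof
      show "a k \<subseteq> a N" by (rule anti[OF k])
      show "a N \<subseteq> a k"
      proof
        fix r assume r: "r \<in> a N"
        have rR: "r \<in> carrier R" using r a(1) ideal_sub by blast
        have "r = r \<oplus> \<zero>" using rR by simp
        then have "r \<in> a N <+> b'" unfolding ab using r ideal_zeroD[OF b'(1)] by blast
        then have "r \<in> c N" unfolding c_def using sat_incl[OF L ci] by blast
        moreover have "c N = c k" using N2[of N] N2[of k] k by (simp add: N_def)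
        ultimately have "r \<in> sat L (a k <+> b')" unfolding c_def by simp
        then obtain s where s: "s \<in> carrier R" "s \<notin> L" "s \<otimes> r \<in> a k <+> b'" by (auto simp: sat_def)
        then obtain \<alpha> \<beta> where \<alpha>: "\<alpha> \<in> a k" "\<beta> \<in> b'" "s \<otimes> r = \<alpha> \<oplus> \<beta>" unfolding ab by blast
        have cl: "\<alpha> \<in> carrier R" "\<beta> \<in> carrier R" using \<alpha> a(1) b'(1) ideal_sub by auto
        have "\<beta> \<oplus> \<alpha> \<in> a N" using ideal.I_l_closed[OF a(1) r s(1)] \<alpha>(3) cl by (simp add: a_comm)
        then have "\<beta> \<in> a N" using ideal_diff[OF a(1) cl(2,1)] \<alpha>(1) anti[OF k] by blast
        then have "\<beta> \<in> a k" using N1[of N] N1[of k] k \<alpha>(2) by (simp add: N_def) blast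
        then have "s \<otimes> r \<in> a k" unfolding \<alpha>(3) using ideal_addD[OF a(1) \<alpha>(1)] by blast
        then have "r \<in> sat L (a k)" using s rR by (auto simp: sat_def)
        then show "r \<in> a k" using a(2) by simp
      qed
    qed
    then show False using nst by blast
  qed
  then have "good b0" using b0 by (auto simp: C_def)
  then have "(\<forall>k. ideal (a k) R \<and> sat L (a k) = a k \<and> b0 \<subseteq> a k \<and> a (Suc k) \<subseteq> a k) \<longrightarrow> (\<exists>N. \<forall>k\<ge>N. a k = a N)"
    unfolding good_def by (rule spec)
  moreover have "\<forall>k. ideal (a k) R \<and> sat L (a k) = a k \<and> b0 \<subseteq> a k \<and> a (Suc k) \<subseteq> a k"
    by (intro allI conjI a)
  ultimately have "\<exists>N. \<forall>k\<ge>N. a k = a N" by (rule mp)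
  then obtain N where N: "\<forall>k\<ge>N. a k = a N" ..
  have "a (Suc N) = a N" by (rule N[THEN spec, THEN mp]) simp
  then show ?thesis ..
qed

text \<open>The principal ideal theorem for the domain R/P0: a prime minimal over P0 + (x) has no
  prime strictly between itself and \<open>P0\<close>. The proof is Krull's. The symbolic powers of
  \<open>Q\<close> modulo \<open>P0\<close> become stationary modulo x at \<open>P\<close>;
  Nakayama's lemma at \<open>P\<close> removes x, and Nakayama's lemma at \<open>Q\<close> then
  makes a symbolic power vanish modulo \<open>P0\<close>, which is impossible in a domain.\<close>

theorem no_prime_below_minimal:
  assumes P0: "primeideal P0 R" and Q: "primeideal Q R" and P: "primeideal P R"
    and "P0 \<subset> Q" "Q \<subset> P" and x: "x \<in> P" "x \<notin> Q"
    and min: "\<And>p. \<lbrakk>primeideal p R; P0 \<subseteq> p; x \<in> p; p \<subseteq> P\<rbrakk> \<Longrightarrow> p = P"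
  shows False
proof -
  have xR: "x \<in> carrier R" using x P primeD(1) ideal_sub by blast
  \<comment> \<open>After localisation at \<open>Q\<close>, \<open>E k\<close> is P0 + Q^k: these
    are the symbolic powers of \<open>Q\<close> modulo \<open>P0\<close>. The summand
    \<open>P0\<close> stays inside so that no quotient ring has to be formed.\<close>
  define E where "E = rec_nat (carrier R) (\<lambda>_ e. sat Q (P0 <+> Q \<cdot> e))"
  have E0: "E 0 = carrier R" and ES: "E (Suc k) = sat Q (P0 <+> Q \<cdot> E k)" for k by (simp_all add: E_def)
  have si: "ideal (P0 <+> Q \<cdot> e) R" if "ideal e R" for e
    by (intro add_ideals ideal_prod_is_ideal primeD(1) P0 Q that)
  have Ei: "ideal (E k) R" for k
    by (induct k) (auto simp: E0 ES oneideal intro!: sat_ideal Q si)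
  have QE: "q \<otimes> e \<in> E (Suc k)" if "q \<in> Q" "e \<in> E k" for q e k
  proof -
    have "q \<otimes> e \<in> Q \<cdot> E k" using that by (rule ideal_prod.prod)
    moreover have "q \<otimes> e = \<zero> \<oplus> q \<otimes> e" using that ideal_sub[OF primeD(1)[OF Q]] ideal_sub[OF Ei] by simp
    ultimately have "q \<otimes> e \<in> P0 <+> Q \<cdot> E k" unfolding set_add_def' using ideal_zeroD[OF primeD(1)[OF P0]] by blast
    then show ?thesis unfolding ES using sat_incl[OF Q si[OF Ei]] by blast
  qed
  have Edesc: "E (Suc k) \<subseteq> E k" for k
  proof (induct k)
    case 0 then show ?case using Ei[of "Suc 0"] ideal_sub by (auto simp: E0)
  next
    case (Suc k)
    have "Q \<cdot> E (Suc k) \<subseteq> Q \<cdot> E k"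
    proof
      fix y assume "y \<in> Q \<cdot> E (Suc k)"
      then show "y \<in> Q \<cdot> E k" by (induct rule: ideal_prod.induct) (use Suc in \<open>auto intro: ideal_prod.intros\<close>)
    qed
    then show ?case unfolding ES[of "Suc k"] ES[of k] by (intro sat_mono) (auto simp: set_add_def')
  qed
  have Esat: "sat Q (E k) = E k" for k
  proof (cases k)
    case 0 then show ?thesis using sat_incl[OF Q Ei[of 0]] by (auto simp: E0 sat_def)
  next
    case (Suc j) then show ?thesis unfolding Suc ES using sat_sat[OF Q si[OF Ei]] by simp
  qed
  have EP0: "P0 \<subseteq> E k" for k
  proof (cases k)
    case 0 then show ?thesis using ideal_sub[OF primeD(1)[OF P0]] by (auto simp: E0)
  next
    case (Suc j)
    have "P0 \<subseteq> P0 <+> Q \<cdot> E j"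
    proof
      fix y assume y: "y \<in> P0"
      then have "y = y \<oplus> \<zero>" using ideal_sub[OF primeD(1)[OF P0]] by simp
      moreover have "\<zero> \<in> Q \<cdot> E j" using ideal_zeroD[OF ideal_prod_is_ideal[OF primeD(1)[OF Q] Ei]] .
      ultimately show "y \<in> P0 <+> Q \<cdot> E j" unfolding set_add_def' using y by blast
    qed
    then show ?thesis unfolding Suc ES using sat_incl[OF Q si[OF Ei]] by blast
  qed
  define b0 where "b0 = sat P (adj P0 x)"
  have ai: "ideal (adj P0 x) R" by (rule adj_ideal[OF primeD(1)[OF P0] xR])
  have aEi: "ideal (adj (E k) x) R" for k by (rule adj_ideal[OF Ei xR])
  \<comment> \<open>By minimality of \<open>P\<close>, an associated prime of a
    \<open>P\<close>-saturated ideal containing P0 + (x) must be \<open>P\<close> itself; the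
    element having it as annihilator is what \<open>saturated_dcc\<close> asks for.\<close>
  have "\<exists>N. sat P (adj (E (Suc N)) x) = sat P (adj (E N) x)"
  proof (rule saturated_dcc[OF P, of b0])
    fix b assume b: "ideal b R" "sat P b = b" "b0 \<subseteq> b" "b \<noteq> carrier R"
    obtain r where r: "r \<in> carrier R" "r \<notin> b" "primeideal {s \<in> carrier R. s \<otimes> r \<in> b} R" using associated_prime[OF b(1,4)] by blast
    have ab: "adj P0 x \<subseteq> b" using sat_incl[OF P ai] b(3) unfolding b0_def by blast
    have inb: "s \<otimes> r \<in> b" if "s \<in> b" for s using ideal.I_r_closed[OF b(1) that r(1)] .
    have "{s \<in> carrier R. s \<otimes> r \<in> b} = P"
    proof (rule min[OF r(3)])
      show "P0 \<subseteq> {s \<in> carrier R. s \<otimes> r \<in> b}" using ab adj_incl(1)[OF primeD(1)[OF P0] xR] inb ideal_sub[OF b(1)] by blast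
      show "x \<in> {s \<in> carrier R. s \<otimes> r \<in> b}" using ab adj_incl(2)[OF primeD(1)[OF P0] xR] inb xR by blast
      show "{s \<in> carrier R. s \<otimes> r \<in> b} \<subseteq> P"
      proof (rule ccontr)
        assume "\<not> ?thesis"
        then have "r \<in> sat P b" using r(1) by (auto simp: sat_def)
        then show False using b(2) r(2) by simp
      qed
    qed
    then show "\<exists>z\<in>carrier R. z \<notin> b \<and> (\<forall>l\<in>P. l \<otimes> z \<in> b)" using r by blast
  next
    show "ideal b0 R" "sat P b0 = b0" unfolding b0_def by (rule sat_ideal[OF P ai], rule sat_sat[OF P ai])
    fix k
    show "ideal (sat P (adj (E k) x)) R" "sat P (sat P (adj (E k) x)) = sat P (adj (E k) x)"
      by (rule sat_ideal[OF P aEi], rule sat_sat[OF P aEi])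
    show "b0 \<subseteq> sat P (adj (E k) x)" unfolding b0_def by (rule sat_mono) (use EP0[of k] in \<open>auto simp: adj_def\<close>)
    show "sat P (adj (E (Suc k)) x) \<subseteq> sat P (adj (E k) x)" by (rule sat_mono) (use Edesc[of k] in \<open>auto simp: adj_def\<close>)
  qed
  then obtain N where N: "sat P (adj (E (Suc N)) x) = sat P (adj (E N) x)" by blast
  \<comment> \<open>For q in \<open>E N\<close> one has s q = q' + r x with q' in the next power.
    Then r x lies in \<open>E N\<close>, which is \<open>Q\<close>-saturated, and x is outside
    \<open>Q\<close>, so r lies in \<open>E N\<close>. Thus the error term is in x
    \<open>E N\<close> and Nakayama's lemma at \<open>P\<close> applies.\<close>
  have "E N \<subseteq> sat P (E (Suc N))"
  proof (rule local_nakayama[OF P Ei Ei primeD(1)[OF P] order_refl])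
    fix q assume q: "q \<in> E N"
    have qR: "q \<in> carrier R" using q ideal_sub[OF Ei] by blast
    have "q \<in> sat P (adj (E N) x)" using q adj_incl(1)[OF Ei xR] sat_incl[OF P aEi] by blast
    then have "q \<in> sat P (adj (E (Suc N)) x)" using N by simp
    then obtain s where s: "s \<in> carrier R" "s \<notin> P" "s \<otimes> q \<in> adj (E (Suc N)) x" by (auto simp: sat_def)
    then obtain q' r where r: "q' \<in> E (Suc N)" "r \<in> carrier R" "s \<otimes> q = q' \<oplus> r \<otimes> x" by (auto simp: adj_def)
    have q'R: "q' \<in> carrier R" using r(1) ideal_sub[OF Ei] by blast
    have "r \<otimes> x \<oplus> q' \<in> E N" using ideal.I_l_closed[OF Ei q s(1)] r q'R xR by (simp add: a_comm)
    then have "r \<otimes> x \<in> E N" using ideal_diff[OF Ei, of "r \<otimes> x" q' N] r q'R xR Edesc by blast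
    then have "x \<otimes> r \<in> E N" using r xR by (simp add: m_comm)
    then have "r \<in> sat Q (E N)" using x(2) xR r(2) by (auto simp: sat_def)
    then have "r \<in> E N" using Esat by simp
    then have "x \<otimes> r \<in> P \<cdot> E N" using x(1) by (intro ideal_prod.prod)
    moreover have "s \<otimes> q = q' \<oplus> x \<otimes> r" using r xR by (simp add: m_comm)
    ultimately show "\<exists>s\<in>carrier R. s \<notin> P \<and> (\<exists>\<nu>\<in>E (Suc N). \<exists>p\<in>P \<cdot> E N. s \<otimes> q = \<nu> \<oplus> p)" using s r(1) by blast
  qed
  also have "sat P (E (Suc N)) \<subseteq> sat Q (E (Suc N))" using \<open>Q \<subset> P\<close> by (auto simp: sat_def)
  also have "\<dots> = sat Q (P0 <+> Q \<cdot> E N)" unfolding ES by (rule sat_sat[OF Q si[OF Ei]])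
  finally have EN: "E N \<subseteq> sat Q (P0 <+> Q \<cdot> E N)" .
  \<comment> \<open>By definition of the next power, locally at \<open>Q\<close> the ideal
    \<open>E N\<close> is contained in \<open>P0\<close> plus \<open>Q\<close> times itself.\<close>
  have "E N \<subseteq> sat Q P0"
  proof (rule local_nakayama[OF Q primeD(1)[OF P0] Ei primeD(1)[OF Q] order_refl])
    fix m assume "m \<in> E N"
    then have "m \<in> sat Q (P0 <+> Q \<cdot> E N)" using EN by blast
    then show "\<exists>s\<in>carrier R. s \<notin> Q \<and> (\<exists>\<nu>\<in>P0. \<exists>p\<in>Q \<cdot> E N. s \<otimes> m = \<nu> \<oplus> p)"
      unfolding sat_def set_add_def' by blast
  qed
  then have "E N \<subseteq> P0" using sat_prime[OF P0, of Q] \<open>P0 \<subset> Q\<close> by blast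
  moreover obtain q where q: "q \<in> Q" "q \<notin> P0" using \<open>P0 \<subset> Q\<close> by blast
  \<comment> \<open>Multiplying by an element of \<open>Q\<close> outside the prime
    \<open>P0\<close> leads from each power to the next without entering \<open>P0\<close>.\<close>
  have "\<exists>e\<in>E k. e \<notin> P0" for k
  proof (induct k)
    case 0 then show ?case using primeD(2)[OF P0] by (auto simp: E0)
  next
    case (Suc k)
    then obtain e where e: "e \<in> E k" "e \<notin> P0" by blast
    then show ?case using QE[OF q(1) e(1)] primeD(4)[OF P0, of q e] q ideal_sub[OF primeD(1)[OF Q] q(1)] ideal_sub[OF Ei e(1)] by blast
  qed
  ultimately show False by blast
qed

end

section \<open>The ideals generated by initial segments of a list\<close>

context cring
begin

lemma sum_multiples:
  assumes "ideal a R" "finite S" "\<And>i. i \<in> S \<Longrightarrow> f i \<in> a" shows "(\<Oplus>i\<in>S. f i) \<in> a"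
  using assms(2,3)
proof (induct set: finite)
  case empty then show ?case using ideal_zeroD[OF assms(1)] by simp
next
  case (insert x F)
  then have "f \<in> F \<rightarrow> carrier R" "f x \<in> carrier R" using ideal_sub[OF assms(1)] by auto
  then show ?case using insert ideal_addD[OF assms(1)] by simp
qed

abbreviation "mk ys k \<equiv> multiples (self_module R) ys k"

lemma mk_ideal: assumes "set ys \<subseteq> carrier R" "k \<le> length ys" shows "ideal (mk ys k) R"
proof -
  interpret S: module R "self_module R" by (rule module_self) (rule is_cring)
  show ?thesis
    by (rule idealI') (use S.multiples_closed[OF assms(1) _ assms(2)] S.multiples_zero[OF assms]
      S.multiples_add[OF assms(1) _ _ assms(2)] S.multiples_smult[OF assms(1) _ assms(2)] in auto)
qed

lemma mk_Suc: assumes "set ys \<subseteq> carrier R" "k < length ys" shows "mk ys (Suc k) = adj (mk ys k) (ys ! k)"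
proof -
  have yR: "\<And>i. i \<le> k \<Longrightarrow> ys ! i \<in> carrier R" using assms by auto
  have e: "(\<Oplus>i\<in>{..<Suc k}. ys ! i \<otimes> m i) = (\<Oplus>i\<in>{..<k}. ys ! i \<otimes> m i) \<oplus> m k \<otimes> ys ! k"
    if "m \<in> {..<Suc k} \<rightarrow> carrier R" for m
    unfolding lessThan_Suc using that yR by (subst finsum_insert) (auto simp: Pi_iff a_comm m_comm)
  show ?thesis
  proof
    show "mk ys (Suc k) \<subseteq> adj (mk ys k) (ys ! k)"
    proof
      fix u assume "u \<in> mk ys (Suc k)"
      then obtain m where m: "m \<in> {..<Suc k} \<rightarrow> carrier R" "u = (\<Oplus>i\<in>{..<Suc k}. ys ! i \<otimes> m i)"
        by (auto simp: multiples_def finsum_self_module)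
      then have "u = (\<Oplus>i\<in>{..<k}. ys ! i \<otimes> m i) \<oplus> m k \<otimes> ys ! k" using e by simp
      moreover have "(\<Oplus>i\<in>{..<k}. ys ! i \<otimes> m i) \<in> mk ys k" "m k \<in> carrier R"
        using m(1) by (auto simp: multiples_def finsum_self_module Pi_iff)
      ultimately show "u \<in> adj (mk ys k) (ys ! k)" unfolding adj_def by blast
    qed
    show "adj (mk ys k) (ys ! k) \<subseteq> mk ys (Suc k)"
    proof
      fix u assume "u \<in> adj (mk ys k) (ys ! k)"
      then obtain m s where m: "m \<in> {..<k} \<rightarrow> carrier R" "s \<in> carrier R" "u = (\<Oplus>i\<in>{..<k}. ys ! i \<otimes> m i) \<oplus> s \<otimes> ys ! k"
        by (auto simp: multiples_def finsum_self_module adj_def)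
      have m': "m(k := s) \<in> {..<Suc k} \<rightarrow> carrier R" using m by (auto simp: lessThan_Suc)
      have "(\<Oplus>i\<in>{..<k}. ys ! i \<otimes> m i) = (\<Oplus>i\<in>{..<k}. ys ! i \<otimes> (m(k := s)) i)"
        using m yR by (intro finsum_cong_simple) auto
      then have "u = (\<Oplus>i\<in>{..<Suc k}. ys ! i \<otimes> (m(k := s)) i)" using e[OF m'] m(3) by simp
      then have "\<exists>m'. u = (\<Oplus>i\<in>{..<Suc k}. ys ! i \<otimes> m' i) \<and> m' \<in> {..<Suc k} \<rightarrow> carrier R" using m' by blast
      then show "u \<in> mk ys (Suc k)" by (simp add: multiples_def finsum_self_module)
    qed
  qed
qed

lemma mk_Idl: assumes ys: "set ys \<subseteq> carrier R" shows "mk ys (length ys) = Idl (set ys)"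
proof
  have gi: "ideal (Idl (set ys)) R" by (rule genideal_ideal[OF ys])
  show "mk ys (length ys) \<subseteq> Idl (set ys)"
  proof
    fix u assume "u \<in> mk ys (length ys)"
    then obtain m where m: "m \<in> {..<length ys} \<rightarrow> carrier R" "u = (\<Oplus>i\<in>{..<length ys}. ys ! i \<otimes> m i)"
      by (auto simp: multiples_def finsum_self_module)
    show "u \<in> Idl (set ys)" unfolding m(2)
    proof (rule sum_multiples[OF gi])
      fix i assume i: "i \<in> {..<length ys}"
      then have "ys ! i \<in> Idl (set ys)" using genideal_self[OF ys] by auto
      then show "ys ! i \<otimes> m i \<in> Idl (set ys)" using m(1) i ideal.I_r_closed[OF gi] by auto
    qed simp
  qed
  show "Idl (set ys) \<subseteq> mk ys (length ys)"
  proof (rule genideal_minimal[OF mk_ideal[OF ys]])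
    have mono: "mk ys i \<subseteq> mk ys (i + j)" if "i + j \<le> length ys" for i j
      using that
    proof (induct j)
      case (Suc j)
      have "mk ys (i + j) \<subseteq> mk ys (Suc (i + j))"
      proof -
        have "ys ! (i + j) \<in> carrier R" using Suc(2) ys nth_mem[of "i + j" ys] by auto
        then show ?thesis using Suc(2) ys adj_incl(1)[OF mk_ideal[OF ys, of "i + j"]] by (subst mk_Suc) auto
      qed
      then show ?case using Suc by auto
    qed simp
    show "set ys \<subseteq> mk ys (length ys)"
    proof
      fix y assume "y \<in> set ys"
      then obtain i where i: "i < length ys" "y = ys ! i" by (auto simp: in_set_conv_nth)
      have "ys ! i \<in> mk ys (Suc i)" using i ys by (subst mk_Suc) (auto intro!: adj_incl mk_ideal)
      moreover have "mk ys (Suc i) \<subseteq> mk ys (length ys)"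
      proof -
        obtain j where "length ys = Suc i + j" using i(1) less_eq_Suc_le le_Suc_ex by blast
        then show ?thesis using mono[of "Suc i" j] by simp
      qed
      ultimately show "y \<in> mk ys (length ys)" unfolding i(2) by (rule rev_subsetD)
    qed
  qed simp
qed

end

section \<open>Regular local rings\<close>

context noetherian_cring
begin

definition pchain where
  "pchain P k \<longleftrightarrow> (\<forall>i\<le>k. primeideal (P i) R) \<and> (\<forall>i<k. P i \<subset> P (Suc i))" for P :: "nat \<Rightarrow> 'a set" and k :: nat

text \<open>If no prime containing x lay strictly between \<open>P0\<close> and \<open>P\<close>,
  then \<open>P\<close> would be minimal over P0 + (x), and \<open>Q\<close> would contradict
  \<open>no_prime_below_minimal\<close>.\<close>

lemma chain_step:
  assumes "primeideal P0 R" "primeideal Q R" "primeideal P R" "P0 \<subset> Q" "Q \<subset> P" "x \<in> P"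
  shows "\<exists>P'. primeideal P' R \<and> x \<in> P' \<and> P0 \<subset> P' \<and> P' \<subset> P"
proof (cases "x \<in> Q")
  case True then show ?thesis using assms by blast
next
  case False
  show ?thesis
  proof (rule ccontr)
    assume n: "\<not> ?thesis"
    show False
    proof (rule no_prime_below_minimal[OF assms False])
      fix p assume p: "primeideal p R" "P0 \<subseteq> p" "x \<in> p" "p \<subseteq> P"
      have "P0 \<noteq> p" using p(3) False assms(4) by blast
      then show "p = P" using n p by blast
    qed
  qed
qed

text \<open>The element x is pushed down the chain: \<open>chain_step\<close> replaces the prime
  below the top by one containing x, and the shorter chain ending there is treated by induction.
  Endpoints and length are preserved.\<close>

lemma chain_modify:
  assumes "pchain P k" "1 \<le> k" "x \<in> P k"
  shows "\<exists>P'. pchain P' k \<and> P' 0 = P 0 \<and> P' k = P k \<and> x \<in> P' 1"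
  using assms
proof (induct k arbitrary: P)
  case (Suc k)
  show ?case
  proof (cases "k = 0")
    case True then show ?thesis using Suc by (intro exI[of _ P]) auto
  next
    case False
    then obtain j where j: "k = Suc j" by (cases k) auto
    have ch: "\<And>i. i \<le> Suc k \<Longrightarrow> primeideal (P i) R" "\<And>i. i < Suc k \<Longrightarrow> P i \<subset> P (Suc i)"
      using Suc(2) by (auto simp: pchain_def)
    obtain P' where P': "primeideal P' R" "x \<in> P'" "P j \<subset> P'" "P' \<subset> P (Suc k)"
      using chain_step[OF ch(1)[of j] ch(1)[of k] ch(1)[of "Suc k"] _ _ Suc(4)] ch(2)[of j] ch(2)[of k] j by auto
    have "pchain (P(k := P')) k" using ch P' j by (auto simp: pchain_def)
    moreover have "x \<in> (P(k := P')) k" using P'(2) by simp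
    ultimately have "\<exists>P''. pchain P'' k \<and> P'' 0 = (P(k := P')) 0 \<and> P'' k = (P(k := P')) k \<and> x \<in> P'' 1"
      using False by (intro Suc(1)) (assumption | simp)+
    then obtain P'' where P'': "pchain P'' k" "P'' 0 = P 0" "P'' k = P'" "x \<in> P'' 1"
      using False by auto
    have "pchain (P''(Suc k := P (Suc k))) (Suc k)"
      unfolding pchain_def
    proof (intro conjI allI impI)
      fix i assume "i \<le> Suc k"
      then show "primeideal ((P''(Suc k := P (Suc k))) i) R" using P''(1) ch(1)[of "Suc k"] by (auto simp: pchain_def le_Suc_eq)
    next
      fix i assume "i < Suc k"
      then show "(P''(Suc k := P (Suc k))) i \<subset> (P''(Suc k := P (Suc k))) (Suc i)"
        using P''(1,3) P'(4) by (auto simp: pchain_def less_Suc_eq)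
    qed
    moreover have "(P''(Suc k := P (Suc k))) 0 = P 0" "(P''(Suc k := P (Suc k))) (Suc k) = P (Suc k)" "x \<in> (P''(Suc k := P (Suc k))) 1"
      using P'' False by auto
    ultimately show ?thesis by blast
  qed
qed simp

end

section \<open>Noetherian local rings: Nakayama's lemma, regular sequences, minimal
  generators\<close>

locale noetherian_local = noetherian_cring +
  fixes \<mm>
  assumes maximal: "maximalideal \<mm> R" and unique: "\<And>M. maximalideal M R \<Longrightarrow> M = \<mm>"
begin

lemma mm_prime: "primeideal \<mm> R" by (rule maximalideal_prime[OF maximal])

lemma mm_ideal: "ideal \<mm> R" by (rule primeD(1)[OF mm_prime])

lemma proper_le_mm:
  assumes a: "ideal a R" "a \<noteq> carrier R" shows "a \<subseteq> \<mm>"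
proof -
  define C where "C = {b. ideal b R \<and> a \<subseteq> b \<and> b \<noteq> carrier R}"
  have "C \<noteq> {}" "\<And>b. b \<in> C \<Longrightarrow> ideal b R" using a by (auto simp: C_def)
  then obtain M where M: "M \<in> C" "\<forall>N\<in>C. M \<subseteq> N \<longrightarrow> N = M" using noeth_max by blast
  have "maximalideal M R"
  proof (rule maximalidealI)
    show "ideal M R" "carrier R \<noteq> M" using M(1) by (auto simp: C_def)
    fix J assume J: "ideal J R" "M \<subseteq> J" "J \<subseteq> carrier R"
    show "J = M \<or> J = carrier R"
    proof (cases "J = carrier R")
      case False
      then have "J \<in> C" using J M(1) by (auto simp: C_def)
      then show ?thesis using M(2) J(2) by blast
    qed simp
  qed
  then show ?thesis using unique M(1) by (auto simp: C_def)
qed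

lemma unit_outside: assumes x: "x \<in> carrier R" "x \<notin> \<mm>" shows "\<exists>y\<in>carrier R. y \<otimes> x = \<one>"
proof -
  have "PIdl x = carrier R" using proper_le_mm[OF cgenideal_ideal[OF x(1)]] cgenideal_self[OF x(1)] x(2) by blast
  then have "\<one> \<in> PIdl x" by simp
  then show ?thesis by (auto simp: cgenideal_def)
qed

text \<open>Denominators outside the maximal ideal are units, so the local form of Nakayama's lemma
  becomes the usual one.\<close>

lemma sat_mm: assumes b: "ideal b R" shows "sat \<mm> b = b"
proof
  show "b \<subseteq> sat \<mm> b" by (rule sat_incl[OF mm_prime b])
  show "sat \<mm> b \<subseteq> b"
  proof
    fix r assume "r \<in> sat \<mm> b"
    then obtain s where s: "r \<in> carrier R" "s \<in> carrier R" "s \<notin> \<mm>" "s \<otimes> r \<in> b" by (auto simp: sat_def)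
    obtain y where y: "y \<in> carrier R" "y \<otimes> s = \<one>" using unit_outside s by blast
    have "y \<otimes> (s \<otimes> r) \<in> b" by (rule ideal.I_l_closed[OF b s(4) y(1)])
    then show "r \<in> b" using s y by (simp add: m_assoc[symmetric])
  qed
qed

lemma nakayama:
  assumes N: "ideal N R" and M: "ideal M R"
    and hyp: "\<And>m. m \<in> M \<Longrightarrow> \<exists>\<nu>\<in>N. \<exists>p\<in>\<mm> \<cdot> M. m = \<nu> \<oplus> p"
  shows "M \<subseteq> N"
proof -
  have "M \<subseteq> sat \<mm> N"
  proof (rule local_nakayama[OF mm_prime N M mm_ideal order_refl])
    fix m assume m: "m \<in> M"
    have "\<one> \<otimes> m = m" using ideal_sub[OF M m] by simp
    then show "\<exists>s\<in>carrier R. s \<notin> \<mm> \<and> (\<exists>\<nu>\<in>N. \<exists>p\<in>\<mm> \<cdot> M. s \<otimes> m = \<nu> \<oplus> p)"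
      using hyp[OF m] primeD(2)[OF mm_prime] by (intro bexI[of _ \<one>]) auto
  qed
  then show ?thesis using sat_mm[OF N] by simp
qed

lemma prime_le_mm: "primeideal P R \<Longrightarrow> P \<subseteq> \<mm>"
  using proper_le_mm primeD(1,2) one_closed by metis

text \<open>Descending induction on \<open>k\<close>. A chain of primes above the first
  \<open>k\<close> generators can be changed so that its second member contains y_k; dropping the
  first member gives a chain above \<open>k + 1\<close> generators, which bounds the length. If the
  bound is attained, the first \<open>k\<close> generators generate the first member of the modified
  chain, so this ideal is prime and does not contain y_k, which is regularity at that place.\<close>

lemma regular_of_chain:
  assumes ys: "set ys \<subseteq> carrier R" and gen: "Idl (set ys) = \<mm>" and k: "k \<le> length ys"
  shows "pchain P m \<Longrightarrow> mk ys k \<subseteq> P 0 \<Longrightarrow> m \<le> length ys - k \<and> (m = length ys - k \<longrightarrow> primeideal (mk ys k) R \<and>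
    (\<forall>i. k \<le> i \<and> i < length ys \<longrightarrow> (\<forall>r\<in>carrier R. ys ! i \<otimes> r \<in> mk ys i \<longrightarrow> r \<in> mk ys i)))"
  using k
proof (induct k arbitrary: P m rule: inc_induct)
  case base
  have P0: "primeideal (P 0) R" using base by (auto simp: pchain_def)
  have "\<mm> \<subseteq> P 0" using base gen mk_Idl[OF ys] by simp
  then have eq: "P 0 = \<mm>" using prime_le_mm[OF P0] by blast
  have "m = 0"
  proof (rule ccontr)
    assume "m \<noteq> 0"
    then have "P 0 \<subset> P 1" "primeideal (P 1) R" using base(1) by (auto simp: pchain_def)
    then show False using eq prime_le_mm by blast
  qed
  then show ?case using mk_Idl[OF ys] gen mm_prime by auto
next
  case (step k)
  define x where "x = ys ! k"
  have xR: "x \<in> carrier R" using step ys by (auto simp: x_def)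
  have mkS: "mk ys (Suc k) = adj (mk ys k) x" using mk_Suc[OF ys step(2)] by (simp add: x_def)
  have mki: "ideal (mk ys k) R" using step by (intro mk_ideal ys) simp
  show ?case
  proof (cases m)
    case 0 then show ?thesis using step by simp
  next
    case (Suc m')
    have ch: "\<And>i. i \<le> m \<Longrightarrow> primeideal (P i) R" "\<And>i. i < m \<Longrightarrow> P i \<subset> P (Suc i)" using step(4) by (auto simp: pchain_def)
    \<comment> \<open>Putting the maximal ideal on top keeps the chain strict and makes its last
      member contain y_k, as \<open>chain_modify\<close> demands.\<close>
    have "pchain (P(m := \<mm>)) m"
      using ch mm_prime prime_le_mm[OF ch(1)[of m]] Suc by (auto simp: pchain_def)
    moreover have "x \<in> (P(m := \<mm>)) m"
      using gen genideal_self[OF ys] step(2) by (auto simp: x_def)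
    ultimately obtain P' where P': "pchain P' m" "P' 0 = P 0" "x \<in> P' 1"
      using chain_modify[of "P(m := \<mm>)" m x] Suc by auto
    have ch': "\<And>i. i \<le> m \<Longrightarrow> primeideal (P' i) R" "\<And>i. i < m \<Longrightarrow> P' i \<subset> P' (Suc i)" using P'(1) by (auto simp: pchain_def)
    have P1: "primeideal (P' 1) R" "P' 0 \<subset> P' 1" using ch'(1)[of 1] ch'(2)[of 0] Suc by auto
    have kP: "mk ys k \<subseteq> P' 0" using step(5) P'(2) by simp
    have SkP: "mk ys (Suc k) \<subseteq> P' 1" unfolding mkS using P1 kP P'(3) by (intro adj_min primeD(1)) auto
    have "pchain (\<lambda>i. P' (Suc i)) m'" using ch' Suc by (auto simp: pchain_def)
    then have IH: "m' \<le> length ys - Suc k" "m' = length ys - Suc k \<Longrightarrow> primeideal (mk ys (Suc k)) R"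
      "\<And>i r. \<lbrakk>m' = length ys - Suc k; Suc k \<le> i; i < length ys; r \<in> carrier R; ys ! i \<otimes> r \<in> mk ys i\<rbrakk> \<Longrightarrow> r \<in> mk ys i"
      using step(3)[of "\<lambda>i. P' (Suc i)" m'] SkP by auto
    show ?thesis
    proof (intro conjI impI)
      show "m \<le> length ys - k" using IH(1) Suc step(2) by simp
      assume m: "m = length ys - k"
      then have m': "m' = length ys - Suc k" using Suc by simp
      \<comment> \<open>Otherwise the whole chain of length \<open>m\<close> would lie above
        \<open>k + 1\<close> generators, exceeding the bound for them.\<close>
      have nx: "x \<notin> P' 0"
      proof
        assume "x \<in> P' 0"
        then have "mk ys (Suc k) \<subseteq> P' 0" unfolding mkS using kP ch'(1)[of 0] by (intro adj_min primeD(1)) auto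
        then have "m \<le> length ys - Suc k" using step(3)[of P' m] P'(1) by blast
        then show False using m step(2) by simp
      qed
      \<comment> \<open>The ideal of \<open>k + 1\<close> generators is prime by induction. Were it
        strictly smaller than the second member, it could replace the first member, again giving too
        long a chain.\<close>
      have eq1: "mk ys (Suc k) = P' 1"
      proof (rule ccontr)
        assume "mk ys (Suc k) \<noteq> P' 1"
        then have "pchain (P'(0 := mk ys (Suc k))) m" using ch' IH(2)[OF m'] SkP Suc by (auto simp: pchain_def)
        moreover have "mk ys (Suc k) \<subseteq> (P'(0 := mk ys (Suc k))) 0" by simp
        ultimately have "m \<le> length ys - Suc k" using step(3)[of "P'(0 := mk ys (Suc k))" m] by blast
        then show False using m step(2) by simp
      qed
      have P0: "primeideal (P' 0) R" using ch'(1)[of 0] by simp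
      \<comment> \<open>An element p of the prime is alpha + s x with alpha in
        \<open>mk ys k\<close>; since x is not in the prime, s is. So the prime lies in
        \<open>mk ys k\<close> plus x times itself, and Nakayama's lemma finishes.\<close>
      have "P' 0 \<subseteq> mk ys k"
      proof (rule nakayama[OF mki primeD(1)[OF P0]])
        fix p assume p: "p \<in> P' 0"
        then have "p \<in> adj (mk ys k) x" using P1(2) eq1 mkS by blast
        then obtain \<alpha> s where s: "\<alpha> \<in> mk ys k" "s \<in> carrier R" "p = \<alpha> \<oplus> s \<otimes> x" by (auto simp: adj_def)
        have \<alpha>R: "\<alpha> \<in> carrier R" using s(1) mki ideal_sub by blast
        have "s \<otimes> x \<oplus> \<alpha> \<in> P' 0" using p s xR \<alpha>R by (simp add: a_comm)
        then have "s \<otimes> x \<in> P' 0" using ideal_diff[OF primeD(1)[OF P0], of "s \<otimes> x" \<alpha>] s xR \<alpha>R kP by blast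
        then have "s \<in> P' 0" using primeD(3)[OF P0 s(2) xR] nx by blast
        moreover have "x \<in> \<mm>" using P'(3) prime_le_mm[OF P1(1)] by blast
        ultimately have "x \<otimes> s \<in> \<mm> \<cdot> P' 0" by (intro ideal_prod.prod)
        moreover have "p = \<alpha> \<oplus> x \<otimes> s" using s xR by (simp add: m_comm)
        ultimately show "\<exists>\<nu>\<in>mk ys k. \<exists>p'\<in>\<mm> \<cdot> P' 0. p = \<nu> \<oplus> p'" using s(1) by blast
      qed
      then have eq0: "mk ys k = P' 0" using kP by blast
      show "primeideal (mk ys k) R" using eq0 P0 by simp
      show "\<forall>i. k \<le> i \<and> i < length ys \<longrightarrow> (\<forall>r\<in>carrier R. ys ! i \<otimes> r \<in> mk ys i \<longrightarrow> r \<in> mk ys i)"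
      proof (intro allI impI ballI)
        fix i r assume i: "k \<le> i \<and> i < length ys" and r: "r \<in> carrier R" and yr: "ys ! i \<otimes> r \<in> mk ys i"
        show "r \<in> mk ys i"
        proof (cases "i = k")
          case True
          then have "x \<otimes> r \<in> P' 0" using yr eq0 by (simp add: x_def)
          then show ?thesis using primeD(3)[OF P0 xR r] nx True eq0 by blast
        next
          case False
          then show ?thesis using IH(3)[OF m', of i r] i r yr by simp
        qed
      qed
    qed
  qed
qed

text \<open>Generation modulo \<open>\<mm>\<^sup>2\<close> is a matroid closure on \<open>\<mm>\<close>; the exchange property bounds irredundant
  generating sets.\<close>

definition cl where "cl S = Idl (S \<union> \<mm> \<cdot> \<mm>)"

lemma mm2_ideal: "ideal (\<mm> \<cdot> \<mm>) R" by (rule ideal_prod_is_ideal[OF mm_ideal mm_ideal])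

lemma mm2_sub: "\<mm> \<cdot> \<mm> \<subseteq> \<mm>"
  using ideal_prod_inter[OF mm_ideal mm_ideal] by blast

lemma cl_facts:
  assumes "S \<subseteq> carrier R"
  shows "ideal (cl S) R" "S \<subseteq> cl S" "\<mm> \<cdot> \<mm> \<subseteq> cl S"
proof -
  have "S \<union> \<mm> \<cdot> \<mm> \<subseteq> carrier R" using assms mm2_ideal ideal_sub by blast
  then show "ideal (cl S) R" "S \<subseteq> cl S" "\<mm> \<cdot> \<mm> \<subseteq> cl S"
    using genideal_ideal genideal_self[of "S \<union> \<mm> \<cdot> \<mm>"] unfolding cl_def by auto
qed

lemma cl_min: "\<lbrakk>ideal b R; S \<subseteq> b; \<mm> \<cdot> \<mm> \<subseteq> b\<rbrakk> \<Longrightarrow> cl S \<subseteq> b"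
  unfolding cl_def by (rule genideal_minimal) auto

lemma cl_insert: assumes "S \<subseteq> carrier R" "t \<in> carrier R" shows "cl (insert t S) \<subseteq> adj (cl S) t"
  using cl_facts[OF assms(1)] assms adj_incl[OF cl_facts(1)[OF assms(1)] assms(2)]
  by (intro cl_min adj_ideal) auto

lemma cl_mono: assumes "S \<subseteq> T" "T \<subseteq> carrier R" shows "cl S \<subseteq> cl T"
  using cl_facts[OF assms(2)] assms(1) by (intro cl_min) auto

text \<open>Write s = alpha + r t with alpha in the closure of \<open>S\<close>. If r were in the
  maximal ideal, r t would lie in its square and s in the closure of \<open>S\<close>; so r is a
  unit and the equation can be solved for t.\<close>

lemma cl_exchange:
  assumes S: "S \<subseteq> \<mm>" and t: "t \<in> \<mm>" and s: "s \<in> cl (insert t S)" "s \<notin> cl S"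
  shows "t \<in> cl (insert s S)"
proof -
  have SR: "S \<subseteq> carrier R" and tR: "t \<in> carrier R" using S t mm_ideal ideal_sub by auto
  note c = cl_facts[OF SR]
  have itR: "insert t S \<subseteq> carrier R" using SR tR by auto
  have sR: "s \<in> carrier R" using ideal_sub[OF cl_facts(1)[OF itR] s(1)] .
  obtain \<alpha> r where r: "\<alpha> \<in> cl S" "r \<in> carrier R" "s = \<alpha> \<oplus> r \<otimes> t" using s(1) cl_insert[OF SR tR] by (auto simp: adj_def)
  have \<alpha>R: "\<alpha> \<in> carrier R" using ideal_sub[OF c(1) r(1)] .
  have "r \<notin> \<mm>"
  proof
    assume "r \<in> \<mm>"
    then have "r \<otimes> t \<in> \<mm> \<cdot> \<mm>" using t by (intro ideal_prod.prod)
    then have "s \<in> cl S" unfolding r(3) using c r(1) ideal_addD by blast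
    then show False using s(2) by simp
  qed
  then obtain y where y: "y \<in> carrier R" "y \<otimes> r = \<one>" using unit_outside r(2) by blast
  have isR: "insert s S \<subseteq> carrier R" using SR sR by auto
  note c' = cl_facts[OF isR]
  have "s \<in> cl (insert s S)" "\<alpha> \<in> cl (insert s S)" using c' cl_mono[of S "insert s S"] isR r(1) by auto
  moreover have "r \<otimes> t \<oplus> \<alpha> = s" using r \<alpha>R tR by (simp add: a_comm)
  ultimately have "r \<otimes> t \<in> cl (insert s S)" using ideal_diff[OF c'(1), of "r \<otimes> t" \<alpha>] r tR \<alpha>R by auto
  then have "y \<otimes> (r \<otimes> t) \<in> cl (insert s S)" by (rule ideal.I_l_closed[OF c'(1) _ y(1)])
  then show ?thesis using y r(2) tR by (simp add: m_assoc[symmetric])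
qed

text \<open>Generation modulo the square of the maximal ideal is generation, by Nakayama's
  lemma.\<close>

lemma cl_gen:
  assumes S: "S \<subseteq> \<mm>" and "\<mm> \<subseteq> cl S" shows "Idl S = \<mm>"
proof
  have SR: "S \<subseteq> carrier R" using S mm_ideal ideal_sub by auto
  have gi: "ideal (Idl S) R" by (rule genideal_ideal[OF SR])
  show "Idl S \<subseteq> \<mm>" by (rule genideal_minimal[OF mm_ideal S])
  show "\<mm> \<subseteq> Idl S"
  proof (rule nakayama[OF gi mm_ideal])
    have "cl S \<subseteq> Idl S <+> \<mm> \<cdot> \<mm>"
    proof (rule cl_min)
      show "ideal (Idl S <+> \<mm> \<cdot> \<mm>) R" by (rule add_ideals[OF gi mm2_ideal])
      show "S \<subseteq> Idl S <+> \<mm> \<cdot> \<mm>"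
      proof
        fix x assume x: "x \<in> S"
        then have "x = x \<oplus> \<zero>" "x \<in> Idl S" using SR genideal_self[OF SR] by auto
        then show "x \<in> Idl S <+> \<mm> \<cdot> \<mm>" unfolding set_add_def' using ideal_zeroD[OF mm2_ideal] by blast
      qed
      show "\<mm> \<cdot> \<mm> \<subseteq> Idl S <+> \<mm> \<cdot> \<mm>"
      proof
        fix x assume x: "x \<in> \<mm> \<cdot> \<mm>"
        then have "x = \<zero> \<oplus> x" using ideal_sub[OF mm2_ideal] by simp
        then show "x \<in> Idl S <+> \<mm> \<cdot> \<mm>" unfolding set_add_def' using ideal_zeroD[OF gi] x by blast
      qed
    qed
    then show "\<exists>\<nu>\<in>Idl S. \<exists>p\<in>\<mm> \<cdot> \<mm>. m = \<nu> \<oplus> p" if "m \<in> \<mm>" for m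
      using assms(2) that unfolding set_add_def' by blast
  qed
qed

text \<open>Steinitz exchange. An element t of \<open>T\<close> outside \<open>S\<close> is replaced
  by an s in \<open>S\<close> outside the closure of \<open>T - {t}\<close>; by
  \<open>cl_exchange\<close> the new set is still generating and irredundant, it has the same size,
  and fewer of its elements lie outside \<open>S\<close>.\<close>

lemma irredundant_card_le:
  assumes S: "finite S" "S \<subseteq> \<mm>" "\<mm> \<subseteq> cl S"
    and T: "finite T" "T \<subseteq> \<mm>" "\<mm> \<subseteq> cl T" "\<And>u. u \<in> T \<Longrightarrow> u \<notin> cl (T - {u})"
  shows "card T \<le> card S"
  using T
proof (induct "card (T - S)" arbitrary: T rule: less_induct)
  case less
  have R: "\<And>V. V \<subseteq> \<mm> \<Longrightarrow> V \<subseteq> carrier R" using mm_ideal ideal_sub by blast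
  show ?case
  proof (cases "T \<subseteq> S")
    case True then show ?thesis using S(1) card_mono by blast
  next
    case False
    then obtain t where t: "t \<in> T" "t \<notin> S" by blast
    define U where "U = T - {t}"
    have U: "T = insert t U" "t \<notin> U" "U \<subseteq> \<mm>" "finite U" using t less(2,3) by (auto simp: U_def)
    have UR: "U \<subseteq> carrier R" using R[OF U(3)] .
    have tm: "t \<in> \<mm>" using t less(3) by blast
    have "\<not> S \<subseteq> cl U"
    proof
      assume "S \<subseteq> cl U"
      then have "cl S \<subseteq> cl U" using cl_facts[OF UR] by (intro cl_min) auto
      then have "t \<in> cl U" using S(3) tm by blast
      then show False using less(5)[OF t(1)] by (simp add: U_def)
    qed
    then obtain s where s: "s \<in> S" "s \<notin> cl U" by blast
    have sm: "s \<in> \<mm>" using s S(2) by blast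
    have sU: "s \<notin> U" using s(2) cl_facts(2)[OF UR] by blast
    have isU: "insert s U \<subseteq> carrier R" using R U(3) sm by blast
    have "s \<in> cl (insert t U)" using less(4) sm U(1) by blast
    then have t_in: "t \<in> cl (insert s U)" by (rule cl_exchange[OF U(3) tm _ s(2)])
    have "card (insert s U) \<le> card S"
    proof (rule less(1))
      have "insert s U - S = (T - S) - {t}" using s t U by auto
      then show "card (insert s U - S) < card (T - S)" using t less(2) card_Diff1_less[of "T - S" t] by simp
      show "finite (insert s U)" "insert s U \<subseteq> \<mm>" using U sm by auto
      have "cl T \<subseteq> cl (insert s U)" using t_in cl_facts[OF isU] U(1) by (intro cl_min) auto
      then show "\<mm> \<subseteq> cl (insert s U)" using less(4) by blast
      fix u assume u: "u \<in> insert s U"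
      show "u \<notin> cl (insert s U - {u})"
      proof (cases "u = s")
        case True then show ?thesis using s(2) sU by simp
      next
        case False
        then have uU: "u \<in> U" using u by simp
        define W where "W = U - {u}"
        have W: "U = insert u W" "W \<subseteq> \<mm>" "insert s U - {u} = insert s W" using uU False U(3) by (auto simp: W_def)
        have um: "u \<in> \<mm>" using uU U(3) by blast
        have "u \<notin> cl W"
        proof
          assume "u \<in> cl W"
          moreover have "W \<subseteq> T - {u}" "T - {u} \<subseteq> carrier R" using U R[OF less(3)] by (auto simp: W_def)
          ultimately have "u \<in> cl (T - {u})" using cl_mono by blast
          then show False using less(5)[of u] uU U(1) by blast
        qed
        then show ?thesis using cl_exchange[OF W(2) sm, of u] s(2) W by auto
      qed
    qed
    moreover have "card (insert s U) = card T" using U sU by simp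
    ultimately show ?thesis by simp
  qed
qed

end

section \<open>Quotients and generating sets\<close>

context ideal
begin

abbreviation "\<phi> \<equiv> (\<lambda>r. I +> r)"
abbreviation "A \<equiv> R Quot I"

lemma phi_hom: "ring_hom_ring R A \<phi>"
  by (rule rcos_ring_hom_ring)

lemma phi_surj: "a \<in> carrier A \<Longrightarrow> \<exists>r\<in>carrier R. \<phi> r = a"
  by (auto simp: FactRing_def A_RCOSETS_def')

lemma phi_eq_iff: "\<lbrakk>r \<in> carrier R; s \<in> carrier R\<rbrakk> \<Longrightarrow> \<phi> r = \<phi> s \<longleftrightarrow> r \<ominus> s \<in> I"
  using quotient_eq_iff_same_a_r_cos[OF is_ideal] by blast

lemma phi_Idl:
  assumes S: "S \<subseteq> carrier R" shows "\<phi> ` (Idl S) = genideal A (\<phi> ` S)"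
proof
  interpret h: ring_hom_ring R A \<phi> by (rule phi_hom)
  have SA: "\<phi> ` S \<subseteq> carrier A" using S by auto
  have gi: "ideal (genideal A (\<phi> ` S)) A" by (rule h.S.genideal_ideal[OF SA])
  show "genideal A (\<phi> ` S) \<subseteq> \<phi> ` (Idl S)"
    using genideal_self[OF S] by (intro h.S.genideal_minimal ring_ideal_imp_quot_ideal is_ideal genideal_ideal S) auto
  have "Idl S \<subseteq> {r \<in> carrier R. \<phi> r \<in> genideal A (\<phi> ` S)}"
    using S h.S.genideal_self[OF SA] by (intro genideal_minimal h.ideal_vimage gi) auto
  then show "\<phi> ` (Idl S) \<subseteq> genideal A (\<phi> ` S)" by auto
qed

lemma quotient_noetherian:
  assumes "noetherian_ring R" shows "noetherian_ring A"
proof -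
  interpret h: ring_hom_ring R A \<phi> by (rule phi_hom)
  interpret noetherian_ring R by fact
  show ?thesis
  proof (rule h.S.noetherian_ringI)
    fix K assume K: "ideal K A"
    obtain S where S: "S \<subseteq> carrier R" "finite S" "{r \<in> carrier R. \<phi> r \<in> K} = Idl S"
      using finetely_gen[OF h.ideal_vimage[OF K]] by blast
    have "K = \<phi> ` {r \<in> carrier R. \<phi> r \<in> K}"
    proof
      show "K \<subseteq> \<phi> ` {r \<in> carrier R. \<phi> r \<in> K}"
      proof
        fix a assume a: "a \<in> K"
        then obtain r where "r \<in> carrier R" "\<phi> r = a" using phi_surj ideal.Icarr[OF K] by blast
        then show "a \<in> \<phi> ` {r \<in> carrier R. \<phi> r \<in> K}" using a by blast
      qed
    qed auto
    then have "K = genideal A (\<phi> ` S)" using phi_Idl[OF S(1)] S(3) by simp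
    moreover have "\<phi> ` S \<subseteq> carrier A" using S(1) by auto
    ultimately show "\<exists>S\<subseteq>carrier A. finite S \<and> K = genideal A S" using S(2) by blast
  qed
qed

lemma lift_generators:
  assumes xs: "set xs \<subseteq> carrier A" "distinct xs"
  shows "\<exists>ys. set ys \<subseteq> carrier R \<and> map \<phi> ys = xs \<and> distinct ys"
proof -
  have "\<forall>x\<in>set xs. \<exists>r\<in>carrier R. \<phi> r = x" using xs phi_surj by blast
  then obtain g where g: "\<And>x. x \<in> set xs \<Longrightarrow> g x \<in> carrier R \<and> \<phi> (g x) = x" by metis
  have "map \<phi> (map g xs) = xs" using g by (simp add: map_idI)
  moreover from this have "distinct (map g xs)" using xs(2) by (metis distinct_map)
  moreover have "set (map g xs) \<subseteq> carrier R" using g by auto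
  ultimately show ?thesis by blast
qed

end

lemma (in cring) maximal_of_units:
  assumes n: "ideal N R" "N \<noteq> carrier R" and units: "\<And>x. \<lbrakk>x \<in> carrier R; x \<notin> N\<rbrakk> \<Longrightarrow> \<exists>y\<in>carrier R. y \<otimes> x = \<one>"
  shows "maximalideal N R" "\<And>M. maximalideal M R \<Longrightarrow> M = N"
proof -
  have le: "J \<subseteq> N" if J: "ideal J R" "J \<noteq> carrier R" for J
  proof
    fix x assume x: "x \<in> J"
    show "x \<in> N"
    proof (rule ccontr)
      assume "x \<notin> N"
      then obtain y where "y \<in> carrier R" "y \<otimes> x = \<one>" using units ideal.Icarr[OF J(1) x] by blast
      then have "\<one> \<in> J" using ideal.I_l_closed[OF J(1) x] by metis
      then show False using ideal.one_imp_carrier[OF J(1)] J(2) by blast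
    qed
  qed
  show "maximalideal N R"
    by (rule maximalidealI) (use n le in auto)
  fix M assume M: "maximalideal M R"
  interpret M: maximalideal M R by fact
  have "M \<subseteq> N" using le M.is_ideal M.I_notcarr by blast
  then show "M = N" using M.I_maximal[OF n(1)] n ideal.Icarr[OF n(1)] by blast
qed

section \<open>The local case\<close>

text \<open>A finite supremum of a nonempty set of natural numbers is attained. The prime
  \<open>P0\<close> guarantees nonemptiness: the supremum of the empty set would be 0 as well, with
  no chain to show for it.\<close>

lemma krull_dim_chain:
  assumes "primeideal P0 R" "enat d = krull_dim R"
  shows "\<exists>P. (\<forall>i\<le>d. primeideal (P i) R) \<and> (\<forall>i<d. P i \<subset> P (Suc i))"
proof -
  define S where "S = {n. \<exists>P. (\<forall>i\<le>n. primeideal (P i) R) \<and> (\<forall>i<n. P i \<subset> P (Suc i))}"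
  have kd: "krull_dim R = Sup (enat ` S)" unfolding krull_dim_def S_def by (rule arg_cong[where f = Sup]) auto
  have 0: "0 \<in> S" unfolding S_def using assms(1) by (intro CollectI exI[of _ "\<lambda>_. P0"]) auto
  have "d \<in> S"
  proof (rule ccontr)
    assume d: "d \<notin> S"
    have le: "n \<le> d" if "n \<in> S" for n
    proof -
      have "enat n \<le> Sup (enat ` S)" using that by (intro Sup_upper) simp
      then have "enat n \<le> enat d" unfolding assms(2) kd .
      then show ?thesis by simp
    qed
    have "d \<noteq> 0" using d 0 by metis
    have "Sup (enat ` S) \<le> enat (d - 1)"
    proof (rule Sup_least)
      fix x assume "x \<in> enat ` S"
      then obtain n where n: "n \<in> S" "x = enat n" by blast
      then have "n \<noteq> d" "n \<le> d" using d le by auto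
      then show "x \<le> enat (d - 1)" using n by simp
    qed
    then have "enat d \<le> enat (d - 1)" unfolding assms(2) kd .
    then show False using \<open>d \<noteq> 0\<close> by simp
  qed
  then show ?thesis by (simp add: S_def)
qed

text \<open>Minimal generators of the maximal ideal of the quotient lift to irredundant generators
  of the maximal ideal of \<open>R\<close> modulo its square, because the product of two proper
  ideals lies in that square. By exchange their number is the minimal one, hence the dimension, and
  \<open>regular_of_chain\<close> makes them a regular sequence.\<close>

lemma golod_local_quotient:
  fixes R :: "('a, 'b) ring_scheme"
  assumes reg: "regular_local_ring R \<mm>"
    and I: "ideal I R" "I \<noteq> carrier R" and J: "ideal J R" "J \<noteq> carrier R"
    and e: "e \<in> {1..t} \<rightarrow> carrier (cx_mod F 1)"
    and trim: "trimming_morphism R I J t e F G Q"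
    and split: "\<And>j. 1 \<le> j \<Longrightarrow> split_injection R (cx_mod F (j + 1)) (power_module t (cx_mod G j)) (Q j)"
    and F: "free_resolution R I F" and G: "minimal_free_resolution R \<mm> J G"
  shows "golod_local (R Quot (I \<cdot>\<^bsub>R\<^esub> J))"
proof -
  have loc: "local_ring R \<mm>" and dim: "enat (min_num_gens R \<mm>) = krull_dim R" using reg by (auto simp: regular_local_ring_def)
  interpret noetherian_local R \<mm>
    using loc by (auto simp: local_ring_def intro!: noetherian_local.intro noetherian_cring.intro noetherian_local_axioms.intro)
  define N where "N = I \<cdot>\<^bsub>R\<^esub> J"
  have Ni: "ideal N R" unfolding N_def by (rule ideal_prod_is_ideal[OF I(1) J(1)])
  have Im: "I \<subseteq> \<mm>" and Jm: "J \<subseteq> \<mm>" using proper_le_mm I J by auto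
  \<comment> \<open>Both factors lie in the maximal ideal. So nothing is lost modulo its square when
    passing to the quotient, and generators can be compared there.\<close>
  have N2: "N \<subseteq> \<mm> \<cdot>\<^bsub>R\<^esub> \<mm>"
  proof
    fix x assume "x \<in> N"
    then show "x \<in> \<mm> \<cdot>\<^bsub>R\<^esub> \<mm>" unfolding N_def
      by (induct rule: ideal_prod.induct) (use Im Jm in \<open>auto intro: ideal_prod.intros\<close>)
  qed
  then have Nm: "N \<subseteq> \<mm>" using mm2_sub by blast
  interpret N: ideal N R by (rule Ni)
  let ?A = "R Quot N" and ?f = "\<lambda>r. N +>\<^bsub>R\<^esub> r"
  interpret h: ring_hom_ring R ?A ?f by (rule N.phi_hom)
  have Ac: "cring ?A" by (rule N.quotient_is_cring[OF is_cring])
  interpret A: cring ?A by (rule Ac)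
  define \<nn> where "\<nn> = ?f ` \<mm>"
  have ni: "ideal \<nn> ?A" unfolding \<nn>_def by (rule ring_ideal_imp_quot_ideal[OF Ni mm_ideal])
  have in_n: "r \<in> \<mm>" if rR: "r \<in> carrier R" and rn: "?f r \<in> \<nn>" for r
  proof -
    obtain m where m: "m \<in> \<mm>" "?f r = ?f m" using rn by (auto simp: \<nn>_def)
    have mR: "m \<in> carrier R" using ideal_sub[OF mm_ideal m(1)] .
    have "r \<ominus>\<^bsub>R\<^esub> m \<in> \<mm>" using N.phi_eq_iff[OF rR mR] m(2) Nm by blast
    then show ?thesis using ideal_diff[OF mm_ideal rR, of "\<ominus>\<^bsub>R\<^esub> m"] mR m(1) ideal_minusD[OF mm_ideal] by (simp add: a_minus_def)
  qed
  have nproper: "\<nn> \<noteq> carrier ?A"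
  proof
    assume "\<nn> = carrier ?A"
    then have "?f \<one>\<^bsub>R\<^esub> \<in> \<nn>" by simp
    then show False using in_n[of "\<one>\<^bsub>R\<^esub>"] primeD(2)[OF mm_prime] by simp
  qed
  have units: "\<exists>y\<in>carrier ?A. y \<otimes>\<^bsub>?A\<^esub> x = \<one>\<^bsub>?A\<^esub>" if x: "x \<in> carrier ?A" "x \<notin> \<nn>" for x
  proof -
    obtain r where r: "r \<in> carrier R" "?f r = x" using N.phi_surj[OF x(1)] by blast
    then have "r \<notin> \<mm>" using x(2) by (auto simp: \<nn>_def)
    then obtain y where y: "y \<in> carrier R" "y \<otimes>\<^bsub>R\<^esub> r = \<one>\<^bsub>R\<^esub>" using unit_outside r(1) by blast
    have "?f y \<otimes>\<^bsub>?A\<^esub> x = ?f (y \<otimes>\<^bsub>R\<^esub> r)" unfolding r(2)[symmetric] by (rule h.hom_mult[symmetric, OF y(1) r(1)])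
    also have "\<dots> = \<one>\<^bsub>?A\<^esub>" unfolding y(2) by (rule h.hom_one)
    finally show ?thesis using y by (intro bexI[of _ "?f y"]) auto
  qed
  have "local_ring ?A \<nn>"
    unfolding local_ring_def
    using Ac N.quotient_noetherian[OF noetherian_ring_axioms] cring.maximal_of_units[OF Ac ni nproper units] by blast
  moreover have "trivial_massey_operation (koszul ?A xs)" if xs: "minimal_generators ?A \<nn> xs" for xs
  proof -
    have xs': "distinct xs" "set xs \<subseteq> carrier ?A" "genideal ?A (set xs) = \<nn>" "\<And>S. S \<subset> set xs \<Longrightarrow> genideal ?A S \<noteq> \<nn>"
      using xs by (auto simp: minimal_generators_def)
    obtain ys where ys: "set ys \<subseteq> carrier R" "map ?f ys = xs" "distinct ys" using N.lift_generators[OF xs'(2,1)] by blast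
    have fys: "?f ` set ys = set xs" using ys(2) by (metis set_map)
    have ys_m: "set ys \<subseteq> \<mm>"
    proof
      fix y assume y: "y \<in> set ys"
      then have "?f y \<in> \<nn>" using fys h.S.genideal_self[OF xs'(2)] xs'(3) by blast
      then show "y \<in> \<mm>" using in_n y ys(1) by blast
    qed
    have sub_cl: "\<mm> \<subseteq> cl S" if S: "S \<subseteq> carrier R" and g: "genideal ?A (?f ` S) = \<nn>" for S
    proof
      fix m assume m: "m \<in> \<mm>"
      have "?f m \<in> ?f ` genideal R S" using N.phi_Idl[OF S] g m by (auto simp: \<nn>_def)
      then obtain r where r: "r \<in> genideal R S" "?f m = ?f r" by blast
      have rR: "r \<in> carrier R" and mR: "m \<in> carrier R" using ideal_sub[OF genideal_ideal[OF S] r(1)] ideal_sub[OF mm_ideal m] by auto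
      have "m \<ominus>\<^bsub>R\<^esub> r \<in> cl S" using N.phi_eq_iff[OF mR rR] r(2) N2 cl_facts(3)[OF S] by blast
      moreover have "r \<in> cl S" using r(1) genideal_minimal[OF cl_facts(1)[OF S] cl_facts(2)[OF S]] by blast
      ultimately show "m \<in> cl S"
        using ideal_diff[OF cl_facts(1)[OF S] mR, of "\<ominus>\<^bsub>R\<^esub> r"] rR ideal_minusD[OF cl_facts(1)[OF S]] by (simp add: a_minus_def)
    qed
    have cl_ys: "\<mm> \<subseteq> cl (set ys)" using sub_cl[OF ys(1)] fys xs'(3) by simp
    then have gen: "genideal R (set ys) = \<mm>" by (rule cl_gen[OF ys_m])
    \<comment> \<open>If one lift were redundant modulo the square, the others would generate the
      maximal ideal by \<open>cl_gen\<close>, and so would their images in the quotient, against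
      minimality of \<open>xs\<close>.\<close>
    have irr: "u \<notin> cl (set ys - {u})" if u: "u \<in> set ys" for u
    proof
      assume uc: "u \<in> cl (set ys - {u})"
      have sR: "set ys - {u} \<subseteq> carrier R" using ys(1) by auto
      have "set ys \<subseteq> cl (set ys - {u})" using uc cl_facts(2)[OF sR] by blast
      then have "cl (set ys) \<subseteq> cl (set ys - {u})" using cl_facts[OF sR] by (intro cl_min)
      then have "\<mm> \<subseteq> cl (set ys - {u})" using cl_ys by blast
      then have "genideal R (set ys - {u}) = \<mm>" using ys_m by (intro cl_gen) auto
      then have "genideal ?A (?f ` (set ys - {u})) = \<nn>" using N.phi_Idl[OF sR] by (simp add: \<nn>_def)
      moreover have "?f ` (set ys - {u}) \<subset> set xs"
      proof -
        have inj: "inj_on ?f (set ys)" using ys(2) xs'(1) by (metis distinct_map)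
        have "?f u \<notin> ?f ` (set ys - {u})" using inj u by (auto simp: inj_on_def)
        then show ?thesis using fys u by blast
      qed
      ultimately show False using xs'(4) by blast
    qed
    define d where "d = min_num_gens R \<mm>"
    have "\<exists>S\<subseteq>carrier R. finite S \<and> card S = card (set ys) \<and> genideal R S = \<mm>" using ys(1) gen by blast
    then have "\<exists>S\<subseteq>carrier R. finite S \<and> card S = d \<and> genideal R S = \<mm>"
      unfolding d_def min_num_gens_def by (rule LeastI)
    then obtain S where S: "S \<subseteq> carrier R" "finite S" "card S = d" "genideal R S = \<mm>" by blast
    have "\<exists>S\<subseteq>carrier R. finite S \<and> card S = length ys \<and> genideal R S = \<mm>"
      by (rule exI[of _ "set ys"]) (use ys(1) gen distinct_card[OF ys(3)] in simp)
    then have "d \<le> length ys" unfolding d_def min_num_gens_def by (rule Least_le)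
    moreover have "length ys \<le> d"
    proof -
      have "S \<subseteq> \<mm>" using genideal_self[OF S(1)] S(4) by simp
      moreover have "\<mm> \<subseteq> cl S" using genideal_minimal[OF cl_facts(1)[OF S(1)] cl_facts(2)[OF S(1)]] S(4) by simp
      ultimately have "card (set ys) \<le> card S" using S(2) ys_m cl_ys irr by (intro irredundant_card_le) auto
      then show ?thesis using S(3) distinct_card[OF ys(3)] by simp
    qed
    ultimately have len: "length ys = d" by simp
    \<comment> \<open>A chain whose length is the number of generators is the extremal case of
      \<open>regular_of_chain\<close> for \<open>k = 0\<close>, where the ideal of the empty segment
      is zero.\<close>
    obtain P where P: "pchain P d" using krull_dim_chain[OF mm_prime, of d] dim by (auto simp: d_def pchain_def)
    have "multiples (self_module R) ys 0 \<subseteq> P 0"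
    proof -
      have "ideal (P 0) R" using P by (auto simp: pchain_def primeD(1))
      then show ?thesis using ideal_zeroD by (auto simp: multiples_def finsum_self_module)
    qed
    then have regi: "\<And>i r. \<lbrakk>i < length ys; r \<in> carrier R; ys ! i \<otimes>\<^bsub>R\<^esub> r \<in> multiples (self_module R) ys i\<rbrakk> \<Longrightarrow> r \<in> multiples (self_module R) ys i"
      using regular_of_chain[OF ys(1) gen _ P, of 0] len by auto
    interpret T: trimming_setup R I J F G t e Q ys \<mm>
    proof (rule trimming_setup.intro)
      show "regular_seq (self_module R) ys" unfolding regular_seq_def using regi by simp
      show "\<mm> = multiples (self_module R) ys (length ys)" using mk_Idl[OF ys(1)] gen by simp
    qed (fact is_cring J(1) ys(1) Jm e trim split F G)+
    have "trivial_massey_operation (koszul ?A (map ?f ys))"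
      unfolding N_def
    proof (rule T.massey_quotient[OF I(1) Im])
      fix r assume r: "r \<in> carrier R"
      show "r \<in> \<mm> \<or> (\<exists>s\<in>carrier R. s \<otimes>\<^bsub>R\<^esub> r \<ominus>\<^bsub>R\<^esub> \<one>\<^bsub>R\<^esub> \<in> \<mm>)"
      proof (cases "r \<in> \<mm>")
        case False
        then obtain s where "s \<in> carrier R" "s \<otimes>\<^bsub>R\<^esub> r = \<one>\<^bsub>R\<^esub>" using unit_outside r by blast
        then show ?thesis using ideal_zeroD[OF mm_ideal] by (intro disjI2 bexI[of _ s]) (simp_all add: a_minus_def r_neg)
      qed simp
    qed
    then show ?thesis using ys(2) by simp
  qed
  ultimately show ?thesis unfolding golod_local_def N_def by blast
qed

section \<open>Linear combinations of monomials\<close>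

context ring
begin

lemma finsum_closed_set:
  assumes "W \<subseteq> carrier R" "\<zero> \<in> W" "\<And>u v. u \<in> W \<Longrightarrow> v \<in> W \<Longrightarrow> u \<oplus> v \<in> W" "finite S" "\<And>i. i \<in> S \<Longrightarrow> f i \<in> W"
  shows "(\<Oplus>i\<in>S. f i) \<in> W"
  using assms(4,5)
proof (induct set: finite)
  case (insert x F)
  then have "f \<in> F \<rightarrow> carrier R" "f x \<in> carrier R" using assms(1) by auto
  then show ?case using insert assms(3) by simp
qed (use assms(2) in simp)

lemma combine_map_eq_finsum:
  assumes "distinct As" "c \<in> set As \<rightarrow> carrier R" "f \<in> set As \<rightarrow> carrier R"
  shows "combine (map c As) (map f As) = (\<Oplus>\<alpha>\<in>set As. c \<alpha> \<otimes> f \<alpha>)"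
  using assms
proof (induct As)
  case (Cons a As)
  then show ?case by (simp add: Pi_iff)
qed simp

lemma coefficient_function:
  assumes "distinct As" "length Ks = length As"
  shows "\<exists>c. Ks = map c As"
proof -
  define c where "c = (\<lambda>a. the (map_of (zip As Ks) a))"
  have "Ks = map c As"
  proof (rule nth_equalityI)
    show "length Ks = length (map c As)" using assms by simp
    fix i assume i: "i < length Ks"
    then have "map_of (zip As Ks) (As ! i) = Some (Ks ! i)" using assms by (intro map_of_zip_nth) auto
    then show "Ks ! i = map c As ! i" using i assms by (simp add: c_def)
  qed
  then show ?thesis by blast
qed

text \<open>Vectors already in the span of their successors are discarded from the end of the list
  on; the list gets strictly shorter as soon as something is discarded, which happens for dependent
  lists.\<close>

lemma spanning_refine:
  assumes K: "subfield K R" and Vs: "set Vs \<subseteq> carrier R"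
  shows "\<exists>Ws. independent K Ws \<and> Span K Ws = Span K Vs \<and> length Ws \<le> length Vs \<and>
    (\<not> independent K Vs \<longrightarrow> length Ws < length Vs)"
  using Vs
proof (induct Vs)
  case Nil
  then show ?case using li_Nil by (intro exI[of _ "[]"]) simp
next
  case (Cons v Vs)
  then obtain Ws where Ws: "independent K Ws" "Span K Ws = Span K Vs" "length Ws \<le> length Vs"
    "\<not> independent K Vs \<longrightarrow> length Ws < length Vs" by auto
  have v: "v \<in> carrier R" "set Vs \<subseteq> carrier R" using Cons(2) by auto
  show ?case
  proof (cases "v \<in> Span K Ws")
    case True
    have "set (v # Vs) \<subseteq> Span K Vs" using True Ws(2) Span_base_incl[OF K v(2)] by auto
    then have "Span K (v # Vs) \<subseteq> Span K Vs" by (rule mono_Span_subset[OF K _ v(2)])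
    moreover have "Span K Vs \<subseteq> Span K (v # Vs)" by (rule mono_Span[OF K v(2,1)])
    ultimately have "Span K Ws = Span K (v # Vs)" using Ws(2) by (metis subset_antisym)
    then show ?thesis using Ws by (intro exI[of _ Ws]) auto
  next
    case False
    have "independent K (v # Ws)" using False v Ws(1) by (intro li_Cons)
    moreover have "Span K (v # Ws) = Span K (v # Vs)" using Ws(2) by simp
    moreover have "length (v # Ws) < length (v # Vs)" if d: "\<not> independent K (v # Vs)"
    proof -
      have "\<not> independent K Vs" using d False v Ws(2) li_Cons[of v K Vs] by auto
      then show ?thesis using Ws(4) by simp
    qed
    ultimately show ?thesis using Ws(3) by (intro exI[of _ "v # Ws"]) auto
  qed
qed

text \<open>If \<open>Vs\<close> were dependent, \<open>spanning_refine\<close> would give an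
  independent list with the same span but shorter than the independent list \<open>Us\<close>
  contained in it.\<close>

lemma short_spanning_independent:
  assumes K: "subfield K R" and "independent K Us" "set Us \<subseteq> Span K Vs" "length Vs \<le> length Us" "set Vs \<subseteq> carrier R"
  shows "independent K Vs"
proof (rule ccontr)
  assume d: "\<not> independent K Vs"
  obtain Ws where Ws: "independent K Ws" "Span K Ws = Span K Vs" "length Ws < length Vs"
    using spanning_refine[OF K assms(5)] d by blast
  have "length Us \<le> length Ws" using independent_length_le[OF K assms(2) Ws(1)] Ws(2) assms(3) by simp
  then show False using Ws(3) assms(4) by simp
qed

text \<open>Only the later vectors are excluded, since \<open>independent\<close> builds lists from
  the right by adding a vector outside the span of the tail.\<close>

lemma irredundant_independent:
  assumes "set ys \<subseteq> carrier R" "\<And>us u vs. ys = us @ u # vs \<Longrightarrow> u \<notin> Span K vs"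
  shows "independent K ys"
  using assms
proof (induct ys)
  case (Cons y ys)
  have "independent K ys"
  proof (rule Cons(1))
    fix us u vs assume "ys = us @ u # vs"
    then show "u \<notin> Span K vs" using Cons(3)[of "y # us" u vs] by simp
  qed (use Cons(2) in simp)
  moreover have "y \<notin> Span K ys" using Cons(3)[of "[]" y ys] by simp
  ultimately show ?case using Cons(2) by (intro li_Cons) auto
qed (rule li_Nil)

end

section \<open>Monomials, polynomial rings and regularity of variables\<close>

abbreviation bump :: "nat \<Rightarrow> (nat \<Rightarrow> nat) \<Rightarrow> nat \<Rightarrow> nat" where "bump i \<alpha> \<equiv> \<alpha>(i := Suc (\<alpha> i))"

text \<open>Relations between monomials are allowed at this level, because the locale also has to
  describe new variables before they are known to be free.\<close>

locale monomials = cring R for R (structure) +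
  fixes K :: "'a set" and n :: nat and z :: "nat \<Rightarrow> 'a"
  assumes K: "subfield K R" and z: "z \<in> {..<n} \<rightarrow> carrier R"
begin

definition E where "E = {..<n} \<rightarrow>\<^sub>E (UNIV :: nat set)"

definition mon where "mon \<alpha> = (\<Otimes>i\<in>{..<n}. z i [^] (\<alpha> i :: nat))"

definition lc where "lc T = {(\<Oplus>\<alpha>\<in>S. b \<alpha> \<otimes> mon \<alpha>) | S b. finite S \<and> S \<subseteq> T \<and> b \<in> S \<rightarrow> K}"

lemma K_props:
  "K \<subseteq> carrier R" "\<zero> \<in> K" "\<one> \<in> K" "\<And>a b. a \<in> K \<Longrightarrow> b \<in> K \<Longrightarrow> a \<oplus> b \<in> K" "\<And>a b. a \<in> K \<Longrightarrow> b \<in> K \<Longrightarrow> a \<otimes> b \<in> K"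
  "\<And>a. a \<in> K \<Longrightarrow> \<ominus> a \<in> K" "\<And>a. a \<in> K \<Longrightarrow> a \<in> carrier R"
  using subringE[OF subfieldE(1)[OF K]] by auto

lemma z_closed: "i < n \<Longrightarrow> z i \<in> carrier R" using z by auto

lemma mon_closed [simp]: "mon \<alpha> \<in> carrier R"
  unfolding mon_def using z by (intro finprod_closed) auto

lemma bump_E: "\<lbrakk>\<alpha> \<in> E; i < n\<rbrakk> \<Longrightarrow> bump i \<alpha> \<in> E"
  by (auto simp: E_def PiE_iff extensional_def)

lemma mon_bump: assumes "i < n" shows "mon (bump i \<alpha>) = z i \<otimes> mon \<alpha>"
proof -
  have ins: "{..<n} = insert i ({..<n} - {i})" using assms by auto
  have "mon (bump i \<alpha>) = z i [^] Suc (\<alpha> i) \<otimes> (\<Otimes>j\<in>{..<n} - {i}. z j [^] bump i \<alpha> j)"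
    unfolding mon_def by (subst ins, subst finprod_insert) (use z assms in auto)
  also have "(\<Otimes>j\<in>{..<n} - {i}. z j [^] bump i \<alpha> j) = (\<Otimes>j\<in>{..<n} - {i}. z j [^] \<alpha> j)"
    by (rule finprod_cong') (use z in auto)
  also have "z i [^] Suc (\<alpha> i) = z i \<otimes> z i [^] \<alpha> i" using z_closed[OF assms] by (simp add: m_comm)
  also have "z i \<otimes> z i [^] \<alpha> i \<otimes> (\<Otimes>j\<in>{..<n} - {i}. z j [^] \<alpha> j)
      = z i \<otimes> (z i [^] \<alpha> i \<otimes> (\<Otimes>j\<in>{..<n} - {i}. z j [^] \<alpha> j))"
    using z assms by (intro m_assoc) (auto intro!: finprod_closed)
  also have "z i [^] \<alpha> i \<otimes> (\<Otimes>j\<in>{..<n} - {i}. z j [^] \<alpha> j) = mon \<alpha>"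
    unfolding mon_def by (subst (2) ins, subst finprod_insert) (use z assms in auto)
  finally show ?thesis .
qed

lemma mon_in:
  assumes "W \<subseteq> carrier R" "\<one> \<in> W" "\<And>u v. u \<in> W \<Longrightarrow> v \<in> W \<Longrightarrow> u \<otimes> v \<in> W" "\<And>i. i < n \<Longrightarrow> z i \<in> W"
  shows "mon \<alpha> \<in> W"
proof -
  have pow: "z i [^] k \<in> W" if "i < n" for i and k :: nat
    using that by (induct k) (auto simp: assms)
  have "(\<Otimes>i\<in>F. z i [^] \<alpha> i) \<in> W" if "finite F" "F \<subseteq> {..<n}" for F
    using that
  proof (induct set: finite)
    case (insert j F)
    have "(\<lambda>i. z i [^] \<alpha> i) \<in> F \<rightarrow> carrier R" "z j [^] \<alpha> j \<in> carrier R" using insert z_closed by auto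
    moreover have "z j [^] \<alpha> j \<in> W" using pow insert by auto
    ultimately show ?case using insert assms(3) by auto
  qed (simp add: assms(2))
  then show ?thesis unfolding mon_def by simp
qed

lemma mon_one: assumes "\<And>i. i < n \<Longrightarrow> \<alpha> i = 0" shows "mon \<alpha> = \<one>"
  unfolding mon_def by (rule finprod_one_eqI) (use assms in auto)

lemma unbump:
  assumes "\<alpha> \<in> E" "i < n" "\<alpha> i > 0"
  shows "\<exists>\<beta>\<in>E. \<alpha> = bump i \<beta>"
  using assms by (intro bexI[of _ "\<alpha>(i := \<alpha> i - 1)"]) (auto simp: E_def PiE_iff extensional_def)

lemma lcI: "\<lbrakk>finite S; S \<subseteq> T; b \<in> S \<rightarrow> K\<rbrakk> \<Longrightarrow> (\<Oplus>\<alpha>\<in>S. b \<alpha> \<otimes> mon \<alpha>) \<in> lc T"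
  unfolding lc_def by blast

lemma term_closed: "b \<in> S \<rightarrow> K \<Longrightarrow> (\<lambda>\<alpha>. b \<alpha> \<otimes> mon \<alpha>) \<in> S \<rightarrow> carrier R"
  using K_props(7) by (simp add: Pi_iff)

lemma lc_closed: "u \<in> lc T \<Longrightarrow> u \<in> carrier R"
  unfolding lc_def using term_closed finsum_closed by fastforce

lemma lc_zero: "\<zero> \<in> lc T"
  using lcI[of "{}" T "\<lambda>_. \<zero>"] by simp

lemma lc_mono: "T \<subseteq> T' \<Longrightarrow> lc T \<subseteq> lc T'"
  unfolding lc_def by blast

lemma lc_extend:
  assumes "finite S" "finite S'" "b \<in> S \<rightarrow> K" "S \<subseteq> S'"
  shows "(\<Oplus>\<alpha>\<in>S. b \<alpha> \<otimes> mon \<alpha>) = (\<Oplus>\<alpha>\<in>S'. (if \<alpha> \<in> S then b \<alpha> else \<zero>) \<otimes> mon \<alpha>)"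
proof -
  have "(\<Oplus>\<alpha>\<in>S. b \<alpha> \<otimes> mon \<alpha>) = (\<Oplus>\<alpha>\<in>S. (if \<alpha> \<in> S then b \<alpha> else \<zero>) \<otimes> mon \<alpha>)"
    by (rule finsum_cong_simple) (use assms K_props(7) in \<open>auto simp: Pi_iff\<close>)
  also have "\<dots> = (\<Oplus>\<alpha>\<in>S'. (if \<alpha> \<in> S then b \<alpha> else \<zero>) \<otimes> mon \<alpha>)"
    by (rule finsum_extend) (use assms K_props(7) in \<open>auto simp: Pi_iff\<close>)
  finally show ?thesis .
qed

lemma lc_add: assumes "u \<in> lc T" "v \<in> lc T" shows "u \<oplus> v \<in> lc T"
proof -
  obtain S b where u: "finite S" "S \<subseteq> T" "b \<in> S \<rightarrow> K" "u = (\<Oplus>\<alpha>\<in>S. b \<alpha> \<otimes> mon \<alpha>)" using assms(1) unfolding lc_def by blast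
  obtain S' b' where v: "finite S'" "S' \<subseteq> T" "b' \<in> S' \<rightarrow> K" "v = (\<Oplus>\<alpha>\<in>S'. b' \<alpha> \<otimes> mon \<alpha>)" using assms(2) unfolding lc_def by blast
  define c where "c = (\<lambda>\<alpha>. if \<alpha> \<in> S then b \<alpha> else \<zero>)"
  define c' where "c' = (\<lambda>\<alpha>. if \<alpha> \<in> S' then b' \<alpha> else \<zero>)"
  have c: "\<And>\<alpha>. c \<alpha> \<in> K" "\<And>\<alpha>. c' \<alpha> \<in> K" using u v K_props(2) by (auto simp: c_def c'_def)
  have cR: "\<And>\<alpha>. c \<alpha> \<in> carrier R" "\<And>\<alpha>. c' \<alpha> \<in> carrier R" using c K_props(7) by auto
  have "u = (\<Oplus>\<alpha>\<in>S \<union> S'. c \<alpha> \<otimes> mon \<alpha>)" unfolding u(4) c_def by (rule lc_extend) (use u v in auto)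
  moreover have "v = (\<Oplus>\<alpha>\<in>S \<union> S'. c' \<alpha> \<otimes> mon \<alpha>)" unfolding v(4) c'_def by (rule lc_extend) (use u v in auto)
  ultimately have "u \<oplus> v = (\<Oplus>\<alpha>\<in>S \<union> S'. c \<alpha> \<otimes> mon \<alpha> \<oplus> c' \<alpha> \<otimes> mon \<alpha>)"
    using cR by (subst finsum_addf) auto
  also have "\<dots> = (\<Oplus>\<alpha>\<in>S \<union> S'. (c \<alpha> \<oplus> c' \<alpha>) \<otimes> mon \<alpha>)"
    using cR by (intro finsum_cong_simple) (auto simp: l_distr)
  finally show ?thesis using u v c K_props(4) by (simp only:) (intro lcI, auto)
qed

lemma lc_smult: assumes "k \<in> K" "u \<in> lc T" shows "k \<otimes> u \<in> lc T"
proof -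
  obtain S b where u: "finite S" "S \<subseteq> T" "b \<in> S \<rightarrow> K" "u = (\<Oplus>\<alpha>\<in>S. b \<alpha> \<otimes> mon \<alpha>)" using assms(2) unfolding lc_def by blast
  have k: "k \<in> carrier R" by (rule K_props(7)[OF assms(1)])
  have "k \<otimes> u = (\<Oplus>\<alpha>\<in>S. k \<otimes> (b \<alpha> \<otimes> mon \<alpha>))" unfolding u(4) by (rule finsum_rdistr[OF u(1) k term_closed[OF u(3)]])
  also have "\<dots> = (\<Oplus>\<alpha>\<in>S. (k \<otimes> b \<alpha>) \<otimes> mon \<alpha>)"
    using u(3) k K_props(7) by (intro finsum_cong_simple) (auto simp: m_assoc Pi_iff)
  finally show ?thesis using u assms(1) K_props(5) by (simp only:) (intro lcI, auto)
qed

lemma lc_mon: assumes "\<alpha> \<in> T" shows "mon \<alpha> \<in> lc T"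
proof -
  have "(\<Oplus>\<beta>\<in>{\<alpha>}. (\<lambda>_. \<one>) \<beta> \<otimes> mon \<beta>) = mon \<alpha>" by simp
  then show ?thesis using lcI[of "{\<alpha>}" T "\<lambda>_. \<one>"] assms K_props(3) by simp
qed

text \<open>The span as the smallest set with these closure properties; this is how statements about
  all combinations are reduced to statements about monomials.\<close>

lemma lc_min:
  assumes "W \<subseteq> carrier R" "\<zero> \<in> W" "\<And>u v. u \<in> W \<Longrightarrow> v \<in> W \<Longrightarrow> u \<oplus> v \<in> W" "\<And>k u. k \<in> K \<Longrightarrow> u \<in> W \<Longrightarrow> k \<otimes> u \<in> W"
    "\<And>\<alpha>. \<alpha> \<in> T \<Longrightarrow> mon \<alpha> \<in> W"
  shows "lc T \<subseteq> W"
proof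
  fix u assume "u \<in> lc T"
  then obtain S b where u: "finite S" "S \<subseteq> T" "b \<in> S \<rightarrow> K" "u = (\<Oplus>\<alpha>\<in>S. b \<alpha> \<otimes> mon \<alpha>)" unfolding lc_def by blast
  show "u \<in> W" unfolding u(4)
    by (rule finsum_closed_set[OF assms(1,2) _ u(1)]) (use assms(3,4,5) u(2,3) in \<open>auto simp: Pi_iff subset_iff\<close>)
qed

lemma lc_times:
  assumes i: "i < n" and u: "u \<in> lc T" and T: "bump i ` T \<subseteq> T'"
  shows "z i \<otimes> u \<in> lc T'"
proof -
  have "lc T \<subseteq> {u \<in> carrier R. z i \<otimes> u \<in> lc T'}"
  proof (rule lc_min)
    fix u v assume "u \<in> {u \<in> carrier R. z i \<otimes> u \<in> lc T'}" "v \<in> {u \<in> carrier R. z i \<otimes> u \<in> lc T'}"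
    then show "u \<oplus> v \<in> {u \<in> carrier R. z i \<otimes> u \<in> lc T'}" using z_closed[OF i] lc_add by (auto simp: r_distr)
  next
    fix k u assume k: "k \<in> K" and "u \<in> {u \<in> carrier R. z i \<otimes> u \<in> lc T'}"
    then show "k \<otimes> u \<in> {u \<in> carrier R. z i \<otimes> u \<in> lc T'}"
      using z_closed[OF i] lc_smult[OF k, of "z i \<otimes> u" T'] K_props(7)[OF k] by (auto simp: m_lcomm)
  next
    fix \<alpha> assume "\<alpha> \<in> T"
    then have "mon (bump i \<alpha>) \<in> lc T'" using T by (intro lc_mon) auto
    then show "mon \<alpha> \<in> {u \<in> carrier R. z i \<otimes> u \<in> lc T'}" using mon_bump[OF i] by simp
  qed (use lc_zero z_closed[OF i] in auto)
  then show ?thesis using u by blast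
qed

lemma lc_split: assumes "u \<in> lc T" shows "\<exists>v\<in>lc (T \<inter> Z). \<exists>w\<in>lc (T - Z). u = v \<oplus> w"
proof -
  obtain S b where u: "finite S" "S \<subseteq> T" "b \<in> S \<rightarrow> K" "u = (\<Oplus>\<alpha>\<in>S. b \<alpha> \<otimes> mon \<alpha>)" using assms unfolding lc_def by blast
  have "u = (\<Oplus>\<alpha>\<in>(S \<inter> Z) \<union> (S - Z). b \<alpha> \<otimes> mon \<alpha>)" unfolding u(4) by (rule arg_cong[where f = "finsum R _"]) auto
  also have "\<dots> = (\<Oplus>\<alpha>\<in>S \<inter> Z. b \<alpha> \<otimes> mon \<alpha>) \<oplus> (\<Oplus>\<alpha>\<in>S - Z. b \<alpha> \<otimes> mon \<alpha>)"
    using term_closed[OF u(3)] u(1) by (intro finsum_Un_disjoint) auto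
  finally have e: "u = (\<Oplus>\<alpha>\<in>S \<inter> Z. b \<alpha> \<otimes> mon \<alpha>) \<oplus> (\<Oplus>\<alpha>\<in>S - Z. b \<alpha> \<otimes> mon \<alpha>)" .
  have "(\<Oplus>\<alpha>\<in>S \<inter> Z. b \<alpha> \<otimes> mon \<alpha>) \<in> lc (T \<inter> Z)" "(\<Oplus>\<alpha>\<in>S - Z. b \<alpha> \<otimes> mon \<alpha>) \<in> lc (T - Z)"
    using u by (auto intro!: lcI)
  then show ?thesis using e by blast
qed

text \<open>Finite truncations of the set of exponents: with them, independence of new monomials can
  be obtained by counting.\<close>

definition upto_degree where "upto_degree d = {\<alpha> \<in> E. (\<Sum>i<n. \<alpha> i) \<le> d}"

lemma upto_degree_bump: "\<lbrakk>i < n; \<alpha> \<in> upto_degree d\<rbrakk> \<Longrightarrow> bump i \<alpha> \<in> upto_degree (Suc d)"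
proof -
  assume i: "i < n" and a: "\<alpha> \<in> upto_degree d"
  have "(\<Sum>j<n. bump i \<alpha> j) = (\<Sum>j<n. \<alpha> j + (if j = i then 1 else 0))" by (rule sum.cong) auto
  also have "\<dots> = Suc (\<Sum>j<n. \<alpha> j)" using i by (simp add: sum.distrib)
  finally show ?thesis using i a bump_E by (auto simp: upto_degree_def)
qed

lemma upto_degree_unbump:
  assumes "\<alpha> \<in> upto_degree (Suc d)" "i < n" "\<alpha> i > 0"
  shows "\<exists>\<beta>\<in>upto_degree d. \<alpha> = bump i \<beta>"
proof -
  have aE: "\<alpha> \<in> E" using assms(1) by (simp add: upto_degree_def)
  obtain \<beta> where b: "\<beta> \<in> E" "\<alpha> = bump i \<beta>" using unbump[OF aE assms(2,3)] by blast
  have "(\<Sum>j<n. bump i \<beta> j) = (\<Sum>j<n. \<beta> j + (if j = i then 1 else 0))" by (rule sum.cong) auto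
  also have "\<dots> = Suc (\<Sum>j<n. \<beta> j)" using assms(2) by (simp add: sum.distrib)
  finally have "\<beta> \<in> upto_degree d" using assms(1) b by (auto simp: upto_degree_def)
  then show ?thesis using b by blast
qed

lemma finite_upto_degree: "finite (upto_degree d)"
proof (rule finite_subset)
  show "upto_degree d \<subseteq> {..<n} \<rightarrow>\<^sub>E {..d}"
  proof
    fix \<alpha> assume a: "\<alpha> \<in> upto_degree d"
    have "\<alpha> i \<le> d" if "i < n" for i
      using a that member_le_sum[of i "{..<n}" \<alpha>] by (auto simp: upto_degree_def)
    then show "\<alpha> \<in> {..<n} \<rightarrow>\<^sub>E {..d}" using a by (auto simp: upto_degree_def E_def PiE_iff)
  qed
qed (auto intro: finite_PiE)

lemma finite_sub_upto: assumes "finite S" "S \<subseteq> E" shows "\<exists>d. S \<subseteq> upto_degree d"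
proof (intro exI subsetI)
  fix \<alpha> assume "\<alpha> \<in> S"
  then show "\<alpha> \<in> upto_degree (\<Sum>\<beta>\<in>S. \<Sum>i<n. \<beta> i)"
    using assms member_le_sum[of \<alpha> S "\<lambda>\<beta>. \<Sum>i<n. \<beta> i"] by (auto simp: upto_degree_def)
qed

end

text \<open>The ring is the polynomial ring over \<open>K\<close> in the elements
  \<open>z i\<close>, described by its basis of monomials.\<close>

locale free_monomials = monomials +
  assumes indep: "\<And>S c. \<lbrakk>finite S; S \<subseteq> E; c \<in> S \<rightarrow> K; (\<Oplus>\<alpha>\<in>S. c \<alpha> \<otimes> mon \<alpha>) = \<zero>\<rbrakk> \<Longrightarrow> \<forall>\<alpha>\<in>S. c \<alpha> = \<zero>"
    and spans: "carrier R \<subseteq> lc E"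
begin

lemma lc_zero_coeffs:
  assumes "finite S" "c \<in> S \<rightarrow> K" "\<forall>\<alpha>\<in>S. c \<alpha> = \<zero>" shows "(\<Oplus>\<alpha>\<in>S. c \<alpha> \<otimes> mon \<alpha>) = \<zero>"
  by (rule finsum_all_zero) (use assms in simp)

text \<open>Two expressions over disjoint sets of exponents combine, one with its sign changed, into
  a single vanishing combination, so all coefficients vanish.\<close>

lemma lc_disjoint:
  assumes T: "T \<subseteq> E" "T' \<subseteq> E" "T \<inter> T' = {}" and u: "u \<in> lc T" "u \<in> lc T'"
  shows "u = \<zero>"
proof -
  obtain S b where S: "finite S" "S \<subseteq> T" "b \<in> S \<rightarrow> K" "u = (\<Oplus>\<alpha>\<in>S. b \<alpha> \<otimes> mon \<alpha>)" using u(1) unfolding lc_def by blast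
  have uR: "u \<in> carrier R" by (rule lc_closed[OF u(1)])
  have "\<ominus> u = \<ominus> \<one> \<otimes> u" using uR by (simp add: l_minus)
  then have "\<ominus> u \<in> lc T'" using lc_smult[OF _ u(2), of "\<ominus> \<one>"] K_props(3,6) by simp
  then obtain S' b' where S': "finite S'" "S' \<subseteq> T'" "b' \<in> S' \<rightarrow> K" "\<ominus> u = (\<Oplus>\<alpha>\<in>S'. b' \<alpha> \<otimes> mon \<alpha>)" unfolding lc_def by blast
  define c where "c = (\<lambda>\<alpha>. if \<alpha> \<in> S then b \<alpha> else b' \<alpha>)"
  have dis: "S \<inter> S' = {}" using S S' T by blast
  have cK: "c \<in> S \<union> S' \<rightarrow> K" using S(3) S'(3) by (auto simp: c_def)
  have "(\<Oplus>\<alpha>\<in>S \<union> S'. c \<alpha> \<otimes> mon \<alpha>) = (\<Oplus>\<alpha>\<in>S. c \<alpha> \<otimes> mon \<alpha>) \<oplus> (\<Oplus>\<alpha>\<in>S'. c \<alpha> \<otimes> mon \<alpha>)"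
    by (rule finsum_Un_disjoint[OF S(1) S'(1) dis]) (use cK in \<open>auto intro!: term_closed\<close>)
  also have "(\<Oplus>\<alpha>\<in>S. c \<alpha> \<otimes> mon \<alpha>) = u" unfolding S(4)
    by (rule finsum_cong_simple) (use S(3) K_props(7) in \<open>auto simp: c_def Pi_iff\<close>)
  also have "(\<Oplus>\<alpha>\<in>S'. c \<alpha> \<otimes> mon \<alpha>) = \<ominus> u" unfolding S'(4)
    by (rule finsum_cong_simple) (use S'(3) K_props(7) dis in \<open>auto simp: c_def Pi_iff\<close>)
  also have "u \<oplus> \<ominus> u = \<zero>" using uR by (rule r_neg)
  finally have "\<forall>\<alpha>\<in>S \<union> S'. c \<alpha> = \<zero>" using S S' T cK by (intro indep) auto
  then have "c \<alpha> = \<zero>" if "\<alpha> \<in> S" for \<alpha> using that by blast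
  then have "\<forall>\<alpha>\<in>S. b \<alpha> = \<zero>" by (simp add: c_def)
  then show ?thesis unfolding S(4) using lc_zero_coeffs S by blast
qed

text \<open>Multiplication by a variable shifts exponents injectively, so the product has the same
  coefficients at other monomials.\<close>

lemma times_cancel:
  assumes T: "T \<subseteq> E" and u: "u \<in> lc T" and i: "i < n" and 0: "z i \<otimes> u = \<zero>"
  shows "u = \<zero>"
proof -
  obtain S b where S: "finite S" "S \<subseteq> T" "b \<in> S \<rightarrow> K" "u = (\<Oplus>\<alpha>\<in>S. b \<alpha> \<otimes> mon \<alpha>)" using u unfolding lc_def by blast
  have inj: "inj_on (bump i) S"
  proof (rule inj_onI)
    fix \<alpha> \<beta> assume e: "bump i \<alpha> = bump i \<beta>"
    show "\<alpha> = \<beta>"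
    proof
      fix j show "\<alpha> j = \<beta> j" using fun_cong[OF e, of j] by (auto split: if_splits)
    qed
  qed
  \<comment> \<open>The coefficients moved along the shift of exponents; the inverse is meaningful
    on the image, where alone it is used.\<close>
  define c where "c = (\<lambda>\<beta>. b (inv_into S (bump i) \<beta>))"
  have cb: "c (bump i \<alpha>) = b \<alpha>" if "\<alpha> \<in> S" for \<alpha>
    unfolding c_def by (rule arg_cong[where f = b]) (rule inv_into_f_f[OF inj that])
  have cK: "c \<in> bump i ` S \<rightarrow> K" using S(3) cb by auto
  have zi: "z i \<in> carrier R" by (rule z_closed[OF i])
  have "(\<Oplus>\<beta>\<in>bump i ` S. c \<beta> \<otimes> mon \<beta>) = (\<Oplus>\<alpha>\<in>S. c (bump i \<alpha>) \<otimes> mon (bump i \<alpha>))"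
    by (rule finsum_reindex[OF term_closed[OF cK] inj])
  also have "\<dots> = (\<Oplus>\<alpha>\<in>S. z i \<otimes> (b \<alpha> \<otimes> mon \<alpha>))"
  proof (rule finsum_cong_simple)
    fix \<alpha> assume a: "\<alpha> \<in> S"
    then have "b \<alpha> \<in> carrier R" using S(3) K_props(7) by auto
    then show "c (bump i \<alpha>) \<otimes> mon (bump i \<alpha>) = z i \<otimes> (b \<alpha> \<otimes> mon \<alpha>)" "z i \<otimes> (b \<alpha> \<otimes> mon \<alpha>) \<in> carrier R"
      using cb[OF a] mon_bump[OF i] zi by (simp_all only: m_lcomm mon_closed m_closed)
  qed
  also have "\<dots> = z i \<otimes> u" unfolding S(4) by (rule finsum_rdistr[symmetric, OF S(1) zi term_closed[OF S(3)]])
  finally have "(\<Oplus>\<beta>\<in>bump i ` S. c \<beta> \<otimes> mon \<beta>) = \<zero>" using 0 by simp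
  then have "\<forall>\<beta>\<in>bump i ` S. c \<beta> = \<zero>" using S T cK bump_E i by (intro indep) auto
  then have "\<forall>\<alpha>\<in>S. b \<alpha> = \<zero>" using cb by auto
  then show ?thesis unfolding S(4) using lc_zero_coeffs S by blast
qed

text \<open>The ideal of the first \<open>k\<close> variables is the span of the monomials divisible
  by one of them. Split r = v + w with w in that ideal and v a combination of the other monomials.
  If z_k r is in the ideal, so is z_k v; but z_k v again involves only other monomials, so it is
  zero and v = 0.\<close>

lemma regular_variables:
  assumes ys: "length ys = n" "\<And>i. i < n \<Longrightarrow> ys ! i = z i"
  shows "regular_seq (self_module R) ys"
proof -
  have ysR: "set ys \<subseteq> carrier R" using ys z_closed by (auto simp: set_conv_nth)
  define Z where "Z k = {\<alpha> \<in> E. \<forall>i<k. \<alpha> i = 0}" for k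
  have mk_id: "ideal (mk ys k) R" if "k \<le> n" for k using mk_ideal[OF ysR] that ys by simp
  have bE: "bump i ` E \<subseteq> E" if "i < n" for i using bump_E that by auto
  have mk_lc: "mk ys k \<subseteq> lc (E - Z k)" if k: "k \<le> n" for k
  proof
    fix u assume "u \<in> mk ys k"
    then obtain m where m: "m \<in> {..<k} \<rightarrow> carrier R" "u = (\<Oplus>i\<in>{..<k}. ys ! i \<otimes> m i)"
      by (auto simp: multiples_def finsum_self_module)
    show "u \<in> lc (E - Z k)" unfolding m(2)
    proof (rule finsum_closed_set)
      fix i assume i: "i \<in> {..<k}"
      then have "m i \<in> lc E" using m(1) spans by auto
      moreover have "bump i ` E \<subseteq> E - Z k" using bE[of i] i k by (auto simp: Z_def)
      ultimately show "ys ! i \<otimes> m i \<in> lc (E - Z k)" using i k ys(2)[of i] lc_times[of i "m i" E] by auto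
    qed (auto intro: lc_zero lc_add lc_closed)
  qed
  have lc_mk: "lc (E - Z k) \<subseteq> mk ys k" if k: "k \<le> n" for k
  proof (rule lc_min)
    note id = mk_id[OF k]
    show "mk ys k \<subseteq> carrier R" using ideal_sub[OF id] by blast
    show "\<zero> \<in> mk ys k" by (rule ideal_zeroD[OF id])
    show "u \<oplus> v \<in> mk ys k" if "u \<in> mk ys k" "v \<in> mk ys k" for u v by (rule ideal_addD[OF id that])
    show "c \<otimes> u \<in> mk ys k" if "c \<in> K" "u \<in> mk ys k" for c u using ideal.I_l_closed[OF id that(2)] K_props(7) that by blast
    fix \<alpha> assume "\<alpha> \<in> E - Z k"
    then obtain i where i: "i < k" "\<alpha> i > 0" "\<alpha> \<in> E" by (auto simp: Z_def)
    obtain \<beta> where b: "\<alpha> = bump i \<beta>" using unbump[OF i(3) _ i(2)] i k by auto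
    have yi: "\<And>j. j < k \<Longrightarrow> ys ! j \<in> carrier R" using ys z_closed k by auto
    have "(\<Oplus>j\<in>{..<k}. ys ! j \<otimes> (if j = i then mon \<beta> else \<zero>)) = ys ! i \<otimes> (if i = i then mon \<beta> else \<zero>)"
      by (rule finsum_single) (use i yi in auto)
    also have "\<dots> = mon \<alpha>" unfolding b using mon_bump[of i \<beta>] i k ys(2)[of i] by simp
    finally have "mon \<alpha> = (\<Oplus>j\<in>{..<k}. ys ! j \<otimes> (if j = i then mon \<beta> else \<zero>))" ..
    moreover have "(\<lambda>j. if j = i then mon \<beta> else \<zero>) \<in> {..<k} \<rightarrow> carrier R" by simp
    ultimately have "\<exists>m. mon \<alpha> = (\<Oplus>j\<in>{..<k}. ys ! j \<otimes> m j) \<and> m \<in> {..<k} \<rightarrow> carrier R"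
      by (intro exI conjI)
    then show "mon \<alpha> \<in> mk ys k" by (simp add: multiples_def finsum_self_module)
  qed
  have "r \<in> mk ys k" if k: "k < n" and r: "r \<in> carrier R" and yr: "ys ! k \<otimes> r \<in> mk ys k" for k r
  proof -
    have k': "k \<le> n" using k by simp
    obtain v w where vw: "v \<in> lc (E \<inter> Z k)" "w \<in> lc (E - Z k)" "r = v \<oplus> w" using lc_split spans r by blast
    have c: "v \<in> carrier R" "w \<in> carrier R" "z k \<in> carrier R" using vw lc_closed z_closed[OF k] by auto
    have w: "w \<in> mk ys k" using vw(2) lc_mk[OF k'] by blast
    then have zw: "z k \<otimes> w \<in> mk ys k" using c ideal.I_l_closed[OF mk_id[OF k']] by blast
    have "z k \<otimes> v \<oplus> z k \<otimes> w \<in> mk ys k" using yr ys(2)[OF k] c unfolding vw(3) by (simp add: r_distr)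
    then have "z k \<otimes> v \<in> mk ys k" using ideal_diff[OF mk_id[OF k'] _ _ _ zw] c by simp
    then have "z k \<otimes> v \<in> lc (E - Z k)" using mk_lc[OF k'] by blast
    moreover have "z k \<otimes> v \<in> lc (Z k)"
      by (rule lc_times[OF k vw(1)]) (use bE[OF k] in \<open>auto simp: Z_def\<close>)
    ultimately have "z k \<otimes> v = \<zero>" by (intro lc_disjoint[of "Z k" "E - Z k"]) (auto simp: Z_def)
    then have "v = \<zero>" by (intro times_cancel[OF _ vw(1) k]) auto
    then show ?thesis using vw(3) w c by simp
  qed
  then show ?thesis unfolding regular_seq_def using ys(1) by simp
qed

text \<open>The new monomials span the polynomials of degree at most \<open>d\<close> and are as many as the old ones,
  hence they are linearly independent.\<close>

lemma change_variables:
  assumes y: "y \<in> {..<n} \<rightarrow> carrier R" and x: "\<And>i. i < n \<Longrightarrow> \<exists>c\<in>{..<n} \<rightarrow> K. z i = (\<Oplus>j\<in>{..<n}. c j \<otimes> y j)"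
  shows "free_monomials R K n y"
proof -
  interpret Y: monomials R K n y by (intro monomials.intro monomials_axioms.intro is_cring K y)
  \<comment> \<open>Multiplication by an old variable raises the degree in the new variables by at
    most one, since the old variables are linear in the new ones. Hence old monomials of degree at
    most d are combinations of new ones of degree at most d.\<close>
  have times: "z i \<otimes> v \<in> Y.lc (upto_degree (Suc d))" if i: "i < n" and v: "v \<in> Y.lc (upto_degree d)" for i v d
  proof -
    obtain c where c: "c \<in> {..<n} \<rightarrow> K" "z i = (\<Oplus>j\<in>{..<n}. c j \<otimes> y j)" using x[OF i] by blast
    have cR: "\<And>j. j < n \<Longrightarrow> c j \<in> carrier R" "\<And>j. j < n \<Longrightarrow> y j \<in> carrier R" using c(1) K_props(7) y by auto
    have vR: "v \<in> carrier R" by (rule Y.lc_closed[OF v])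
    have "z i \<otimes> v = (\<Oplus>j\<in>{..<n}. (c j \<otimes> y j) \<otimes> v)" unfolding c(2)
      by (rule finsum_ldistr) (use cR vR in auto)
    also have "\<dots> = (\<Oplus>j\<in>{..<n}. c j \<otimes> (y j \<otimes> v))"
      by (rule finsum_cong_simple) (use cR vR in \<open>auto simp: m_assoc\<close>)
    also have "\<dots> \<in> Y.lc (upto_degree (Suc d))"
    proof (rule finsum_closed_set)
      fix j assume j: "j \<in> {..<n}"
      have "bump j ` upto_degree d \<subseteq> upto_degree (Suc d)" using j upto_degree_bump by auto
      then have "y j \<otimes> v \<in> Y.lc (upto_degree (Suc d))" using j by (intro Y.lc_times[OF _ v]) auto
      then show "c j \<otimes> (y j \<otimes> v) \<in> Y.lc (upto_degree (Suc d))" using Y.lc_smult[OF funcset_mem[OF c(1) j]] by blast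
    qed (auto intro: Y.lc_zero Y.lc_add Y.lc_closed)
    finally show ?thesis .
  qed
  have mons: "mon \<alpha> \<in> Y.lc (upto_degree d)" if "\<alpha> \<in> upto_degree d" for \<alpha> d
    using that
  proof (induct d arbitrary: \<alpha>)
    case (0 \<alpha>)
    then have z0: "\<And>i. i < n \<Longrightarrow> \<alpha> i = 0" by (auto simp: upto_degree_def)
    have "mon \<alpha> = Y.mon \<alpha>" using mon_one[OF z0] Y.mon_one[OF z0] by simp
    then show ?case using 0 Y.lc_mon[of \<alpha>] by simp
  next
    case (Suc d \<alpha>)
    show ?case
    proof (cases "\<forall>i<n. \<alpha> i = 0")
      case True
      then have "mon \<alpha> = Y.mon \<alpha>" using mon_one[of \<alpha>] Y.mon_one[of \<alpha>] by simp
      then show ?thesis using Suc(2) Y.lc_mon[of \<alpha>] by simp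
    next
      case False
      then obtain i where i: "i < n" "\<alpha> i > 0" by auto
      obtain \<beta> where b: "\<beta> \<in> upto_degree d" "\<alpha> = bump i \<beta>" using upto_degree_unbump[OF Suc(2) i] by blast
      show ?thesis unfolding b(2) mon_bump[OF i(1)] by (rule times[OF i(1) Suc(1)[OF b(1)]])
    qed
  qed
  show ?thesis
  proof (intro free_monomials.intro free_monomials_axioms.intro Y.monomials_axioms)
    have "lc E \<subseteq> Y.lc E"
    proof (rule lc_min)
      fix \<alpha> assume a: "\<alpha> \<in> E"
      obtain d where "{\<alpha>} \<subseteq> upto_degree d" using finite_sub_upto[of "{\<alpha>}"] a by auto
      then have "mon \<alpha> \<in> Y.lc (upto_degree d)" using mons by simp
      then show "mon \<alpha> \<in> Y.lc E" using Y.lc_mono[of "upto_degree d" E] by (auto simp: upto_degree_def)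
    qed (auto intro: Y.lc_zero Y.lc_add Y.lc_closed Y.lc_smult)
    then show "carrier R \<subseteq> Y.lc Y.E" using spans by simp
  next
    fix S c assume S: "finite S" "S \<subseteq> Y.E" "c \<in> S \<rightarrow> K" "(\<Oplus>\<alpha>\<in>S. c \<alpha> \<otimes> Y.mon \<alpha>) = \<zero>"
    obtain d where d: "S \<subseteq> upto_degree d" using finite_sub_upto[OF S(1,2)] by blast
    obtain As where As: "set As = upto_degree d" "distinct As" using finite_distinct_list[OF finite_upto_degree] by blast
    have AE: "set As \<subseteq> E" using As by (auto simp: upto_degree_def)
    have ind: "independent K (map mon As)"
    proof (rule trivial_combine_imp_independent[OF K])
      show "set (map mon As) \<subseteq> carrier R" by auto
      fix Ks assume Ks: "set Ks \<subseteq> K" "combine Ks (map mon As) = \<zero>"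
      have "set Ks \<subseteq> carrier R" "set (map mon As) \<subseteq> carrier R" using Ks K_props(1) by auto
      \<comment> \<open>\<open>combine\<close> accepts coefficient lists of any length; after
        padding or truncation the list can be read as a function on exponents.\<close>
      then obtain Ks' where Ks': "set (take (length (map mon As)) Ks) \<subseteq> set Ks'"
        "set Ks' \<subseteq> set (take (length (map mon As)) Ks) \<union> {\<zero>}" "length Ks' = length (map mon As)" "combine Ks' (map mon As) = \<zero>"
        using combine_normalize[OF _ _ Ks(2)] by metis
      obtain b where b: "Ks' = map b As" using coefficient_function[OF As(2), of Ks'] Ks'(3) by auto
      have "set Ks' \<subseteq> K" using Ks'(2) Ks(1) K_props(2) set_take_subset[of "length (map mon As)" Ks] by blast
      then have bK: "b \<in> set As \<rightarrow> K" unfolding b by auto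
      have bR: "b \<in> set As \<rightarrow> carrier R" using bK K_props(7) by auto
      have "(\<Oplus>\<alpha>\<in>set As. b \<alpha> \<otimes> mon \<alpha>) = combine (map b As) (map mon As)"
        by (rule combine_map_eq_finsum[symmetric, OF As(2) bR]) simp
      then have "(\<Oplus>\<alpha>\<in>set As. b \<alpha> \<otimes> mon \<alpha>) = \<zero>" using Ks'(4) b by simp
      then have "\<forall>\<alpha>\<in>set As. b \<alpha> = \<zero>" using AE bK by (intro indep) auto
      then have "set Ks' \<subseteq> {\<zero>}" unfolding b by auto
      then show "set (take (length (map mon As)) Ks) \<subseteq> {\<zero>}" using Ks'(1) by blast
    qed
    have VR: "set (map Y.mon As) \<subseteq> carrier R" by auto
    have "Y.lc (set As) \<subseteq> Span K (map Y.mon As)"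
      by (rule Y.lc_min) (use Span_subgroup_props[OF K VR] Span_smult_closed[OF K VR] Span_base_incl[OF K VR] in auto)
    then have "set (map mon As) \<subseteq> Span K (map Y.mon As)" using mons As(1) by auto
    \<comment> \<open>Old and new monomials are indexed by the same list \<open>As\<close>, so the
      new list is no longer than the independent old one contained in its span.\<close>
    then have indY: "independent K (map Y.mon As)" by (rule short_spanning_independent[OF K ind _ _ VR]) simp
    define c' where "c' = (\<lambda>\<alpha>. if \<alpha> \<in> S then c \<alpha> else \<zero>)"
    have c'K: "\<And>\<alpha>. c' \<alpha> \<in> K" using S(3) K_props(2) by (auto simp: c'_def)
    have "combine (map c' As) (map Y.mon As) = (\<Oplus>\<alpha>\<in>set As. c' \<alpha> \<otimes> Y.mon \<alpha>)"
      by (rule combine_map_eq_finsum[OF As(2)]) (use c'K K_props(7) in auto)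
    also have "\<dots> = (\<Oplus>\<alpha>\<in>S. c \<alpha> \<otimes> Y.mon \<alpha>)" unfolding c'_def
      by (rule Y.lc_extend[symmetric]) (use S d As(1) finite_upto_degree in auto)
    finally have "combine (map c' As) (map Y.mon As) = \<zero>" using S(4) by simp
    then have "set (take (length (map Y.mon As)) (map c' As)) \<subseteq> {\<zero>}"
      by (intro independent_imp_trivial_combine[OF K indY]) (use c'K in auto)
    then have "\<forall>\<alpha>\<in>set As. c' \<alpha> = \<zero>" by auto
    then have "c' \<alpha> = \<zero>" if "\<alpha> \<in> S" for \<alpha> using d As(1) that by blast
    then show "\<forall>\<alpha>\<in>S. c \<alpha> = \<zero>" by (simp add: c'_def)
  qed
qed

end

section \<open>Graded rings\<close>

lemma (in ring) span_sub_ideal: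
  assumes a: "ideal a R" and K: "K \<subseteq> carrier R" and Us: "set Us \<subseteq> a" shows "Span K Us \<subseteq> a"
  using Us
proof (induct Us)
  case Nil
  then show ?case using additive_subgroup.zero_closed[OF ideal.axioms(1)[OF a]] by simp
next
  case (Cons u Us)
  show ?case
  proof
    fix v assume "v \<in> Span K (u # Us)"
    then obtain k w where v: "k \<in> K" "w \<in> Span K Us" "v = k \<otimes> u \<oplus> w" by (auto simp: line_extension_mem_iff)
    have "k \<otimes> u \<in> a" using ideal.I_l_closed[OF a] v(1) K Cons(2) by auto
    moreover have "w \<in> a" using v(2) Cons by auto
    ultimately show "v \<in> a" unfolding v(3) by (rule additive_subgroup.a_closed[OF ideal.axioms(1)[OF a]])
  qed
qed

locale graded = cring R for R (structure) +
  fixes gr :: "nat \<Rightarrow> 'a set"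
  assumes dsd: "direct_sum_decomposition R gr" and gr_one: "\<one> \<in> gr 0"
    and gr_mult: "\<And>i j a b. \<lbrakk>a \<in> gr i; b \<in> gr j\<rbrakk> \<Longrightarrow> a \<otimes> b \<in> gr (i + j)"
begin

lemma gr_additive: "additive_subgroup (gr i) R"
  using dsd by (simp add: direct_sum_decomposition_def)

lemma gr_props:
  "\<zero> \<in> gr i" "\<And>a b. a \<in> gr i \<Longrightarrow> b \<in> gr i \<Longrightarrow> a \<oplus> b \<in> gr i" "\<And>a. a \<in> gr i \<Longrightarrow> \<ominus> a \<in> gr i" "\<And>a. a \<in> gr i \<Longrightarrow> a \<in> carrier R"
  using additive_subgroup.zero_closed[OF gr_additive] additive_subgroup.a_closed[OF gr_additive]
    additive_subgroup.a_inv_closed[OF gr_additive] additive_subgroup.a_Hcarr[OF gr_additive] by auto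

definition hcomp where
  "hcomp r = (THE c. (\<forall>i. c i \<in> gr i) \<and> finite {i. c i \<noteq> \<zero>} \<and> r = (\<Oplus>i\<in>{i. c i \<noteq> \<zero>}. c i))"

lemma hcomp_ex1: "r \<in> carrier R \<Longrightarrow> \<exists>!c. (\<forall>i. c i \<in> gr i) \<and> finite {i. c i \<noteq> \<zero>} \<and> r = (\<Oplus>i\<in>{i. c i \<noteq> \<zero>}. c i)"
  using dsd by (simp add: direct_sum_decomposition_def)

lemma hcomp_props:
  assumes "r \<in> carrier R"
  shows "hcomp r i \<in> gr i" "finite {i. hcomp r i \<noteq> \<zero>}" "r = (\<Oplus>i\<in>{i. hcomp r i \<noteq> \<zero>}. hcomp r i)" "hcomp r i \<in> carrier R"
proof -
  have *: "(\<forall>i. hcomp r i \<in> gr i) \<and> finite {i. hcomp r i \<noteq> \<zero>} \<and> r = (\<Oplus>i\<in>{i. hcomp r i \<noteq> \<zero>}. hcomp r i)"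
    unfolding hcomp_def by (rule theI'[OF hcomp_ex1[OF assms]])
  from * show "hcomp r i \<in> gr i" by blast
  then show "hcomp r i \<in> carrier R" by (rule gr_props(4))
  from * show "finite {i. hcomp r i \<noteq> \<zero>}" by blast
  from * show "r = (\<Oplus>i\<in>{i. hcomp r i \<noteq> \<zero>}. hcomp r i)" by (elim conjE)
qed

lemma hcomp_eqI:
  assumes c: "\<And>i. c i \<in> gr i" and F: "finite F" "\<And>i. i \<notin> F \<Longrightarrow> c i = \<zero>" and r: "r = (\<Oplus>i\<in>F. c i)"
  shows "hcomp r = c"
proof -
  have sub: "{i. c i \<noteq> \<zero>} \<subseteq> F" using F(2) by blast
  have cR: "\<And>i. c i \<in> carrier R" using c gr_props(4) by blast
  have e: "(\<Oplus>i\<in>{i. c i \<noteq> \<zero>}. c i) = (\<Oplus>i\<in>F. c i)"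
    by (rule finsum_extend[OF F(1) sub]) (use cR in auto)
  have rR: "r \<in> carrier R" unfolding r using cR by (intro finsum_closed) auto
  show ?thesis unfolding hcomp_def
  proof (rule the1_equality[OF hcomp_ex1[OF rR]], intro conjI allI c)
    show "finite {i. c i \<noteq> \<zero>}" by (rule finite_subset[OF sub F(1)])
    show "r = (\<Oplus>i\<in>{i. c i \<noteq> \<zero>}. c i)" unfolding e by (rule r)
  qed
qed

lemma hcomp_sum:
  assumes r: "r \<in> carrier R" and F: "finite F" "\<And>i. i \<notin> F \<Longrightarrow> hcomp r i = \<zero>"
  shows "(\<Oplus>i\<in>F. hcomp r i) = r"
proof -
  have sub: "{i. hcomp r i \<noteq> \<zero>} \<subseteq> F" using F(2) by blast
  have "(\<Oplus>i\<in>{i. hcomp r i \<noteq> \<zero>}. hcomp r i) = (\<Oplus>i\<in>F. hcomp r i)"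
    by (rule finsum_extend[OF F(1) sub]) (use hcomp_props(4)[OF r] in auto)
  then show ?thesis using hcomp_props(3)[OF r] by simp
qed

lemma hcomp_zero: "hcomp \<zero> = (\<lambda>_. \<zero>)"
  by (rule hcomp_eqI[of _ "{}"]) (auto simp: gr_props)

lemma hcomp_homog: assumes "r \<in> gr d" shows "hcomp r = (\<lambda>i. if i = d then r else \<zero>)"
  by (rule hcomp_eqI[of _ "{d}"]) (use assms gr_props in auto)

lemma hcomp_add: assumes "r \<in> carrier R" "s \<in> carrier R" shows "hcomp (r \<oplus> s) = (\<lambda>i. hcomp r i \<oplus> hcomp s i)"
proof -
  define F where "F = {i. hcomp r i \<noteq> \<zero>} \<union> {i. hcomp s i \<noteq> \<zero>}"
  have F: "finite F" using hcomp_props(2) assms by (simp add: F_def)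
  have z: "\<And>i. i \<notin> F \<Longrightarrow> hcomp r i = \<zero>" "\<And>i. i \<notin> F \<Longrightarrow> hcomp s i = \<zero>" by (auto simp: F_def)
  show ?thesis
  proof (rule hcomp_eqI[OF _ F])
    have "(\<Oplus>i\<in>F. hcomp r i \<oplus> hcomp s i) = (\<Oplus>i\<in>F. hcomp r i) \<oplus> (\<Oplus>i\<in>F. hcomp s i)"
      using hcomp_props(4) assms by (intro finsum_addf) auto
    then show "r \<oplus> s = (\<Oplus>i\<in>F. hcomp r i \<oplus> hcomp s i)"
      using hcomp_sum[OF assms(1) F z(1)] hcomp_sum[OF assms(2) F z(2)] by simp
  qed (use hcomp_props(1) assms gr_props(2) z in auto)
qed

lemma hcomp_minus: assumes "r \<in> carrier R" shows "hcomp (\<ominus> r) = (\<lambda>i. \<ominus> hcomp r i)"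
proof -
  note F = hcomp_props(2)[OF assms]
  show ?thesis
  proof (rule hcomp_eqI[OF _ F])
    show "\<ominus> r = (\<Oplus>i\<in>{i. hcomp r i \<noteq> \<zero>}. \<ominus> hcomp r i)"
      using finsum_minus[OF F, of "hcomp r"] hcomp_props(3,4)[OF assms] by simp
  qed (use hcomp_props(1) assms gr_props(3) in auto)
qed

lemma hcomp_diff: assumes "r \<in> carrier R" "s \<in> carrier R" shows "hcomp (r \<ominus> s) i = hcomp r i \<ominus> hcomp s i"
  using hcomp_add[of r "\<ominus> s"] hcomp_minus[of s] assms by (simp add: a_minus_def)

lemma hcomp_mult:
  assumes a: "a \<in> gr d" and r: "r \<in> carrier R"
  shows "hcomp (a \<otimes> r) = (\<lambda>i. if d \<le> i then a \<otimes> hcomp r (i - d) else \<zero>)"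
proof -
  define F where "F = {i. hcomp r i \<noteq> \<zero>}"
  have F: "finite F" using hcomp_props(2)[OF r] by (simp add: F_def)
  have aR: "a \<in> carrier R" by (rule gr_props(4)[OF a])
  define c where "c = (\<lambda>i. if d \<le> i then a \<otimes> hcomp r (i - d) else \<zero>)"
  have cR: "c \<in> (+) d ` F \<rightarrow> carrier R" using aR hcomp_props(4)[OF r] by (auto simp: c_def)
  have "hcomp (a \<otimes> r) = c"
  proof (rule hcomp_eqI[of _ "(+) d ` F"])
    fix i
    have "a \<otimes> hcomp r (i - d) \<in> gr (d + (i - d))" by (rule gr_mult[OF a hcomp_props(1)[OF r]])
    then show "c i \<in> gr i" using gr_props(1) by (auto simp: c_def)
    show "c i = \<zero>" if "i \<notin> (+) d ` F"
    proof (cases "d \<le> i")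
      case True
      then have "i = d + (i - d)" by simp
      then have "i - d \<notin> F" using that by blast
      then show ?thesis using aR by (simp add: c_def F_def)
    qed (simp add: c_def)
  next
    have "(\<Oplus>i\<in>(+) d ` F. c i) = (\<Oplus>i\<in>F. c (d + i))"
      by (rule finsum_reindex[OF cR]) simp
    also have "\<dots> = (\<Oplus>i\<in>F. a \<otimes> hcomp r i)" by (simp add: c_def)
    also have "\<dots> = a \<otimes> (\<Oplus>i\<in>F. hcomp r i)"
      using finsum_rdistr[OF F aR, of "hcomp r"] hcomp_props(4)[OF r] by auto
    also have "\<dots> = a \<otimes> r" using hcomp_props(3)[OF r] by (simp add: F_def)
    finally show "a \<otimes> r = (\<Oplus>i\<in>(+) d ` F. c i)" ..
  qed (simp add: F)
  then show ?thesis by (simp add: c_def)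
qed

lemma mult_in_by_components:
  assumes T: "ideal T R" and r: "r \<in> carrier R" "s \<in> carrier R" and comps: "\<And>i. hcomp r i \<otimes> s \<in> T"
  shows "r \<otimes> s \<in> T"
proof -
  have "(\<Oplus>i\<in>{i. hcomp r i \<noteq> \<zero>}. hcomp r i) \<otimes> s = (\<Oplus>i\<in>{i. hcomp r i \<noteq> \<zero>}. hcomp r i \<otimes> s)"
    by (rule finsum_ldistr) (use hcomp_props[OF r(1)] r(2) in auto)
  also have "\<dots> \<in> T" by (rule sum_multiples[OF T hcomp_props(2)[OF r(1)] comps])
  finally show ?thesis using hcomp_props(3)[OF r(1)] by simp
qed

text \<open>Conditions imposed degree by degree cut out an ideal if they are additive and respect
  multiplication by homogeneous elements. To bound the components of a generated ideal it is then
  enough to check the generators.\<close>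

lemma component_ideal:
  assumes L0: "\<And>i. \<zero> \<in> L i" and La: "\<And>i u v. \<lbrakk>u \<in> L i; v \<in> L i\<rbrakk> \<Longrightarrow> u \<oplus> v \<in> L i"
    and Lm: "\<And>d i a v. \<lbrakk>a \<in> gr d; v \<in> L i; v \<in> carrier R\<rbrakk> \<Longrightarrow> a \<otimes> v \<in> L (d + i)"
  shows "ideal {r \<in> carrier R. \<forall>i. hcomp r i \<in> L i} R" (is "ideal ?T R")
proof (rule idealI')
  show "\<zero> \<in> ?T" by (simp add: hcomp_zero L0)
  show add: "u \<oplus> v \<in> ?T" if "u \<in> ?T" "v \<in> ?T" for u v using that by (simp add: hcomp_add La)
  show "s \<otimes> r \<in> ?T" if s: "s \<in> carrier R" and r: "r \<in> ?T" for s r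
  proof -
    have rR: "r \<in> carrier R" using r by simp
    have homog: "a \<otimes> r \<in> ?T" if a: "a \<in> gr d" for a d
    proof -
      have "hcomp (a \<otimes> r) i \<in> L i" for i
      proof (cases "d \<le> i")
        case True
        have "a \<otimes> hcomp r (i - d) \<in> L (d + (i - d))" using Lm[OF a] r hcomp_props(4)[OF rR] by simp
        then show ?thesis using True hcomp_mult[OF a rR] by simp
      qed (simp add: hcomp_mult[OF a rR] L0)
      then show ?thesis using gr_props(4)[OF a] rR by simp
    qed
    have "(\<Oplus>i\<in>{i. hcomp s i \<noteq> \<zero>}. hcomp s i) \<otimes> r = (\<Oplus>i\<in>{i. hcomp s i \<noteq> \<zero>}. hcomp s i \<otimes> r)"
      by (rule finsum_ldistr) (use hcomp_props[OF s] rR in auto)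
    also have "\<dots> \<in> ?T"
    proof (rule finsum_closed_set)
      show "hcomp s i \<otimes> r \<in> ?T" for i by (rule homog[OF hcomp_props(1)[OF s]])
    qed (use add hcomp_props(2)[OF s] in \<open>auto simp: hcomp_zero L0\<close>)
    finally show ?thesis using hcomp_props(3)[OF s] by simp
  qed
qed auto

lemma irrelevant_gens: "(\<Union>i\<in>{1..}. gr i) \<subseteq> carrier R"
  using gr_props(4) by auto

text \<open>Elements without constant term form an ideal by \<open>component_ideal\<close>, which
  contains the homogeneous elements of positive degree; conversely such an element is the sum of its
  components of positive degree.\<close>

lemma irrelevant_eq: "irrelevant_ideal R gr = {r \<in> carrier R. hcomp r 0 = \<zero>}"
proof
  define L where "L = (\<lambda>i::nat. if i = 0 then {\<zero>} else UNIV)"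
  have T: "ideal {r \<in> carrier R. \<forall>i. hcomp r i \<in> L i} R"
  proof (rule component_ideal)
    show "a \<otimes> v \<in> L (d + i)" if "a \<in> gr d" "v \<in> L i" "v \<in> carrier R" for a d v i
      using that gr_props(4) by (auto simp: L_def split: if_splits)
  qed (auto simp: L_def split: if_splits)
  have e: "{r \<in> carrier R. \<forall>i. hcomp r i \<in> L i} = {r \<in> carrier R. hcomp r 0 = \<zero>}" by (auto simp: L_def)
  show "irrelevant_ideal R gr \<subseteq> {r \<in> carrier R. hcomp r 0 = \<zero>}"
    unfolding irrelevant_ideal_def
  proof (rule genideal_minimal)
    show "ideal {r \<in> carrier R. hcomp r 0 = \<zero>} R" using T unfolding e .
    show "(\<Union>i\<in>{1..}. gr i) \<subseteq> {r \<in> carrier R. hcomp r 0 = \<zero>}" using gr_props(4) hcomp_homog by auto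
  qed
  show "{r \<in> carrier R. hcomp r 0 = \<zero>} \<subseteq> irrelevant_ideal R gr"
  proof
    fix r assume r: "r \<in> {r \<in> carrier R. hcomp r 0 = \<zero>}"
    have id: "ideal (Idl (\<Union>i\<in>{1..}. gr i)) R" by (rule genideal_ideal[OF irrelevant_gens])
    have rR: "r \<in> carrier R" using r by simp
    have "(\<Oplus>i\<in>{i. hcomp r i \<noteq> \<zero>}. hcomp r i) \<in> Idl (\<Union>i\<in>{1..}. gr i)"
    proof (rule sum_multiples[OF id hcomp_props(2)[OF rR]])
      fix i assume "i \<in> {i. hcomp r i \<noteq> \<zero>}"
      then have "i \<noteq> 0" using r by (intro notI) auto
      then have "hcomp r i \<in> (\<Union>i\<in>{1..}. gr i)" using hcomp_props(1)[OF rR, of i] by (intro UN_I[of i]) auto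
      then show "hcomp r i \<in> Idl (\<Union>i\<in>{1..}. gr i)" using genideal_self[OF irrelevant_gens] by blast
    qed
    then show "r \<in> irrelevant_ideal R gr" using hcomp_props(3)[OF rR] by (simp add: irrelevant_ideal_def)
  qed
qed

lemma irrelevant_is_ideal: "ideal (irrelevant_ideal R gr) R"
  unfolding irrelevant_ideal_def by (rule genideal_ideal[OF irrelevant_gens])

lemma positive_irrelevant: "\<lbrakk>a \<in> gr i; 1 \<le> i\<rbrakk> \<Longrightarrow> a \<in> irrelevant_ideal R gr"
  unfolding irrelevant_ideal_def using genideal_self[OF irrelevant_gens] by auto

text \<open>The elements all of whose components lie in \<open>K\<close> form an ideal containing
  the homogeneous elements of \<open>K\<close>, and these generate \<open>K\<close>.\<close>

lemma homogeneous_components: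
  assumes K: "homogeneous_ideal R gr K" and r: "r \<in> K" shows "hcomp r i \<in> K"
proof -
  have Ki: "ideal K R" and Ke: "K = Idl (K \<inter> (\<Union>i. gr i))" using K unfolding homogeneous_ideal_def by blast+
  have T: "ideal {r \<in> carrier R. \<forall>i. hcomp r i \<in> K} R"
    by (rule component_ideal) (use ideal_zeroD[OF Ki] ideal_addD[OF Ki] ideal.I_l_closed[OF Ki] gr_props(4) in auto)
  have "K \<inter> (\<Union>i. gr i) \<subseteq> {r \<in> carrier R. \<forall>i. hcomp r i \<in> K}"
    using gr_props(4) hcomp_homog ideal_zeroD[OF Ki] by auto
  then have "Idl (K \<inter> (\<Union>i. gr i)) \<subseteq> {r \<in> carrier R. \<forall>i. hcomp r i \<in> K}" by (rule genideal_minimal[OF T])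
  then show ?thesis using r Ke by blast
qed

text \<open>A product of two elements is expanded in the components of its first factor, and a
  component of each resulting product is zero or a product of components, which stay in the two
  homogeneous ideals.\<close>

lemma ideal_prod_components:
  assumes I: "homogeneous_ideal R gr I" and J: "homogeneous_ideal R gr J" and r: "r \<in> I \<cdot> J"
  shows "hcomp r i \<in> I \<cdot> J"
proof -
  have Ii: "ideal I R" and Ji: "ideal J R" using I J unfolding homogeneous_ideal_def by blast+
  have N: "ideal (I \<cdot> J) R" by (rule ideal_prod_is_ideal[OF Ii Ji])
  have T: "ideal {r \<in> carrier R. \<forall>i. hcomp r i \<in> I \<cdot> J} R" (is "ideal ?T R")
    by (rule component_ideal) (use ideal_zeroD[OF N] ideal_addD[OF N] ideal.I_l_closed[OF N] gr_props(4) in auto)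
  have "u \<in> ?T" if "u \<in> I \<cdot> J" for u
    using that
  proof (induct rule: ideal_prod.induct)
    case (prod a b)
    have ab: "a \<in> carrier R" "b \<in> carrier R" using ideal_sub[OF Ii prod(1)] ideal_sub[OF Ji prod(2)] .
    show ?case
    proof (rule mult_in_by_components[OF T ab])
      fix d
      have a: "hcomp a d \<in> gr d" "hcomp a d \<in> I" by (rule hcomp_props(1)[OF ab(1)], rule homogeneous_components[OF I prod(1)])
      have "hcomp (hcomp a d \<otimes> b) i \<in> I \<cdot> J" for i
        using hcomp_mult[OF a(1) ab(2)] ideal_prod.prod[where R = R, OF a(2) homogeneous_components[OF J prod(2)]] ideal_zeroD[OF N] by simp
      then show "hcomp a d \<otimes> b \<in> ?T" using gr_props(4)[OF a(1)] ab(2) by simp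
    qed
  next
    case (sum s1 s2)
    then show ?case by (intro ideal_addD[OF T])
  qed
  then show ?thesis using r by blast
qed

text \<open>Both factors start in degree 1, so products start in degree 2. In the graded case this
  plays the part that containment in the square of the maximal ideal plays in the local
  case.\<close>

lemma ideal_prod_low_degree:
  assumes I: "I \<subseteq> irrelevant_ideal R gr" and J: "J \<subseteq> irrelevant_ideal R gr" and r: "r \<in> I \<cdot> J"
  shows "r \<in> carrier R" "hcomp r 0 = \<zero>" "hcomp r 1 = \<zero>"
proof -
  define L where "L = (\<lambda>i::nat. if i \<le> 1 then {\<zero>} else UNIV)"
  have T: "ideal {r \<in> carrier R. \<forall>i. hcomp r i \<in> L i} R" (is "ideal ?T R")
  proof (rule component_ideal)
    show "a \<otimes> v \<in> L (d + i)" if "a \<in> gr d" "v \<in> L i" "v \<in> carrier R" for a d v i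
      using that gr_props(4) by (auto simp: L_def split: if_splits)
  qed (auto simp: L_def split: if_splits)
  have "u \<in> ?T" if "u \<in> I \<cdot> J" for u
    using that
  proof (induct rule: ideal_prod.induct)
    case (prod a b)
    have ab: "a \<in> carrier R" "hcomp a 0 = \<zero>" "b \<in> carrier R" "hcomp b 0 = \<zero>"
      using prod I J by (auto simp: irrelevant_eq)
    show ?case
    proof (rule mult_in_by_components[OF T ab(1,3)])
      fix d
      have a: "hcomp a d \<in> gr d" "hcomp a d \<in> carrier R" by (rule hcomp_props[OF ab(1)])+
      have "hcomp (hcomp a d \<otimes> b) i = \<zero>" if i: "i \<le> 1" for i
      proof (cases "d = 0")
        case True
        then show ?thesis using ab hcomp_zero by simp
      next
        case False
        then have "d \<le> i \<Longrightarrow> i - d = 0" using i by simp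
        then show ?thesis using hcomp_mult[OF a(1) ab(3)] ab(4) a(2) by auto
      qed
      then show "hcomp a d \<otimes> b \<in> ?T" using a(2) ab(3) by (simp add: L_def)
    qed
  next
    case (sum s1 s2)
    then show ?case by (intro ideal_addD[OF T])
  qed
  then have "r \<in> ?T" using r by blast
  then have "r \<in> carrier R" "hcomp r 0 \<in> L 0" "hcomp r 1 \<in> L 1" by blast+
  then show "r \<in> carrier R" "hcomp r 0 = \<zero>" "hcomp r 1 = \<zero>" by (simp_all add: L_def)
qed

text \<open>The degree 1 component of an element of the ideal generated by \<open>S\<close> only
  receives scalar multiples of the degree 1 members of \<open>S\<close>. The family \<open>L\<close>
  encodes this: nothing in degree 0, the span in degree 1, no condition above.\<close>

lemma degree_one_span:
  assumes K: "subfield (gr 0) R" and Ys: "set Ys \<subseteq> carrier R"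
    and S: "S \<subseteq> (\<Union>i\<in>{1..}. gr i)" "S \<inter> gr 1 \<subseteq> Span (gr 0) Ys"
    and v: "v \<in> gr 1" and r: "r \<in> Idl S" and vr: "hcomp (v \<ominus> r) 1 = \<zero>"
  shows "v \<in> Span (gr 0) Ys"
proof -
  note sp = Span_subgroup_props[OF K Ys] Span_smult_closed[OF K Ys]
  define L where "L = (\<lambda>i::nat. if i = 0 then {\<zero>} else if i = 1 then Span (gr 0) Ys else UNIV)"
  have T: "ideal {r \<in> carrier R. \<forall>i. hcomp r i \<in> L i} R" (is "ideal ?T R")
  proof (rule component_ideal)
    show "a \<otimes> v \<in> L (d + i)" if a: "a \<in> gr d" and v: "v \<in> L i" "v \<in> carrier R" for a d v i
    proof -
      have aR: "a \<in> carrier R" by (rule gr_props(4)[OF a])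
      consider "i = 0" | "d = 0" "i = 1" | "2 \<le> d + i" by linarith
      then show ?thesis
      proof cases
        case 1
        then have "a \<otimes> v = \<zero>" using v(1) aR by (simp add: L_def)
        then show ?thesis using sp(2) by (auto simp: L_def)
      next
        case 2
        then show ?thesis using sp(5)[of a v] a v(1) by (simp add: L_def)
      qed (auto simp: L_def)
    qed
  qed (use sp(2,3) in \<open>auto simp: L_def split: if_splits\<close>)
  have "S \<subseteq> ?T"
  proof
    fix s assume s: "s \<in> S"
    then obtain d where d: "1 \<le> d" "s \<in> gr d" using S(1) by auto
    have "hcomp s i \<in> L i" for i
      using d s S(2) sp(2) by (auto simp: hcomp_homog[OF d(2)] L_def)
    then show "s \<in> ?T" using gr_props(4)[OF d(2)] by simp
  qed
  then have "r \<in> ?T" using genideal_minimal[OF T] r by blast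
  then have "r \<in> carrier R" "hcomp r 1 \<in> L 1" by blast+
  then have r1: "r \<in> carrier R" "hcomp r 1 \<in> Span (gr 0) Ys" by (simp_all add: L_def)
  have vR: "v \<in> carrier R" by (rule gr_props(4)[OF v])
  have "v \<ominus> hcomp r 1 = \<zero>" using vr hcomp_diff[OF vR r1(1), of 1] by (simp add: hcomp_homog[OF v])
  then have "v = hcomp r 1" using r_right_minus_eq[OF vR hcomp_props(4)[OF r1(1)]] by blast
  then show ?thesis using r1(2) by simp
qed

text \<open>The inverse of the constant term, which exists in the ground field, makes the constant
  term of the product equal to 1.\<close>

lemma inverse_modulo_irrelevant:
  assumes K: "subfield (gr 0) R" and r: "r \<in> carrier R" "hcomp r 0 \<noteq> \<zero>"
  shows "\<exists>s\<in>carrier R. s \<otimes> hcomp r 0 = \<one> \<and> s \<otimes> r \<ominus> \<one> \<in> irrelevant_ideal R gr"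
proof -
  define s where "s = inv (hcomp r 0)"
  have k: "hcomp r 0 \<in> gr 0 - {\<zero>}" using r hcomp_props(1)[OF r(1)] by simp
  have s: "s \<in> gr 0" "s \<otimes> hcomp r 0 = \<one>" using subfield_m_inv[OF K k] by (auto simp: s_def)
  have sR: "s \<in> carrier R" by (rule gr_props(4)[OF s(1)])
  have "hcomp (s \<otimes> r \<ominus> \<one>) 0 = \<one> \<ominus> \<one>"
    using hcomp_diff[of "s \<otimes> r" \<one> 0] hcomp_mult[OF s(1) r(1)] hcomp_homog[OF gr_one] s(2) sR r(1) by simp
  then have "s \<otimes> r \<ominus> \<one> \<in> irrelevant_ideal R gr" using sR r(1) by (simp add: irrelevant_eq a_minus_def r_neg)
  then show ?thesis using s(2) sR by blast
qed

text \<open>A nonzero constant term of an element of \<open>I\<close> would itself belong to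
  \<open>I\<close> and be a unit.\<close>

lemma proper_homogeneous_irrelevant:
  assumes K: "subfield (gr 0) R" and I: "homogeneous_ideal R gr I" "I \<noteq> carrier R" shows "I \<subseteq> irrelevant_ideal R gr"
proof
  fix r assume r: "r \<in> I"
  have Ii: "ideal I R" using I unfolding homogeneous_ideal_def by blast
  have rR: "r \<in> carrier R" by (rule ideal_sub[OF Ii r])
  have "hcomp r 0 = \<zero>"
  proof (rule ccontr)
    assume "hcomp r 0 \<noteq> \<zero>"
    then obtain s where "s \<in> carrier R" "s \<otimes> hcomp r 0 = \<one>" using inverse_modulo_irrelevant[OF K rR] by blast
    then have "\<one> \<in> I" using ideal.I_l_closed[OF Ii homogeneous_components[OF I(1) r]] by metis
    then show False using ideal.one_imp_carrier[OF Ii] I(2) by blast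
  qed
  then show "r \<in> irrelevant_ideal R gr" using rR by (simp add: irrelevant_eq)
qed

end

section \<open>The graded case\<close>

context graded
begin

text \<open>Translates the basis statement over the ring with carrier \<open>gr 0\<close> into
  spanning by finite combinations and vanishing of coefficients, the form used for polynomial
  rings.\<close>

lemma monomial_basis_free:
  assumes K: "subfield (gr 0) R" and x: "x \<in> {..<n} \<rightarrow> gr 1"
    and basis: "is_basis (R\<lparr>carrier := gr 0\<rparr>) (self_module R) ({..<n} \<rightarrow>\<^sub>E (UNIV :: nat set))
          (\<lambda>\<alpha>. \<Otimes>i\<in>{..<n}. x i [^] \<alpha> i)"
  shows "free_monomials R (gr 0) n x"
proof -
  interpret monomials R "gr 0" n x
    by (intro monomials.intro monomials_axioms.intro is_cring K) (use x gr_props(4) in auto)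
  have comb: "combination (R\<lparr>carrier := gr 0\<rparr>) (self_module R) E mon c r \<longleftrightarrow>
      c \<in> E \<rightarrow>\<^sub>E gr 0 \<and> finite {\<alpha> \<in> E. c \<alpha> \<noteq> \<zero>} \<and> r = (\<Oplus>\<alpha>\<in>{\<alpha> \<in> E. c \<alpha> \<noteq> \<zero>}. c \<alpha> \<otimes> mon \<alpha>)" for c r
    by (simp add: combination_def finsum_self_module self_module_simps)
  have ex1: "\<exists>!c. combination (R\<lparr>carrier := gr 0\<rparr>) (self_module R) E mon c r" if "r \<in> carrier R" for r
    using basis that unfolding is_basis_def E_def mon_def[abs_def] by (simp add: self_module_def)
  show ?thesis
  proof (intro free_monomials.intro free_monomials_axioms.intro monomials_axioms)
    show "carrier R \<subseteq> lc E"
    proof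
      fix r assume "r \<in> carrier R"
      then obtain c where "combination (R\<lparr>carrier := gr 0\<rparr>) (self_module R) E mon c r" using ex1 by blast
      note cc = iffD1[OF comb this]
      show "r \<in> lc E"
        unfolding conjunct2[OF conjunct2[OF cc]]
        by (rule lcI[OF conjunct1[OF conjunct2[OF cc]]]) (use conjunct1[OF cc] in auto)
    qed
  next
    fix S c assume S: "finite S" "S \<subseteq> E" "c \<in> S \<rightarrow> gr 0" "(\<Oplus>\<alpha>\<in>S. c \<alpha> \<otimes> mon \<alpha>) = \<zero>"
    \<comment> \<open>\<open>combination\<close> works with extensional functions on all exponents:
      the given relation is extended by zero and compared with the zero family, both being
      expansions of zero.\<close>
    define c' where "c' = (\<lambda>\<alpha>\<in>E. if \<alpha> \<in> S then c \<alpha> else \<zero>)"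
    define o' where "o' = (\<lambda>\<alpha>\<in>E. \<zero>)"
    have cS: "c' \<alpha> = c \<alpha>" if "\<alpha> \<in> S" for \<alpha> using that S(2) by (auto simp: c'_def)
    have sub: "{\<alpha> \<in> E. c' \<alpha> \<noteq> \<zero>} \<subseteq> S" by (auto simp: c'_def split: if_splits)
    have cR: "\<And>\<alpha>. \<alpha> \<in> S \<Longrightarrow> c \<alpha> \<in> carrier R" using S(3) gr_props(4) by auto
    have "(\<Oplus>\<alpha>\<in>{\<alpha> \<in> E. c' \<alpha> \<noteq> \<zero>}. c' \<alpha> \<otimes> mon \<alpha>) = (\<Oplus>\<alpha>\<in>S. c' \<alpha> \<otimes> mon \<alpha>)"
    proof (rule finsum_extend[OF S(1) sub])
      fix \<alpha> assume "\<alpha> \<in> S - {\<alpha> \<in> E. c' \<alpha> \<noteq> \<zero>}"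
      then have "c' \<alpha> = \<zero>" using S(2) by blast
      then show "c' \<alpha> \<otimes> mon \<alpha> = \<zero>" by simp
    next
      fix \<alpha> assume "\<alpha> \<in> {\<alpha> \<in> E. c' \<alpha> \<noteq> \<zero>}"
      then have "\<alpha> \<in> S" using sub by blast
      then show "c' \<alpha> \<otimes> mon \<alpha> \<in> carrier R" using cS cR by simp
    qed
    also have "\<dots> = (\<Oplus>\<alpha>\<in>S. c \<alpha> \<otimes> mon \<alpha>)"
      by (rule finsum_cong_simple) (use cS cR in auto)
    finally have c0: "(\<Oplus>\<alpha>\<in>{\<alpha> \<in> E. c' \<alpha> \<noteq> \<zero>}. c' \<alpha> \<otimes> mon \<alpha>) = \<zero>" using S(4) by simp
    have "combination (R\<lparr>carrier := gr 0\<rparr>) (self_module R) E mon c' \<zero>"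
      unfolding comb
    proof (intro conjI)
      show "c' \<in> E \<rightarrow>\<^sub>E gr 0" using S(3) gr_props(1) unfolding c'_def by auto
      show "finite {\<alpha> \<in> E. c' \<alpha> \<noteq> \<zero>}" by (rule finite_subset[OF sub S(1)])
    qed (rule c0[symmetric])
    moreover have "combination (R\<lparr>carrier := gr 0\<rparr>) (self_module R) E mon o' \<zero>"
    proof -
      have e: "{\<alpha> \<in> E. o' \<alpha> \<noteq> \<zero>} = {}" by (auto simp: o'_def)
      have "o' \<in> E \<rightarrow>\<^sub>E gr 0" using gr_props(1) unfolding o'_def by auto
      then show ?thesis unfolding comb e by simp
    qed
    ultimately have "c' = o'" using ex1[OF zero_closed] by blast
    then have "c' \<alpha> = \<zero>" if "\<alpha> \<in> S" for \<alpha> using that S(2) by (auto simp: o'_def)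
    then show "\<forall>\<alpha>\<in>S. c \<alpha> = \<zero>" using cS by simp
  qed
qed

text \<open>Every combination of monomials is a scalar plus an element of the ideal generated by the
  variables; for an element without constant term the scalar is zero.\<close>

lemma variables_generate:
  assumes "free_monomials R (gr 0) n x" and x: "x \<in> {..<n} \<rightarrow> gr 1"
  shows "irrelevant_ideal R gr = Idl (x ` {..<n})"
proof
  interpret free_monomials R "gr 0" n x by fact
  have xR: "x ` {..<n} \<subseteq> carrier R" using x gr_props(4) by auto
  have id: "ideal (Idl (x ` {..<n})) R" by (rule genideal_ideal[OF xR])
  have sub: "Idl (x ` {..<n}) \<subseteq> irrelevant_ideal R gr"
    by (rule genideal_minimal[OF irrelevant_is_ideal]) (use x positive_irrelevant in auto)
  then show "Idl (x ` {..<n}) \<subseteq> irrelevant_ideal R gr" .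
  show "irrelevant_ideal R gr \<subseteq> Idl (x ` {..<n})"
  proof
    fix r assume r: "r \<in> irrelevant_ideal R gr"
    define W where "W = {k \<oplus> m | k m. k \<in> gr 0 \<and> m \<in> Idl (x ` {..<n})}"
    have WI: "k \<oplus> m \<in> W" if "k \<in> gr 0" "m \<in> Idl (x ` {..<n})" for k m using that unfolding W_def by blast
    have "lc E \<subseteq> W"
    proof (rule lc_min)
      show "W \<subseteq> carrier R" using gr_props(4) ideal_sub[OF id] by (auto simp: W_def)
      have "\<zero> \<oplus> \<zero> \<in> W" using gr_props(1) ideal_zeroD[OF id] by (rule WI)
      then show "\<zero> \<in> W" by simp
    next
      fix u v assume "u \<in> W" "v \<in> W"
      then obtain k m k' m' where *: "k \<in> gr 0" "k' \<in> gr 0" "m \<in> Idl (x ` {..<n})" "m' \<in> Idl (x ` {..<n})"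
        "u = k \<oplus> m" "v = k' \<oplus> m'" unfolding W_def by blast
      have "u \<oplus> v = (k \<oplus> k') \<oplus> (m \<oplus> m')"
        using * gr_props(4)[OF *(1)] gr_props(4)[OF *(2)] ideal_sub[OF id *(3)] ideal_sub[OF id *(4)] by (simp add: a_ac)
      then show "u \<oplus> v \<in> W" using WI[OF gr_props(2)[OF *(1,2)] ideal_addD[OF id *(3,4)]] by simp
    next
      fix k u assume k: "k \<in> gr 0" and "u \<in> W"
      then obtain k' m where *: "k' \<in> gr 0" "m \<in> Idl (x ` {..<n})" "u = k' \<oplus> m" unfolding W_def by blast
      have kR: "k \<in> carrier R" by (rule gr_props(4)[OF k])
      have "k \<otimes> u = k \<otimes> k' \<oplus> k \<otimes> m"
        using * kR gr_props(4)[OF *(1)] ideal_sub[OF id *(2)] by (simp add: r_distr)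
      then show "k \<otimes> u \<in> W" using WI[OF K_props(5)[OF k *(1)] ideal.I_l_closed[OF id *(2) kR]] by simp
    next
      fix \<alpha> assume a: "\<alpha> \<in> E"
      show "mon \<alpha> \<in> W"
      proof (cases "\<forall>i<n. \<alpha> i = 0")
        case True
        have "\<one> \<oplus> \<zero> \<in> W" using gr_one ideal_zeroD[OF id] by (rule WI)
        then show ?thesis using mon_one[of \<alpha>] True by simp
      next
        case False
        then obtain i where i: "i < n" "\<alpha> i > 0" by auto
        obtain \<beta> where b: "\<alpha> = bump i \<beta>" using unbump[OF a i] by blast
        have "x i \<in> Idl (x ` {..<n})" using genideal_self[OF xR] i(1) by auto
        then have "x i \<otimes> mon \<beta> \<in> Idl (x ` {..<n})" using ideal.I_r_closed[OF id] by simp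
        then have "\<zero> \<oplus> x i \<otimes> mon \<beta> \<in> W" using gr_props(1) by (intro WI)
        then show ?thesis unfolding b mon_bump[OF i(1)] using z_closed[OF i(1)] by simp
      qed
    qed
    then have "r \<in> W" using r spans by (auto simp: irrelevant_eq)
    then obtain k m where km: "k \<in> gr 0" "m \<in> Idl (x ` {..<n})" "r = k \<oplus> m" unfolding W_def by blast
    have c: "k \<in> carrier R" "m \<in> carrier R" by (rule gr_props(4)[OF km(1)], rule ideal_sub[OF id km(2)])
    have "hcomp m 0 = \<zero>" "hcomp r 0 = \<zero>" using km(2) sub r by (auto simp: irrelevant_eq)
    then have "k = \<zero>" using hcomp_add[OF c] hcomp_homog[OF km(1)] c by (simp add: km(3))
    then show "r \<in> Idl (x ` {..<n})" using km c by simp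
  qed
qed

text \<open>The decomposition descends because \<open>N\<close> contains the components of its
  elements. For uniqueness, a second decomposition in the quotient is lifted to homogeneous elements
  of \<open>R\<close>; their sum differs from r by an element of \<open>N\<close>, whose components
  are the differences to be killed.\<close>

lemma quotient_standard_graded:
  assumes K: "subfield (gr 0) R" and N: "ideal N R" "N \<noteq> carrier R" and Nc: "\<And>r i. r \<in> N \<Longrightarrow> hcomp r i \<in> N"
    and free: "free_monomials R (gr 0) n x" and x: "x \<in> {..<n} \<rightarrow> gr 1"
  shows "standard_graded_algebra (R Quot N) (quotient_grading R gr N)"
proof -
  interpret N: ideal N R by (rule N(1))
  define A where "A = R Quot N"
  define f where "f = (\<lambda>r. N +> r)"
  have hom: "ring_hom_ring R A f" unfolding A_def f_def by (rule N.phi_hom)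
  have add_hom: "group_hom (add_monoid R) (add_monoid A) f"
  proof -
    interpret hr: ring_hom_ring R A f by (rule hom)
    show ?thesis by (rule hr.a_group_hom)
  qed
  interpret h: ring_hom_cring R A f unfolding A_def f_def by (rule N.rcos_ring_hom_cring[OF is_cring])
  have qg: "quotient_grading R gr N = (\<lambda>i. f ` gr i)" by (simp add: quotient_grading_def f_def fun_eq_iff)
  have surj: "\<exists>r\<in>carrier R. f r = a" if "a \<in> carrier A" for a using N.phi_surj that by (simp add: A_def f_def)
  have eq_iff: "f r = f s \<longleftrightarrow> r \<ominus> s \<in> N" if "r \<in> carrier R" "s \<in> carrier R" for r s
    using N.phi_eq_iff[OF that] by (simp add: f_def)
  have f_sum: "f (finsum R g F) = finsum A (\<lambda>i. f (g i)) F" if "g \<in> F \<rightarrow> carrier R" for g :: "nat \<Rightarrow> 'a" and F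
    using h.hom_finsum[OF that] by (simp add: comp_def)
  have gen: "generate_ring A (f ` gr 0 \<union> f ` x ` {..<n}) = carrier A"
  proof
    have sub: "f ` gr 0 \<union> f ` x ` {..<n} \<subseteq> carrier A" using gr_props(4) x by auto
    then show "generate_ring A (f ` gr 0 \<union> f ` x ` {..<n}) \<subseteq> carrier A"
      by (rule h.S.generate_ring_incl)
    interpret free_monomials R "gr 0" n x by (rule free)
    define W where "W = {r \<in> carrier R. f r \<in> generate_ring A (f ` gr 0 \<union> f ` x ` {..<n})}"
    have k0: "k \<in> W" if "k \<in> gr 0" for k using that gr_props(4) by (auto simp: W_def intro: generate_ring.incl)
    have mult: "u \<otimes> v \<in> W" if "u \<in> W" "v \<in> W" for u v
      using that by (auto simp: W_def intro: generate_ring.eng_mult)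
    have "lc E \<subseteq> W"
    proof (rule lc_min)
      show "W \<subseteq> carrier R" by (auto simp: W_def)
      show "\<zero> \<in> W" by (rule k0[OF gr_props(1)])
      show "u \<oplus> v \<in> W" if "u \<in> W" "v \<in> W" for u v using that by (auto simp: W_def intro: generate_ring.eng_add)
      show "k \<otimes> u \<in> W" if "k \<in> gr 0" "u \<in> W" for k u using that k0 mult by blast
      show "mon \<alpha> \<in> W" for \<alpha>
      proof (rule mon_in)
        show "W \<subseteq> carrier R" by (auto simp: W_def)
        show "\<one> \<in> W" by (rule k0[OF gr_one])
        show "x i \<in> W" if "i < n" for i using that z_closed by (auto simp: W_def intro: generate_ring.incl)
      qed (rule mult)
    qed
    then have W: "carrier R \<subseteq> W" using spans by blast
    show "carrier A \<subseteq> generate_ring A (f ` gr 0 \<union> f ` x ` {..<n})"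
    proof
      fix a assume "a \<in> carrier A"
      then obtain r where "r \<in> carrier R" "f r = a" using surj by blast
      then show "a \<in> generate_ring A (f ` gr 0 \<union> f ` x ` {..<n})" using W by (auto simp: W_def)
    qed
  qed
  have dec: "\<exists>!c. (\<forall>i. c i \<in> f ` gr i) \<and> finite {i. c i \<noteq> \<zero>\<^bsub>A\<^esub>} \<and> a = (\<Oplus>\<^bsub>A\<^esub>i\<in>{i. c i \<noteq> \<zero>\<^bsub>A\<^esub>}. c i)" if a: "a \<in> carrier A" for a
  proof -
    obtain r where r: "r \<in> carrier R" "f r = a" using surj[OF a] by blast
    define F where "F = {i. hcomp r i \<noteq> \<zero>}"
    have F: "finite F" using hcomp_props(2)[OF r(1)] by (simp add: F_def)
    define c where "c = (\<lambda>i. f (hcomp r i))"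
    have cA: "\<And>i. c i \<in> carrier A" using hcomp_props(4)[OF r(1)] by (simp add: c_def)
    have sub: "{i. c i \<noteq> \<zero>\<^bsub>A\<^esub>} \<subseteq> F" by (auto simp: F_def c_def)
    show ?thesis
    proof (rule ex1I[of _ c], intro conjI allI)
      show "c i \<in> f ` gr i" for i using hcomp_props(1)[OF r(1)] by (auto simp: c_def)
      show "finite {i. c i \<noteq> \<zero>\<^bsub>A\<^esub>}" by (rule finite_subset[OF sub F])
      have "(\<Oplus>i\<in>F. hcomp r i) = r" by (rule hcomp_sum[OF r(1) F]) (simp add: F_def)
      then have "a = f (\<Oplus>i\<in>F. hcomp r i)" using r(2) by simp
      also have "\<dots> = (\<Oplus>\<^bsub>A\<^esub>i\<in>F. c i)" unfolding c_def by (rule f_sum) (use hcomp_props(4)[OF r(1)] in auto)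
      also have "\<dots> = (\<Oplus>\<^bsub>A\<^esub>i\<in>{i. c i \<noteq> \<zero>\<^bsub>A\<^esub>}. c i)"
        by (rule h.S.finsum_extend[symmetric, OF F sub]) (use cA in auto)
      finally show "a = (\<Oplus>\<^bsub>A\<^esub>i\<in>{i. c i \<noteq> \<zero>\<^bsub>A\<^esub>}. c i)" .
    next
      fix c' assume c': "(\<forall>i. c' i \<in> f ` gr i) \<and> finite {i. c' i \<noteq> \<zero>\<^bsub>A\<^esub>} \<and> a = (\<Oplus>\<^bsub>A\<^esub>i\<in>{i. c' i \<noteq> \<zero>\<^bsub>A\<^esub>}. c' i)"
      define F' where "F' = {i. c' i \<noteq> \<zero>\<^bsub>A\<^esub>}"
      \<comment> \<open>Off the finite support the lift is chosen to be zero, so that the lifted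
        family has a finite sum and is its decomposition.\<close>
      have "\<forall>i. \<exists>g. g \<in> gr i \<and> f g = c' i \<and> (i \<notin> F' \<longrightarrow> g = \<zero>)"
      proof
        fix i
        show "\<exists>g. g \<in> gr i \<and> f g = c' i \<and> (i \<notin> F' \<longrightarrow> g = \<zero>)"
        proof (cases "i \<in> F'")
          case True then show ?thesis using c' by (metis imageE)
        next
          case False then show ?thesis using gr_props(1)[of i] by (intro exI[of _ \<zero>]) (simp add: F'_def)
        qed
      qed
      then obtain g where g: "\<And>i. g i \<in> gr i" "\<And>i. f (g i) = c' i" "\<And>i. i \<notin> F' \<Longrightarrow> g i = \<zero>" by metis
      have gR: "\<And>i. g i \<in> carrier R" using g(1) gr_props(4) by blast
      define r' where "r' = (\<Oplus>i\<in>F'. g i)"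
      have r'R: "r' \<in> carrier R" unfolding r'_def using gR by (intro finsum_closed) auto
      have "finite F'" using c' by (simp add: F'_def)
      then have hr': "hcomp r' = g" by (intro hcomp_eqI[OF g(1) _ g(3) r'_def])
      have "f r' = (\<Oplus>\<^bsub>A\<^esub>i\<in>F'. c' i)" unfolding r'_def using f_sum[of g F'] gR g(2) by simp
      also have "\<dots> = f r" using c' r(2) by (simp add: F'_def)
      finally have "r' \<ominus> r \<in> N" using eq_iff[OF r'R r(1)] by blast
      then have "g i \<ominus> hcomp r i \<in> N" for i using Nc[of "r' \<ominus> r" i] hcomp_diff[OF r'R r(1)] hr' by simp
      then have "f (g i) = f (hcomp r i)" for i using eq_iff[OF gR hcomp_props(4)[OF r(1)]] by blast
      then show "c' = c" using g(2) by (simp add: c_def fun_eq_iff)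
    qed
  qed
  have add: "additive_subgroup (f ` gr i) A" for i
  proof (rule additive_subgroup.intro)
    show "subgroup (f ` gr i) (add_monoid A)"
      by (rule group_hom.subgroup_img_is_subgroup[OF add_hom additive_subgroup.a_subgroup[OF gr_additive]])
  qed
  have "\<one> \<notin> N" using N.one_imp_carrier N(2) by blast
  then have "\<one>\<^bsub>A\<^esub> \<noteq> \<zero>\<^bsub>A\<^esub>" using eq_iff[of \<one> \<zero>] by (simp add: a_minus_def)
  then have sf: "subfield (f ` gr 0) A" by (rule ring_hom_ring.img_is_subfield(2)[OF hom K])
  have m: "a \<otimes>\<^bsub>A\<^esub> b \<in> f ` gr (i + j)" if ab: "a \<in> f ` gr i" "b \<in> f ` gr j" for i j a b
  proof -
    obtain u v where uv: "u \<in> gr i" "v \<in> gr j" "a = f u" "b = f v" using ab by blast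
    have "a \<otimes>\<^bsub>A\<^esub> b = f (u \<otimes> v)" unfolding uv(3,4) by (rule h.hom_mult[symmetric, OF gr_props(4)[OF uv(1)] gr_props(4)[OF uv(2)]])
    then show ?thesis using gr_mult[OF uv(1,2)] by blast
  qed
  have o: "\<one>\<^bsub>A\<^esub> \<in> f ` gr 0" using gr_one h.hom_one by (metis imageI)
  have Ac: "cring A" by (rule h.S.is_cring)
  have ex: "\<exists>S\<subseteq>f ` gr 1. finite S \<and> generate_ring A (f ` gr 0 \<union> S) = carrier A"
    using gen x by (intro exI[of _ "f ` x ` {..<n}"]) auto
  show ?thesis
    unfolding standard_graded_algebra_def graded_ring_def direct_sum_decomposition_def qg A_def[symmetric]
    by (intro conjI allI ballI Ac add dec o m sf ex)
qed

end

text \<open>Homogeneous minimal generators of the quotient lift to homogeneous elements of positive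
  degree. Those of degree 1 already span the linear forms, because the product ideal begins in
  degree 2, so irredundance forces all of them to be linear. They then form a basis of the linear
  forms, and \<open>change_variables\<close> makes them the variables of the polynomial ring, hence
  a regular sequence.\<close>

lemma golod_graded_quotient:
  fixes R :: "('a, 'b) ring_scheme"
  assumes poly: "standard_graded_polynomial_ring R gr"
    and I: "homogeneous_ideal R gr I" "I \<noteq> carrier R" and J: "homogeneous_ideal R gr J" "J \<noteq> carrier R"
    and e: "e \<in> {1..t} \<rightarrow> carrier (cx_mod F 1)"
    and trim: "trimming_morphism R I J t e F G Q"
    and split: "\<And>j. 1 \<le> j \<Longrightarrow> split_injection R (cx_mod F (j + 1)) (power_module t (cx_mod G j)) (Q j)"
    and F: "free_resolution R I F" and G: "minimal_free_resolution R (irrelevant_ideal R gr) J G"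
  shows "golod_graded (R Quot (I \<cdot>\<^bsub>R\<^esub> J)) (quotient_grading R gr (I \<cdot>\<^bsub>R\<^esub> J))"
proof -
  have gring: "graded_ring R gr" and K: "subfield (gr 0) R" using poly by (auto simp: standard_graded_polynomial_ring_def)
  obtain n :: nat and x where x: "x \<in> {..<n} \<rightarrow> gr 1" and basis: "is_basis (R\<lparr>carrier := gr 0\<rparr>) (self_module R) ({..<n} \<rightarrow>\<^sub>E (UNIV :: nat set))
          (\<lambda>\<alpha>. \<Otimes>\<^bsub>R\<^esub>i\<in>{..<n}. x i [^]\<^bsub>R\<^esub> \<alpha> i)"
    using poly unfolding standard_graded_polynomial_ring_def by blast
  interpret graded R gr
    using gring by (auto simp: graded_ring_def intro!: graded.intro graded_axioms.intro)
  have free: "free_monomials R (gr 0) n x" by (rule monomial_basis_free[OF K x basis])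
  define \<mm> where "\<mm> = irrelevant_ideal R gr"
  have mi: "ideal \<mm> R" unfolding \<mm>_def by (rule irrelevant_is_ideal)
  have mx: "\<mm> = genideal R (x ` {..<n})" unfolding \<mm>_def by (rule variables_generate[OF free x])
  have xR: "x ` {..<n} \<subseteq> carrier R" using x gr_props(4) by auto
  have Ii: "ideal I R" and Ji: "ideal J R" using I(1) J(1) unfolding homogeneous_ideal_def by blast+
  have Im: "I \<subseteq> irrelevant_ideal R gr" and Jm: "J \<subseteq> irrelevant_ideal R gr"
    using proper_homogeneous_irrelevant[OF K] I J by auto
  define N where "N = I \<cdot>\<^bsub>R\<^esub> J"
  have Ni: "ideal N R" unfolding N_def by (rule ideal_prod_is_ideal[OF Ii Ji])
  have Nlow: "r \<in> carrier R" "hcomp r 0 = \<zero>\<^bsub>R\<^esub>" "hcomp r 1 = \<zero>\<^bsub>R\<^esub>" if "r \<in> N" for r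
    using ideal_prod_low_degree[OF Im Jm] that unfolding N_def by blast+
  have Nm: "N \<subseteq> \<mm>" using Nlow by (auto simp: \<mm>_def irrelevant_eq)
  have one: "\<one>\<^bsub>R\<^esub> \<noteq> \<zero>\<^bsub>R\<^esub>" using subfieldE(6)[OF K] by auto
  have Nproper: "N \<noteq> carrier R"
  proof
    assume "N = carrier R"
    then have "hcomp \<one>\<^bsub>R\<^esub> 0 = \<zero>\<^bsub>R\<^esub>" using Nlow(2) by blast
    then show False using hcomp_homog[OF gr_one] one by simp
  qed
  interpret N: ideal N R by (rule Ni)
  let ?A = "R Quot N" and ?f = "\<lambda>r. N +>\<^bsub>R\<^esub> r"
  interpret h: ring_hom_ring R ?A ?f by (rule N.phi_hom)
  have qg: "quotient_grading R gr N = (\<lambda>i. ?f ` gr i)" by (simp add: quotient_grading_def fun_eq_iff)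
  have std: "standard_graded_algebra ?A (quotient_grading R gr N)"
    by (rule quotient_standard_graded[OF K Ni Nproper _ free x]) (use ideal_prod_components[OF I(1) J(1)] N_def in blast)
  define \<nn> where "\<nn> = ?f ` \<mm>"
  have nn: "irrelevant_ideal ?A (quotient_grading R gr N) = \<nn>"
  proof -
    have "(\<Union>i\<in>{1..}. quotient_grading R gr N i) = ?f ` (\<Union>i\<in>{1..}. gr i)" unfolding qg by blast
    then show ?thesis unfolding irrelevant_ideal_def \<nn>_def \<mm>_def using N.phi_Idl[OF irrelevant_gens] by simp
  qed
  have "trivial_massey_operation (koszul ?A xs)"
    if xs: "minimal_generators ?A \<nn> xs" and xh: "set xs \<subseteq> (\<Union>i. ?f ` gr i)" for xs
  proof -
    have xs': "distinct xs" "set xs \<subseteq> carrier ?A" "genideal ?A (set xs) = \<nn>" "\<And>S. S \<subset> set xs \<Longrightarrow> genideal ?A S \<noteq> \<nn>"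
      using xs by (auto simp: minimal_generators_def)
    \<comment> \<open>A lift of degree 0 has zero constant term, as its image lies in the irrelevant
      ideal, and so it is zero; zero also counts as an element of degree 1.\<close>
    have "\<exists>r. r \<in> (\<Union>i\<in>{1..}. gr i) \<and> ?f r = u" if u: "u \<in> set xs" for u
    proof -
      obtain i r where r: "r \<in> gr i" "?f r = u" using xh u by blast
      have rR: "r \<in> carrier R" by (rule gr_props(4)[OF r(1)])
      have "u \<in> \<nn>" using h.S.genideal_self[OF xs'(2)] xs'(3) u by blast
      then obtain m where m: "m \<in> \<mm>" "?f r = ?f m" using r(2) by (auto simp: \<nn>_def)
      have mR: "m \<in> carrier R" using ideal_sub[OF mi m(1)] .
      have "hcomp (r \<ominus>\<^bsub>R\<^esub> m) 0 = \<zero>\<^bsub>R\<^esub>" using N.phi_eq_iff[OF rR mR] m(2) Nlow(2) by blast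
      moreover have "hcomp m 0 = \<zero>\<^bsub>R\<^esub>" using m(1) by (simp add: \<mm>_def irrelevant_eq)
      ultimately have r0: "hcomp r 0 = \<zero>\<^bsub>R\<^esub>" using hcomp_diff[OF rR mR, of 0] hcomp_props(4)[OF rR] by (simp add: a_minus_def)
      show ?thesis
      proof (cases "i = 0")
        case True
        then have "r = \<zero>\<^bsub>R\<^esub>" using r0 hcomp_homog[OF r(1)] by simp
        then show ?thesis using gr_props(1)[of 1] r(2) by auto
      next
        case False
        then show ?thesis using r by (intro exI[of _ r]) auto
      qed
    qed
    then obtain g where g: "\<And>u. u \<in> set xs \<Longrightarrow> g u \<in> (\<Union>i\<in>{1..}. gr i) \<and> ?f (g u) = u" by metis
    define ys where "ys = map g xs"
    have ysx: "map ?f ys = xs" unfolding ys_def using g by (simp add: map_idI)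
    have ysd: "distinct ys" using ysx xs'(1) by (metis distinct_map)
    have ysh: "set ys \<subseteq> (\<Union>i\<in>{1..}. gr i)" unfolding ys_def using g by auto
    have ysR: "set ys \<subseteq> carrier R" using ysh irrelevant_gens by blast
    have fys: "?f ` set ys = set xs" using ysx by (metis set_map)
    have inj: "inj_on ?f (set ys)" using ysx xs'(1) by (metis distinct_map)
    have gen: "genideal R (set zs) = \<mm>" if zs: "set zs \<subseteq> \<mm>" and sp: "\<And>i. i < n \<Longrightarrow> x i \<in> Span (gr 0) zs" for zs
    proof
      have zR: "set zs \<subseteq> carrier R" using zs ideal_sub[OF mi] by blast
      show "genideal R (set zs) \<subseteq> \<mm>" by (rule genideal_minimal[OF mi zs])
      have "gr 0 \<subseteq> carrier R" using gr_props(4) by blast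
      then have "Span (gr 0) zs \<subseteq> genideal R (set zs)" by (rule span_sub_ideal[OF genideal_ideal[OF zR] _ genideal_self[OF zR]])
      then show "\<mm> \<subseteq> genideal R (set zs)" unfolding mx using sp by (intro genideal_minimal[OF genideal_ideal[OF zR]]) auto
    qed
    \<comment> \<open>A sublist whose span contains the variables generates the irrelevant ideal, so
      by minimality downstairs and injectivity on the lifts it uses all of them.\<close>
    have full: "set zs = set ys" if zs: "set zs \<subseteq> set ys" and sp: "\<And>i. i < n \<Longrightarrow> x i \<in> Span (gr 0) zs" for zs
    proof -
      have "set ys \<subseteq> \<mm>" unfolding \<mm>_def irrelevant_ideal_def using ysh genideal_self[OF irrelevant_gens] by blast
      then have "genideal R (set zs) = \<mm>" using zs by (intro gen sp) auto
      moreover have zR: "set zs \<subseteq> carrier R" using zs ysR by blast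
      ultimately have gzs: "genideal ?A (?f ` set zs) = \<nn>" using N.phi_Idl[OF zR] by (simp add: \<nn>_def)
      have "?f ` set zs \<subseteq> set xs" unfolding fys[symmetric] by (rule image_mono[OF zs])
      moreover have "\<not> ?f ` set zs \<subset> set xs" using xs'(4)[of "?f ` set zs"] gzs by (rule_tac notI) simp
      ultimately have "?f ` set zs = ?f ` set ys" unfolding fys psubset_eq by simp
      then show ?thesis using inj_on_image_eq_iff[OF inj zs subset_refl] by blast
    qed
    \<comment> \<open>The linear ones among the lifts. The aim is that they are all of them.\<close>
    define Y where "Y = filter (\<lambda>y. y \<in> gr 1) ys"
    have YR: "set Y \<subseteq> carrier R" using ysR by (auto simp: Y_def)
    have spanY: "v \<in> Span (gr 0) Y" if v: "v \<in> gr 1" for v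
    proof -
      have vR: "v \<in> carrier R" by (rule gr_props(4)[OF v])
      have "v \<in> \<mm>" unfolding \<mm>_def by (rule positive_irrelevant[OF v]) simp
      then have "?f v \<in> ?f ` genideal R (set ys)" using N.phi_Idl[OF ysR] fys xs'(3) by (auto simp: \<nn>_def)
      then obtain r where r: "r \<in> genideal R (set ys)" "?f v = ?f r" by blast
      have rR: "r \<in> carrier R" using ideal_sub[OF genideal_ideal[OF ysR] r(1)] .
      have "hcomp (v \<ominus>\<^bsub>R\<^esub> r) 1 = \<zero>\<^bsub>R\<^esub>" using N.phi_eq_iff[OF vR rR] r(2) Nlow(3) by blast
      moreover have "set ys \<inter> gr 1 \<subseteq> Span (gr 0) Y" using Span_base_incl[OF K YR] by (auto simp: Y_def)
      ultimately show ?thesis using degree_one_span[OF K YR ysh _ v r(1)] by blast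
    qed
    have x1: "x i \<in> gr 1" if "i < n" for i using x that by auto
    have setY: "set Y = set ys" by (rule full) (use spanY x1 in \<open>auto simp: Y_def\<close>)
    have "set Y \<subseteq> gr 1" by (auto simp: Y_def)
    then have ys1: "set ys \<subseteq> gr 1" unfolding setY .
    have Yy: "Y = ys" unfolding Y_def by (rule filter_True) (use ys1 in auto)
    have spany: "v \<in> Span (gr 0) ys" if "v \<in> gr 1" for v using spanY[OF that] Yy by simp
    \<comment> \<open>A vector in the span of later ones could be dropped without shrinking the
      span, contrary to \<open>full\<close> and distinctness of the lifts.\<close>
    have indep: "independent (gr 0) ys"
    proof (rule irredundant_independent[OF ysR], rule notI)
      fix us u vs assume split: "ys = us @ u # vs" and u: "u \<in> Span (gr 0) vs"
      have R': "set (us @ vs) \<subseteq> carrier R" using ysR split by auto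
      have "Span (gr 0) vs \<subseteq> Span (gr 0) (us @ vs)" using mono_Span_append(2)[OF K, of vs us] R' by auto
      then have "set ys \<subseteq> Span (gr 0) (us @ vs)" using u Span_base_incl[OF K R'] split by auto
      then have "Span (gr 0) ys \<subseteq> Span (gr 0) (us @ vs)" by (rule mono_Span_subset[OF K _ R'])
      then have "set (us @ vs) = set ys" using spany x1 split by (intro full) auto
      then show False using ysd split by auto
    qed
    define xl where "xl = map x [0..<n]"
    have xlR: "set xl \<subseteq> carrier R" and xls: "set xl = x ` {..<n}" using xR by (auto simp: xl_def atLeast0LessThan)
    have len: "length ys \<le> n"
    proof -
      have in_span: "set ys \<subseteq> Span (gr 0) xl"
      proof
        fix y assume "y \<in> set ys"
        then have y: "y \<in> gr 1" using ys1 by blast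
        have yR: "y \<in> carrier R" by (rule gr_props(4)[OF y])
        have "y \<in> \<mm>" unfolding \<mm>_def by (rule positive_irrelevant[OF y]) simp
        then have "y \<in> genideal R (set xl)" using mx xls by simp
        moreover have "set xl \<subseteq> (\<Union>i\<in>{1..}. gr i)" using xls x1 by auto
        moreover have "hcomp (y \<ominus>\<^bsub>R\<^esub> y) 1 = \<zero>\<^bsub>R\<^esub>" using yR by (simp add: a_minus_def r_neg hcomp_zero)
        ultimately show "y \<in> Span (gr 0) xl" using degree_one_span[OF K xlR _ _ y] Span_base_incl[OF K xlR] by blast
      qed
      obtain Ws where Ws: "independent (gr 0) Ws" "Span (gr 0) Ws = Span (gr 0) xl" "length Ws \<le> length xl"
        using spanning_refine[OF K xlR] by blast
      have "length ys \<le> length Ws" using independent_length_le[OF K indep Ws(1)] in_span Ws(2) by simp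
      then show ?thesis using Ws(3) by (simp add: xl_def)
    qed
    \<comment> \<open>\<open>change_variables\<close> keeps the number of variables, while so far
      the lifts are only known to be at most \<open>n\<close> many; the list is padded with
      zeros.\<close>
    define y where "y = (\<lambda>i. if i < length ys then ys ! i else \<zero>\<^bsub>R\<^esub>)"
    have yR: "y \<in> {..<n} \<rightarrow> carrier R" using ysR nth_mem by (fastforce simp: y_def)
    have free_y: "free_monomials R (gr 0) n y"
    proof (rule free_monomials.change_variables[OF free yR])
      fix i assume i: "i < n"
      obtain Ks where Ks: "set Ks \<subseteq> gr 0" "length Ks = length ys" "x i = combine Ks ys"
        using Span_mem_iff_length_version[OF K ysR] spany[OF x1[OF i]] by blast
      define c where "c = (\<lambda>j. if j < length ys then Ks ! j else \<zero>\<^bsub>R\<^esub>)"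
      have cK: "c j \<in> gr 0" for j using Ks nth_mem[of j Ks] gr_props(1) by (auto simp: c_def)
      have cR: "c j \<in> carrier R" for j by (rule gr_props(4)[OF cK])
      have c0: "c j = \<zero>\<^bsub>R\<^esub>" if "\<not> j < length ys" for j using that by (simp add: c_def)
      have yjR: "y j \<in> carrier R" for j using ysR nth_mem[of j ys] by (auto simp: y_def)
      have K1: "Ks = map c [0..<length ys]" by (rule nth_equalityI) (auto simp: Ks c_def)
      have K2: "ys = map y [0..<length ys]" by (rule nth_equalityI) (auto simp: y_def)
      have "x i = combine (map c [0..<length ys]) (map y [0..<length ys])"
        using Ks(3) K1 K2 by simp
      also have "\<dots> = (\<Oplus>\<^bsub>R\<^esub>j\<in>set [0..<length ys]. c j \<otimes>\<^bsub>R\<^esub> y j)"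
        by (rule combine_map_eq_finsum) (use cR yjR in auto)
      also have "\<dots> = (\<Oplus>\<^bsub>R\<^esub>j\<in>{..<n}. c j \<otimes>\<^bsub>R\<^esub> y j)"
        by (rule finsum_extend) (use len cR yjR c0 in auto)
      finally show "\<exists>c\<in>{..<n} \<rightarrow> gr 0. x i = (\<Oplus>\<^bsub>R\<^esub>j\<in>{..<n}. c j \<otimes>\<^bsub>R\<^esub> y j)" using cK by blast
    qed
    interpret Y: free_monomials R "gr 0" n y by (rule free_y)
    \<comment> \<open>A padded entry would be the variable zero of a polynomial ring; multiplication
      by a variable is injective, so 1 would be 0.\<close>
    have ln: "length ys = n"
    proof (rule ccontr)
      assume "length ys \<noteq> n"
      then have l: "length ys < n" using len by simp
      have "\<one>\<^bsub>R\<^esub> \<in> Y.lc Y.E" using Y.spans by blast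
      then have "\<one>\<^bsub>R\<^esub> = \<zero>\<^bsub>R\<^esub>" by (rule Y.times_cancel[OF subset_refl _ l]) (simp add: y_def)
      then show False using one by simp
    qed
    have reg: "regular_seq (self_module R) ys" by (rule Y.regular_variables[OF ln]) (simp add: y_def ln)
    have genm: "genideal R (set ys) = \<mm>"
      by (rule gen) (use ys1 positive_irrelevant spany x1 in \<open>auto simp: \<mm>_def\<close>)
    interpret T: trimming_setup R I J F G t e Q ys \<mm>
    proof (rule trimming_setup.intro)
      show "\<mm> = multiples (self_module R) ys (length ys)" using mk_Idl[OF ysR] genm by simp
      show "J \<subseteq> \<mm>" "minimal_free_resolution R \<mm> J G" using Jm G by (simp_all add: \<mm>_def)
    qed (fact is_cring Ji ysR reg e trim split F)+
    have "trivial_massey_operation (koszul ?A (map ?f ys))"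
      unfolding N_def
    proof (rule T.massey_quotient[OF Ii])
      show "I \<subseteq> \<mm>" using Im by (simp add: \<mm>_def)
      fix r assume r: "r \<in> carrier R"
      show "r \<in> \<mm> \<or> (\<exists>s\<in>carrier R. s \<otimes>\<^bsub>R\<^esub> r \<ominus>\<^bsub>R\<^esub> \<one>\<^bsub>R\<^esub> \<in> \<mm>)"
        using inverse_modulo_irrelevant[OF K r] r unfolding \<mm>_def irrelevant_eq by blast
    qed
    then show ?thesis using ysx by simp
  qed
  then show ?thesis using std nn qg unfolding golod_graded_def N_def by simp
qed

theorem proposition4p4:
  fixes R :: "('a, 'b) ring_scheme" and \<mm> I J :: "'a set" and gr :: "nat \<Rightarrow> 'a set"
    and F :: "('a, 'f) ring_complex" and G :: "('a, 'g) ring_complex"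
    and t s :: nat and e f :: "nat \<Rightarrow> 'f" and Q :: "nat \<Rightarrow> 'f \<Rightarrow> nat \<Rightarrow> 'g"
  assumes "ideal I R" and "I \<noteq> carrier R" and "ideal J R" and "J \<noteq> carrier R"
    and "t = min_num_gens R I"
    and "is_basis R (cx_mod F 1) {1..t} e"
    and "is_basis R (cx_mod F 2) {1..s} f"
    and "genideal R (matrix_entries R (cx_mod F 1) {1..t} e {1..s} f (cx_diff F 2)) \<subseteq> J"
    and "trimming_morphism R I J t e F G Q"
    and "\<And>j. 1 \<le> j \<Longrightarrow> split_injection R (cx_mod F (j + 1)) (power_module t (cx_mod G j)) (Q j)"
  shows "(regular_local_ring R \<mm> \<and>
          minimal_free_resolution R \<mm> I F \<and> minimal_free_resolution R \<mm> J G
            \<longrightarrow> golod_local (R Quot (I \<cdot>\<^bsub>R\<^esub> J)))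
       \<and> (standard_graded_polynomial_ring R gr \<and> homogeneous_ideal R gr I \<and> homogeneous_ideal R gr J \<and>
          minimal_graded_free_resolution R gr I F \<and> minimal_graded_free_resolution R gr J G
            \<longrightarrow> golod_graded (R Quot (I \<cdot>\<^bsub>R\<^esub> J)) (quotient_grading R gr (I \<cdot>\<^bsub>R\<^esub> J)))"
proof (intro conjI impI)
  have e: "e \<in> {1..t} \<rightarrow> carrier (cx_mod F 1)" using assms(6) by (simp add: is_basis_def)
  have free: "free_resolution R I F" if "minimal_free_resolution R \<nn> I F" for \<nn>
    using that by (simp add: minimal_free_resolution_def)
  show "golod_local (R Quot (I \<cdot>\<^bsub>R\<^esub> J))"
    if *: "regular_local_ring R \<mm> \<and> minimal_free_resolution R \<mm> I F \<and> minimal_free_resolution R \<mm> J G"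
  proof -
    have h: "regular_local_ring R \<mm>" "minimal_free_resolution R \<mm> I F" "minimal_free_resolution R \<mm> J G"
      using * by simp_all
    show ?thesis by (rule golod_local_quotient[OF h(1) assms(1-4) e assms(9,10) free[OF h(2)] h(3)])
  qed
  show "golod_graded (R Quot (I \<cdot>\<^bsub>R\<^esub> J)) (quotient_grading R gr (I \<cdot>\<^bsub>R\<^esub> J))"
    if *: "standard_graded_polynomial_ring R gr \<and> homogeneous_ideal R gr I \<and> homogeneous_ideal R gr J \<and>
      minimal_graded_free_resolution R gr I F \<and> minimal_graded_free_resolution R gr J G"
  proof -
    have h: "standard_graded_polynomial_ring R gr" "homogeneous_ideal R gr I" "homogeneous_ideal R gr J"
      "minimal_free_resolution R (irrelevant_ideal R gr) I F" "minimal_free_resolution R (irrelevant_ideal R gr) J G"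
      using * by (simp_all add: minimal_graded_free_resolution_def)
    show ?thesis
      by (rule golod_graded_quotient[OF h(1,2) assms(2) h(3) assms(4) e assms(9,10) free[OF h(4)] h(5)])
  qed
qed

end
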